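(* Let $A$ be an associative unital algebra over a field $\mathbf{k}$, let $(P,\mu_P)$ be an $A^e$-projective resolution of $A$, let $(t_P,\eta_P)$ be a left contracting homotopy for it, and let $\iota$, $t_L$, $\eta_L$, $d_R$, $\mu_R$ and $S=(1_{P\otimes_AP}+t_Ld_R)^{-1}$ be the maps defined in the context. For $f:P\to A[-n]$ and $g:P\to A[-m]$ put $$f\circ g=-f\mu_RSt_L(1_P\otimes g\otimes1_P)(1_P\otimes S\eta_L)S\eta_L .$$ Then the operation defined by $[f,g]=f\circ g-(-1)^{(n-1)(m-1)}g\circ f$ induces the usual Lie (Gerstenhaber) bracket on the Hochschild cohomology $\mathrm{HH}^*(A)$.
   Context: Complexes. $A^e=A\otimes_{\mathbf{k}}A^{op}$, $\otimes=\otimes_{\mathbf{k}}$ for vector spaces. An $A^e$-complex is a $\mathbb{Z}$-graded $A$-bimodule $P=\bigoplus_n P_n$ with a bimodule differential $d_P$ of degree $-1$. $P[t]$ is the complex with $P[t]_n=P_{t+n}$ and $d_{P[t]}=(-1)^td_P$. A map of complexes $f:P\to Q$ is a degree-preserving bimodule homomorphism (not necessarily commuting with differentials); it is also regarded as a map $P[t]\to Q[t]$. A bimodule is viewed as a complex concentrated in degree $0$. For $f:P\to P'[n]$, $g:Q\to Q'[m]$, the map $f\otimes g:P\otimes_AQ\to (P'\otimes_AQ')[n+m]$ is $(f\otimes g)(x\otimes y)=(-1)^{im}f(x)\otimes g(y)$ for $x\in P_i$. $P\otimes_AA$ and $A\otimes_AP$ are identified with $P$. An $A^e$-projective resolution $(P,\mu_P)$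 of $A$ is an $A^e$-complex $P$ of projective bimodules with $P_n=0$ for $n<0$, $H_n(P)=0$ for $n>0$, and a bimodule map $\mu_P:P_0\to A$ inducing $H_0(P)\cong A$ ($\mu_P$ is extended by zero to $P$). A left contracting homotopy for $(P,\mu_P)$ is a pair $(t_P,\eta_P)$ of left $A$-module homomorphisms $t_P:P\to P$, $\eta_P:A\to P$ with $t_P(P_i)\subset P_{i+1}$, $\eta_P(A)\subset P_0$, $d_Pt_P+t_Pd_P+\eta_P\mu_P=1_P$ and $t_P(t_P+\eta_P)=0$. Let $\pi:A\otimes P\to P$, $\pi(a\otimes x)=ax$, a graded epimorphism of $A$-bimodules, and let $\iota:P\to A\otimes P$ be a fixed graded $A$-bimodule homomorphism with $\pi\iota=1_P$. Identifying $P\otimes_A(A\otimes P)$ with $P\otimes P$, define the bimodule homomorphisms $t_L=(1_P\otimes\pi)(t_P\otimes1_P)(1_P\otimes\iota):P\otimes_AP\to(P\otimes_AP)[1]$, $\eta_L=(1_P\otimes\pi)(\eta_P\otimes1_P)\iota:P\to P\otimes_AP$, $d_R=1_P\otimes d_P:P\otimes_AP\to(P\otimes_AP)[-1]$ (so $d_R(x\otimes y)=(-1)^ix\otimes d_P(y)$ for $x\in P_i$), $\mu_R=1_P\otimes\mu_P:P\otimes_AP\to P$. The map $t_Ld_R$ is locally nilpotent, so $1_{P\otimes_AP}+t_Ld_R$ is invertible; $S$ is its inverse. Hochschild cohomology. $\mathrm{HH}^n(A)$ is the space of maps $f:P\to A[-n]$ (i.e. bimodule maps $P_n\to A$) with $fd_P=0$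 modulo those of the form $hd_P$; different resolutions are identified via comparison chain maps over $A$. For the bar resolution ($\mathrm{Bar}_n(A)=A^{\otimes(n+2)}$, $d(a_0\otimes\cdots\otimes a_{n+1})=\sum_{i=0}^n(-1)^ia_0\otimes\cdots\otimes a_ia_{i+1}\otimes\cdots\otimes a_{n+1}$, $\mu$ the multiplication), cochains are $C^n(A)=\mathrm{Hom}_{\mathbf{k}}(A^{\otimes n},A)$, and the Gerstenhaber bracket of $\alpha\in C^n(A)$, $\beta\in C^m(A)$ is $[\alpha,\beta]=\alpha\circ\beta-(-1)^{(n-1)(m-1)}\beta\circ\alpha$ with $\alpha\circ\beta=\sum_{i=1}^n(-1)^{(m-1)(i-1)}\alpha\circ_i\beta$, where $(\alpha\circ_i\beta)(a_1\otimes\cdots\otimes a_{n+m-1})=\alpha(a_1\otimes\cdots\otimes a_{i-1}\otimes\beta(a_i\otimes\cdots\otimes a_{i+m-1})\otimes a_{i+m}\otimes\cdots\otimes a_{n+m-1})$ (for $m=0$ the element $\beta\in A$ is inserted in position $i$; for $n=0$, $\alpha\circ\beta=0$). *)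

theory Defs
  imports "HOL-Algebra.Algebra"
begin

section \<open>Algebras and graded bimodules\<close>

text \<open>
  \<^const>\<open>algebra\<close> in HOL-Algebra is commutative, so unital associative algebras are introduced here.
  The zero algebra is not excluded.
\<close>

definition assoc_algebra :: "'k ring \<Rightarrow> ('k, 'a) module \<Rightarrow> bool" where
  "assoc_algebra K A \<longleftrightarrow> field K \<and> ring A \<and> module K A \<and>
     (\<forall>c\<in>carrier K. \<forall>x\<in>carrier A. \<forall>y\<in>carrier A.
        (c \<odot>\<^bsub>A\<^esub> x) \<otimes>\<^bsub>A\<^esub> y = c \<odot>\<^bsub>A\<^esub> (x \<otimes>\<^bsub>A\<^esub> y) \<and>
        x \<otimes>\<^bsub>A\<^esub> (c \<odot>\<^bsub>A\<^esub> y) = c \<odot>\<^bsub>A\<^esub> (x \<otimes>\<^bsub>A\<^esub> y))"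

text \<open>
  As for \<^typ>\<open>('a, 'm) module\<close>, the fields \<^const>\<open>monoid.mult\<close> and \<^const>\<open>monoid.one\<close> inherited from
  \<^typ>\<open>'m ring\<close> carry no meaning; \<^const>\<open>smult\<close> is the left action.
\<close>

record ('a, 'm) bimodule = "('a, 'm) module" +
  rsmult :: "'m \<Rightarrow> 'a \<Rightarrow> 'm"

text \<open>
  The last condition says that the field acts centrally, i.e. that \<open>M\<close> is a module over the
  enveloping algebra of \<open>A\<close>. The vector space structure of \<open>M\<close> is the one induced by \<open>c \<mapsto> c1\<close>.
\<close>

definition bimod :: "'k ring \<Rightarrow> ('k, 'a) module \<Rightarrow> ('a, 'm, 'e) bimodule_scheme \<Rightarrow> bool" where
  "bimod K A M \<longleftrightarrow> abelian_group M \<and>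
     (\<forall>a\<in>carrier A. \<forall>x\<in>carrier M. a \<odot>\<^bsub>M\<^esub> x \<in> carrier M \<and> rsmult M x a \<in> carrier M) \<and>
     (\<forall>a\<in>carrier A. \<forall>x\<in>carrier M. \<forall>y\<in>carrier M.
        a \<odot>\<^bsub>M\<^esub> (x \<oplus>\<^bsub>M\<^esub> y) = a \<odot>\<^bsub>M\<^esub> x \<oplus>\<^bsub>M\<^esub> a \<odot>\<^bsub>M\<^esub> y \<and>
        rsmult M (x \<oplus>\<^bsub>M\<^esub> y) a = rsmult M x a \<oplus>\<^bsub>M\<^esub> rsmult M y a) \<and>
     (\<forall>a\<in>carrier A. \<forall>b\<in>carrier A. \<forall>x\<in>carrier M.
        (a \<oplus>\<^bsub>A\<^esub> b) \<odot>\<^bsub>M\<^esub> x = a \<odot>\<^bsub>M\<^esub> x \<oplus>\<^bsub>M\<^esub> b \<odot>\<^bsub>M\<^esub> x \<and>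
        rsmult M x (a \<oplus>\<^bsub>A\<^esub> b) = rsmult M x a \<oplus>\<^bsub>M\<^esub> rsmult M x b \<and>
        (a \<otimes>\<^bsub>A\<^esub> b) \<odot>\<^bsub>M\<^esub> x = a \<odot>\<^bsub>M\<^esub> (b \<odot>\<^bsub>M\<^esub> x) \<and>
        rsmult M x (a \<otimes>\<^bsub>A\<^esub> b) = rsmult M (rsmult M x a) b \<and>
        rsmult M (a \<odot>\<^bsub>M\<^esub> x) b = a \<odot>\<^bsub>M\<^esub> rsmult M x b) \<and>
     (\<forall>x\<in>carrier M. \<one>\<^bsub>A\<^esub> \<odot>\<^bsub>M\<^esub> x = x \<and> rsmult M x \<one>\<^bsub>A\<^esub> = x) \<and>
     (\<forall>c\<in>carrier K. \<forall>x\<in>carrier M. (c \<odot>\<^bsub>A\<^esub> \<one>\<^bsub>A\<^esub>) \<odot>\<^bsub>M\<^esub> x = rsmult M x (c \<odot>\<^bsub>A\<^esub> \<one>\<^bsub>A\<^esub>))"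

definition left_hom ::
  "('k, 'a) module \<Rightarrow> ('a, 'm, 'e) bimodule_scheme \<Rightarrow> ('a, 'n, 'f) bimodule_scheme \<Rightarrow> ('m \<Rightarrow> 'n) \<Rightarrow> bool" where
  "left_hom A M N f \<longleftrightarrow> f \<in> carrier M \<rightarrow> carrier N \<and>
     (\<forall>x\<in>carrier M. \<forall>y\<in>carrier M. f (x \<oplus>\<^bsub>M\<^esub> y) = f x \<oplus>\<^bsub>N\<^esub> f y) \<and>
     (\<forall>a\<in>carrier A. \<forall>x\<in>carrier M. f (a \<odot>\<^bsub>M\<^esub> x) = a \<odot>\<^bsub>N\<^esub> f x)"

definition bimod_hom ::
  "('k, 'a) module \<Rightarrow> ('a, 'm, 'e) bimodule_scheme \<Rightarrow> ('a, 'n, 'f) bimodule_scheme \<Rightarrow> ('m \<Rightarrow> 'n) \<Rightarrow> bool" where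
  "bimod_hom A M N f \<longleftrightarrow> left_hom A M N f \<and>
     (\<forall>a\<in>carrier A. \<forall>x\<in>carrier M. f (rsmult M x a) = rsmult N (f x) a)"

text \<open>
  HOL cannot quantify over all bimodules, so the lifting property is tested on bimodules over two
  fixed types. They are large enough: the type of \<open>M\<close> contains (as cosets in a free abelian group on
  triples \<open>(a, x, b)\<close>) the free bimodule on the underlying set of \<open>Q\<close>, and the type of \<open>N\<close> contains \<open>Q\<close>
  itself. Hence this is equivalent to the lifting property for bimodules over arbitrary types.
\<close>

definition projective_bimod ::
  "'k ring \<Rightarrow> ('k, 'a) module \<Rightarrow> ('a, 'm, 'e) bimodule_scheme \<Rightarrow> bool" where
  "projective_bimod K A Q \<longleftrightarrow> bimod K A Q \<and>
     (\<forall>(M :: ('a, ('a \<times> 'm \<times> 'a \<Rightarrow>\<^sub>0 int) set) bimodule) (N :: ('a, 'm) bimodule) g f.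
        bimod K A M \<and> bimod K A N \<and> bimod_hom A M N g \<and> g ` carrier M = carrier N \<and>
        bimod_hom A Q N f \<longrightarrow>
        (\<exists>h. bimod_hom A Q M h \<and> (\<forall>x\<in>carrier Q. g (h x) = f x)))"

text \<open>
  A \<open>\<int>\<close>-graded bimodule is the internal direct sum of the sub-bimodules \<open>grade P n\<close>.
\<close>

record ('a, 'm) graded_bimodule = "('a, 'm) bimodule" +
  grade :: "int \<Rightarrow> 'm set"

definition homogeneous_decomp :: "('a, 'm) graded_bimodule \<Rightarrow> 'm \<Rightarrow> (int \<Rightarrow> 'm) \<Rightarrow> bool" where
  "homogeneous_decomp P x c \<longleftrightarrow> (\<forall>n. c n \<in> grade P n) \<and> finite {n. c n \<noteq> \<zero>\<^bsub>P\<^esub>} \<and>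
     x = finsum P c {n. c n \<noteq> \<zero>\<^bsub>P\<^esub>}"

definition hcomp :: "('a, 'm) graded_bimodule \<Rightarrow> 'm \<Rightarrow> int \<Rightarrow> 'm" where
  "hcomp P x = (THE c. homogeneous_decomp P x c)"

definition component :: "('a, 'm) graded_bimodule \<Rightarrow> int \<Rightarrow> ('a, 'm) graded_bimodule" where
  "component P n = P\<lparr>carrier := grade P n\<rparr>"

definition graded_bimod :: "'k ring \<Rightarrow> ('k, 'a) module \<Rightarrow> ('a, 'm) graded_bimodule \<Rightarrow> bool" where
  "graded_bimod K A P \<longleftrightarrow> bimod K A P \<and>
     (\<forall>n. grade P n \<subseteq> carrier P \<and> bimod K A (component P n)) \<and>
     (\<forall>x\<in>carrier P. \<exists>!c. homogeneous_decomp P x c)"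

definition shift :: "int \<Rightarrow> ('a, 'm) graded_bimodule \<Rightarrow> ('a, 'm) graded_bimodule" where
  "shift t P = P\<lparr>grade := (\<lambda>n. grade P (t + n))\<rparr>"

definition graded_hom ::
  "('k, 'a) module \<Rightarrow> ('a, 'm) graded_bimodule \<Rightarrow> ('a, 'n) graded_bimodule \<Rightarrow> ('m \<Rightarrow> 'n) \<Rightarrow> bool" where
  "graded_hom A P Q f \<longleftrightarrow> bimod_hom A P Q f \<and> (\<forall>n. f ` grade P n \<subseteq> grade Q n)"

definition regular :: "('k, 'a) module \<Rightarrow> ('a, 'a) graded_bimodule" where
  "regular A = \<lparr>carrier = carrier A, monoid.mult = monoid.mult A, one = one A,
     ring.zero = ring.zero A, ring.add = ring.add A, smult = monoid.mult A, rsmult = monoid.mult A,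
     grade = (\<lambda>n. if n = 0 then carrier A else {\<zero>\<^bsub>A\<^esub>})\<rparr>"

definition koszul_sign :: "int \<Rightarrow> int" where
  "koszul_sign n = (if even n then 1 else - 1)"


section \<open>Resolutions and contracting homotopies\<close>

definition bimod_complex ::
  "'k ring \<Rightarrow> ('k, 'a) module \<Rightarrow> ('a, 'm) graded_bimodule \<Rightarrow> ('m \<Rightarrow> 'm) \<Rightarrow> bool" where
  "bimod_complex K A P d \<longleftrightarrow> graded_bimod K A P \<and> graded_hom A P (shift (- 1) P) d \<and>
     (\<forall>x\<in>carrier P. d (d x) = \<zero>\<^bsub>P\<^esub>)"

text \<open>
  The augmentation is defined on all of \<open>P\<close>; being graded, it vanishes outside degree 0. The last two
  conditions say that it induces an isomorphism from the homology in degree 0 onto \<open>A\<close>.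
\<close>

definition projective_resolution ::
  "'k ring \<Rightarrow> ('k, 'a) module \<Rightarrow> ('a, 'm) graded_bimodule \<Rightarrow> ('m \<Rightarrow> 'm) \<Rightarrow> ('m \<Rightarrow> 'a) \<Rightarrow> bool" where
  "projective_resolution K A P d \<mu> \<longleftrightarrow> bimod_complex K A P d \<and>
     (\<forall>n. projective_bimod K A (component P n)) \<and>
     (\<forall>n<0. grade P n = {\<zero>\<^bsub>P\<^esub>}) \<and>
     (\<forall>n>0. {x \<in> grade P n. d x = \<zero>\<^bsub>P\<^esub>} = d ` grade P (n + 1)) \<and>
     graded_hom A P (regular A) \<mu> \<and>
     \<mu> ` grade P 0 = carrier A \<and>
     {x \<in> grade P 0. \<mu> x = \<zero>\<^bsub>A\<^esub>} = d ` grade P 1"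

text \<open>
  The condition \<open>t (t + \<eta>) = 0\<close> concerns \<open>t + \<eta> : P \<oplus> A \<rightarrow> P\<close>, hence it amounts to \<open>t t = 0\<close> and \<open>t \<eta> = 0\<close>.
\<close>

definition left_contracting_homotopy ::
  "('k, 'a) module \<Rightarrow> ('a, 'm) graded_bimodule \<Rightarrow> ('m \<Rightarrow> 'm) \<Rightarrow> ('m \<Rightarrow> 'a) \<Rightarrow>
   ('m \<Rightarrow> 'm) \<Rightarrow> ('a \<Rightarrow> 'm) \<Rightarrow> bool" where
  "left_contracting_homotopy A P d \<mu> t \<eta> \<longleftrightarrow>
     left_hom A P P t \<and> left_hom A (regular A) P \<eta> \<and>
     (\<forall>n. t ` grade P n \<subseteq> grade P (n + 1)) \<and> \<eta> ` carrier A \<subseteq> grade P 0 \<and>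
     (\<forall>x\<in>carrier P. d (t x) \<oplus>\<^bsub>P\<^esub> t (d x) \<oplus>\<^bsub>P\<^esub> \<eta> (\<mu> x) = x) \<and>
     (\<forall>x\<in>carrier P. t (t x) = \<zero>\<^bsub>P\<^esub>) \<and> (\<forall>a\<in>carrier A. t (\<eta> a) = \<zero>\<^bsub>P\<^esub>)"


section \<open>Tensor products\<close>

text \<open>
  \<open>pres_group U R\<close> is the abelian group with generators \<open>U\<close> and relators \<open>R\<close> (elements of the free abelian
  group on \<open>U\<close>), \<open>pres_gen U R x\<close> is the class of the generator \<open>x\<close>, and \<open>pres_lift G b\<close> is the
  homomorphism to \<open>G\<close> extending \<open>b\<close>. The latter computes with an arbitrary representative of a coset,
  which is immaterial as soon as \<open>b\<close> respects the relators.
\<close>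

definition pres_group :: "'x set \<Rightarrow> ('x \<Rightarrow>\<^sub>0 int) set \<Rightarrow> ('x \<Rightarrow>\<^sub>0 int) set ring" where
  "pres_group U R =
     (let F = free_Abelian_group U; Q = F Mod generate F R
      in \<lparr>carrier = carrier Q, monoid.mult = undefined, one = undefined,
          ring.zero = one Q, ring.add = monoid.mult Q\<rparr>)"

definition pres_gen :: "'x set \<Rightarrow> ('x \<Rightarrow>\<^sub>0 int) set \<Rightarrow> 'x \<Rightarrow> ('x \<Rightarrow>\<^sub>0 int) set" where
  "pres_gen U R x =
     (let F = free_Abelian_group U in generate F R #>\<^bsub>F\<^esub> frag_of x)"

definition pres_lift :: "('g, 'e) ring_scheme \<Rightarrow> ('x \<Rightarrow> 'g) \<Rightarrow> ('x \<Rightarrow>\<^sub>0 int) set \<Rightarrow> 'g" where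
  "pres_lift G b C =
     (let c = (SOME c. c \<in> C)
      in finsum G (\<lambda>x. [Poly_Mapping.lookup c x] \<cdot>\<^bsub>G\<^esub> b x) (Poly_Mapping.keys c))"

type_synonym ('m, 'n) tens = "('m \<times> 'n \<Rightarrow>\<^sub>0 int) set"

definition balancing_relators ::
  "'s set \<Rightarrow> ('m \<Rightarrow> 's \<Rightarrow> 'm) \<Rightarrow> ('s \<Rightarrow> 'n \<Rightarrow> 'n) \<Rightarrow>
   ('a, 'm) graded_bimodule \<Rightarrow> ('a, 'n) graded_bimodule \<Rightarrow> ('m \<times> 'n \<Rightarrow>\<^sub>0 int) set" where
  "balancing_relators T r l M N =
     {frag_of (x \<oplus>\<^bsub>M\<^esub> x', y) - frag_of (x, y) - frag_of (x', y) | x x' y.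
        x \<in> carrier M \<and> x' \<in> carrier M \<and> y \<in> carrier N} \<union>
     {frag_of (x, y \<oplus>\<^bsub>N\<^esub> y') - frag_of (x, y) - frag_of (x, y') | x y y'.
        x \<in> carrier M \<and> y \<in> carrier N \<and> y' \<in> carrier N} \<union>
     {frag_of (r x s, y) - frag_of (x, l s y) | x s y.
        x \<in> carrier M \<and> s \<in> T \<and> y \<in> carrier N}"

definition relators_A ::
  "('k, 'a) module \<Rightarrow> ('a, 'm) graded_bimodule \<Rightarrow> ('a, 'n) graded_bimodule \<Rightarrow> ('m \<times> 'n \<Rightarrow>\<^sub>0 int) set" where
  "relators_A A M N = balancing_relators (carrier A) (rsmult M) (smult N) M N"

definition relators_K ::
  "'k ring \<Rightarrow> ('k, 'a) module \<Rightarrow> ('a, 'm) graded_bimodule \<Rightarrow> ('a, 'n) graded_bimodule \<Rightarrow>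
   ('m \<times> 'n \<Rightarrow>\<^sub>0 int) set" where
  "relators_K K A M N = balancing_relators (carrier K)
     (\<lambda>x c. (c \<odot>\<^bsub>A\<^esub> \<one>\<^bsub>A\<^esub>) \<odot>\<^bsub>M\<^esub> x) (\<lambda>c y. (c \<odot>\<^bsub>A\<^esub> \<one>\<^bsub>A\<^esub>) \<odot>\<^bsub>N\<^esub> y) M N"

definition pure_tensor ::
  "('m \<times> 'n \<Rightarrow>\<^sub>0 int) set \<Rightarrow> ('a, 'm) graded_bimodule \<Rightarrow> ('a, 'n) graded_bimodule \<Rightarrow>
   'm \<Rightarrow> 'n \<Rightarrow> ('m, 'n) tens" where
  "pure_tensor R M N x y = pres_gen (carrier M \<times> carrier N) R (x, y)"

definition tensor ::
  "('m \<times> 'n \<Rightarrow>\<^sub>0 int) set \<Rightarrow> ('a, 'm) graded_bimodule \<Rightarrow> ('a, 'n) graded_bimodule \<Rightarrow>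
   ('a, ('m, 'n) tens) graded_bimodule" where
  "tensor R M N =
     (let G = pres_group (carrier M \<times> carrier N) R
      in \<lparr>carrier = carrier G, monoid.mult = undefined, one = undefined,
          ring.zero = ring.zero G, ring.add = ring.add G,
          smult = (\<lambda>a. pres_lift G (\<lambda>(x, y). pure_tensor R M N (a \<odot>\<^bsub>M\<^esub> x) y)),
          rsmult = (\<lambda>z a. pres_lift G (\<lambda>(x, y). pure_tensor R M N x (rsmult N y a)) z),
          grade = (\<lambda>n. generate (add_monoid G)
            {pure_tensor R M N x y | x y i j. x \<in> grade M i \<and> y \<in> grade N j \<and> i + j = n})\<rparr>)"

definition tensor_A ::
  "('k, 'a) module \<Rightarrow> ('a, 'm) graded_bimodule \<Rightarrow> ('a, 'n) graded_bimodule \<Rightarrow>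
   ('a, ('m, 'n) tens) graded_bimodule" where
  "tensor_A A M N = tensor (relators_A A M N) M N"

definition pure_A ::
  "('k, 'a) module \<Rightarrow> ('a, 'm) graded_bimodule \<Rightarrow> ('a, 'n) graded_bimodule \<Rightarrow> 'm \<Rightarrow> 'n \<Rightarrow> ('m, 'n) tens" where
  "pure_A A M N = pure_tensor (relators_A A M N) M N"

definition tensor_K ::
  "'k ring \<Rightarrow> ('k, 'a) module \<Rightarrow> ('a, 'm) graded_bimodule \<Rightarrow> ('a, 'n) graded_bimodule \<Rightarrow>
   ('a, ('m, 'n) tens) graded_bimodule" where
  "tensor_K K A M N = tensor (relators_K K A M N) M N"

definition pure_K ::
  "'k ring \<Rightarrow> ('k, 'a) module \<Rightarrow> ('a, 'm) graded_bimodule \<Rightarrow> ('a, 'n) graded_bimodule \<Rightarrow>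
   'm \<Rightarrow> 'n \<Rightarrow> ('m, 'n) tens" where
  "pure_K K A M N = pure_tensor (relators_K K A M N) M N"

text \<open>
  \<open>f \<otimes> g\<close> for \<open>g\<close> of degree \<open>m\<close> (i.e. a map to a shift by \<open>m\<close>): a homogeneous \<open>x\<close> of degree \<open>i\<close> gives
  \<open>(f \<otimes> g) (x \<otimes> y) = (-1)\<^sup>i\<^sup>m f x \<otimes> g y\<close>, and a general \<open>x\<close> is split into its homogeneous components.
  The first argument \<open>M\<close> is the domain of \<open>f\<close>; \<open>T\<close> and \<open>p\<close> are the target and its pure tensors.
\<close>

definition tensor_map ::
  "('a, 'm) graded_bimodule \<Rightarrow> ('a, 'u) graded_bimodule \<Rightarrow> ('m' \<Rightarrow> 'n' \<Rightarrow> 'u) \<Rightarrow> int \<Rightarrow>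
   ('m \<Rightarrow> 'm') \<Rightarrow> ('n \<Rightarrow> 'n') \<Rightarrow> ('m, 'n) tens \<Rightarrow> 'u" where
  "tensor_map M T p m f g = pres_lift T (\<lambda>(x, y).
     finsum T (\<lambda>i. [koszul_sign (i * m)] \<cdot>\<^bsub>T\<^esub> p (f (hcomp M x i)) (g y))
       {i. hcomp M x i \<noteq> \<zero>\<^bsub>M\<^esub>})"

definition tensor_map_A ::
  "('k, 'a) module \<Rightarrow> ('a, 'm) graded_bimodule \<Rightarrow> ('a, 'm') graded_bimodule \<Rightarrow> ('a, 'n') graded_bimodule \<Rightarrow>
   int \<Rightarrow> ('m \<Rightarrow> 'm') \<Rightarrow> ('n \<Rightarrow> 'n') \<Rightarrow> ('m, 'n) tens \<Rightarrow> ('m', 'n') tens" where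
  "tensor_map_A A M M' N' = tensor_map M (tensor_A A M' N') (pure_A A M' N')"

definition tensor_map_K ::
  "'k ring \<Rightarrow> ('k, 'a) module \<Rightarrow> ('a, 'm) graded_bimodule \<Rightarrow> ('a, 'm') graded_bimodule \<Rightarrow>
   ('a, 'n') graded_bimodule \<Rightarrow> int \<Rightarrow> ('m \<Rightarrow> 'm') \<Rightarrow> ('n \<Rightarrow> 'n') \<Rightarrow> ('m, 'n) tens \<Rightarrow> ('m', 'n') tens" where
  "tensor_map_K K A M M' N' = tensor_map M (tensor_K K A M' N') (pure_K K A M' N')"

text \<open>
  \<open>a \<otimes> x \<mapsto> ax\<close> is both the map \<open>\<pi>\<close> on the tensor product of \<open>A\<close> and \<open>M\<close> over the field and, on the
  tensor product over \<open>A\<close>, the identification with \<open>M\<close>.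
\<close>

definition left_action_map :: "('a, 'm) graded_bimodule \<Rightarrow> ('a, 'm) tens \<Rightarrow> 'm" where
  "left_action_map M = pres_lift M (\<lambda>(a, x). a \<odot>\<^bsub>M\<^esub> x)"

definition right_action_map :: "('a, 'm) graded_bimodule \<Rightarrow> ('m, 'a) tens \<Rightarrow> 'm" where
  "right_action_map M = pres_lift M (\<lambda>(x, a). rsmult M x a)"

text \<open>
  The identification of \<open>P \<otimes>\<^sub>A (A \<otimes> P)\<close> with \<open>P \<otimes> P\<close>, namely \<open>x \<otimes> (a \<otimes> y) \<mapsto> xa \<otimes> y\<close>, and its inverse
  \<open>x \<otimes> y \<mapsto> x \<otimes> (1 \<otimes> y)\<close>.
\<close>

definition contract_mid ::
  "'k ring \<Rightarrow> ('k, 'a) module \<Rightarrow> ('a, 'p) graded_bimodule \<Rightarrow> ('p, ('a, 'p) tens) tens \<Rightarrow> ('p, 'p) tens" where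
  "contract_mid K A P = pres_lift (tensor_K K A P P)
     (\<lambda>(x, w). pres_lift (tensor_K K A P P) (\<lambda>(a, y). pure_K K A P P (rsmult P x a) y) w)"

definition expand_mid ::
  "'k ring \<Rightarrow> ('k, 'a) module \<Rightarrow> ('a, 'p) graded_bimodule \<Rightarrow> ('p, 'p) tens \<Rightarrow> ('p, ('a, 'p) tens) tens" where
  "expand_mid K A P = pres_lift (tensor_A A P (tensor_K K A (regular A) P))
     (\<lambda>(x, y). pure_A A P (tensor_K K A (regular A) P) x (pure_K K A (regular A) P \<one>\<^bsub>A\<^esub> y))"


section \<open>The bracket on an arbitrary resolution\<close>

definition t_L ::
  "'k ring \<Rightarrow> ('k, 'a) module \<Rightarrow> ('a, 'p) graded_bimodule \<Rightarrow> ('p \<Rightarrow> 'p) \<Rightarrow> ('p \<Rightarrow> ('a, 'p) tens) \<Rightarrow>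
   ('p, 'p) tens \<Rightarrow> ('p, 'p) tens" where
  "t_L K A P t \<iota> =
     tensor_map_A A P P P 0 id (left_action_map P) \<circ> expand_mid K A P \<circ>
     tensor_map_K K A P P P 0 t id \<circ>
     contract_mid K A P \<circ> tensor_map_A A P P (tensor_K K A (regular A) P) 0 id \<iota>"

definition eta_L ::
  "'k ring \<Rightarrow> ('k, 'a) module \<Rightarrow> ('a, 'p) graded_bimodule \<Rightarrow> ('a \<Rightarrow> 'p) \<Rightarrow> ('p \<Rightarrow> ('a, 'p) tens) \<Rightarrow>
   'p \<Rightarrow> ('p, 'p) tens" where
  "eta_L K A P \<eta> \<iota> =
     tensor_map_A A P P P 0 id (left_action_map P) \<circ> expand_mid K A P \<circ>
     tensor_map_K K A (regular A) P P 0 \<eta> id \<circ> \<iota>"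

definition d_R ::
  "('k, 'a) module \<Rightarrow> ('a, 'p) graded_bimodule \<Rightarrow> ('p \<Rightarrow> 'p) \<Rightarrow> ('p, 'p) tens \<Rightarrow> ('p, 'p) tens" where
  "d_R A P d = tensor_map_A A P P P (- 1) id d"

definition mu_R ::
  "('k, 'a) module \<Rightarrow> ('a, 'p) graded_bimodule \<Rightarrow> ('p \<Rightarrow> 'a) \<Rightarrow> ('p, 'p) tens \<Rightarrow> 'p" where
  "mu_R A P \<mu> = right_action_map P \<circ> tensor_map_A A P P (regular A) 0 id \<mu>"

definition S_map ::
  "'k ring \<Rightarrow> ('k, 'a) module \<Rightarrow> ('a, 'p) graded_bimodule \<Rightarrow> ('p \<Rightarrow> 'p) \<Rightarrow> ('p \<Rightarrow> 'p) \<Rightarrow>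
   ('p \<Rightarrow> ('a, 'p) tens) \<Rightarrow> ('p, 'p) tens \<Rightarrow> ('p, 'p) tens" where
  "S_map K A P d t \<iota> = inv_into (carrier (tensor_A A P P))
     (\<lambda>z. z \<oplus>\<^bsub>tensor_A A P P\<^esub> t_L K A P t \<iota> (d_R A P d z))"

text \<open>
  Here \<open>g\<close> is a map to \<open>A[-m]\<close>, so that \<open>g \<otimes> 1\<close> has degree \<open>-m\<close>. The threefold tensor product is
  bracketed to the right.
\<close>

definition circle ::
  "'k ring \<Rightarrow> ('k, 'a) module \<Rightarrow> ('a, 'p) graded_bimodule \<Rightarrow> ('p \<Rightarrow> 'p) \<Rightarrow> ('p \<Rightarrow> 'a) \<Rightarrow>
   ('p \<Rightarrow> 'p) \<Rightarrow> ('a \<Rightarrow> 'p) \<Rightarrow> ('p \<Rightarrow> ('a, 'p) tens) \<Rightarrow> int \<Rightarrow> ('p \<Rightarrow> 'a) \<Rightarrow> ('p \<Rightarrow> 'a) \<Rightarrow> 'p \<Rightarrow> 'a" where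
  "circle K A P d \<mu> t \<eta> \<iota> m f g =
     (let S = S_map K A P d t \<iota>;
          S_eta = S \<circ> eta_L K A P \<eta> \<iota>;
          g1 = left_action_map P \<circ> tensor_map_A A P (regular A) P 0 g id;
          h = f \<circ> mu_R A P \<mu> \<circ> S \<circ> t_L K A P t \<iota> \<circ>
              tensor_map_A A P P P (- m) id g1 \<circ>
              tensor_map_A A P P (tensor_A A P P) 0 id S_eta \<circ> S_eta
      in (\<lambda>x. \<ominus>\<^bsub>A\<^esub> h x))"

definition bracket ::
  "'k ring \<Rightarrow> ('k, 'a) module \<Rightarrow> ('a, 'p) graded_bimodule \<Rightarrow> ('p \<Rightarrow> 'p) \<Rightarrow> ('p \<Rightarrow> 'a) \<Rightarrow>
   ('p \<Rightarrow> 'p) \<Rightarrow> ('a \<Rightarrow> 'p) \<Rightarrow> ('p \<Rightarrow> ('a, 'p) tens) \<Rightarrow>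
   int \<Rightarrow> int \<Rightarrow> ('p \<Rightarrow> 'a) \<Rightarrow> ('p \<Rightarrow> 'a) \<Rightarrow> 'p \<Rightarrow> 'a" where
  "bracket K A P d \<mu> t \<eta> \<iota> n m f g = (\<lambda>x.
     circle K A P d \<mu> t \<eta> \<iota> m f g x \<ominus>\<^bsub>A\<^esub>
     [koszul_sign ((n - 1) * (m - 1))] \<cdot>\<^bsub>A\<^esub> circle K A P d \<mu> t \<eta> \<iota> n g f x)"


section \<open>Hochschild cohomology\<close>

text \<open>
  Maps are only considered on the carrier: \<open>hh_rel\<close> identifies in particular cochains that differ
  outside of it.
\<close>

definition hh_cochains ::
  "('k, 'a) module \<Rightarrow> ('a, 'p) graded_bimodule \<Rightarrow> int \<Rightarrow> ('p \<Rightarrow> 'a) set" where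
  "hh_cochains A P n = {f. graded_hom A P (shift (- n) (regular A)) f}"

definition hh_cocycles ::
  "('k, 'a) module \<Rightarrow> ('a, 'p) graded_bimodule \<Rightarrow> ('p \<Rightarrow> 'p) \<Rightarrow> int \<Rightarrow> ('p \<Rightarrow> 'a) set" where
  "hh_cocycles A P d n = {f \<in> hh_cochains A P n. \<forall>x\<in>carrier P. f (d x) = \<zero>\<^bsub>A\<^esub>}"

definition hh_rel ::
  "('k, 'a) module \<Rightarrow> ('a, 'p) graded_bimodule \<Rightarrow> ('p \<Rightarrow> 'p) \<Rightarrow> int \<Rightarrow> (('p \<Rightarrow> 'a) \<times> ('p \<Rightarrow> 'a)) set" where
  "hh_rel A P d n = {(f, f'). f \<in> hh_cocycles A P d n \<and> f' \<in> hh_cocycles A P d n \<and>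
     (\<exists>h\<in>hh_cochains A P (n - 1). \<forall>x\<in>carrier P. f x = f' x \<oplus>\<^bsub>A\<^esub> h (d x))}"

definition HH ::
  "('k, 'a) module \<Rightarrow> ('a, 'p) graded_bimodule \<Rightarrow> ('p \<Rightarrow> 'p) \<Rightarrow> int \<Rightarrow> ('p \<Rightarrow> 'a) set set" where
  "HH A P d n = hh_cocycles A P d n // hh_rel A P d n"

definition comparison_map ::
  "('k, 'a) module \<Rightarrow> ('a, 'q) graded_bimodule \<Rightarrow> ('q \<Rightarrow> 'q) \<Rightarrow> ('q \<Rightarrow> 'a) \<Rightarrow>
   ('a, 'p) graded_bimodule \<Rightarrow> ('p \<Rightarrow> 'p) \<Rightarrow> ('p \<Rightarrow> 'a) \<Rightarrow> ('q \<Rightarrow> 'p) \<Rightarrow> bool" where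
  "comparison_map A Q d' \<mu>' P d \<mu> \<phi> \<longleftrightarrow> graded_hom A Q P \<phi> \<and>
     (\<forall>x\<in>carrier Q. d (\<phi> x) = \<phi> (d' x) \<and> \<mu> (\<phi> x) = \<mu>' x)"

definition hh_pullback ::
  "('k, 'a) module \<Rightarrow> ('a, 'q) graded_bimodule \<Rightarrow> ('q \<Rightarrow> 'q) \<Rightarrow> int \<Rightarrow> ('q \<Rightarrow> 'p) \<Rightarrow>
   ('p \<Rightarrow> 'a) set \<Rightarrow> ('q \<Rightarrow> 'a) set" where
  "hh_pullback A Q d' n \<phi> F = (\<Union>f\<in>F. hh_rel A Q d' n `` {f \<circ> \<phi>})"


section \<open>The bar resolution and the Gerstenhaber bracket\<close>

text \<open>
  The bar resolution is built at once as the abelian group generated by all lists of length at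
  least 2 subject to multilinearity over the field. As every relator involves lists of one length only,
  this is the direct sum of the tensor powers of \<open>A\<close> with at least two factors; degree \<open>n\<close> is spanned by
  the lists of length \<open>n + 2\<close>.
\<close>

type_synonym 'a bar = "('a list \<Rightarrow>\<^sub>0 int) set"

definition bar_lists :: "('k, 'a) module \<Rightarrow> 'a list set" where
  "bar_lists A = {as. set as \<subseteq> carrier A \<and> 2 \<le> length as}"

definition bar_relators :: "'k ring \<Rightarrow> ('k, 'a) module \<Rightarrow> ('a list \<Rightarrow>\<^sub>0 int) set" where
  "bar_relators K A =
     {frag_of (as @ [x \<oplus>\<^bsub>A\<^esub> y] @ bs) - frag_of (as @ [x] @ bs) - frag_of (as @ [y] @ bs) | as bs x y.
        as @ [x] @ bs \<in> bar_lists A \<and> y \<in> carrier A} \<union>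
     {frag_of (as @ [c \<odot>\<^bsub>A\<^esub> x, y] @ bs) - frag_of (as @ [x, c \<odot>\<^bsub>A\<^esub> y] @ bs) | as bs c x y.
        as @ [x, y] @ bs \<in> bar_lists A \<and> c \<in> carrier K}"

definition bar_gen :: "'k ring \<Rightarrow> ('k, 'a) module \<Rightarrow> 'a list \<Rightarrow> 'a bar" where
  "bar_gen K A = pres_gen (bar_lists A) (bar_relators K A)"

definition bar :: "'k ring \<Rightarrow> ('k, 'a) module \<Rightarrow> ('a, 'a bar) graded_bimodule" where
  "bar K A =
     (let G = pres_group (bar_lists A) (bar_relators K A)
      in \<lparr>carrier = carrier G, monoid.mult = undefined, one = undefined,
          ring.zero = ring.zero G, ring.add = ring.add G,
          smult = (\<lambda>a. pres_lift G (\<lambda>as. bar_gen K A ((a \<otimes>\<^bsub>A\<^esub> hd as) # tl as))),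
          rsmult = (\<lambda>z a. pres_lift G (\<lambda>as. bar_gen K A (butlast as @ [last as \<otimes>\<^bsub>A\<^esub> a])) z),
          grade = (\<lambda>n. generate (add_monoid G)
            {bar_gen K A as | as. as \<in> bar_lists A \<and> int (length as) = n + 2})\<rparr>)"

text \<open>On the list \<open>a\<^sub>0, \<dots>, a\<^sub>n\<^sub>+\<^sub>1\<close> the summation index runs from 0 to \<open>n\<close>; the differential is 0 for \<open>n = 0\<close>.\<close>

definition bar_diff :: "'k ring \<Rightarrow> ('k, 'a) module \<Rightarrow> 'a bar \<Rightarrow> 'a bar" where
  "bar_diff K A = pres_lift (bar K A) (\<lambda>as.
     if length as = 2 then \<zero>\<^bsub>bar K A\<^esub>
     else finsum (bar K A) (\<lambda>i. [koszul_sign (int i)] \<cdot>\<^bsub>bar K A\<^esub>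
            bar_gen K A (take i as @ [as ! i \<otimes>\<^bsub>A\<^esub> as ! Suc i] @ drop (i + 2) as))
          {0..length as - 2})"

definition bar_aug :: "'k ring \<Rightarrow> ('k, 'a) module \<Rightarrow> 'a bar \<Rightarrow> 'a" where
  "bar_aug K A = pres_lift A (\<lambda>as. if length as = 2 then as ! 0 \<otimes>\<^bsub>A\<^esub> as ! 1 else \<zero>\<^bsub>A\<^esub>)"

text \<open>
  Elements of \<open>C\<^sup>n(A)\<close> are represented by multilinear functions on lists of length \<open>n\<close>. In \<open>gerst_circle\<close>
  the degrees of \<open>\<alpha>\<close> and \<open>\<beta>\<close> are \<open>n\<close> and \<open>m\<close>.
\<close>

definition gerst_insert ::
  "nat \<Rightarrow> nat \<Rightarrow> ('a list \<Rightarrow> 'a) \<Rightarrow> ('a list \<Rightarrow> 'a) \<Rightarrow> 'a list \<Rightarrow> 'a" where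
  "gerst_insert m i \<alpha> \<beta> as =
     \<alpha> (take (i - 1) as @ [\<beta> (take m (drop (i - 1) as))] @ drop (i - 1 + m) as)"

definition gerst_circle ::
  "('k, 'a) module \<Rightarrow> nat \<Rightarrow> nat \<Rightarrow> ('a list \<Rightarrow> 'a) \<Rightarrow> ('a list \<Rightarrow> 'a) \<Rightarrow> 'a list \<Rightarrow> 'a" where
  "gerst_circle A n m \<alpha> \<beta> as =
     finsum A (\<lambda>i. [koszul_sign ((int m - 1) * (int i - 1))] \<cdot>\<^bsub>A\<^esub> gerst_insert m i \<alpha> \<beta> as) {1..n}"

definition gerst_bracket ::
  "('k, 'a) module \<Rightarrow> nat \<Rightarrow> nat \<Rightarrow> ('a list \<Rightarrow> 'a) \<Rightarrow> ('a list \<Rightarrow> 'a) \<Rightarrow> 'a list \<Rightarrow> 'a" where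
  "gerst_bracket A n m \<alpha> \<beta> as = gerst_circle A n m \<alpha> \<beta> as \<ominus>\<^bsub>A\<^esub>
     [koszul_sign ((int n - 1) * (int m - 1))] \<cdot>\<^bsub>A\<^esub> gerst_circle A m n \<beta> \<alpha> as"

text \<open>
  The identification of bimodule maps on the bar resolution in degree \<open>n\<close> with \<open>C\<^sup>n(A)\<close>: the map \<open>f\<close>
  corresponds to \<open>\<alpha> (a\<^sub>1, \<dots>, a\<^sub>n) = f (1 \<otimes> a\<^sub>1 \<otimes> \<dots> \<otimes> a\<^sub>n \<otimes> 1)\<close>, and conversely
  \<open>f (a\<^sub>0 \<otimes> \<dots> \<otimes> a\<^sub>n\<^sub>+\<^sub>1) = a\<^sub>0 \<alpha> (a\<^sub>1, \<dots>, a\<^sub>n) a\<^sub>n\<^sub>+\<^sub>1\<close>.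
\<close>

definition to_cochain :: "'k ring \<Rightarrow> ('k, 'a) module \<Rightarrow> ('a bar \<Rightarrow> 'a) \<Rightarrow> 'a list \<Rightarrow> 'a" where
  "to_cochain K A f as = f (bar_gen K A ([\<one>\<^bsub>A\<^esub>] @ as @ [\<one>\<^bsub>A\<^esub>]))"

definition of_cochain :: "('k, 'a) module \<Rightarrow> int \<Rightarrow> ('a list \<Rightarrow> 'a) \<Rightarrow> 'a bar \<Rightarrow> 'a" where
  "of_cochain A n \<alpha> = pres_lift A (\<lambda>as.
     if int (length as) = n + 2 then hd as \<otimes>\<^bsub>A\<^esub> \<alpha> (butlast (tl as)) \<otimes>\<^bsub>A\<^esub> last as else \<zero>\<^bsub>A\<^esub>)"

definition bar_bracket ::
  "'k ring \<Rightarrow> ('k, 'a) module \<Rightarrow> nat \<Rightarrow> nat \<Rightarrow> ('a bar \<Rightarrow> 'a) \<Rightarrow> ('a bar \<Rightarrow> 'a) \<Rightarrow> 'a bar \<Rightarrow> 'a" where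
  "bar_bracket K A n m f g = of_cochain A (int n + int m - 1)
     (gerst_bracket A n m (to_cochain K A f) (to_cochain K A g))"

end

theory Submission imports Defs begin

text \<open>Let \<open>D\<close> be the differential of \<open>P \<otimes>\<^sub>A P\<close> and \<open>\<mu>\<^sub>L\<close>, \<open>\<mu>\<^sub>R\<close> the maps to \<open>P\<close> given by \<open>\<mu>\<close> on the left and on the
  right factor. Perturbing the contraction \<open>t\<^sub>L\<close> of the differential of the left factor, the maps \<open>h = S t\<^sub>L\<close> and \<open>\<Delta> = S \<eta>\<^sub>L\<close>
 satisfy \<open>D h + h D + \<Delta> \<mu>\<^sub>L = 1\<close>, \<open>D \<Delta> = \<Delta> d\<close>, \<open>\<mu>\<^sub>L \<Delta> = 1\<close> and \<open>\<mu>\<^sub>L h = 0\<close>. With \<open>\<phi> = - \<mu>\<^sub>R h\<close>, \<open>\<psi> = \<mu>\<^sub>R \<Delta>\<close> and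
 \<open>g\<^sub>\<Delta> = (g \<otimes> 1) \<Delta>\<close> one has \<open>f \<circ> g = f \<psi>\<^sub>g\<close> for \<open>\<psi>\<^sub>g = \<phi> (1 \<otimes> g\<^sub>\<Delta>) \<Delta>\<close>, and \<open>d \<psi>\<^sub>g \<plusminus> \<psi>\<^sub>g d\<close> is computed from
 \<open>d \<phi> + \<phi> D = \<psi> \<mu>\<^sub>L - \<mu>\<^sub>R\<close>. After antisymmetrisation the error terms cancel, so the bracket is defined on cohomology.
 The bar complex carries data of the same kind (deconcatenation and concatenation, with \<open>\<psi> = 1\<close>), for which \<open>f \<circ> g\<close> is
 Gerstenhaber's circle product. For a comparison map \<open>\<Phi>\<close> from the bar complex to \<open>P\<close>, the map \<open>\<psi>\<^sub>g \<Phi> - \<Phi> \<psi>\<^sub>g\<^sub>\<Phi>\<close>, corrected by terms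
 that cancel in the bracket, is a chain map over the zero map of \<open>A\<close>, hence null-homotopic; so the two brackets agree.\<close>

section \<open>Additive maps\<close>

text \<open>Every statement about f o g is f applied to an identity between bimodule maps that
  involve \<open>g\<close> alone, so the signs are settled once for \<open>psi\<close> and then
  evaluated. The obstacle is that the diagonal of the resolution is counital only on the left: on
  the right it returns \<psi>, a chain map over the identity of \<open>A\<close> but not the
  identity. Hence \<psi> enters the cup products that arise as error terms, and a comparison map
  respects neither the diagonals nor \<psi> strictly. The homotopies \<open>u\<close> and
  \<open>v\<close>, built from the contraction, repair these two failures at the cost of two
  correction terms each. A cochain turns the corrections into cup products in both orders of f and
  g, which is why they cancel in the commutator. Null-homotopies are needed out of the bar complex
  and out of the resolution. The former use a contraction linear over the field; for the latter, the
  lifting property is given at fixed types and is carried to other types by splitting a free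
  bimodule. Koszul signs are encoded by an automorphism of the graded bimodule, so that tensor
  products of maps become sign-free.\<close>

definition amap :: "('g, 'e) ring_scheme => ('h, 'f) ring_scheme => ('g => 'h) => bool" where
 "amap G H f \<longleftrightarrow> abelian_group G & abelian_group H & f : carrier G \<rightarrow> carrier H &
   (ALL x:carrier G. ALL y:carrier G. f (x \<oplus>\<^bsub>G\<^esub> y) = f x \<oplus>\<^bsub>H\<^esub> f y)"

lemma amapI:
 assumes "abelian_group G" "abelian_group H" "!!x. x : carrier G ==> f x : carrier H"
  "!!x y. [|x : carrier G; y : carrier G|] ==> f (x \<oplus>\<^bsub>G\<^esub> y) = f x \<oplus>\<^bsub>H\<^esub> f y"
 shows "amap G H f"
 using assms by (auto simp: amap_def)

lemma ag_simps:
 assumes "abelian_group G"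
 shows "!!x y. [|x : carrier G; y : carrier G|] ==> x \<oplus>\<^bsub>G\<^esub> y : carrier G"
  and "!!x y. [|x : carrier G; y : carrier G|] ==> x \<ominus>\<^bsub>G\<^esub> y : carrier G"
  and "!!x. x : carrier G ==> \<ominus>\<^bsub>G\<^esub> x : carrier G"
  and "\<zero>\<^bsub>G\<^esub> : carrier G"
  and "!!x. x : carrier G ==> \<zero>\<^bsub>G\<^esub> \<oplus>\<^bsub>G\<^esub> x = x"
  and "!!x. x : carrier G ==> x \<oplus>\<^bsub>G\<^esub> \<zero>\<^bsub>G\<^esub> = x"
  and "!!x. x : carrier G ==> \<ominus>\<^bsub>G\<^esub> (\<ominus>\<^bsub>G\<^esub> x) = x"
  and "\<ominus>\<^bsub>G\<^esub> \<zero>\<^bsub>G\<^esub> = \<zero>\<^bsub>G\<^esub>"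
proof -
 interpret abelian_group G by fact
 show "!!x y. [|x : carrier G; y : carrier G|] ==> x \<oplus>\<^bsub>G\<^esub> y : carrier G"
  and "!!x y. [|x : carrier G; y : carrier G|] ==> x \<ominus>\<^bsub>G\<^esub> y : carrier G"
  and "!!x. x : carrier G ==> \<ominus>\<^bsub>G\<^esub> x : carrier G"
  and "\<zero>\<^bsub>G\<^esub> : carrier G"
  and "!!x. x : carrier G ==> \<zero>\<^bsub>G\<^esub> \<oplus>\<^bsub>G\<^esub> x = x"
  and "!!x. x : carrier G ==> x \<oplus>\<^bsub>G\<^esub> \<zero>\<^bsub>G\<^esub> = x"
  and "!!x. x : carrier G ==> \<ominus>\<^bsub>G\<^esub> (\<ominus>\<^bsub>G\<^esub> x) = x"
  and "\<ominus>\<^bsub>G\<^esub> \<zero>\<^bsub>G\<^esub> = \<zero>\<^bsub>G\<^esub>"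
  by (simp_all add: minus_minus)
qed

lemma amapD:
 assumes f: "amap G H f"
 shows "abelian_group G" "abelian_group H"
  and amap_closed: "!!x. x : carrier G ==> f x : carrier H"
  and amap_add: "!!x y. [|x : carrier G; y : carrier G|] ==> f (x \<oplus>\<^bsub>G\<^esub> y) = f x \<oplus>\<^bsub>H\<^esub> f y"
  and amap_zero: "f \<zero>\<^bsub>G\<^esub> = \<zero>\<^bsub>H\<^esub>"
  and amap_neg: "!!x. x : carrier G ==> f (\<ominus>\<^bsub>G\<^esub> x) = \<ominus>\<^bsub>H\<^esub> f x"
  and amap_minus: "!!x y. [|x : carrier G; y : carrier G|] ==> f (x \<ominus>\<^bsub>G\<^esub> y) = f x \<ominus>\<^bsub>H\<^esub> f y"
proof -
 show G: "abelian_group G" and H: "abelian_group H" using f by (auto simp: amap_def)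
 interpret G: abelian_group G by fact
 interpret H: abelian_group H by fact
 show cl: "!!x. x : carrier G ==> f x : carrier H"
  and ad: "!!x y. [|x : carrier G; y : carrier G|] ==> f (x \<oplus>\<^bsub>G\<^esub> y) = f x \<oplus>\<^bsub>H\<^esub> f y"
  using f by (auto simp: amap_def)
 have "f \<zero>\<^bsub>G\<^esub> \<oplus>\<^bsub>H\<^esub> f \<zero>\<^bsub>G\<^esub> = f \<zero>\<^bsub>G\<^esub>" using ad[of "\<zero>\<^bsub>G\<^esub>" "\<zero>\<^bsub>G\<^esub>"] by simp
 then show z: "f \<zero>\<^bsub>G\<^esub> = \<zero>\<^bsub>H\<^esub>" using cl[OF G.zero_closed]
  using H.add.l_cancel_one' by metis
 show n: "f (\<ominus>\<^bsub>G\<^esub> x) = \<ominus>\<^bsub>H\<^esub> f x" if x: "x : carrier G" for x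
  using ad[of "\<ominus>\<^bsub>G\<^esub> x" x] x z cl by (intro H.minus_equality[symmetric]) (auto simp: G.l_neg)
 show "!!x y. [|x : carrier G; y : carrier G|] ==> f (x \<ominus>\<^bsub>G\<^esub> y) = f x \<ominus>\<^bsub>H\<^esub> f y"
  by (simp add: a_minus_def ad n)
qed

lemma amap_comp: "amap H L g ==> amap G H f ==> amap G L (%x. g (f x))"
 by (auto simp: amap_def Pi_def)

lemma amap_id: "abelian_group G ==> amap G G (%x. x)"
 by (simp add: amap_def)

lemma amap_const_zero: "abelian_group G ==> abelian_group H ==> amap G H (%x. \<zero>\<^bsub>H\<^esub>)"
 by (rule amapI) (simp_all add: ag_simps)

lemma amap_plus:
 assumes f: "amap G H f" and g: "amap G H g" shows "amap G H (%x. f x \<oplus>\<^bsub>H\<^esub> g x)"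
proof -
 interpret H: abelian_group H by (rule amapD(2)[OF f])
 show ?thesis
  using amapD[OF f] amapD[OF g] by (intro amapI) (auto simp: H.a_ac)
qed

lemma amap_uminus:
 assumes f: "amap G H f" shows "amap G H (%x. \<ominus>\<^bsub>H\<^esub> f x)"
proof -
 interpret H: abelian_group H by (rule amapD(2)[OF f])
 show ?thesis
  using amapD[OF f] by (intro amapI) (auto simp: H.minus_add)
qed

lemma amap_diff:
 assumes f: "amap G H f" and g: "amap G H g" shows "amap G H (%x. f x \<ominus>\<^bsub>H\<^esub> g x)"
 using amap_plus[OF f amap_uminus[OF g]] by (simp add: a_minus_def)

lemma amap_cong: "amap G H f ==> (!!x. x : carrier G ==> f x = g x) ==> amap G H g"
 unfolding amap_def abelian_group_def by (auto simp: abelian_monoid.a_closed Pi_def)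

lemma amap_finsum:
 assumes f: "amap G H f" and "finite S" and "!!i. i : S ==> h i : carrier G"
 shows "f (finsum G h S) = finsum H (%i. f (h i)) S"
proof -
 interpret G: abelian_group G by (rule amapD(1)[OF f])
 interpret H: abelian_group H by (rule amapD(2)[OF f])
 show ?thesis using assms(2,3)
 proof (induction S)
  case empty then show ?case by (simp add: amap_zero[OF f])
 next
  case (insert i S)
  have h: "h : S \<rightarrow> carrier G" using insert by auto
  then show ?case using insert amap_closed[OF f]
   by (simp add: amap_add[OF f] Pi_def)
 qed
qed

text \<open>Signs enter the definitions as integer multiples; all later computations use the case
  distinction on parity instead.\<close>

lemma koszul_pow:
 assumes "abelian_group G" "x : carrier G"
 shows "[koszul_sign n] \<cdot>\<^bsub>G\<^esub> x = (if even n then x else \<ominus>\<^bsub>G\<^esub> x)"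
proof -
 interpret abelian_group G by fact
 have "[(1::int)] \<cdot>\<^bsub>G\<^esub> x = x" "[(-1::int)] \<cdot>\<^bsub>G\<^esub> x = \<ominus>\<^bsub>G\<^esub> x"
  using assms(2) add.int_pow_neg[of x 1] by (simp_all add: add.int_pow_1)
 then show ?thesis by (simp add: koszul_sign_def)
qed


section \<open>Maps out of free abelian groups\<close>

text \<open>This is \<open>pres_lift\<close> with an explicit representative in place of the chosen
  one.\<close>

definition flift :: "('g, 'e) ring_scheme => ('x => 'g) => ('x \<Rightarrow>\<^sub>0 int) => 'g" where
 "flift G b c = finsum G (%x. [Poly_Mapping.lookup c x] \<cdot>\<^bsub>G\<^esub> b x) (Poly_Mapping.keys c)"

context abelian_group begin

lemma int_pow_closed: "x : carrier G ==> [(k::int)] \<cdot>\<^bsub>G\<^esub> x : carrier G"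
 by (rule add.int_pow_closed)

lemma int_pow_zero: "[(0::int)] \<cdot>\<^bsub>G\<^esub> x = \<zero>"
 by (simp add: add_pow_def int_pow_def nat_pow_def)

text \<open>Terms may cancel in \<open>c + c'\<close>, so its support can be smaller than the union
  of the supports. Additivity is therefore checked on sums over a common superset.\<close>

lemma flift_superset:
 assumes "finite S" "Poly_Mapping.keys c <= S" "!!x. x : S ==> b x : carrier G"
 shows "flift G b c = finsum G (%x. [Poly_Mapping.lookup c x] \<cdot>\<^bsub>G\<^esub> b x) S"
 unfolding flift_def
 by (rule add.finprod_mono_neutral_cong_left)
   (use assms in "auto simp: in_keys_iff int_pow_closed int_pow_zero")

lemma flift_closed:
 "(!!x. x : Poly_Mapping.keys c ==> b x : carrier G) ==> flift G b c : carrier G"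
 unfolding flift_def by (rule finsum_closed) (auto simp: int_pow_closed)

lemma flift_add:
 assumes "Poly_Mapping.keys c <= U" "Poly_Mapping.keys c' <= U" "!!x. x : U ==> b x : carrier G"
 shows "flift G b (c + c') = flift G b c \<oplus> flift G b c'"
proof -
 let ?S = "Poly_Mapping.keys c \<union> Poly_Mapping.keys c'"
 have S: "!!x. x : ?S ==> b x : carrier G" and f: "finite ?S" using assms by auto
 have "flift G b (c + c') =
  finsum G (%x. [Poly_Mapping.lookup (c + c') x] \<cdot>\<^bsub>G\<^esub> b x) ?S"
  by (rule flift_superset) (use S f keys_add[of c c'] in auto)
 also have "\<dots> = finsum G (%x. [Poly_Mapping.lookup c x] \<cdot>\<^bsub>G\<^esub> b x \<oplus> [Poly_Mapping.lookup c' x] \<cdot>\<^bsub>G\<^esub> b x) ?S"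
  by (rule finsum_cong') (use S in "auto simp: lookup_add add.int_pow_mult int_pow_closed")
 also have "\<dots> = flift G b c \<oplus> flift G b c'"
  using S flift_superset[OF f _ S, of c] flift_superset[OF f _ S, of c']
  by (subst finsum_addf) (auto simp: int_pow_closed)
 finally show ?thesis .
qed

lemma flift_zero: "flift G b 0 = \<zero>"
 by (simp add: flift_def)

lemma flift_neg:
 assumes "Poly_Mapping.keys c <= U" "!!x. x : U ==> b x : carrier G"
 shows "flift G b (- c) = \<ominus> flift G b c"
proof -
 have "flift G b (- c) \<oplus> flift G b c = \<zero>"
  using flift_add[of "-c" U c b] assms by (simp add: flift_zero)
 then show ?thesis
  using assms by (intro minus_equality[symmetric] flift_closed) auto
qed

lemma flift_diff:
 assumes "Poly_Mapping.keys c <= U" "Poly_Mapping.keys c' <= U" "!!x. x : U ==> b x : carrier G"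
 shows "flift G b (c - c') = flift G b c \<ominus> flift G b c'"
 using flift_add[of c U "- c'" b] flift_neg[of c' U b] assms by (simp add: a_minus_def)

lemma flift_frag_of: "b x : carrier G ==> flift G b (frag_of x) = b x"
 by (simp add: flift_def add.int_pow_1)

end

text \<open>
  \<open>rep G c x\<close>: the formal combination \<open>c\<close> of elements of \<open>G\<close> evaluates to \<open>x\<close>. The rules below reduce
  an identity of an abelian group to one in a free abelian group, where it is settled by type class
  arithmetic.
\<close>

definition rep :: "('g, 'e) ring_scheme => ('g \<Rightarrow>\<^sub>0 int) => 'g => bool" where
 "rep G c x \<longleftrightarrow> abelian_group G & Poly_Mapping.keys c <= carrier G & flift G (%x. x) c = x"

lemma rep_eq: "rep G c x ==> rep G c' y ==> c = c' ==> x = y"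
 by (simp add: rep_def)

lemma rep_add: "rep G c x ==> rep G c' y ==> rep G (c + c') (x \<oplus>\<^bsub>G\<^esub> y)"
 unfolding rep_def
 using keys_add[of c c'] abelian_group.flift_add[of G c "carrier G" c' "%x. x"] by auto

lemma rep_neg: "rep G c x ==> rep G (- c) (\<ominus>\<^bsub>G\<^esub> x)"
 unfolding rep_def
 using abelian_group.flift_neg[of G c "carrier G" "%x. x"] by auto

lemma rep_minus: "rep G c x ==> rep G c' y ==> rep G (c - c') (x \<ominus>\<^bsub>G\<^esub> y)"
 using rep_add[OF _ rep_neg] by (simp add: a_minus_def)

lemma rep_zero: "abelian_group G ==> rep G 0 \<zero>\<^bsub>G\<^esub>"
 by (simp add: rep_def abelian_group.flift_zero)

lemma rep_atom: "abelian_group G ==> x : carrier G ==> rep G (frag_of x) x"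
 by (simp add: rep_def abelian_group.flift_frag_of)

lemmas rep_rules = rep_add rep_neg rep_minus


lemmas frag_ind [consumes 1, case_names zero diff gen] = free_Abelian_group_induct


section \<open>Groups given by generators and relators\<close>

definition cls :: "'x set => ('x \<Rightarrow>\<^sub>0 int) set => ('x \<Rightarrow>\<^sub>0 int) => ('x \<Rightarrow>\<^sub>0 int) set" where
 "cls U R c = generate (free_Abelian_group U) R #>\<^bsub>free_Abelian_group U\<^esub> c"

lemma pres_gen_cls: "pres_gen U R x = cls U R (frag_of x)"
 by (simp add: pres_gen_def cls_def Let_def)

locale presentation =
 fixes U :: "'x set" and R :: "('x \<Rightarrow>\<^sub>0 int) set"
 assumes rel: "!!c. c : R ==> Poly_Mapping.keys c <= U"
begin

abbreviation "F == free_Abelian_group U"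
abbreviation "N == generate F R"
abbreviation "G == pres_group U R"

sublocale F: comm_group F by (rule abelian_free_Abelian_group)

lemma N_sub: "subgroup N F"
 using rel by (intro F.generate_is_subgroup) auto

lemma N_normal: "N \<lhd> F"
 using N_sub by (rule F.subgroup_imp_normal)

interpretation N: normal N F by (rule N_normal)

lemma cls_eq_iff:
 assumes "Poly_Mapping.keys c <= U" "Poly_Mapping.keys c' <= U"
 shows "cls U R c = cls U R c' \<longleftrightarrow> c - c' : N"
proof
 assume "cls U R c = cls U R c'"
 then have "c : cls U R c'"
  using F.rcos_self[OF _ N_sub, of c] assms by (simp add: cls_def)
 then obtain n where "n : N" "c = n + c'" by (auto simp: cls_def r_coset_def)
 then show "c - c' : N" by simp
next
 assume "c - c' : N"
 then have "c : cls U R c'"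
  by (auto simp: cls_def r_coset_def intro!: bexI[of _ "c - c'"])
 then show "cls U R c = cls U R c'"
  using F.repr_independence[OF _ _ N_sub, of c c'] assms by (simp add: cls_def)
qed

lemma G_carrier: "carrier G = cls U R ` {c. Poly_Mapping.keys c <= U}"
 by (auto simp: pres_group_def Let_def FactGroup_def RCOSETS_def cls_def)

lemma cls_closed: "Poly_Mapping.keys c <= U ==> cls U R c : carrier G"
 by (auto simp: G_carrier)

lemma G_add:
 "Poly_Mapping.keys c <= U ==> Poly_Mapping.keys c' <= U ==>
  cls U R c \<oplus>\<^bsub>G\<^esub> cls U R c' = cls U R (c + c')"
 using N.rcos_sum[of c c'] by (simp add: pres_group_def Let_def FactGroup_def cls_def)

lemma G_zero: "\<zero>\<^bsub>G\<^esub> = cls U R 0"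
 using F.coset_mult_one[of N] N_sub subgroup.subset
 by (simp add: pres_group_def Let_def FactGroup_def cls_def) blast

lemma G_group: "abelian_group G"
proof (rule abelian_groupI)
 fix x assume "x : carrier G"
 then obtain c where c: "x = cls U R c" "Poly_Mapping.keys c <= U" by (auto simp: G_carrier)
 show "EX y:carrier G. y \<oplus>\<^bsub>G\<^esub> x = \<zero>\<^bsub>G\<^esub>"
  using c by (intro bexI[of _ "cls U R (- c)"]) (simp_all add: G_add G_zero cls_closed)
qed (auto simp: G_carrier G_add G_zero add_ac subset_trans[OF keys_add]
   intro!: imageI)

sublocale G: abelian_group G by (rule G_group)

lemma gen_closed: "x : U ==> pres_gen U R x : carrier G"
 by (simp add: pres_gen_cls cls_closed)

lemma cls_rel: "c : R ==> cls U R c = \<zero>\<^bsub>G\<^esub>"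
 using rel[of c] by (simp add: G_zero cls_eq_iff generate.incl)

lemma cls_diff:
 "Poly_Mapping.keys c <= U ==> Poly_Mapping.keys c' <= U ==>
  cls U R (c - c') = cls U R c \<ominus>\<^bsub>G\<^esub> cls U R c'"
proof -
 assume c: "Poly_Mapping.keys c <= U" "Poly_Mapping.keys c' <= U"
 have "\<ominus>\<^bsub>G\<^esub> cls U R c' = cls U R (- c')"
  using c by (intro G.minus_equality) (simp_all add: G_add G_zero cls_closed)
 then show ?thesis using c by (simp add: a_minus_def G_add)
qed

lemma cls_diff_rel:
 assumes "c - c' : R" "Poly_Mapping.keys c <= U" "Poly_Mapping.keys c' <= U"
 shows "cls U R c = cls U R c'"
 using assms by (simp add: cls_eq_iff generate.incl)

lemma amap_cls:
 assumes f: "amap G H f" and c: "Poly_Mapping.keys c <= U"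
 shows "f (cls U R c) = flift H (%x. f (pres_gen U R x)) c"
 using c
proof (induction rule: frag_ind)
 case zero
 then show ?case using amap_zero[OF f] amapD(2)[OF f] by (simp add: G_zero abelian_group.flift_zero)
next
 case (diff x y)
 interpret H: abelian_group H by (rule amapD(2)[OF f])
 show ?case using diff f
  by (simp add: cls_diff amap_minus[OF f] cls_closed
    H.flift_diff[where U = U] amap_closed[OF f] gen_closed)
next
 case (gen a)
 interpret H: abelian_group H by (rule amapD(2)[OF f])
 show ?case using gen
  by (simp add: H.flift_frag_of pres_gen_cls amap_closed[OF f] cls_closed)
qed

text \<open>By \<open>amap_cls\<close> both maps, evaluated on one representative, are the same
  combination of their values on generators.\<close>

lemma gen_ext:
 assumes "amap G H f" "amap G H g" "!!x. x : U ==> f (pres_gen U R x) = g (pres_gen U R x)"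
  and "z : carrier G"
 shows "f z = g z"
proof -
 obtain c where c: "z = cls U R c" "Poly_Mapping.keys c <= U" using assms(4) by (auto simp: G_carrier)
 interpret H: abelian_group H by (rule amapD(2)[OF assms(1)])
 have "flift H (%x. f (pres_gen U R x)) c = flift H (%x. g (pres_gen U R x)) c"
  unfolding flift_def using c(2)
  by (intro H.finsum_cong')
    (auto simp: assms(3) subsetD intro!: H.int_pow_closed amap_closed[OF assms(2)] gen_closed)
 then show ?thesis using c amap_cls[OF assms(1)] amap_cls[OF assms(2)] by simp
qed

lemma gen_induct [consumes 1, case_names zero gen diff]:
 assumes "z : carrier G" "Q \<zero>\<^bsub>G\<^esub>" "!!x. x : U ==> Q (pres_gen U R x)"
  "!!x y. [|x : carrier G; y : carrier G; Q x; Q y|] ==> Q (x \<ominus>\<^bsub>G\<^esub> y)"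
 shows "Q z"
proof -
 obtain c where c: "z = cls U R c" "Poly_Mapping.keys c <= U" using assms(1) by (auto simp: G_carrier)
 have "Q (cls U R c)" using c(2)
 proof (induction rule: frag_ind)
  case zero then show ?case using assms(2) by (simp add: G_zero)
 next
  case (diff x y) then show ?case using assms(4) by (simp add: cls_diff cls_closed)
 next
  case (gen a) then show ?case using assms(3) by (simp add: pres_gen_cls)
 qed
 then show ?thesis using c by simp
qed

text \<open>The representative picked by \<open>pres_lift\<close> differs from any given one by an
  element of the relation subgroup, and the lift of \<open>b\<close> kills that subgroup as soon as
  it kills the relators.\<close>

lemma
 assumes H: "abelian_group H" and b: "!!x. x : U ==> b x : carrier H"
  and r: "!!c. c : R ==> flift H b c = \<zero>\<^bsub>H\<^esub>"
 shows pres_lift_amap: "amap G H (pres_lift H b)"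
  and pres_lift_gen: "x : U ==> pres_lift H b (pres_gen U R x) = b x"
proof -
 interpret H: abelian_group H by fact
 have keysN: "Poly_Mapping.keys n <= U" if "n : N" for n
  using subsetD[OF subgroup.subset[OF N_sub] that] by simp
 have N0: "flift H b n = \<zero>\<^bsub>H\<^esub>" if "n : N" for n
  using that
 proof (induction rule: generate.induct)
  case one then show ?case by (simp add: H.flift_zero)
 next
  case (incl h) then show ?case by (simp add: r)
 next
  case (inv h) then show ?case using rel[of h] b by (simp add: H.flift_neg[where U = U] r)
 next
  case (eng h1 h2)
  then show ?case using keysN b by (simp add: H.flift_add[where U = U])
 qed
 have val: "pres_lift H b (cls U R c) = flift H b c" if c: "Poly_Mapping.keys c <= U" for c
 proof -
  define e where "e = (SOME e. e : cls U R c)"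
  have "c : cls U R c" using F.rcos_self[OF _ N_sub, of c] c by (simp add: cls_def)
  then have "e : cls U R c" unfolding e_def by (rule someI)
  then obtain n where n: "n : N" "e = n + c" by (auto simp: cls_def r_coset_def)
  have "pres_lift H b (cls U R c) = flift H b e"
   by (simp add: pres_lift_def flift_def Let_def e_def)
  also have "\<dots> = flift H b c"
   using n c keysN[OF n(1)] b N0[OF n(1)] by (simp add: H.flift_add[where U = U] H.flift_closed subsetD)
  finally show ?thesis .
 qed
 show "amap G H (pres_lift H b)"
 proof (rule amapI)
  fix x assume "x : carrier G"
  then show "pres_lift H b x : carrier H" using b by (auto simp: G_carrier val H.flift_closed subsetD)
 next
  fix x y assume "x : carrier G" "y : carrier G"
  then show "pres_lift H b (x \<oplus>\<^bsub>G\<^esub> y) = pres_lift H b x \<oplus>\<^bsub>H\<^esub> pres_lift H b y"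
   using b by (auto simp: G_carrier G_add val H.flift_add[where U = U] subset_trans[OF keys_add])
 qed (rule G_group, rule H)
 show "x : U ==> pres_lift H b (pres_gen U R x) = b x"
  using b by (simp add: pres_gen_cls val H.flift_frag_of)
qed

end

section \<open>Homogeneous maps of graded bimodules\<close>

text \<open>Weaker than \<open>graded_bimod\<close>: neither the module laws nor the decomposition
  into homogeneous components is included. For tensor products this is all that homogeneous maps
  require, so their decomposition never has to be established.\<close>

definition gab :: "('k, 'a) module => ('a, 'm) graded_bimodule => bool" where
 "gab A Y \<longleftrightarrow> abelian_group Y &
   (ALL a:carrier A. amap Y Y (%x. a \<odot>\<^bsub>Y\<^esub> x) & amap Y Y (%x. rsmult Y x a)) &
   (ALL n. grade Y n <= carrier Y & \<zero>\<^bsub>Y\<^esub> : grade Y n &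
    (ALL x:grade Y n. \<ominus>\<^bsub>Y\<^esub> x : grade Y n & (ALL y:grade Y n. x \<oplus>\<^bsub>Y\<^esub> y : grade Y n)))"

lemma gabD:
 assumes "gab A Y"
 shows gab_group: "abelian_group Y"
  and gab_smult: "!!a. a : carrier A ==> amap Y Y (%x. a \<odot>\<^bsub>Y\<^esub> x)"
  and gab_rsmult: "!!a. a : carrier A ==> amap Y Y (%x. rsmult Y x a)"
  and gab_grade: "!!x n. x : grade Y n ==> x : carrier Y"
  and gab_grade_zero: "!!n. \<zero>\<^bsub>Y\<^esub> : grade Y n"
  and gab_grade_neg: "!!x n. x : grade Y n ==> \<ominus>\<^bsub>Y\<^esub> x : grade Y n"
  and gab_grade_add: "!!x y n. x : grade Y n ==> y : grade Y n ==> x \<oplus>\<^bsub>Y\<^esub> y : grade Y n"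
  and gab_grade_minus: "!!x y n. x : grade Y n ==> y : grade Y n ==> x \<ominus>\<^bsub>Y\<^esub> y : grade Y n"
 using assms by (auto simp: gab_def a_minus_def)

text \<open>Degree \<open>s\<close> means a map to the shift by \<open>s\<close>. A Hochschild
  cochain of degree \<open>n\<close> is thus a map of degree \<open>- n\<close> to the regular
  bimodule.\<close>

definition ghom ::
 "('k, 'a) module => ('a, 'm) graded_bimodule => ('a, 'n) graded_bimodule => int => ('m => 'n) => bool" where
 "ghom A Q Y s f \<longleftrightarrow> gab A Q & gab A Y & amap Q Y f &
   (ALL a:carrier A. ALL x:carrier Q. f (a \<odot>\<^bsub>Q\<^esub> x) = a \<odot>\<^bsub>Y\<^esub> f x & f (rsmult Q x a) = rsmult Y (f x) a) &
   (ALL n. ALL x:grade Q n. f x : grade Y (n + s))"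

lemma ghomD:
 assumes "ghom A Q Y s f"
 shows "gab A Q" "gab A Y"
  and ghom_amap: "amap Q Y f"
  and ghom_closed: "!!x. x : carrier Q ==> f x : carrier Y"
  and ghom_add: "!!x y. [|x : carrier Q; y : carrier Q|] ==> f (x \<oplus>\<^bsub>Q\<^esub> y) = f x \<oplus>\<^bsub>Y\<^esub> f y"
  and ghom_zero: "f \<zero>\<^bsub>Q\<^esub> = \<zero>\<^bsub>Y\<^esub>"
  and ghom_neg: "!!x. x : carrier Q ==> f (\<ominus>\<^bsub>Q\<^esub> x) = \<ominus>\<^bsub>Y\<^esub> f x"
  and ghom_minus: "!!x y. [|x : carrier Q; y : carrier Q|] ==> f (x \<ominus>\<^bsub>Q\<^esub> y) = f x \<ominus>\<^bsub>Y\<^esub> f y"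
  and ghom_smult: "!!a x. [|a : carrier A; x : carrier Q|] ==> f (a \<odot>\<^bsub>Q\<^esub> x) = a \<odot>\<^bsub>Y\<^esub> f x"
  and ghom_rsmult: "!!a x. [|a : carrier A; x : carrier Q|] ==> f (rsmult Q x a) = rsmult Y (f x) a"
 using assms amapD[of Q Y f] by (simp_all add: ghom_def)

lemma ghom_degree: "ghom A Q Y s f ==> x : grade Q n ==> k = n + s ==> f x : grade Y k"
 by (simp add: ghom_def)

lemma ghomI:
 assumes "gab A Q" "gab A Y" "amap Q Y f"
  "!!a x. [|a : carrier A; x : carrier Q|] ==> f (a \<odot>\<^bsub>Q\<^esub> x) = a \<odot>\<^bsub>Y\<^esub> f x"
  "!!a x. [|a : carrier A; x : carrier Q|] ==> f (rsmult Q x a) = rsmult Y (f x) a"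
  "!!n x. x : grade Q n ==> f x : grade Y (n + s)"
 shows "ghom A Q Y s f"
 using assms by (simp add: ghom_def)

lemma ghom_comp:
 assumes g: "ghom A Y Z s g" and f: "ghom A Q Y r f" and t: "t = r + s"
 shows "ghom A Q Z t (%x. g (f x))"
 using ghomD[OF g] ghomD[OF f] t
 by (intro ghomI) (auto simp: add.assoc intro!: amap_comp[OF ghom_amap[OF g] ghom_amap[OF f]]
   ghom_degree[OF g] ghom_degree[OF f])

lemma ghom_id: "gab A Q ==> ghom A Q Q 0 (%x. x)"
 by (rule ghomI) (auto intro: amap_id gab_group)

lemma ghom_plus:
 assumes g: "ghom A Q Y s g" and f: "ghom A Q Y s f"
 shows "ghom A Q Y s (%x. f x \<oplus>\<^bsub>Y\<^esub> g x)"
proof (rule ghomI)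
 note Y = ghomD(2)[OF f]
 show "gab A Q" "gab A Y" using ghomD[OF f] by simp_all
 show "amap Q Y (%x. f x \<oplus>\<^bsub>Y\<^esub> g x)" by (rule amap_plus[OF ghom_amap[OF f] ghom_amap[OF g]])
 fix a x assume "a : carrier A" "x : carrier Q"
 then show "f (a \<odot>\<^bsub>Q\<^esub> x) \<oplus>\<^bsub>Y\<^esub> g (a \<odot>\<^bsub>Q\<^esub> x) = a \<odot>\<^bsub>Y\<^esub> (f x \<oplus>\<^bsub>Y\<^esub> g x)"
  "f (rsmult Q x a) \<oplus>\<^bsub>Y\<^esub> g (rsmult Q x a) = rsmult Y (f x \<oplus>\<^bsub>Y\<^esub> g x) a"
  using ghomD[OF f] ghomD[OF g] amap_add[OF gab_smult[OF Y]] amap_add[OF gab_rsmult[OF Y]] by simp_all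
next
 fix n x assume "x : grade Q n"
 then show "f x \<oplus>\<^bsub>Y\<^esub> g x : grade Y (n + s)"
  by (intro gab_grade_add[OF ghomD(2)[OF f]] ghom_degree[OF f] ghom_degree[OF g]) auto
qed

lemma ghom_uminus:
 assumes f: "ghom A Q Y s f"
 shows "ghom A Q Y s (%x. \<ominus>\<^bsub>Y\<^esub> f x)"
proof (rule ghomI)
 note Y = ghomD(2)[OF f]
 show "gab A Q" "gab A Y" using ghomD[OF f] by simp_all
 show "amap Q Y (%x. \<ominus>\<^bsub>Y\<^esub> f x)" by (rule amap_uminus[OF ghom_amap[OF f]])
 fix a x assume "a : carrier A" "x : carrier Q"
 then show "\<ominus>\<^bsub>Y\<^esub> f (a \<odot>\<^bsub>Q\<^esub> x) = a \<odot>\<^bsub>Y\<^esub> (\<ominus>\<^bsub>Y\<^esub> f x)"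
  "\<ominus>\<^bsub>Y\<^esub> f (rsmult Q x a) = rsmult Y (\<ominus>\<^bsub>Y\<^esub> f x) a"
  using ghomD[OF f] amap_neg[OF gab_smult[OF Y]] amap_neg[OF gab_rsmult[OF Y]] by simp_all
next
 fix n x assume "x : grade Q n"
 then show "\<ominus>\<^bsub>Y\<^esub> f x : grade Y (n + s)"
  by (intro gab_grade_neg[OF ghomD(2)[OF f]] ghom_degree[OF f]) auto
qed

lemma ghom_diff:
 assumes f: "ghom A Q Y s f" and g: "ghom A Q Y s g"
 shows "ghom A Q Y s (%x. f x \<ominus>\<^bsub>Y\<^esub> g x)"
 using ghom_plus[OF ghom_uminus[OF g] f] by (simp add: a_minus_def)

lemma ghom_cong:
 assumes f: "ghom A Q Y s f" and eq: "!!x. x : carrier Q ==> f x = g x"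
 shows "ghom A Q Y s g"
proof (rule ghomI)
 note Q = ghomD(1)[OF f]
 show "gab A Q" "gab A Y" using ghomD[OF f] by simp_all
 show "amap Q Y g" by (rule amap_cong[OF ghom_amap[OF f] eq])
 fix a x assume "a : carrier A" "x : carrier Q"
 then show "g (a \<odot>\<^bsub>Q\<^esub> x) = a \<odot>\<^bsub>Y\<^esub> g x" "g (rsmult Q x a) = rsmult Y (g x) a"
  using ghomD[OF f] amap_closed[OF gab_smult[OF Q]] amap_closed[OF gab_rsmult[OF Q]]
  by (simp_all flip: eq)
next
 fix n x assume "x : grade Q n"
 then show "g x : grade Y (n + s)"
  using ghom_degree[OF f] gab_grade[OF ghomD(1)[OF f]] by (simp flip: eq)
qed

text \<open>The action of the sign \<open>(-1)\<^sup>m\<close>, avoiding integer multiples.\<close>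

definition sneg :: "('g, 'e) ring_scheme => int => 'g => 'g" where
 "sneg G m x = (if even m then x else \<ominus>\<^bsub>G\<^esub> x)"

lemma ghom_sneg: "ghom A Q Y s f ==> ghom A Q Y s (%x. sneg Y m (f x))"
 by (cases "even m") (simp_all add: sneg_def ghom_uminus)


section \<open>Homogeneous components\<close>

lemma gab_graded_bimod:
 assumes "graded_bimod K A Q" shows "gab A Q"
proof -
 have b: "bimod K A Q" and c: "!!n. bimod K A (component Q n)" and s: "!!n. grade Q n <= carrier Q"
  using assms by (auto simp: graded_bimod_def)
 interpret Q: abelian_group Q using b by (simp add: bimod_def)
 have z: "\<zero>\<^bsub>Q\<^esub> : grade Q n" and ad: "x : grade Q n ==> y : grade Q n ==> x \<oplus>\<^bsub>Q\<^esub> y : grade Q n"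
  and ng: "x : grade Q n ==> \<ominus>\<^bsub>Q\<^esub> x : grade Q n" for n x y
 proof -
  interpret C: abelian_group "component Q n" using c[of n] by (simp add: bimod_def)
  show "\<zero>\<^bsub>Q\<^esub> : grade Q n" using C.zero_closed by (simp add: component_def)
  show "x : grade Q n ==> y : grade Q n ==> x \<oplus>\<^bsub>Q\<^esub> y : grade Q n"
   using C.a_closed[of x y] by (simp add: component_def)
  assume x: "x : grade Q n"
  then have y: "\<ominus>\<^bsub>component Q n\<^esub> x : grade Q n" "\<ominus>\<^bsub>component Q n\<^esub> x \<oplus>\<^bsub>Q\<^esub> x = \<zero>\<^bsub>Q\<^esub>"
   using C.a_inv_closed[of x] C.l_neg[of x] by (auto simp: component_def)
  then have "\<ominus>\<^bsub>Q\<^esub> x = \<ominus>\<^bsub>component Q n\<^esub> x"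
   using x s[of n] by (intro Q.minus_equality) auto
  then show "\<ominus>\<^bsub>Q\<^esub> x : grade Q n" using y by simp
 qed
 show ?thesis
  using b s z ad ng unfolding gab_def bimod_def by (auto simp: amap_def)
qed

lemma hcomp_decomp:
 assumes "graded_bimod K A Q" "x : carrier Q"
 shows "homogeneous_decomp Q x (hcomp Q x)"
proof -
 have "EX! c. homogeneous_decomp Q x c" using assms by (simp add: graded_bimod_def)
 then show ?thesis unfolding hcomp_def by (rule theI')
qed

lemma hcomp_eqI:
 assumes "graded_bimod K A Q" "x : carrier Q" "homogeneous_decomp Q x c"
 shows "hcomp Q x = c"
 using assms hcomp_decomp[OF assms(1,2)] by (auto simp: graded_bimod_def)

lemma homogeneous_decompI:
 assumes Q: "gab A Q" and c: "!!n. c n : grade Q n" and S: "finite S" "!!n. n \<notin> S ==> c n = \<zero>\<^bsub>Q\<^esub>"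
  and x: "x = finsum Q c S"
 shows "homogeneous_decomp Q x c"
proof -
 interpret Q: abelian_group Q by (rule gab_group[OF Q])
 have f: "{n. c n ~= \<zero>\<^bsub>Q\<^esub>} <= S" using S by auto
 have cc: "c n : carrier Q" for n using c gab_grade[OF Q] by blast
 have "finsum Q c {n. c n ~= \<zero>\<^bsub>Q\<^esub>} = finsum Q c S"
  by (rule Q.add.finprod_mono_neutral_cong_left) (use S f cc in auto)
 then show ?thesis
  using c x finite_subset[OF f S(1)] by (simp add: homogeneous_decomp_def)
qed

lemma hcomp_homog:
 assumes Q: "graded_bimod K A Q" and x: "x : grade Q n"
 shows "hcomp Q x = (%i. if i = n then x else \<zero>\<^bsub>Q\<^esub>)"
proof -
 have g: "gab A Q" by (rule gab_graded_bimod[OF Q])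
 interpret Q: abelian_group Q by (rule gab_group[OF g])
 show ?thesis
  by (rule hcomp_eqI[OF Q gab_grade[OF g x]], rule homogeneous_decompI[OF g, where S = "{n}"])
    (use x gab_grade[OF g] gab_grade_zero[OF g] in auto)
qed

lemma hcomp_props:
 assumes Q: "graded_bimod K A Q" and x: "x : carrier Q"
 shows "hcomp Q x i : grade Q i" "finite {i. hcomp Q x i ~= \<zero>\<^bsub>Q\<^esub>}"
  "finsum Q (hcomp Q x) {i. hcomp Q x i ~= \<zero>\<^bsub>Q\<^esub>} = x"
 using hcomp_decomp[OF Q x] by (auto simp: homogeneous_decomp_def)

lemma hcomp_superset:
 assumes Q: "graded_bimod K A Q" and x: "x : carrier Q"
  and H: "abelian_group H" and S: "finite S" "{i. hcomp Q x i ~= \<zero>\<^bsub>Q\<^esub>} <= S"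
  and k: "!!i y. y : grade Q i ==> \<kappa> i y : carrier H" "!!i. \<kappa> i \<zero>\<^bsub>Q\<^esub> = \<zero>\<^bsub>H\<^esub>"
 shows "finsum H (%i. \<kappa> i (hcomp Q x i)) {i. hcomp Q x i ~= \<zero>\<^bsub>Q\<^esub>} = finsum H (%i. \<kappa> i (hcomp Q x i)) S"
proof -
 interpret H: abelian_group H by fact
 show ?thesis
  by (rule H.add.finprod_mono_neutral_cong_left) (use S k hcomp_props[OF Q x] in auto)
qed

text \<open>The componentwise sum is a homogeneous decomposition, and decompositions are
  unique.\<close>

lemma hcomp_add:
 assumes Q: "graded_bimod K A Q" and x: "x : carrier Q" and y: "y : carrier Q"
 shows "hcomp Q (x \<oplus>\<^bsub>Q\<^esub> y) = (%i. hcomp Q x i \<oplus>\<^bsub>Q\<^esub> hcomp Q y i)"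
proof -
 have g: "gab A Q" by (rule gab_graded_bimod[OF Q])
 interpret Q: abelian_group Q by (rule gab_group[OF g])
 let ?S = "{i. hcomp Q x i ~= \<zero>\<^bsub>Q\<^esub>} \<union> {i. hcomp Q y i ~= \<zero>\<^bsub>Q\<^esub>}"
 note px = hcomp_props[OF Q x] and py = hcomp_props[OF Q y]
 have c: "hcomp Q x i : carrier Q" "hcomp Q y i : carrier Q" for i
  using px(1) py(1) gab_grade[OF g] by auto
 have "x = finsum Q (hcomp Q x) ?S" "y = finsum Q (hcomp Q y) ?S"
  using hcomp_superset[OF Q x Q.abelian_group_axioms, of ?S "%i y. y"] px
   hcomp_superset[OF Q y Q.abelian_group_axioms, of ?S "%i y. y"] py gab_grade[OF g] by auto
 then have "x \<oplus>\<^bsub>Q\<^esub> y = finsum Q (%i. hcomp Q x i \<oplus>\<^bsub>Q\<^esub> hcomp Q y i) ?S"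
  using c by (subst Q.finsum_addf) auto
 then show ?thesis
  using px py c gab_grade_add[OF g]
  by (intro hcomp_eqI[OF Q] homogeneous_decompI[OF g, where S = ?S]) (auto simp: x y)
qed

text \<open>The universal property of the direct sum. Only the values of \<open>\<kappa> i\<close>
  on the component of degree \<open>i\<close> enter, so the family may be arbitrary
  elsewhere.\<close>

definition assemble ::
 "('a, 'm) graded_bimodule => ('h, 'e) ring_scheme => (int => 'm => 'h) => 'm => 'h" where
 "assemble Q H \<kappa> x = finsum H (%i. \<kappa> i (hcomp Q x i)) {i. hcomp Q x i ~= \<zero>\<^bsub>Q\<^esub>}"

lemma
 assumes Q: "graded_bimod K A Q" and H: "abelian_group H"
  and cl: "!!i y. y : grade Q i ==> \<kappa> i y : carrier H"
  and ad: "!!i y z. y : grade Q i ==> z : grade Q i ==> \<kappa> i (y \<oplus>\<^bsub>Q\<^esub> z) = \<kappa> i y \<oplus>\<^bsub>H\<^esub> \<kappa> i z"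
 shows assemble_amap: "amap Q H (assemble Q H \<kappa>)"
  and assemble_val: "x : grade Q n ==> assemble Q H \<kappa> x = \<kappa> n x"
proof -
 have g: "gab A Q" by (rule gab_graded_bimod[OF Q])
 interpret Q: abelian_group Q by (rule gab_group[OF g])
 interpret H: abelian_group H by (rule H)
 have z: "\<kappa> i \<zero>\<^bsub>Q\<^esub> = \<zero>\<^bsub>H\<^esub>" for i
 proof -
  have "\<kappa> i \<zero>\<^bsub>Q\<^esub> \<oplus>\<^bsub>H\<^esub> \<kappa> i \<zero>\<^bsub>Q\<^esub> = \<kappa> i \<zero>\<^bsub>Q\<^esub>"
   using ad[of "\<zero>\<^bsub>Q\<^esub>" i "\<zero>\<^bsub>Q\<^esub>"] gab_grade_zero[OF g] by simp
  then show ?thesis using cl[OF gab_grade_zero[OF g]] H.add.l_cancel_one' by metis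
 qed
 show "amap Q H (assemble Q H \<kappa>)"
 proof (rule amapI[OF Q.abelian_group_axioms H])
  fix x assume x: "x : carrier Q"
  show "assemble Q H \<kappa> x : carrier H"
   unfolding assemble_def by (rule H.finsum_closed) (use hcomp_props[OF Q x] cl in auto)
  fix y assume y: "y : carrier Q"
  let ?S = "{i. hcomp Q x i ~= \<zero>\<^bsub>Q\<^esub>} \<union> {i. hcomp Q y i ~= \<zero>\<^bsub>Q\<^esub>}"
  have S: "finite ?S" using hcomp_props[OF Q x] hcomp_props[OF Q y] by auto
  have "assemble Q H \<kappa> (x \<oplus>\<^bsub>Q\<^esub> y) = finsum H (%i. \<kappa> i (hcomp Q (x \<oplus>\<^bsub>Q\<^esub> y) i)) ?S"
   unfolding assemble_def by (rule hcomp_superset[OF Q _ H S]) (auto simp: x y hcomp_add[OF Q x y] cl z)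
  also have "\<dots> = finsum H (%i. \<kappa> i (hcomp Q x i)) ?S \<oplus>\<^bsub>H\<^esub> finsum H (%i. \<kappa> i (hcomp Q y i)) ?S"
   using hcomp_props(1)[OF Q x] hcomp_props(1)[OF Q y]
   by (subst H.finsum_addf[symmetric]) (auto simp: hcomp_add[OF Q x y] ad cl)
  also have "\<dots> = assemble Q H \<kappa> x \<oplus>\<^bsub>H\<^esub> assemble Q H \<kappa> y"
   unfolding assemble_def
   using hcomp_superset[OF Q x H S, of \<kappa>] hcomp_superset[OF Q y H S, of \<kappa>] cl z by simp
  finally show "assemble Q H \<kappa> (x \<oplus>\<^bsub>Q\<^esub> y) = assemble Q H \<kappa> x \<oplus>\<^bsub>H\<^esub> assemble Q H \<kappa> y" .
 qed
 assume x: "x : grade Q n"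
 have "assemble Q H \<kappa> x = finsum H (%i. \<kappa> i (hcomp Q x i)) {n}"
  unfolding assemble_def
  by (rule hcomp_superset[OF Q gab_grade[OF g x] H]) (auto simp: hcomp_homog[OF Q x] cl z)
 then show "assemble Q H \<kappa> x = \<kappa> n x"
  using cl[OF x] by (simp add: hcomp_homog[OF Q x])
qed

lemma graded_ext:
 assumes Q: "graded_bimod K A Q" and f: "amap Q H f" and g: "amap Q H g"
  and eq: "!!n x. x : grade Q n ==> f x = g x" and x: "x : carrier Q"
 shows "f x = g x"
proof -
 interpret H: abelian_group H by (rule amapD(2)[OF f])
 note p = hcomp_props[OF Q x]
 have c: "hcomp Q x i : carrier Q" for i using p(1) gab_grade[OF gab_graded_bimod[OF Q]] by blast
 have "f x = finsum H (%i. f (hcomp Q x i)) {i. hcomp Q x i ~= \<zero>\<^bsub>Q\<^esub>}"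
  using amap_finsum[OF f p(2), of "hcomp Q x"] c p(3) by simp
 also have "\<dots> = finsum H (%i. g (hcomp Q x i)) {i. hcomp Q x i ~= \<zero>\<^bsub>Q\<^esub>}"
  using c amap_closed[OF g] by (intro H.finsum_cong') (auto simp: eq[OF p(1)])
 also have "\<dots> = g x"
  using amap_finsum[OF g p(2), of "hcomp Q x"] c p(3) by simp
 finally show ?thesis .
qed

lemma graded_bimod_smult:
 assumes Q: "graded_bimod K A Q" and a: "a : carrier A" and x: "x : grade Q n"
 shows "a \<odot>\<^bsub>Q\<^esub> x : grade Q n" "rsmult Q x a : grade Q n"
proof -
 have "bimod K A (component Q n)" using Q by (simp add: graded_bimod_def)
 then show "a \<odot>\<^bsub>Q\<^esub> x : grade Q n" "rsmult Q x a : grade Q n"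
  using a x unfolding bimod_def by (auto simp: component_def)
qed

lemma assemble_ghom:
 assumes Q: "graded_bimod K A Q" and Y: "gab A Y"
  and dg: "!!i x. x : grade Q i ==> \<kappa> i x : grade Y (i + s)"
  and ad: "!!i x y. x : grade Q i ==> y : grade Q i ==> \<kappa> i (x \<oplus>\<^bsub>Q\<^esub> y) = \<kappa> i x \<oplus>\<^bsub>Y\<^esub> \<kappa> i y"
  and sm: "!!i x a. x : grade Q i ==> a : carrier A ==> \<kappa> i (a \<odot>\<^bsub>Q\<^esub> x) = a \<odot>\<^bsub>Y\<^esub> \<kappa> i x"
  and rs: "!!i x a. x : grade Q i ==> a : carrier A ==> \<kappa> i (rsmult Q x a) = rsmult Y (\<kappa> i x) a"
 shows "ghom A Q Y s (assemble Q Y \<kappa>)"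
proof -
 have g: "gab A Q" by (rule gab_graded_bimod[OF Q])
 have cl: "!!i y. y : grade Q i ==> \<kappa> i y : carrier Y" using dg gab_grade[OF Y] by blast
 note am = assemble_amap[OF Q gab_group[OF Y] cl ad]
 have v: "assemble Q Y \<kappa> x = \<kappa> n x" if "x : grade Q n" for x n
  by (rule assemble_val[OF Q gab_group[OF Y] cl ad that])
 show ?thesis
 proof (rule ghomI[OF g Y am])
  fix a x assume a: "a : carrier A" and x: "x : carrier Q"
  have e: "assemble Q Y \<kappa> (a \<odot>\<^bsub>Q\<^esub> x) = a \<odot>\<^bsub>Y\<^esub> assemble Q Y \<kappa> x" if "x : grade Q n" for n x
   using that by (simp add: v[OF that] v[OF graded_bimod_smult(1)[OF Q a that]] sm[OF that a])
  show "assemble Q Y \<kappa> (a \<odot>\<^bsub>Q\<^esub> x) = a \<odot>\<^bsub>Y\<^esub> assemble Q Y \<kappa> x"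
   by (rule graded_ext[OF Q amap_comp[OF am gab_smult[OF g a]] amap_comp[OF gab_smult[OF Y a] am] e x])
  have e: "assemble Q Y \<kappa> (rsmult Q x a) = rsmult Y (assemble Q Y \<kappa> x) a" if "x : grade Q n" for n x
   using that by (simp add: v[OF that] v[OF graded_bimod_smult(2)[OF Q a that]] rs[OF that a])
  show "assemble Q Y \<kappa> (rsmult Q x a) = rsmult Y (assemble Q Y \<kappa> x) a"
   by (rule graded_ext[OF Q amap_comp[OF am gab_rsmult[OF g a]] amap_comp[OF gab_rsmult[OF Y a] am] e x])
 next
  fix n x assume x: "x : grade Q n"
  show "assemble Q Y \<kappa> x : grade Y (n + s)" by (simp add: v[OF x] dg[OF x])
 qed
qed

text \<open>Multiplication by \<open>(-1)^(im)\<close> in degree \<open>i\<close>, as a bimodule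
  automorphism. Composing the left factor with it turns the Koszul rule for f \<otimes> g, with g of
  degree m, into a tensor product of maps without signs. Only the parity of \<open>m\<close>
  matters.\<close>

definition sgnmap :: "('a, 'm) graded_bimodule => int => 'm => 'm" where
 "sgnmap Q m = (if even m then (%x. x) else assemble Q Q (%i x. sneg Q i x))"

lemma
 assumes Q: "graded_bimod K A Q"
 shows sgnmap_ghom: "ghom A Q Q 0 (sgnmap Q m)"
  and sgnmap_val: "x : grade Q n ==> sgnmap Q m x = sneg Q (n * m) x"
proof -
 have g: "gab A Q" by (rule gab_graded_bimod[OF Q])
 interpret Q: abelian_group Q by (rule gab_group[OF g])
 have *: "sneg Q i (x \<oplus>\<^bsub>Q\<^esub> y) = sneg Q i x \<oplus>\<^bsub>Q\<^esub> sneg Q i y" if "x : grade Q i" "y : grade Q i" for i x y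
  using that gab_grade[OF g] by (auto simp: sneg_def Q.minus_add)
 show "ghom A Q Q 0 (sgnmap Q m)"
 proof (cases "even m")
  case True then show ?thesis by (simp add: sgnmap_def ghom_id[OF g])
 next
  case False
  then show ?thesis
   using gab_grade[OF g]
   by (auto simp: sgnmap_def sneg_def Q.minus_add gab_grade_neg[OF g]
      amap_neg[OF gab_smult[OF g]] amap_neg[OF gab_rsmult[OF g]]
     intro!: assemble_ghom[OF Q g])
 qed
 show "x : grade Q n ==> sgnmap Q m x = sneg Q (n * m) x"
  using assemble_val[OF Q Q.abelian_group_axioms, of "sneg Q" x n] * gab_grade[OF g]
  by (auto simp: sgnmap_def sneg_def)
qed

lemma sgnmap_sgnmap:
 assumes Q: "graded_bimod K A Q" and x: "x : carrier Q"
 shows "sgnmap Q m (sgnmap Q n x) = sgnmap Q (m + n) x"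
proof -
 have g: "gab A Q" by (rule gab_graded_bimod[OF Q])
 interpret Q: abelian_group Q by (rule gab_group[OF g])
 note am = ghom_amap[OF sgnmap_ghom[OF Q]]
 show ?thesis
  by (rule graded_ext[OF Q amap_comp[OF am am] am _ x])
    (auto simp: sgnmap_val[OF Q] sneg_def gab_grade_neg[OF g] amap_neg[OF am] gab_grade[OF g] Q.minus_minus)
qed

lemma sgnmap_even: "even m ==> sgnmap Q m x = x"
 by (simp add: sgnmap_def)

lemma sgnmap_parity: "even m = even n ==> sgnmap Q m = sgnmap Q n"
 by (simp add: sgnmap_def)

text \<open>A map of degree \<open>s\<close> shifts the degree that the twist sees, which costs the
  constant sign \<open>(-1)^(ms)\<close>.\<close>

lemma ghom_sgnmap:
 assumes Q: "graded_bimod K A Q" and Y: "graded_bimod K A Y" and f: "ghom A Q Y s f" and x: "x : carrier Q"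
 shows "f (sgnmap Q m x) = sneg Y (m * s) (sgnmap Y m (f x))"
proof -
 interpret Y: abelian_group Y by (rule gab_group[OF ghomD(2)[OF f]])
 note amX = ghom_amap[OF sgnmap_ghom[OF Q]] and amY = ghom_amap[OF sgnmap_ghom[OF Y]]
 note fa = ghom_amap[OF f]
 have am: "amap Q Y (%x. sneg Y (m * s) (sgnmap Y m (f x)))"
  by (cases "even (m * s)") (simp_all add: sneg_def amap_uminus amap_comp[OF amY fa] del: even_mult_iff)
 show ?thesis
 proof (rule graded_ext[OF Q amap_comp[OF fa amX] am _ x])
  fix n x assume x: "x : grade Q n"
  have "x : carrier Q" "f x : carrier Y" using x gab_grade[OF ghomD(1)[OF f]] amap_closed[OF fa] by auto
  then show "f (sgnmap Q m x) = sneg Y (m * s) (sgnmap Y m (f x))"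
   using x ghom_degree[OF f x refl]
   by (auto simp: sgnmap_val[OF Q x] sgnmap_val[OF Y] sneg_def amap_neg[OF fa] Y.minus_minus)
 qed
qed

text \<open>The sum over homogeneous components in \<open>tensor_map\<close> collapses to a single
  evaluation at the twisted argument.\<close>

lemma tensor_sign_sum:
 assumes Q: "graded_bimod K A Q" and q: "amap Q H q" and x: "x : carrier Q"
 shows "finsum H (%i. [koszul_sign (i * m)] \<cdot>\<^bsub>H\<^esub> q (hcomp Q x i)) {i. hcomp Q x i ~= \<zero>\<^bsub>Q\<^esub>}
  = q (sgnmap Q m x)"
proof -
 have g: "gab A Q" by (rule gab_graded_bimod[OF Q])
 interpret H: abelian_group H by (rule amapD(2)[OF q])
 let ?k = "%i y. [koszul_sign (i * m)] \<cdot>\<^bsub>H\<^esub> q y"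
 have k: "?k i y = sneg H (i * m) (q y)" if "y : carrier Q" for i y
  using koszul_pow[OF H.abelian_group_axioms amap_closed[OF q that]] by (simp add: sneg_def)
 have c: "?k i y : carrier H" if "y : grade Q i" for i y
  using that amap_closed[OF q] gab_grade[OF g] by (simp add: H.int_pow_closed)
 have ad: "?k i (y \<oplus>\<^bsub>Q\<^esub> z) = ?k i y \<oplus>\<^bsub>H\<^esub> ?k i z" if "y : grade Q i" "z : grade Q i" for i y z
 proof -
  have c: "y : carrier Q" "z : carrier Q" "y \<oplus>\<^bsub>Q\<^esub> z : carrier Q"
   using that gab_grade[OF g] abelian_groupE(1)[OF gab_group[OF g]] by auto
  then show ?thesis
   unfolding k[OF c(1)] k[OF c(2)] k[OF c(3)]
   using amap_closed[OF q] by (auto simp: sneg_def amap_add[OF q] H.minus_add)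
 qed
 have "assemble Q H ?k x = q (sgnmap Q m x)"
  by (rule graded_ext[OF Q assemble_amap[OF Q H.abelian_group_axioms c ad]
     amap_comp[OF q ghom_amap[OF sgnmap_ghom[OF Q]]] _ x])
    (auto simp: assemble_val[OF Q H.abelian_group_axioms c ad] sgnmap_val[OF Q]
     gab_grade[OF g] k sneg_def amap_neg[OF q])
 then show ?thesis by (simp add: assemble_def)
qed

section \<open>Tensor products\<close>

lemma frag_keys:
 "x : U ==> Poly_Mapping.keys (frag_of x) <= U"
 "Poly_Mapping.keys c <= U ==> Poly_Mapping.keys c' <= U ==> Poly_Mapping.keys (c + c') <= U"
 "Poly_Mapping.keys c <= U ==> Poly_Mapping.keys c' <= U ==> Poly_Mapping.keys (c - c') <= U"
 using keys_add[of c c'] keys_diff[of c c'] by auto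

text \<open>A tensor product and the presented group underlying it are different records with the
  same additive part. This and the following lemmas carry additive facts from one record to the
  other.\<close>

lemma abelian_group_cong:
 assumes "abelian_group G" "carrier T = carrier G" "add T = add G" "\<zero>\<^bsub>T\<^esub> = \<zero>\<^bsub>G\<^esub>"
 shows "abelian_group T"
 using assms abelian_groupE[OF assms(1)] by (intro abelian_groupI) auto

lemma amap_record_cong:
 assumes "amap G H f" "carrier T = carrier G" "add T = add G" "\<zero>\<^bsub>T\<^esub> = \<zero>\<^bsub>G\<^esub>"
 shows "amap T H f"
 using assms abelian_group_cong[of G T] by (auto simp: amap_def)

lemma amap_record_cong2:
 assumes "amap H G f" "carrier T = carrier G" "add T = add G" "\<zero>\<^bsub>T\<^esub> = \<zero>\<^bsub>G\<^esub>"
 shows "amap H T f"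
 using assms abelian_group_cong[of G T] by (auto simp: amap_def)

lemma a_inv_record_cong:
 assumes "carrier T = carrier G" "add T = add G" "\<zero>\<^bsub>T\<^esub> = \<zero>\<^bsub>G\<^esub>"
 shows "a_inv T = a_inv G"
 using assms by (auto simp: a_inv_def m_inv_def)

lemma generate_record_cong:
 assumes "carrier G = carrier G'" "monoid.mult G = monoid.mult G'" "\<one>\<^bsub>G\<^esub> = \<one>\<^bsub>G'\<^esub>"
 shows "generate G Y = generate G' Y"
proof -
 have i: "m_inv G = m_inv G'" using assms by (auto simp: m_inv_def)
 have "x : generate G' Y" if "x : generate G Y" for x
  using that
 proof (induction rule: generate.induct)
  case one show ?case using generate.one[of G' Y] by (simp add: assms)
 next
  case (incl h) then show ?case by (rule generate.incl)
 next
  case (inv h) then show ?case using generate.inv[of h Y G'] by (simp add: i)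
 next
  case (eng h1 h2) then show ?case using generate.eng[of h1 G' Y h2] by (simp add: assms)
 qed
 moreover have "x : generate G Y" if "x : generate G' Y" for x
  using that
 proof (induction rule: generate.induct)
  case one show ?case using generate.one[of G Y] by (simp add: assms)
 next
  case (incl h) then show ?case by (rule generate.incl)
 next
  case (inv h) then show ?case using generate.inv[of h Y G] by (simp add: i)
 next
  case (eng h1 h2) then show ?case using generate.eng[of h1 G Y h2] by (simp add: assms)
 qed
 ultimately show ?thesis by blast
qed

section \<open>Balanced maps and tensor products over an abstract set of scalars\<close>

definition balanced ::
 "'s set => ('m => 's => 'm) => ('s => 'n => 'n) => ('a, 'm) graded_bimodule =>
  ('a, 'n) graded_bimodule => ('h, 'e) ring_scheme => ('m => 'n => 'h) => bool" where
 "balanced S r l M N H b \<longleftrightarrow>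
   (ALL y:carrier N. amap M H (%x. b x y)) & (ALL x:carrier M. amap N H (b x)) &
   (ALL x:carrier M. ALL s:S. ALL y:carrier N. b (r x s) y = b x (l s y))"

lemma balancedI:
 assumes "!!y. y : carrier N ==> amap M H (%x. b x y)" "!!x. x : carrier M ==> amap N H (b x)"
  "!!x s y. [|x : carrier M; s : S; y : carrier N|] ==> b (r x s) y = b x (l s y)"
 shows "balanced S r l M N H b"
 using assms by (simp add: balanced_def)

text \<open>The balancing scalars are left abstract, so that the products over \<open>A\<close> and
  over the field are two instances of one development.\<close>

locale tprod =
 fixes S :: "'s set" and r :: "'m => 's => 'm" and l :: "'s => 'n => 'n"
  and M :: "('a, 'm) graded_bimodule" and N :: "('a, 'n) graded_bimodule"
 assumes M_group: "abelian_group M" and N_group: "abelian_group N"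
  and r_closed: "!!x s. x : carrier M ==> s : S ==> r x s : carrier M"
  and l_closed: "!!y s. y : carrier N ==> s : S ==> l s y : carrier N"
begin

abbreviation "rel == balancing_relators S r l M N"
abbreviation "T == tensor rel M N"
abbreviation "pt == pure_tensor rel M N"

interpretation M: abelian_group M by (rule M_group)
interpretation N: abelian_group N by (rule N_group)

lemma rel_keys: "c : rel ==> Poly_Mapping.keys c <= carrier M \<times> carrier N"
 unfolding balancing_relators_def
 by (elim UnE CollectE exE conjE; hypsubst; intro frag_keys) (auto simp: r_closed l_closed)

interpretation pr: presentation "carrier M \<times> carrier N" rel
 by unfold_locales (rule rel_keys)

lemma T_simps:
 "carrier T = carrier (pres_group (carrier M \<times> carrier N) rel)"
 "add T = add (pres_group (carrier M \<times> carrier N) rel)"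
 "\<zero>\<^bsub>T\<^esub> = \<zero>\<^bsub>pres_group (carrier M \<times> carrier N) rel\<^esub>"
 by (simp_all add: tensor_def Let_def)

lemma T_group: "abelian_group T"
 by (rule abelian_group_cong[OF pr.G_group T_simps])

interpretation T: abelian_group T by (rule T_group)

lemma pt_closed: "x : carrier M ==> y : carrier N ==> pt x y : carrier T"
 by (simp add: pure_tensor_def T_simps pr.gen_closed)

lemma pt_rel:
 assumes "frag_of (x, y) - frag_of (x', y') - frag_of (x'', y'') : rel"
  "x : carrier M" "y : carrier N" "x' : carrier M" "y' : carrier N" "x'' : carrier M" "y'' : carrier N"
 shows "pt x y = pt x' y' \<oplus>\<^bsub>T\<^esub> pt x'' y''"
 using pr.cls_diff_rel[of "frag_of (x, y)" "frag_of (x', y') + frag_of (x'', y'')"] assms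
 by (simp add: pure_tensor_def pres_gen_cls T_simps diff_diff_eq pr.G_add frag_keys)

lemma pt_add_l:
 "[|x : carrier M; x' : carrier M; y : carrier N|] ==> pt (x \<oplus>\<^bsub>M\<^esub> x') y = pt x y \<oplus>\<^bsub>T\<^esub> pt x' y"
 by (rule pt_rel) (auto simp: balancing_relators_def)

lemma pt_add_r:
 "[|x : carrier M; y : carrier N; y' : carrier N|] ==> pt x (y \<oplus>\<^bsub>N\<^esub> y') = pt x y \<oplus>\<^bsub>T\<^esub> pt x y'"
 by (rule pt_rel) (auto simp: balancing_relators_def)

lemma pt_bal:
 "[|x : carrier M; s : S; y : carrier N|] ==> pt (r x s) y = pt x (l s y)"
 using pr.cls_diff_rel[of "frag_of (r x s, y)" "frag_of (x, l s y)"]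
 by (auto simp: pure_tensor_def pres_gen_cls balancing_relators_def r_closed l_closed)

lemma pt_amap_l: "y : carrier N ==> amap M T (%x. pt x y)"
 by (rule amapI[OF M_group T_group]) (simp_all add: pt_closed pt_add_l)

lemma pt_amap_r: "x : carrier M ==> amap N T (pt x)"
 by (rule amapI[OF N_group T_group]) (simp_all add: pt_closed pt_add_r)

lemma balanced_pt: "balanced S r l M N T pt"
 by (rule balancedI) (simp_all add: pt_amap_l pt_amap_r pt_bal)

lemma T_ext:
 assumes "amap T H f" "amap T H g" "!!x y. x : carrier M ==> y : carrier N ==> f (pt x y) = g (pt x y)"
  and "z : carrier T"
 shows "f z = g z"
proof (rule pr.gen_ext)
 show "amap pr.G H f" "amap pr.G H g" using assms(1,2) amap_record_cong[of T H _ pr.G] T_simps by auto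
 show "z : carrier pr.G" using assms(4) by (simp add: T_simps)
 show "f (pres_gen (carrier M \<times> carrier N) rel x) = g (pres_gen (carrier M \<times> carrier N) rel x)"
  if "x : carrier M \<times> carrier N" for x
  using that assms(3) by (auto simp: pure_tensor_def)
qed

lemma T_induct [consumes 1, case_names zero pure diff]:
 assumes "z : carrier T" "Q \<zero>\<^bsub>T\<^esub>" "!!x y. x : carrier M ==> y : carrier N ==> Q (pt x y)"
  "!!x y. [|x : carrier T; y : carrier T; Q x; Q y|] ==> Q (x \<ominus>\<^bsub>T\<^esub> y)"
 shows "Q z"
proof -
 have "z : carrier pr.G" using assms(1) by (simp add: T_simps)
 then show ?thesis
 proof (induction rule: pr.gen_induct)
  case zero then show ?case using assms(2) by (simp add: T_simps)
 next
  case (gen x) then show ?case using assms(3) by (auto simp: pure_tensor_def)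
 next
  case (diff x y)
  then show ?case using assms(4)[of x y] a_inv_record_cong[of T pr.G] T_simps by (simp add: a_minus_def)
 qed
qed

lemma
 assumes b: "balanced S r l M N H b" and H: "abelian_group H"
 shows tlift_amap: "amap T H (pres_lift H (%(x, y). b x y))"
  and tlift_pure: "x : carrier M ==> y : carrier N ==> pres_lift H (%(x, y). b x y) (pt x y) = b x y"
proof -
 interpret H: abelian_group H by (rule H)
 have bl: "amap M H (%x. b x y)" if "y : carrier N" for y using b that by (simp add: balanced_def)
 have br: "amap N H (b x)" if "x : carrier M" for x using b that by (simp add: balanced_def)
 have cl: "b x y : carrier H" if "x : carrier M" "y : carrier N" for x y using amap_closed[OF bl] that by simp
 have 1: "(%(x, y). b x y) z : carrier H" if "z : carrier M \<times> carrier N" for z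
  using that cl by auto
 have fl: "flift H (%(x, y). b x y) (frag_of z - frag_of w)
   = (%(x, y). b x y) z \<ominus>\<^bsub>H\<^esub> (%(x, y). b x y) w"
  if "z : carrier M \<times> carrier N" "w : carrier M \<times> carrier N" for z w
  using that 1
  by (simp_all add: H.flift_diff[where U = "carrier M \<times> carrier N"] H.flift_frag_of frag_keys)
 have fl2: "flift H (%(x, y). b x y) (frag_of z - frag_of w - frag_of v)
   = (%(x, y). b x y) z \<ominus>\<^bsub>H\<^esub> (%(x, y). b x y) w \<ominus>\<^bsub>H\<^esub> (%(x, y). b x y) v"
  if "z : carrier M \<times> carrier N" "w : carrier M \<times> carrier N" "v : carrier M \<times> carrier N" for z w v
  using that 1
  by (simp_all add: H.flift_diff[where U = "carrier M \<times> carrier N"] H.flift_frag_of frag_keys)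
 have cancel: "u \<oplus>\<^bsub>H\<^esub> v \<ominus>\<^bsub>H\<^esub> u \<ominus>\<^bsub>H\<^esub> v = \<zero>\<^bsub>H\<^esub>" if "u : carrier H" "v : carrier H" for u v
  by (rule rep_eq[of H], (rule rep_rules rep_zero | rule rep_atom | rule H.abelian_group_axioms | rule that)+, simp)
 have cancel2: "u \<ominus>\<^bsub>H\<^esub> u = \<zero>\<^bsub>H\<^esub>" if "u : carrier H" for u
  using that by (simp add: a_minus_def H.r_neg)
 have 2: "flift H (%(x, y). b x y) c = \<zero>\<^bsub>H\<^esub>" if "c : rel" for c
  using that unfolding balancing_relators_def
  by (auto simp: fl fl2 r_closed l_closed amap_add[OF bl] amap_add[OF br] cancel cl)
    (use b in "auto simp: balanced_def cancel2 cl l_closed")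
 show "amap T H (pres_lift H (%(x, y). b x y))"
  by (rule amap_record_cong[OF pr.pres_lift_amap[OF H 1 2] T_simps])
 show "x : carrier M ==> y : carrier N ==> pres_lift H (%(x, y). b x y) (pt x y) = b x y"
  unfolding pure_tensor_def by (subst pr.pres_lift_gen[OF H 1 2]) auto
qed

text \<open>With the sum over components replaced by the twist, \<open>tensor_map\<close> is an
  ordinary lift of a balanced map and its value on a pure tensor can be read off. This is why the
  balancing hypothesis is stated after twisting.\<close>

lemma
 assumes M: "graded_bimod K A M"
  and l: "!!y. y : carrier N ==> amap M H (%x. p (f x) (g y))"
  and rr: "!!x. x : carrier M ==> amap N H (%y. p (f x) (g y))"
  and bal: "!!x s y. [|x : carrier M; s : S; y : carrier N|] ==>
   p (f (sgnmap M m (r x s))) (g y) = p (f (sgnmap M m x)) (g (l s y))"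
  and H: "abelian_group H"
 shows tensor_map_amap: "amap T H (tensor_map M H p m f g)"
  and tensor_map_pure: "x : carrier M ==> y : carrier N ==>
   tensor_map M H p m f g (pt x y) = p (f (sgnmap M m x)) (g y)"
proof -
 define b where "b x y = finsum H (%i. [koszul_sign (i * m)] \<cdot>\<^bsub>H\<^esub> p (f (hcomp M x i)) (g y))
    {i. hcomp M x i ~= \<zero>\<^bsub>M\<^esub>}" for x y
 have v: "b x y = p (f (sgnmap M m x)) (g y)" if "x : carrier M" "y : carrier N" for x y
  unfolding b_def by (rule tensor_sign_sum[OF M l that(1)]) (rule that)
 note sg = sgnmap_ghom[OF M, of m]
 have B: "balanced S r l M N H b"
 proof (rule balancedI)
  show "amap M H (%x. b x y)" if "y : carrier N" for y
   by (rule amap_cong[OF amap_comp[OF l[OF that] ghom_amap[OF sg]]]) (simp add: v that)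
  show "amap N H (b x)" if "x : carrier M" for x
   by (rule amap_cong[OF rr[OF ghom_closed[OF sg that]]]) (simp add: v that)
  show "b (r x s) y = b x (l s y)" if "x : carrier M" "s : S" "y : carrier N" for x s y
   using that by (simp add: v r_closed l_closed bal)
 qed
 have e: "tensor_map M H p m f g = pres_lift H (%(x, y). b x y)"
  by (simp add: tensor_map_def b_def)
 show "amap T H (tensor_map M H p m f g)" unfolding e by (rule tlift_amap[OF B H])
 show "x : carrier M ==> y : carrier N ==> tensor_map M H p m f g (pt x y) = p (f (sgnmap M m x)) (g y)"
  unfolding e by (simp add: tlift_pure[OF B H] v)
qed

end

text \<open>The inner scalars commute with the outer actions; this is what makes the outer actions
  descend to the product.\<close>

locale tbimod = tprod S r l M N for S :: "'s set" and r :: "'m => 's => 'm"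
  and l :: "'s => 'n => 'n" and M :: "('a, 'm) graded_bimodule" and N :: "('a, 'n) graded_bimodule" +
 fixes A :: "('k, 'a) module" (structure)
 assumes M_gab: "gab A M" and N_gab: "gab A N"
  and r_smult: "!!a x s. [|a : carrier A; x : carrier M; s : S|] ==> a \<odot>\<^bsub>M\<^esub> r x s = r (a \<odot>\<^bsub>M\<^esub> x) s"
  and l_rsmult: "!!a y s. [|a : carrier A; y : carrier N; s : S|] ==> rsmult N (l s y) a = l s (rsmult N y a)"
begin

lemma
 assumes a: "a : carrier A"
 shows T_smult_amap: "amap T T (%z. a \<odot>\<^bsub>T\<^esub> z)" and T_rsmult_amap: "amap T T (%z. rsmult T z a)"
  and T_smult: "[|x : carrier M; y : carrier N|] ==> a \<odot>\<^bsub>T\<^esub> pt x y = pt (a \<odot>\<^bsub>M\<^esub> x) y"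
  and T_rsmult: "[|x : carrier M; y : carrier N|] ==> rsmult T (pt x y) a = pt x (rsmult N y a)"
proof -
 let ?G = "pres_group (carrier M \<times> carrier N) rel"
 have G: "abelian_group ?G" by (rule abelian_group_cong[OF T_group]) (simp_all add: T_simps)
 note am = gab_smult[OF M_gab a] and an = gab_rsmult[OF N_gab a]
 have toG: "amap H ?G f" if "amap H T f" for H :: "('h, 'e) ring_scheme" and f
  by (rule amap_record_cong2[OF that]) (simp_all add: T_simps)
 have toT: "amap H T f" if "amap H ?G f" for H :: "('h, 'e) ring_scheme" and f
  by (rule amap_record_cong2[OF that]) (simp_all add: T_simps)
 have b1: "balanced S r l M N ?G (%x y. pt (a \<odot>\<^bsub>M\<^esub> x) y)"
  by (rule balancedI)
    (use a in "auto simp: r_smult pt_bal amap_closed[OF am] intro!: toG amap_comp[OF pt_amap_l am] pt_amap_r")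
 have b2: "balanced S r l M N ?G (%x y. pt x (rsmult N y a))"
  by (rule balancedI)
    (use a in "auto simp flip: l_rsmult simp: pt_bal l_rsmult[symmetric] amap_closed[OF an] intro!: toG amap_comp[OF pt_amap_r an] pt_amap_l")
 have e: "(%z. a \<odot>\<^bsub>T\<^esub> z) = pres_lift ?G (%(x, y). pt (a \<odot>\<^bsub>M\<^esub> x) y)"
  "(%z. rsmult T z a) = pres_lift ?G (%(x, y). pt x (rsmult N y a))"
  by (simp_all add: tensor_def Let_def)
 show "amap T T (%z. a \<odot>\<^bsub>T\<^esub> z)" unfolding e by (rule toT[OF tlift_amap[OF b1 G]])
 show "amap T T (%z. rsmult T z a)" unfolding e by (rule toT[OF tlift_amap[OF b2 G]])
 show "[|x : carrier M; y : carrier N|] ==> a \<odot>\<^bsub>T\<^esub> pt x y = pt (a \<odot>\<^bsub>M\<^esub> x) y"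
  using tlift_pure[OF b1 G] fun_cong[OF e(1)] by simp
 show "[|x : carrier M; y : carrier N|] ==> rsmult T (pt x y) a = pt x (rsmult N y a)"
  using tlift_pure[OF b2 G] fun_cong[OF e(2)] by simp
qed

lemma grade_T: "grade T n = generate (add_monoid T) {pt x y | x y i j. x : grade M i & y : grade N j & i + j = n}"
 by (simp add: tensor_def Let_def) (rule generate_record_cong; simp)

lemma pt_grade: "[|x : grade M i; y : grade N j; i + j = n|] ==> pt x y : grade T n"
 unfolding grade_T by (rule generate.incl) auto

lemma T_gab: "gab A T"
proof -
 interpret T: abelian_group T by (rule T_group)
 have s: "{pt x y | x y i j. x : grade M i & y : grade N j & i + j = n} <= carrier T" for n
  using gab_grade[OF M_gab] gab_grade[OF N_gab] by (auto simp: pt_closed)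
 have sub: "subgroup (grade T n) (add_monoid T)" for n
  unfolding grade_T by (rule T.add.generate_is_subgroup[simplified]) (use s in simp)
 show ?thesis
  unfolding gab_def
  using T_group T_smult_amap T_rsmult_amap subgroup.subset[OF sub] subgroup.one_closed[OF sub]
   subgroup.m_closed[OF sub] subgroup.m_inv_closed[OF sub]
  by (auto simp: a_inv_def)
qed

lemma grade_T_induct [consumes 1, case_names zero pure neg add]:
 assumes z: "z : grade T n" and 0: "Q \<zero>\<^bsub>T\<^esub>"
  and p: "!!x y i j. [|x : grade M i; y : grade N j; i + j = n|] ==> Q (pt x y)"
  and ng: "!!z. z : grade T n ==> Q z ==> Q (\<ominus>\<^bsub>T\<^esub> z)"
  and ad: "!!z w. [|z : grade T n; w : grade T n; Q z; Q w|] ==> Q (z \<oplus>\<^bsub>T\<^esub> w)"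
 shows "Q z"
proof -
 note T = T_gab
 define W where "W = {pt x y | x y i j. x : grade M i & y : grade N j & i + j = n}"
 have g: "grade T n = generate (add_monoid T) W" unfolding W_def by (rule grade_T)
 have W: "h : grade T n & Q h" if "h : W" for h using that p pt_grade by (auto simp: W_def)
 have "z : grade T n & Q z"
  using z unfolding g
 proof (induction rule: generate.induct)
  case one then show ?case using 0 gab_grade_zero[OF T] by (simp flip: g)
 next
  case (incl h) then show ?case using W by (simp flip: g)
 next
  case (inv h)
  then show ?case using W ng[of h] gab_grade_neg[OF T, of h n] by (simp add: a_inv_def flip: g)
 next
  case (eng h1 h2) then show ?case using ad gab_grade_add[OF T] by (simp flip: g)
 qed
 then show ?thesis by simp
qed

lemma T_ghomI:
 assumes f: "amap T Y f" and Y: "gab A Y"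
  and sm: "!!a x y. [|a : carrier A; x : carrier M; y : carrier N|] ==> f (pt (a \<odot>\<^bsub>M\<^esub> x) y) = a \<odot>\<^bsub>Y\<^esub> f (pt x y)"
  and rs: "!!a x y. [|a : carrier A; x : carrier M; y : carrier N|] ==> f (pt x (rsmult N y a)) = rsmult Y (f (pt x y)) a"
  and dg: "!!i j x y. [|x : grade M i; y : grade N j|] ==> f (pt x y) : grade Y (i + j + s)"
 shows "ghom A T Y s f"
proof (rule ghomI[OF T_gab Y f])
 fix a z assume a: "a : carrier A" and z: "z : carrier T"
 show "f (a \<odot>\<^bsub>T\<^esub> z) = a \<odot>\<^bsub>Y\<^esub> f z"
  by (rule T_ext[OF amap_comp[OF f T_smult_amap[OF a]] amap_comp[OF gab_smult[OF Y a] f] _ z])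
    (simp add: T_smult[OF a] sm a)
 show "f (rsmult T z a) = rsmult Y (f z) a"
  by (rule T_ext[OF amap_comp[OF f T_rsmult_amap[OF a]] amap_comp[OF gab_rsmult[OF Y a] f] _ z])
    (simp add: T_rsmult[OF a] rs a)
next
 fix n z assume "z : grade T n"
 then show "f z : grade Y (n + s)"
  by (induction rule: grade_T_induct)
    (use dg gab_grade[OF T_gab] in "auto simp: amap_zero[OF f] amap_neg[OF f] amap_add[OF f]
     gab_grade_zero[OF Y] gab_grade_neg[OF Y] gab_grade_add[OF Y]")
qed

end

section \<open>Graded bimodules over an algebra\<close>

lemma bimodD:
 assumes "bimod K A M"
 shows "abelian_group M"
  and "!!a x. [|a : carrier A; x : carrier M|] ==> a \<odot>\<^bsub>M\<^esub> x : carrier M"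
  and "!!a x. [|a : carrier A; x : carrier M|] ==> rsmult M x a : carrier M"
  and "!!a x y. [|a : carrier A; x : carrier M; y : carrier M|] ==> a \<odot>\<^bsub>M\<^esub> (x \<oplus>\<^bsub>M\<^esub> y) = a \<odot>\<^bsub>M\<^esub> x \<oplus>\<^bsub>M\<^esub> a \<odot>\<^bsub>M\<^esub> y"
  and "!!a x y. [|a : carrier A; x : carrier M; y : carrier M|] ==> rsmult M (x \<oplus>\<^bsub>M\<^esub> y) a = rsmult M x a \<oplus>\<^bsub>M\<^esub> rsmult M y a"
  and "!!a b x. [|a : carrier A; b : carrier A; x : carrier M|] ==> (a \<oplus>\<^bsub>A\<^esub> b) \<odot>\<^bsub>M\<^esub> x = a \<odot>\<^bsub>M\<^esub> x \<oplus>\<^bsub>M\<^esub> b \<odot>\<^bsub>M\<^esub> x"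
  and "!!a b x. [|a : carrier A; b : carrier A; x : carrier M|] ==> rsmult M x (a \<oplus>\<^bsub>A\<^esub> b) = rsmult M x a \<oplus>\<^bsub>M\<^esub> rsmult M x b"
  and "!!a b x. [|a : carrier A; b : carrier A; x : carrier M|] ==> (a \<otimes>\<^bsub>A\<^esub> b) \<odot>\<^bsub>M\<^esub> x = a \<odot>\<^bsub>M\<^esub> (b \<odot>\<^bsub>M\<^esub> x)"
  and "!!a b x. [|a : carrier A; b : carrier A; x : carrier M|] ==> rsmult M x (a \<otimes>\<^bsub>A\<^esub> b) = rsmult M (rsmult M x a) b"
  and "!!a b x. [|a : carrier A; b : carrier A; x : carrier M|] ==> rsmult M (a \<odot>\<^bsub>M\<^esub> x) b = a \<odot>\<^bsub>M\<^esub> rsmult M x b"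
  and "!!x. x : carrier M ==> \<one>\<^bsub>A\<^esub> \<odot>\<^bsub>M\<^esub> x = x"
  and "!!x. x : carrier M ==> rsmult M x \<one>\<^bsub>A\<^esub> = x"
  and "!!c x. [|c : carrier K; x : carrier M|] ==> (c \<odot>\<^bsub>A\<^esub> \<one>\<^bsub>A\<^esub>) \<odot>\<^bsub>M\<^esub> x = rsmult M x (c \<odot>\<^bsub>A\<^esub> \<one>\<^bsub>A\<^esub>)"
 using assms unfolding bimod_def by blast+

lemma graded_bimodD: "graded_bimod K A Q ==> bimod K A Q"
 by (simp add: graded_bimod_def)

lemma regular_simps [simp]:
 "carrier (regular A) = carrier A" "add (regular A) = add A" "\<zero>\<^bsub>regular A\<^esub> = \<zero>\<^bsub>A\<^esub>"
 "a \<odot>\<^bsub>regular A\<^esub> b = a \<otimes>\<^bsub>A\<^esub> b" "rsmult (regular A) a b = a \<otimes>\<^bsub>A\<^esub> b"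
 "grade (regular A) n = (if n = 0 then carrier A else {\<zero>\<^bsub>A\<^esub>})"
 by (simp_all add: regular_def)

lemma regular_inv [simp]: "a_inv (regular A) = a_inv A"
 by (rule a_inv_record_cong) simp_all

lemma regular_minus [simp]: "a_minus (regular A) = a_minus A"
 by (simp add: fun_eq_iff a_minus_def)

lemma sneg_regular [simp]: "sneg (regular A) = sneg A"
 by (simp add: fun_eq_iff sneg_def)

locale alg =
 fixes K :: "'k ring" and A :: "('k, 'a) module" (structure)
 assumes algebra: "assoc_algebra K A"
begin

sublocale A: ring A using algebra by (simp add: assoc_algebra_def)

lemma scalar_closed: "c : carrier K ==> c \<odot> \<one> : carrier A"
 using algebra module.smult_closed[of K A c "\<one>"] by (simp add: assoc_algebra_def)

lemma scalar_central: "c : carrier K ==> a : carrier A ==> (c \<odot> \<one>) \<otimes> a = a \<otimes> (c \<odot> \<one>)"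
 using algebra by (simp add: assoc_algebra_def)

lemma scalar_mult: "c : carrier K ==> a : carrier A ==> (c \<odot> \<one>) \<otimes> a = c \<odot> a"
 using algebra by (simp add: assoc_algebra_def)

lemma regular_bimod: "bimod K A (regular A)"
 unfolding bimod_def
 by (auto simp: A.l_distr A.r_distr A.m_assoc scalar_central
   intro!: abelian_group_cong[OF A.abelian_group_axioms])

lemma regular_graded: "graded_bimod K A (regular A)"
proof -
 interpret R: abelian_group "regular A" by (rule bimodD(1)[OF regular_bimod])
 have z: "bimod K A (component (regular A) n)" for n
 proof (cases "n = 0")
  case True
  then have "component (regular A) n = regular A" by (simp add: component_def)
  then show ?thesis by (simp add: regular_bimod)
 next
  case False
  have "abelian_group (component (regular A) n)"
   by (rule abelian_groupI) (use False in "auto simp: component_def")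
  then show ?thesis using False scalar_closed by (auto simp: bimod_def component_def)
 qed
 have "EX! c. homogeneous_decomp (regular A) x c" if x: "x : carrier A" for x
 proof (rule ex1I)
  show "homogeneous_decomp (regular A) x (%n. if n = 0 then x else \<zero>)"
  proof (cases "x = \<zero>")
   case True
   then show ?thesis using R.finsum_empty by (simp add: homogeneous_decomp_def)
  next
   case False
   have "finsum (regular A) (%n. if n = 0 then x else \<zero>) {0::int} = x"
    using x by (subst R.finsum_insert) (auto simp: R.finsum_empty)
   moreover have "{n::int. (if n = 0 then x else \<zero>) ~= \<zero>} = {0}" using False by auto
   ultimately show ?thesis using x by (simp add: homogeneous_decomp_def)
  qed
  fix c assume c: "homogeneous_decomp (regular A) x c"
  then have c0: "c n = \<zero>" if "n ~= 0" for n
   using that by (auto simp: homogeneous_decomp_def split: if_splits dest: spec[of _ n])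
  have c1: "c 0 : carrier A" using c by (auto simp: homogeneous_decomp_def split: if_splits dest: spec[of _ 0])
  have xc: "x = finsum (regular A) c {n. c n ~= \<zero>}"
   using c by (simp add: homogeneous_decomp_def)
  have "x = c 0"
  proof (cases "c 0 = \<zero>")
   case True
   then have s: "{n. c n ~= \<zero>} = {}" using c0 by (metis (mono_tags, lifting) empty_Collect_eq)
   show ?thesis using R.finsum_empty True xc unfolding s by simp
  next
   case False
   then have s: "{n. c n ~= \<zero>} = {0}" using c0 by auto
   have "finsum (regular A) c {0} = c 0"
    using c1 by (subst R.finsum_insert) (auto simp: R.finsum_empty)
   then show ?thesis using xc unfolding s by simp
  qed
  then have "c n = (if n = 0 then x else \<zero>)" for n by (cases "n = 0") (simp_all add: c0)
  then show "c = (%n. if n = 0 then x else \<zero>)" by blast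
 qed
 then show ?thesis using z by (auto simp: graded_bimod_def regular_bimod)
qed

lemma regular_gab: "gab A (regular A)"
 by (rule gab_graded_bimod[OF regular_graded])

text \<open>A cochain of degree \<open>n\<close> vanishes outside degree \<open>n\<close>, so the
  degree-dependent sign of the twist becomes the constant \<open>(-1)^(nm)\<close>.\<close>

lemma cochain_sgn:
 assumes Q: "graded_bimod K A Q" and f: "ghom A Q (regular A) (- n) f" and x: "x : carrier Q"
 shows "f (sgnmap Q m x) = sneg A (n * m) (f x)"
proof -
 note sg = sgnmap_ghom[OF Q, of m]
 have am: "amap Q (regular A) (%x. sneg A (n * m) (f x))"
  using ghom_amap[OF ghom_sneg[OF f]] by simp
 have dg: "f x : grade (regular A) (i - n)" if "x : grade Q i" for x i
  by (rule ghom_degree[OF f that]) simp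
 show ?thesis
  by (rule graded_ext[OF Q amap_comp[OF ghom_amap[OF f] ghom_amap[OF sg]] am _ x])
    (use dg in "force simp: sgnmap_val[OF Q] sneg_def ghom_neg[OF f] gab_grade[OF ghomD(1)[OF f]] split: if_splits")
qed

lemma tbimod_A:
 assumes M: "graded_bimod K A M" and N: "graded_bimod K A N"
 shows "tbimod (carrier A) (rsmult M) (smult N) M N A"
 by (intro tbimod.intro tprod.intro tbimod_axioms.intro)
  (simp_all add: gab_graded_bimod[OF M] gab_graded_bimod[OF N]
   bimodD[OF graded_bimodD[OF M]] bimodD[OF graded_bimodD[OF N]])

end

locale gbm = alg K A for K :: "'k ring" and A :: "('k, 'a) module" (structure) +
 fixes Q :: "('a, 'q) graded_bimodule"
 assumes Q_graded: "graded_bimod K A Q"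
begin

abbreviation "TQ == tensor_A A Q Q"
abbreviation tq (infixl "\<otimes>\<^sub>Q" 70) where "x \<otimes>\<^sub>Q y == pure_A A Q Q x y"
abbreviation "\<sigma> == sgnmap Q"

lemmas Q_bimod = bimodD[OF graded_bimodD[OF Q_graded]]
lemmas Q_gab = gab_graded_bimod[OF Q_graded]
lemmas \<sigma>_ghom = sgnmap_ghom[OF Q_graded]

sublocale T: tbimod "carrier A" "rsmult Q" "smult Q" Q Q A
 rewrites "tensor (balancing_relators (carrier A) (rsmult Q) (smult Q) Q Q) Q Q = TQ"
  and "pure_tensor (balancing_relators (carrier A) (rsmult Q) (smult Q) Q Q) Q Q = pure_A A Q Q"
 by (rule tbimod_A[OF Q_graded Q_graded]) (simp_all add: tensor_A_def pure_A_def relators_A_def)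

lemma T_hext:
 assumes f: "amap TQ H f" and g: "amap TQ H g"
  and eq: "!!i j x y. x : grade Q i ==> y : grade Q j ==> f (x \<otimes>\<^sub>Q y) = g (x \<otimes>\<^sub>Q y)"
  and z: "z : carrier TQ"
 shows "f z = g z"
proof (rule T.T_ext[OF f g _ z])
 fix x y assume x: "x : carrier Q" and y: "y : carrier Q"
 have 1: "f (x' \<otimes>\<^sub>Q y) = g (x' \<otimes>\<^sub>Q y)" if "x' : grade Q i" for x' i
 proof -
  note pr = T.pt_amap_r[OF gab_grade[OF Q_gab that]]
  show ?thesis by (rule graded_ext[OF Q_graded amap_comp[OF f pr] amap_comp[OF g pr] eq[OF that] y])
 qed
 note pl = T.pt_amap_l[OF y]
 show "f (x \<otimes>\<^sub>Q y) = g (x \<otimes>\<^sub>Q y)"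
  by (rule graded_ext[OF Q_graded amap_comp[OF f pl] amap_comp[OF g pl] 1 x])
qed

definition tl :: "('h, 'e) ring_scheme => ('q => 'q => 'h) => ('q, 'q) tens => 'h" where
 "tl H b = pres_lift H (%(x, y). b x y)"

lemma
 assumes Y: "gab A Y"
  and bl: "!!y. y : carrier Q ==> amap Q Y (%x. b x y)"
  and br: "!!x. x : carrier Q ==> amap Q Y (b x)"
  and bal: "!!x a y. [|x : carrier Q; a : carrier A; y : carrier Q|] ==> b (rsmult Q x a) y = b x (a \<odot>\<^bsub>Q\<^esub> y)"
  and sm: "!!a x y. [|a : carrier A; x : carrier Q; y : carrier Q|] ==> b (a \<odot>\<^bsub>Q\<^esub> x) y = a \<odot>\<^bsub>Y\<^esub> b x y"
  and rs: "!!a x y. [|a : carrier A; x : carrier Q; y : carrier Q|] ==> b x (rsmult Q y a) = rsmult Y (b x y) a"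
  and dg: "!!i j x y. [|x : grade Q i; y : grade Q j|] ==> b x y : grade Y (i + j + s)"
 shows tl_ghom: "ghom A TQ Y s (tl Y b)"
  and tl_val: "[|x : carrier Q; y : carrier Q|] ==> tl Y b (x \<otimes>\<^sub>Q y) = b x y"
proof -
 have B: "balanced (carrier A) (rsmult Q) (smult Q) Q Q Y b"
  by (rule balancedI) (simp_all add: bl br bal)
 note v = T.tlift_pure[OF B gab_group[OF Y], folded tl_def]
 show "ghom A TQ Y s (tl Y b)"
  by (rule T.T_ghomI[OF T.tlift_amap[OF B gab_group[OF Y], folded tl_def] Y])
    (simp_all add: v sm rs dg Q_bimod(2,3) gab_grade[OF Q_gab])
 show "[|x : carrier Q; y : carrier Q|] ==> tl Y b (x \<otimes>\<^sub>Q y) = b x y" by (rule v)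
qed

text \<open>The target \<open>Y\<close> is left free: \<open>Y = Q\<close> gives the operations on a
  single complex, the regular bimodule gives cup products, and another complex gives maps along a
  comparison map. Signs are put into the maps \<open>w\<close> by means of the twist.\<close>

definition "capV Y g v = tl Y (%x y. g x \<odot>\<^bsub>Y\<^esub> v y)"
definition "rmapV Y w h = tl Y (%x y. rsmult Y (w x) (h y))"
definition "tmapV Y w v = tl (tensor_A A Y Y) (%x y. pure_A A Y Y (w x) (v y))"

lemma
 assumes Y: "graded_bimod K A Y" and g: "ghom A Q (regular A) r g" and v: "ghom A Q Y s v" and t: "t = r + s"
 shows capV_ghom: "ghom A TQ Y t (capV Y g v)"
  and capV_val: "[|x : carrier Q; y : carrier Q|] ==> capV Y g v (x \<otimes>\<^sub>Q y) = g x \<odot>\<^bsub>Y\<^esub> v y"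
proof -
 note Yb = bimodD[OF graded_bimodD[OF Y]] and Yg = gab_graded_bimod[OF Y]
 note gs = ghomD[OF g] and vs = ghomD[OF v]
 have sz: "amap (regular A) Y (%a. a \<odot>\<^bsub>Y\<^esub> y)" if "y : carrier Y" for y
  using that by (intro amapI) (simp_all add: Yb gab_group[OF regular_gab])
 have 1: "amap Q Y (%x. g x \<odot>\<^bsub>Y\<^esub> v y)" if "y : carrier Q" for y
  using amap_comp[OF sz ghom_amap[OF g]] vs(4)[OF that] by simp
 have 2: "amap Q Y (%y. g x \<odot>\<^bsub>Y\<^esub> v y)" if "x : carrier Q" for x
  using amap_comp[OF gab_smult[OF Yg] ghom_amap[OF v]] gs(4)[OF that] by simp
 have 3: "g x \<odot>\<^bsub>Y\<^esub> v y : grade Y (i + j + t)" if x: "x : grade Q i" and y: "y : grade Q j" for i j x y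
 \<comment> \<open>Outside the degree where \<open>g\<close> lives the factor \<open>g x\<close> is
   zero, so the total degree has to be right only when \<open>i + r = 0\<close>.\<close>
 proof (cases "i + r = 0")
  case True
  then have vy: "v y : grade Y (i + j + t)" using t by (intro ghom_degree[OF v y]) simp
  show ?thesis by (rule graded_bimod_smult[OF Y _ vy]) (use gs(4) x gab_grade[OF Q_gab] in auto)
 next
  case False
  then have "g x = \<zero>" using ghom_degree[OF g x refl] by simp
  moreover have "v y : carrier Y" using vs(4) y gab_grade[OF Q_gab] by blast
  ultimately show ?thesis using amap_zero[OF sz] by (simp add: gab_grade_zero[OF Yg])
 qed
 show "ghom A TQ Y t (capV Y g v)" unfolding capV_def
  by (rule tl_ghom[OF Yg 1 2 _ _ _ 3]) (use gs vs in "simp_all add: Yb Q_bimod")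
 show "[|x : carrier Q; y : carrier Q|] ==> capV Y g v (x \<otimes>\<^sub>Q y) = g x \<odot>\<^bsub>Y\<^esub> v y" unfolding capV_def
  by (rule tl_val[OF Yg 1 2 _ _ _ 3]) (use gs vs in "simp_all add: Yb Q_bimod")
qed

lemma
 assumes Y: "graded_bimod K A Y" and w: "ghom A Q Y s w" and h: "ghom A Q (regular A) r h" and t: "t = r + s"
 shows rmapV_ghom: "ghom A TQ Y t (rmapV Y w h)"
  and rmapV_val: "[|x : carrier Q; y : carrier Q|] ==> rmapV Y w h (x \<otimes>\<^sub>Q y) = rsmult Y (w x) (h y)"
proof -
 note Yb = bimodD[OF graded_bimodD[OF Y]] and Yg = gab_graded_bimod[OF Y]
 note hs = ghomD[OF h] and ws = ghomD[OF w]
 have sz: "amap (regular A) Y (%a. rsmult Y y a)" if "y : carrier Y" for y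
  using that by (intro amapI) (simp_all add: Yb gab_group[OF regular_gab])
 have 1: "amap Q Y (%x. rsmult Y (w x) (h y))" if "y : carrier Q" for y
  using amap_comp[OF gab_rsmult[OF Yg] ghom_amap[OF w]] hs(4)[OF that] by simp
 have 2: "amap Q Y (%y. rsmult Y (w x) (h y))" if "x : carrier Q" for x
  using amap_comp[OF sz ghom_amap[OF h]] ws(4)[OF that] by simp
 have 3: "rsmult Y (w x) (h y) : grade Y (i + j + t)" if x: "x : grade Q i" and y: "y : grade Q j" for i j x y
 proof (cases "j + r = 0")
  case True
  then have wx: "w x : grade Y (i + j + t)" using t by (intro ghom_degree[OF w x]) simp
  show ?thesis by (rule graded_bimod_smult[OF Y _ wx]) (use hs(4) y gab_grade[OF Q_gab] in auto)
 next
  case False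
  then have "h y = \<zero>" using ghom_degree[OF h y refl] by simp
  moreover have "w x : carrier Y" using ws(4) x gab_grade[OF Q_gab] by blast
  ultimately show ?thesis using amap_zero[OF sz] by (simp add: gab_grade_zero[OF Yg])
 qed
 show "ghom A TQ Y t (rmapV Y w h)" unfolding rmapV_def
  by (rule tl_ghom[OF Yg 1 2 _ _ _ 3]) (use hs ws in "simp_all add: Yb Q_bimod")
 show "[|x : carrier Q; y : carrier Q|] ==> rmapV Y w h (x \<otimes>\<^sub>Q y) = rsmult Y (w x) (h y)" unfolding rmapV_def
  by (rule tl_val[OF Yg 1 2 _ _ _ 3]) (use hs ws in "simp_all add: Yb Q_bimod")
qed

lemma
 assumes Y: "graded_bimod K A Y" and w: "ghom A Q Y r w" and v: "ghom A Q Y s v" and t: "t = r + s"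
 shows tmapV_ghom: "ghom A TQ (tensor_A A Y Y) t (tmapV Y w v)"
  and tmapV_val: "[|x : carrier Q; y : carrier Q|] ==> tmapV Y w v (x \<otimes>\<^sub>Q y) = pure_A A Y Y (w x) (v y)"
proof -
 interpret Y: gbm K A Y by unfold_locales (rule Y)
 note ws = ghomD[OF w] and vs = ghomD[OF v]
 have 1: "amap Q Y.TQ (%x. pure_A A Y Y (w x) (v y))" if "y : carrier Q" for y
  using amap_comp[OF Y.T.pt_amap_l ghom_amap[OF w]] vs(4)[OF that] by simp
 have 2: "amap Q Y.TQ (%y. pure_A A Y Y (w x) (v y))" if "x : carrier Q" for x
  using amap_comp[OF Y.T.pt_amap_r ghom_amap[OF v]] ws(4)[OF that] by simp
 have 3: "pure_A A Y Y (w x) (v y) : grade Y.TQ (i + j + t)" if x: "x : grade Q i" and y: "y : grade Q j" for i j x y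
  by (rule Y.T.pt_grade[OF ghom_degree[OF w x refl] ghom_degree[OF v y refl]]) (simp add: t)
 show "ghom A TQ Y.TQ t (tmapV Y w v)" unfolding tmapV_def
  by (rule tl_ghom[OF Y.T.T_gab 1 2 _ _ _ 3])
    (use ws vs in "simp_all add: Y.T.pt_bal Y.T.T_smult Y.T.T_rsmult Q_bimod")
 show "[|x : carrier Q; y : carrier Q|] ==> tmapV Y w v (x \<otimes>\<^sub>Q y) = pure_A A Y Y (w x) (v y)" unfolding tmapV_def
  by (rule tl_val[OF Y.T.T_gab 1 2 _ _ _ 3])
    (use ws vs in "simp_all add: Y.T.pt_bal Y.T.T_smult Y.T.T_rsmult Q_bimod")
qed

end

section \<open>Complexes with a diagonal\<close>

lemma amap_sneg: "amap G H f ==> amap G H (%x. sneg H m (f x))"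
 by (cases "even m") (simp_all add: sneg_def amap_uminus)

lemma sneg_closed: "abelian_group G ==> x : carrier G ==> sneg G m x : carrier G"
 by (simp add: sneg_def ag_simps)

text \<open>A non-negatively graded complex augmented over \<open>A\<close>. Exactness is deferred
  to the locale \<open>contracted\<close>, where it appears as a splitting.\<close>

locale cplx = gbm K A Q for K :: "'k ring" and A :: "('k, 'a) module" (structure) and Q :: "('a, 'q) graded_bimodule" +
 fixes d :: "'q => 'q" and \<mu> :: "'q => 'a"
 assumes d_ghom: "ghom A Q Q (- 1) d" and dd: "!!x. x : carrier Q ==> d (d x) = \<zero>\<^bsub>Q\<^esub>"
  and neg_grade: "!!n x. n < 0 ==> x : grade Q n ==> x = \<zero>\<^bsub>Q\<^esub>"
  and \<mu>_ghom: "ghom A Q (regular A) 0 \<mu>" and \<mu>d: "!!x. x : carrier Q ==> \<mu> (d x) = \<zero>"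
begin

text \<open>\<open>D\<close> is the differential of the tensor square, the sign of its second
  summand being the twist; \<open>mul\<close> and \<open>mur\<close> are the left and right
  augmentations of the overview. \<open>cap g\<close> is g \<otimes> 1, and
  \<open>ins m \<beta>\<close> is 1 \<otimes> \<beta> with the Koszul sign of a map whose degree has
  the parity of \<open>m\<close>.\<close>

definition "D z = tmapV Q d (%x. x) z \<oplus>\<^bsub>TQ\<^esub> tmapV Q (\<sigma> 1) d z"
definition "mul = capV Q \<mu> (%x. x)"
definition "mur = rmapV Q (%x. x) \<mu>"
definition "cap g = capV Q g (%x. x)"
definition "ins m \<beta> = tmapV Q (\<sigma> m) \<beta>"
definition "cup f g = capV (regular A) f g"

lemmas Q_id = ghom_id[OF Q_gab]
lemmas Q_gp = gab_group[OF Q_gab] and T_gp = T.T_group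

lemma D_ghom: "ghom A TQ TQ (- 1) D"
 unfolding D_def
 by (rule ghom_plus[OF tmapV_ghom[OF Q_graded \<sigma>_ghom d_ghom] tmapV_ghom[OF Q_graded d_ghom Q_id]]) simp_all

lemma D_val: "x : carrier Q ==> y : carrier Q ==> D (x \<otimes>\<^sub>Q y) = d x \<otimes>\<^sub>Q y \<oplus>\<^bsub>TQ\<^esub> \<sigma> 1 x \<otimes>\<^sub>Q d y"
 unfolding D_def
 by (simp add: tmapV_val[OF Q_graded d_ghom Q_id refl] tmapV_val[OF Q_graded \<sigma>_ghom d_ghom refl])

lemma mul_ghom: "ghom A TQ Q 0 mul" unfolding mul_def by (rule capV_ghom[OF Q_graded \<mu>_ghom Q_id]) simp
lemma mur_ghom: "ghom A TQ Q 0 mur" unfolding mur_def by (rule rmapV_ghom[OF Q_graded Q_id \<mu>_ghom]) simp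

lemma mul_val: "x : carrier Q ==> y : carrier Q ==> mul (x \<otimes>\<^sub>Q y) = \<mu> x \<odot>\<^bsub>Q\<^esub> y"
 unfolding mul_def by (rule capV_val[OF Q_graded \<mu>_ghom Q_id refl])
lemma mur_val: "x : carrier Q ==> y : carrier Q ==> mur (x \<otimes>\<^sub>Q y) = rsmult Q x (\<mu> y)"
 unfolding mur_def by (rule rmapV_val[OF Q_graded Q_id \<mu>_ghom refl])

lemma cap_ghom: "ghom A Q (regular A) s g ==> ghom A TQ Q s (cap g)"
 unfolding cap_def by (rule capV_ghom[OF Q_graded _ Q_id]) simp_all
lemma cap_val: "ghom A Q (regular A) s g ==> x : carrier Q ==> y : carrier Q ==> cap g (x \<otimes>\<^sub>Q y) = g x \<odot>\<^bsub>Q\<^esub> y"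
 unfolding cap_def by (rule capV_val[OF Q_graded _ Q_id refl])

lemma ins_ghom: "ghom A Q Q s \<beta> ==> ghom A TQ TQ s (ins m \<beta>)"
 unfolding ins_def by (rule tmapV_ghom[OF Q_graded \<sigma>_ghom]) simp_all
lemma ins_val: "ghom A Q Q s \<beta> ==> x : carrier Q ==> y : carrier Q ==> ins m \<beta> (x \<otimes>\<^sub>Q y) = \<sigma> m x \<otimes>\<^sub>Q \<beta> y"
 unfolding ins_def by (rule tmapV_val[OF Q_graded \<sigma>_ghom _ refl])

lemma cup_ghom: "ghom A Q (regular A) r f ==> ghom A Q (regular A) s g ==> t = r + s ==> ghom A TQ (regular A) t (cup f g)"
 unfolding cup_def by (rule capV_ghom[OF regular_graded])
lemma cup_val: "ghom A Q (regular A) r f ==> ghom A Q (regular A) s g ==> x : carrier Q ==> y : carrier Q ==>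
  cup f g (x \<otimes>\<^sub>Q y) = f x \<otimes> g y"
 unfolding cup_def using capV_val[OF regular_graded _ _ refl, of r f s g x y] by simp

lemmas [simp] = ghomD(4-8)[OF d_ghom] ghomD(9,10)[OF d_ghom] ghomD(4-8)[OF D_ghom] ghomD(4-8)[OF mul_ghom]
 ghomD(4-8)[OF mur_ghom] ghomD(4-8)[OF \<sigma>_ghom] ghomD(9,10)[OF \<sigma>_ghom] ghomD(9,10)[OF \<mu>_ghom, simplified]
 ghomD(4-8)[OF \<mu>_ghom, simplified]
 dd \<mu>d Q_bimod(2,3) T.pt_closed D_val mul_val mur_val Q_gp T_gp A.abelian_group_axioms

lemmas [simp] = ag_simps[OF Q_gp] ag_simps[OF T_gp] sneg_closed[OF Q_gp] sneg_closed[OF T_gp]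
 sneg_closed[OF A.abelian_group_axioms]

lemmas tneg [simp] = amap_neg[OF T.pt_amap_l] amap_neg[OF T.pt_amap_r] amap_add[OF T.pt_amap_l] amap_add[OF T.pt_amap_r]
 amap_zero[OF T.pt_amap_l] amap_zero[OF T.pt_amap_r] amap_neg[OF gab_smult[OF Q_gab]] amap_neg[OF gab_rsmult[OF Q_gab]]
 amap_zero[OF gab_smult[OF Q_gab]] amap_zero[OF gab_rsmult[OF Q_gab]]

lemma \<mu>\<sigma> [simp]: "x : carrier Q ==> \<mu> (\<sigma> m x) = \<mu> x"
 using cochain_sgn[OF Q_graded, where f = \<mu> and n = 0] \<mu>_ghom by (simp add: sneg_def)

lemma d\<sigma>: "x : carrier Q ==> d (\<sigma> m x) = sneg Q m (\<sigma> m (d x))"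
 using ghom_sgnmap[OF Q_graded Q_graded d_ghom] by (simp add: sneg_def)

lemma \<sigma>\<sigma>: "x : carrier Q ==> \<sigma> m (\<sigma> n x) = \<sigma> (m + n) x"
 by (rule sgnmap_sgnmap[OF Q_graded])

lemmas Q_comp = amap_comp[OF ghom_amap[OF d_ghom]] amap_comp[OF ghom_amap[OF D_ghom]]
 amap_comp[OF ghom_amap[OF mul_ghom]] amap_comp[OF ghom_amap[OF mur_ghom]] amap_id[OF T_gp] amap_id[OF Q_gp]
 amap_plus amap_diff amap_sneg

text \<open>On a pure tensor both sides are \<open>g x \<otimes> \<mu> y\<close>, by left linearity
  of \<open>\<mu>\<close> and right linearity of \<open>g\<close>.\<close>

lemma \<mu>_cap:
 assumes g: "ghom A Q (regular A) s g" and z: "z : carrier TQ"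
 shows "\<mu> (cap g z) = g (mur z)"
proof (rule T.T_ext[OF _ _ _ z])
 show "amap TQ (regular A) (%z. \<mu> (cap g z))" "amap TQ (regular A) (%z. g (mur z))"
  by (rule amap_comp[OF ghom_amap ghom_amap], rule \<mu>_ghom g, rule cap_ghom[OF g] mur_ghom)+
 show "\<mu> (cap g (x \<otimes>\<^sub>Q y)) = g (mur (x \<otimes>\<^sub>Q y))" if "x : carrier Q" "y : carrier Q" for x y
  using that ghomD[OF g] by (simp add: cap_val[OF g])
qed

text \<open>The first summand of \<open>D\<close> produces the coboundary of \<open>g\<close>. In
  the second one, \<open>g\<close> is evaluated at a twisted argument and contributes
  \<open>(-1)^m\<close> by \<open>cochain_sgn\<close>.\<close>

lemma cap_D:
 assumes g: "ghom A Q (regular A) (- m) g" and z: "z : carrier TQ"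
 shows "cap g (D z) = cap (%x. g (d x)) z \<oplus>\<^bsub>Q\<^esub> sneg Q m (d (cap g z))"
proof (rule T.T_ext[OF _ _ _ z])
 have gd: "ghom A Q (regular A) (- m - 1) (%x. g (d x))" by (rule ghom_comp[OF g d_ghom]) simp
 show "amap TQ Q (%z. cap g (D z))" "amap TQ Q (%z. cap (%x. g (d x)) z \<oplus>\<^bsub>Q\<^esub> sneg Q m (d (cap g z)))"
  by (intro Q_comp amap_comp[OF ghom_amap[OF cap_ghom[OF g]]] amap_comp[OF ghom_amap[OF cap_ghom[OF gd]]])+
 fix x y assume xy: "x : carrier Q" "y : carrier Q"
 note [simp] = ghomD(4-8)[OF cap_ghom[OF g]] ghomD(4-8)[OF g, simplified] cap_val[OF g] cap_val[OF gd]
  cochain_sgn[OF Q_graded g]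
 show "cap g (D (x \<otimes>\<^sub>Q y)) = cap (%x. g (d x)) (x \<otimes>\<^sub>Q y) \<oplus>\<^bsub>Q\<^esub> sneg Q m (d (cap g (x \<otimes>\<^sub>Q y)))"
  using xy amap_neg[OF amapI[of "regular A" Q "%a. a \<odot>\<^bsub>Q\<^esub> d y"], of "g x"]
  by (auto simp: sneg_def Q_bimod(6) gab_group[OF regular_gab])
qed

text \<open>There is no sign: \<open>\<mu>\<close> lives in degree 0, where the twist is
  trivial.\<close>

lemma mul_ins:
 assumes \<beta>: "ghom A Q Q s \<beta>" and z: "z : carrier TQ"
 shows "mul (ins m \<beta> z) = \<beta> (mul z)"
proof (rule T.T_ext[OF _ _ _ z])
 show "amap TQ Q (%z. mul (ins m \<beta> z))" "amap TQ Q (%z. \<beta> (mul z))"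
  by (intro Q_comp amap_comp[OF ghom_amap[OF ins_ghom[OF \<beta>]]] amap_comp[OF ghom_amap[OF \<beta>]])+
 show "mul (ins m \<beta> (x \<otimes>\<^sub>Q y)) = \<beta> (mul (x \<otimes>\<^sub>Q y))" if "x : carrier Q" "y : carrier Q" for x y
  using that ghomD[OF \<beta>] by (simp add: ins_val[OF \<beta>])
qed

text \<open>\<open>\<gamma>\<close> is the failure of \<open>\<beta>\<close> to commute with the
  differential up to sign. In the application \<open>\<beta>\<close> is \<open>G g\<close> and
  \<open>\<gamma>\<close> comes from the coboundary of \<open>g\<close>.\<close>

lemma D_ins:
 assumes \<beta>: "ghom A Q Q s \<beta>" and \<gamma>: "ghom A Q Q (s - 1) \<gamma>"
  and rel: "!!y. y : carrier Q ==> \<beta> (d y) = \<gamma> y \<oplus>\<^bsub>Q\<^esub> sneg Q m (d (\<beta> y))"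
  and z: "z : carrier TQ"
 shows "D (ins m \<beta> z) = sneg TQ m (ins m \<beta> (D z)) \<ominus>\<^bsub>TQ\<^esub> sneg TQ m (ins (m + 1) \<gamma> z)"
proof (rule T.T_ext[OF _ _ _ z])
 show "amap TQ TQ (%z. D (ins m \<beta> z))"
  "amap TQ TQ (%z. sneg TQ m (ins m \<beta> (D z)) \<ominus>\<^bsub>TQ\<^esub> sneg TQ m (ins (m + 1) \<gamma> z))"
  by (intro Q_comp amap_comp[OF ghom_amap[OF ins_ghom[OF \<beta>]]] amap_comp[OF ghom_amap[OF ins_ghom[OF \<gamma>]]])+
 fix x y assume xy: "x : carrier Q" "y : carrier Q"
 note [simp] = ghomD(4-8)[OF ins_ghom[OF \<beta>]] ghomD(4-8)[OF \<beta>] ghomD(4-8)[OF \<gamma>] ins_val[OF \<beta>] ins_val[OF \<gamma>]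
 have 1: "1 + m = m + 1" by simp
 show "D (ins m \<beta> (x \<otimes>\<^sub>Q y)) = sneg TQ m (ins m \<beta> (D (x \<otimes>\<^sub>Q y))) \<ominus>\<^bsub>TQ\<^esub> sneg TQ m (ins (m + 1) \<gamma> (x \<otimes>\<^sub>Q y))"
  by (cases "even m"; simp add: xy rel d\<sigma> \<sigma>\<sigma> sneg_def 1;
    rule rep_eq[of TQ], (rule rep_rules | (rule rep_atom, simp, simp add: xy))+, simp)
qed

end

text \<open>The interface shared by the resolution and the bar complex. \<open>\<psi>\<close>
  records how far the right counit law fails: \<open>\<Delta>\<close> is a section of
  \<open>mul\<close>, while \<open>mur\<close> returns \<open>\<psi>\<close>, which is the identity
  for the bar complex.\<close>

locale bdata = cplx K A Q d \<mu> for K :: "'k ring" and A :: "('k, 'a) module" (structure) and Q :: "('a, 'q) graded_bimodule"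
  and d \<mu> +
 fixes \<Delta> :: "'q => ('q, 'q) tens" and \<phi> :: "('q, 'q) tens => 'q" and \<psi> :: "'q => 'q"
 assumes \<Delta>_ghom: "ghom A Q TQ 0 \<Delta>" and D\<Delta>: "!!x. x : carrier Q ==> D (\<Delta> x) = \<Delta> (d x)"
  and \<phi>_ghom: "ghom A TQ Q 1 \<phi>"
  and d\<phi>: "!!z. z : carrier TQ ==> d (\<phi> z) = \<psi> (mul z) \<ominus>\<^bsub>Q\<^esub> mur z \<ominus>\<^bsub>Q\<^esub> \<phi> (D z)"
  and \<psi>_ghom: "ghom A Q Q 0 \<psi>"
  and mul\<Delta>: "!!x. x : carrier Q ==> mul (\<Delta> x) = x" and mur\<Delta>: "!!x. x : carrier Q ==> mur (\<Delta> x) = \<psi> x"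
begin

lemmas [simp] = ghomD(4-8)[OF \<Delta>_ghom] ghomD(4-8)[OF \<phi>_ghom] ghomD(4-8)[OF \<psi>_ghom] ghomD(9,10)[OF \<psi>_ghom] D\<Delta> mul\<Delta> mur\<Delta>

text \<open>Nonzero homogeneous tensors have non-negative degree and \<open>\<phi>\<close> raises
  the degree by one, so its values have no component in degree 0, the only one that
  \<open>\<mu>\<close> sees.\<close>

lemma \<mu>\<phi> [simp]: "z : carrier TQ ==> \<mu> (\<phi> z) = \<zero>"
proof (rule T_hext[of "regular A" "%z. \<mu> (\<phi> z)" "%z. \<zero>"])
 show "amap TQ (regular A) (%z. \<mu> (\<phi> z))" by (rule amap_comp[OF ghom_amap[OF \<mu>_ghom] ghom_amap[OF \<phi>_ghom]])
 show "amap TQ (regular A) (%z. \<zero>)" using amap_const_zero[OF T_gp gab_group[OF regular_gab]] by simp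
 fix i j x y assume x: "x : grade Q i" and y: "y : grade Q j"
 show "\<mu> (\<phi> (x \<otimes>\<^sub>Q y)) = \<zero>"
 proof (cases "i < 0 | j < 0")
  case True
  then have "x = \<zero>\<^bsub>Q\<^esub> | y = \<zero>\<^bsub>Q\<^esub>" using neg_grade x y by blast
  then show ?thesis using gab_grade[OF Q_gab] x y by auto
 next
  case False
  have "\<phi> (x \<otimes>\<^sub>Q y) : grade Q (i + j + 1)"
   by (rule ghom_degree[OF \<phi>_ghom T.pt_grade[OF x y refl] refl])
  from ghom_degree[OF \<mu>_ghom this refl] show ?thesis using False by simp
 qed
qed

text \<open>\<open>G g\<close> and \<open>psi m g\<close> are the maps written with index \<Delta>
  and with index g on \<psi> in the overview. \<open>Rm\<close> is what \<open>mur\<close> makes of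
  the inserted map, see \<open>mur_ins\<close>.\<close>

definition "G g y = cap g (\<Delta> y)"
definition "psi m g x = \<phi> (ins m (G g) (\<Delta> x))"
definition "Rm m g = rmapV Q (\<sigma> m) (%y. g (\<psi> y))"

lemma G_ghom: "ghom A Q (regular A) s g ==> ghom A Q Q s (G g)"
 unfolding G_def by (rule ghom_comp[OF cap_ghom \<Delta>_ghom]) simp_all

lemma psi_ghom: "ghom A Q (regular A) s g ==> t = s + 1 ==> ghom A Q Q t (psi m g)"
 unfolding psi_def
 by (rule ghom_comp[OF \<phi>_ghom ghom_comp[OF ins_ghom[OF G_ghom] \<Delta>_ghom refl]]) simp_all

lemma \<mu>_psi: "ghom A Q (regular A) s g ==> x : carrier Q ==> \<mu> (psi m g x) = \<zero>"
 unfolding psi_def using ghomD[OF ins_ghom[OF G_ghom]] by simp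

lemma gpsi_ghom: "ghom A Q (regular A) s g ==> ghom A Q (regular A) s (%y. g (\<psi> y))"
 by (rule ghom_comp[OF _ \<psi>_ghom]) simp_all

lemma Rm_ghom: "ghom A Q (regular A) s g ==> ghom A TQ Q s (Rm m g)"
 unfolding Rm_def by (rule rmapV_ghom[OF Q_graded \<sigma>_ghom gpsi_ghom]) simp_all
lemma Rm_val: "ghom A Q (regular A) s g ==> x : carrier Q ==> y : carrier Q ==>
  Rm m g (x \<otimes>\<^sub>Q y) = rsmult Q (\<sigma> m x) (g (\<psi> y))"
 unfolding Rm_def by (rule rmapV_val[OF Q_graded \<sigma>_ghom gpsi_ghom refl])

lemma mur_ins:
 assumes g: "ghom A Q (regular A) s g" and z: "z : carrier TQ"
 shows "mur (ins m (G g) z) = Rm m g z"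
proof (rule T.T_ext[OF _ _ _ z])
 note Gg = G_ghom[OF g]
 show "amap TQ Q (%z. mur (ins m (G g) z))" by (intro Q_comp ghom_amap[OF ins_ghom[OF Gg]])
 show "amap TQ Q (Rm m g)" by (rule ghom_amap[OF Rm_ghom[OF g]])
 show "mur (ins m (G g) (x \<otimes>\<^sub>Q y)) = Rm m g (x \<otimes>\<^sub>Q y)" if "x : carrier Q" "y : carrier Q" for x y
  using that ghomD[OF Gg] by (simp add: ins_val[OF Gg] Rm_val[OF g], simp add: G_def \<mu>_cap[OF g])
qed

lemma G_d:
 assumes g: "ghom A Q (regular A) (- m) g" and y: "y : carrier Q"
 shows "G g (d y) = G (%x. g (d x)) y \<oplus>\<^bsub>Q\<^esub> sneg Q m (d (G g y))"
 using cap_D[OF g, of "\<Delta> y"] y by (simp add: G_def)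

text \<open>This is \<open>d\<phi>\<close> at the tensor \<open>ins m (G g) (\<Delta> x)\<close>:
  the term with \<open>mul\<close> gives \<open>\<psi> (G g x)\<close>, the one with
  \<open>mur\<close> gives \<open>Rm\<close>, and \<open>D\<close> moves past the insertion by
  \<open>D_ins\<close>, leaving the coboundary of \<open>g\<close>.\<close>

lemma psi_d:
 assumes g: "ghom A Q (regular A) (- m) g" and x: "x : carrier Q"
 shows "d (psi m g x) = \<psi> (G g x) \<ominus>\<^bsub>Q\<^esub> Rm m g (\<Delta> x)
   \<oplus>\<^bsub>Q\<^esub> sneg Q m (psi (m + 1) (%x. g (d x)) x) \<ominus>\<^bsub>Q\<^esub> sneg Q m (psi m g (d x))"
proof -
 have gd: "ghom A Q (regular A) (- m - 1) (%x. g (d x))" by (rule ghom_comp[OF g d_ghom]) simp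
 note Gg = G_ghom[OF g] and Ggd = G_ghom[OF gd]
 note [simp] = ghomD(4-8)[OF Gg] ghomD(4-8)[OF ins_ghom[OF Gg]] ghomD(4-8)[OF ins_ghom[OF Ggd]]
  ghomD(4-8)[OF Rm_ghom[OF g]]
 have "D (ins m (G g) (\<Delta> x)) = sneg TQ m (ins m (G g) (\<Delta> (d x))) \<ominus>\<^bsub>TQ\<^esub> sneg TQ m (ins (m + 1) (G (%x. g (d x))) (\<Delta> x))"
  using D_ins[OF Gg Ggd G_d[OF g], of "\<Delta> x"] x by simp
 moreover have "mul (ins m (G g) (\<Delta> x)) = G g x" using mul_ins[OF Gg] x by simp
 ultimately have "d (psi m g x) = \<psi> (G g x) \<ominus>\<^bsub>Q\<^esub> Rm m g (\<Delta> x) \<ominus>\<^bsub>Q\<^esub> (sneg Q m (psi m g (d x)) \<ominus>\<^bsub>Q\<^esub> sneg Q m (psi (m + 1) (%x. g (d x)) x))"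
  unfolding psi_def using x by (simp add: d\<phi> mur_ins[OF g]) (simp add: sneg_def)
 also have "\<dots> = \<psi> (G g x) \<ominus>\<^bsub>Q\<^esub> Rm m g (\<Delta> x)
   \<oplus>\<^bsub>Q\<^esub> sneg Q m (psi (m + 1) (%x. g (d x)) x) \<ominus>\<^bsub>Q\<^esub> sneg Q m (psi m g (d x))"
  by (rule rep_eq[of Q], (rule rep_rules | (rule rep_atom, simp, simp add: x psi_def))+, simp)
 finally show ?thesis .
qed

end

section \<open>Circle product, bracket and cup product of cochains\<close>

context bdata begin

abbreviation "coch n f == ghom A Q (regular A) (- n) f"

text \<open>\<open>cupc\<close> is the cup product defined by the diagonal, with
  \<open>\<psi>\<close> inserted before the second cochain. In this form it arises as the error term
  of \<open>circ\<close>.\<close>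

definition "circ m f g x = f (psi m g x)"
definition "br n m f g x = circ m f g x \<ominus> sneg A ((n - 1) * (m - 1)) (circ n g f x)"
definition "cupc f g x = cup f (%y. g (\<psi> y)) (\<Delta> x)"

lemma circ_ghom: "coch n f ==> coch m g ==> k = n + m - 1 ==> coch k (circ m f g)"
 unfolding circ_def by (rule ghom_comp[OF _ psi_ghom[OF _ refl]], assumption, assumption) linarith

lemma cupc_closed: "coch n f ==> coch m g ==> x : carrier Q ==> cupc f g x : carrier A"
 unfolding cupc_def using ghomD(4)[OF cup_ghom[OF _ gpsi_ghom refl], of "- n" f "- m" g] by simp

lemma circ_closed: "coch n f ==> coch m g ==> x : carrier Q ==> circ m f g x : carrier A"
 using ghomD(4)[OF circ_ghom[OF _ _ refl]] by simp

lemma br_ghom: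
 assumes "coch n f" "coch m g" "k = n + m - 1"
 shows "coch k (br n m f g)"
proof -
 have 1: "coch k (circ m f g)" "coch k (circ n g f)" by (rule circ_ghom; use assms in simp)+
 show ?thesis using ghom_diff[OF 1(1) ghom_sneg[OF 1(2)]] by (simp add: br_def[abs_def])
qed

text \<open>Together with \<open>coch_Rm\<close>: a cochain \<open>f\<close> turns the two error
  terms of \<open>psi_d\<close> into cup products of \<open>f\<close> and \<open>g\<close> in
  opposite orders, the second with the sign \<open>(-1)^(nm)\<close> of the twist.\<close>

lemma coch_cap:
 assumes f: "coch n f" and g: "coch m g" and z: "z : carrier TQ"
 shows "f (\<psi> (cap g z)) = cup g (%y. f (\<psi> y)) z"
proof (rule T.T_ext[OF _ _ _ z])
 note fp = gpsi_ghom[OF f]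
 show "amap TQ (regular A) (%z. f (\<psi> (cap g z)))" by (rule amap_comp[OF ghom_amap[OF fp] ghom_amap[OF cap_ghom[OF g]]])
 show "amap TQ (regular A) (cup g (%y. f (\<psi> y)))" by (rule ghom_amap[OF cup_ghom[OF g fp refl]])
 show "f (\<psi> (cap g (x \<otimes>\<^sub>Q y))) = cup g (%y. f (\<psi> y)) (x \<otimes>\<^sub>Q y)" if "x : carrier Q" "y : carrier Q" for x y
  using that ghomD[OF f] ghomD[OF g] by (simp add: cap_val[OF g] cup_val[OF g fp])
qed

lemma coch_Rm:
 assumes f: "coch n f" and g: "coch m g" and z: "z : carrier TQ"
 shows "f (Rm m g z) = sneg A (n * m) (cup f (%y. g (\<psi> y)) z)"
proof (rule T.T_ext[OF _ _ _ z])
 note gp = gpsi_ghom[OF g]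
 show "amap TQ (regular A) (%z. f (Rm m g z))" by (rule amap_comp[OF ghom_amap[OF f] ghom_amap[OF Rm_ghom[OF g]]])
 show "amap TQ (regular A) (%z. sneg A (n * m) (cup f (%y. g (\<psi> y)) z))"
  using amap_sneg[OF ghom_amap[OF cup_ghom[OF f gp refl]]] by simp
 show "f (Rm m g (x \<otimes>\<^sub>Q y)) = sneg A (n * m) (cup f (%y. g (\<psi> y)) (x \<otimes>\<^sub>Q y))"
  if "x : carrier Q" "y : carrier Q" for x y
  using that ghomD[OF f] ghomD[OF g]
  by (simp add: Rm_val[OF g] cup_val[OF f gp] cochain_sgn[OF Q_graded f])
    (simp add: sneg_def A.l_minus)
qed

text \<open>For cocycles this is the classical fact that the circle product is a homotopy between
  the two orders of the cup product, here with \<open>\<psi>\<close> in the second factor.\<close>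

lemma circ_d:
 assumes f: "coch n f" and g: "coch m g" and x: "x : carrier Q"
 shows "f (d (psi m g x)) = cupc g f x \<ominus> sneg A (n * m) (cupc f g x)
  \<oplus> sneg A m (circ (m + 1) f (%x. g (d x)) x) \<ominus> sneg A m (circ m f g (d x))"
proof -
 have gd: "coch (m + 1) (%x. g (d x))" by (rule ghom_comp[OF g d_ghom]) simp
 note [simp] = ghomD(4-8)[OF f, simplified] ghomD(4)[OF G_ghom[OF g]] ghomD(4)[OF Rm_ghom[OF g]]
  ghomD(4)[OF psi_ghom[OF g refl]] ghomD(4)[OF psi_ghom[OF gd refl]] x
 have fs: "f (sneg Q m y) = sneg A m (f y)" if "y : carrier Q" for y
  using that by (simp add: sneg_def)
 have "f (\<psi> (G g x)) = cupc g f x" "f (Rm m g (\<Delta> x)) = sneg A (n * m) (cupc f g x)"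
  by (simp_all add: G_def cupc_def coch_cap[OF f g] coch_Rm[OF f g])
 then show ?thesis
  by (simp add: psi_d[OF g x] circ_def fs)
qed

lemma cap_cong: "coch m g ==> coch m g' ==> (!!x. x : carrier Q ==> g x = g' x) ==> z : carrier TQ ==> cap g z = cap g' z"
 by (rule T.T_ext[OF ghom_amap[OF cap_ghom] ghom_amap[OF cap_ghom]]) (simp_all add: cap_val)

lemma cap_plus:
 assumes g: "coch m g" and g': "coch m g'" and z: "z : carrier TQ"
 shows "cap (%x. g x \<oplus> g' x) z = cap g z \<oplus>\<^bsub>Q\<^esub> cap g' z"
proof (rule T.T_ext[OF _ _ _ z])
 have s: "coch m (%x. g x \<oplus> g' x)" using ghom_plus[OF g' g] by simp
 show "amap TQ Q (cap (%x. g x \<oplus> g' x))" by (rule ghom_amap[OF cap_ghom[OF s]])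
 show "amap TQ Q (%z. cap g z \<oplus>\<^bsub>Q\<^esub> cap g' z)" by (intro amap_plus ghom_amap[OF cap_ghom[OF g]] ghom_amap[OF cap_ghom[OF g']])
 show "cap (%x. g x \<oplus> g' x) (x \<otimes>\<^sub>Q y) = cap g (x \<otimes>\<^sub>Q y) \<oplus>\<^bsub>Q\<^esub> cap g' (x \<otimes>\<^sub>Q y)"
  if "x : carrier Q" "y : carrier Q" for x y
  using that ghomD[OF g] ghomD[OF g'] by (simp add: cap_val[OF g] cap_val[OF g'] cap_val[OF s] Q_bimod(6))
qed

lemma ins_cong: "ghom A Q Q s \<beta> ==> ghom A Q Q s \<beta>' ==> (!!x. x : carrier Q ==> \<beta> x = \<beta>' x) ==> z : carrier TQ ==>
  ins m \<beta> z = ins m \<beta>' z"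
 by (rule T.T_ext[OF ghom_amap[OF ins_ghom] ghom_amap[OF ins_ghom]]) (simp_all add: ins_val)

lemma ins_plus:
 assumes g: "ghom A Q Q s g" and g': "ghom A Q Q s g'" and z: "z : carrier TQ"
 shows "ins m (%x. g x \<oplus>\<^bsub>Q\<^esub> g' x) z = ins m g z \<oplus>\<^bsub>TQ\<^esub> ins m g' z"
proof (rule T.T_ext[OF _ _ _ z])
 have s: "ghom A Q Q s (%x. g x \<oplus>\<^bsub>Q\<^esub> g' x)" using ghom_plus[OF g' g] by simp
 show "amap TQ TQ (ins m (%x. g x \<oplus>\<^bsub>Q\<^esub> g' x))" by (rule ghom_amap[OF ins_ghom[OF s]])
 show "amap TQ TQ (%z. ins m g z \<oplus>\<^bsub>TQ\<^esub> ins m g' z)" by (intro amap_plus ghom_amap[OF ins_ghom[OF g]] ghom_amap[OF ins_ghom[OF g']])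
 show "ins m (%x. g x \<oplus>\<^bsub>Q\<^esub> g' x) (x \<otimes>\<^sub>Q y) = ins m g (x \<otimes>\<^sub>Q y) \<oplus>\<^bsub>TQ\<^esub> ins m g' (x \<otimes>\<^sub>Q y)"
  if "x : carrier Q" "y : carrier Q" for x y
  using that ghomD[OF g] ghomD[OF g'] by (simp add: ins_val[OF g] ins_val[OF g'] ins_val[OF s])
qed

lemma psi_cong:
 assumes g: "coch m g" and g': "coch m g'" and eq: "!!x. x : carrier Q ==> g x = g' x" and x: "x : carrier Q"
 shows "psi k g x = psi k g' x"
 unfolding psi_def
 by (rule arg_cong[of _ _ \<phi>], rule ins_cong[OF G_ghom[OF g] G_ghom[OF g']])
   (simp_all add: G_def x cap_cong[OF g g' eq])

lemma psi_plus:
 assumes g: "coch m g" and g': "coch m g'" and x: "x : carrier Q"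
 shows "psi k (%x. g x \<oplus> g' x) x = psi k g x \<oplus>\<^bsub>Q\<^esub> psi k g' x"
proof -
 have s: "coch m (%x. g x \<oplus> g' x)" using ghom_plus[OF g' g] by simp
 note Gg = G_ghom[OF g] and Gg' = G_ghom[OF g'] and Gs = G_ghom[OF s]
 have p: "ghom A Q Q (- m) (%x. G g x \<oplus>\<^bsub>Q\<^esub> G g' x)" by (rule ghom_plus[OF Gg' Gg])
 have "ins k (G (%x. g x \<oplus> g' x)) (\<Delta> x) = ins k (%x. G g x \<oplus>\<^bsub>Q\<^esub> G g' x) (\<Delta> x)"
  by (rule ins_cong[OF Gs p]) (simp_all add: G_def x cap_plus[OF g g'])
 then show ?thesis
  unfolding psi_def using x ghomD[OF ins_ghom[OF Gg]] ghomD[OF ins_ghom[OF Gg']] by (simp add: ins_plus[OF Gg Gg'])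
qed

text \<open>On the carrier \<open>g\<close> equals its own double, so by additivity the value
  \<open>u\<close> satisfies \<open>u + u = u\<close>.\<close>

lemma psi_zero:
 assumes g: "coch m g" and 0: "!!x. x : carrier Q ==> g x = \<zero>" and x: "x : carrier Q"
 shows "psi k g x = \<zero>\<^bsub>Q\<^esub>"
proof -
 have s: "coch m (%x. g x \<oplus> g x)" using ghom_plus[OF g g] by simp
 have c: "psi k g x : carrier Q" using ghomD(4)[OF psi_ghom[OF g refl] x] .
 interpret Q: abelian_group Q by simp
 have "psi k g x \<oplus>\<^bsub>Q\<^esub> psi k g x = psi k g x"
  using psi_plus[OF g g x, of k] psi_cong[OF s g _ x, of k] by (simp add: 0)
 then show ?thesis using c Q.add.l_cancel_one' by metis
qed

lemma circ_plus1: "coch m g ==> x : carrier Q ==>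
  circ m (%x. f x \<oplus> f' x) g x = circ m f g x \<oplus> circ m f' g x"
 by (simp add: circ_def)

lemma circ_plus2: "coch n f ==> coch m g ==> coch m g' ==> x : carrier Q ==>
  circ k f (%x. g x \<oplus> g' x) x = circ k f g x \<oplus> circ k f g' x"
 unfolding circ_def
 using ghomD(5)[of A Q "regular A" "- n" f] ghomD(4)[OF psi_ghom[OF _ refl], of "- m" g x k] ghomD(4)[OF psi_ghom[OF _ refl], of "- m" g' x k]
 by (simp add: psi_plus)

lemma circ_cong1: "coch m g ==> (!!x. x : carrier Q ==> f x = f' x) ==> x : carrier Q ==> circ k f g x = circ k f' g x"
 unfolding circ_def using ghomD(4)[OF psi_ghom[OF _ refl]] by blast

lemma circ_cong2: "coch m g ==> coch m g' ==> (!!x. x : carrier Q ==> g x = g' x) ==> x : carrier Q ==> circ k f g x = circ k f g' x"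
 unfolding circ_def using psi_cong[of m g g' x k] by simp

text \<open>By \<open>circ_d\<close> each circle product of cocycles takes on a boundary the value
  of a signed commutator of cup products. The two commutators agree up to the sign in the
  bracket.\<close>

lemma br_cocycle:
 assumes f: "coch n f" and g: "coch m g" and fd: "!!x. x : carrier Q ==> f (d x) = \<zero>"
  and gd: "!!x. x : carrier Q ==> g (d x) = \<zero>" and x: "x : carrier Q"
 shows "br n m f g (d x) = \<zero>"
proof -
 have gdc: "coch (m + 1) (%x. g (d x))" by (rule ghom_comp[OF g d_ghom]) simp
 have fdc: "coch (n + 1) (%x. f (d x))" by (rule ghom_comp[OF f d_ghom]) simp
 have 1: "f (d (psi m g x)) = \<zero>" "g (d (psi n f x)) = \<zero>"
  using fd gd ghomD(4)[OF psi_ghom[OF g refl] x] ghomD(4)[OF psi_ghom[OF f refl] x] by auto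
 have 2: "circ (m + 1) f (%x. g (d x)) x = \<zero>" "circ (n + 1) g (%x. f (d x)) x = \<zero>"
  unfolding circ_def using ghomD(6)[OF f] ghomD(6)[OF g]
  by (simp_all add: psi_zero[OF gdc gd x] psi_zero[OF fdc fd x])
 note [simp] = cupc_closed[OF f g x] cupc_closed[OF g f x] circ_closed[OF f g] circ_closed[OF g f] x
 \<comment> \<open>Solves \<open>circ_d\<close> for its last term when the left side and the
   coboundary term are zero.\<close>
 have sw: "u = sneg A k w" if "\<zero> = w \<oplus> sneg A k \<zero> \<ominus> sneg A k u" "u : carrier A" "w : carrier A" for u w k
 proof -
  have "w \<ominus> sneg A k u = \<zero>"
   using that(1)[symmetric] that(2,3) by (cases "even k") (simp_all add: sneg_def)
  then have "w = sneg A k u" using that by simp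
  then show ?thesis using that by (simp add: sneg_def)
 qed
 have 3: "circ m f g (d x) = sneg A m (cupc g f x \<ominus> sneg A (n * m) (cupc f g x))"
  by (rule sw) (use circ_d[OF f g x] 1 2 in simp_all)
 have 4: "circ n g f (d x) = sneg A n (cupc f g x \<ominus> sneg A (m * n) (cupc g f x))"
  by (rule sw) (use circ_d[OF g f x] 1 2 in simp_all)
 show ?thesis
  unfolding br_def 3 4
  by (cases "even n"; cases "even m"; simp add: sneg_def;
    rule rep_eq[of A], (rule rep_rules rep_zero | (rule rep_atom, simp, simp) | simp)+)
qed

text \<open>Here \<open>circ_d\<close> is used once with \<open>h\<close> as the outer cochain and
  once with \<open>h\<close> as the inserted one. Each use brings in both cup products of
  \<open>g\<close> and \<open>h\<close>; they cancel, and what remains is evaluated at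
  \<open>d x\<close>, which exhibits a primitive of the bracket.\<close>

lemma br_coboundary:
 assumes h: "coch (n - 1) h" and g: "coch m g"
  and gd: "!!x. x : carrier Q ==> g (d x) = \<zero>" and x: "x : carrier Q"
 shows "br n m (%x. h (d x)) g x =
  sneg A (m + 1) (circ m h g (d x)) \<ominus> sneg A ((n - 1) * (m - 1)) (circ (n - 1) g h (d x))"
proof -
 have gdc: "coch (m + 1) (%x. g (d x))" by (rule ghom_comp[OF g d_ghom]) simp
 have hdc: "coch n (%x. h (d x))" by (rule ghom_comp[OF h d_ghom]) simp
 have 1: "g (d (psi (n - 1) h x)) = \<zero>"
  using gd ghomD(4)[OF psi_ghom[OF h refl] x] by auto
 have 2: "circ (m + 1) h (%x. g (d x)) x = \<zero>"
  unfolding circ_def using ghomD(6)[OF h]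
  by (simp add: psi_zero[OF gdc gd x])
 note [simp] = cupc_closed[OF h g x] cupc_closed[OF g h x] circ_closed[OF h g] circ_closed[OF g h] x circ_closed[OF g hdc]
 have sw: "u = sneg A k (v \<ominus> w)" if "\<zero> = w \<oplus> sneg A k u \<ominus> v" "u : carrier A" "v : carrier A" "w : carrier A" for u v w k
 proof -
  have "w \<oplus> sneg A k u = v" using that A.r_right_minus_eq[of "w \<oplus> sneg A k u" v] by simp
  then have "sneg A k u = v \<ominus> w" using that
   by (metis A.a_comm A.add.inv_solve_right' A.minus_eq A.minus_closed sneg_closed[OF A.abelian_group_axioms])
  then show ?thesis using that by (metis sneg_def A.minus_minus)
 qed
 have 3: "circ m (%x. h (d x)) g x = cupc g h x \<ominus> sneg A ((n - 1) * m) (cupc h g x) \<ominus> sneg A m (circ m h g (d x))"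
  using circ_d[OF h g x] 2 by (simp add: circ_def[of m "%x. h (d x)"]) (simp add: sneg_def)
 have 4: "circ n g (%x. h (d x)) x = sneg A (n - 1) (sneg A (n - 1) (circ (n - 1) g h (d x)) \<ominus> (cupc h g x \<ominus> sneg A (m * (n - 1)) (cupc g h x)))"
  by (rule sw) (use circ_d[OF g h x] 1 in simp_all)
 show ?thesis
  unfolding br_def 3 4
  by (cases "even n"; cases "even m"; simp add: sneg_def;
    rule rep_eq[of A], (rule rep_rules rep_zero | (rule rep_atom, simp, simp) | simp)+)
qed

lemma br_swap:
 assumes f: "coch n f" and g: "coch m g" and x: "x : carrier Q"
 shows "br n m f g x = \<ominus> sneg A ((n - 1) * (m - 1)) (br m n g f x)"
proof -
 note [simp] = circ_closed[OF f g] circ_closed[OF g f] x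
 show ?thesis unfolding br_def
  by (cases "even n"; cases "even m"; simp add: sneg_def;
    rule rep_eq[of A], (rule rep_rules rep_zero | (rule rep_atom, simp, simp) | simp)+)
qed

lemma br_plus1:
 assumes f: "coch n f" and f': "coch n f'" and g: "coch m g" and x: "x : carrier Q"
 shows "br n m (%x. f x \<oplus> f' x) g x = br n m f g x \<oplus> br n m f' g x"
proof -
 note [simp] = circ_closed[OF f g] circ_closed[OF g f] circ_closed[OF f' g] circ_closed[OF g f'] x
 show ?thesis unfolding br_def circ_plus1[OF g x] circ_plus2[OF g f f' x]
  by (cases "even ((n - 1) * (m - 1))"; simp add: sneg_def del: even_mult_iff;
    rule rep_eq[of A], (rule rep_rules rep_zero | (rule rep_atom, simp, simp) | simp)+)
qed

lemma br_cong1: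
 assumes "coch n f" "coch n f'" "coch m g" "!!x. x : carrier Q ==> f x = f' x" "x : carrier Q"
 shows "br n m f g x = br n m f' g x"
 unfolding br_def using circ_cong1[of m g f f' x m] circ_cong2[of n f f' x n g] assms by simp

text \<open>Adding a coboundary to the first argument; the second argument is then treated by antisymmetry.\<close>

lemma br_homotopic1:
 assumes f: "coch n f" and f': "coch n f'" and h: "coch (n - 1) h" and g: "coch m g"
  and eq: "!!x. x : carrier Q ==> f x = f' x \<oplus> h (d x)"
  and gd: "!!x. x : carrier Q ==> g (d x) = \<zero>"
 shows "EX H. coch (n + m - 2) H & (ALL x:carrier Q. br n m f g x = br n m f' g x \<oplus> H (d x))"
proof (intro exI conjI ballI)
 let ?H = "%x. sneg A (m + 1) (circ m h g x) \<ominus> sneg A ((n - 1) * (m - 1)) (circ (n - 1) g h x)"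
 have hdc: "coch n (%x. h (d x))" by (rule ghom_comp[OF h d_ghom]) simp
 have 1: "coch (n + m - 2) (circ m h g)" "coch (n + m - 2) (circ (n - 1) g h)"
  by (rule circ_ghom[OF h g], simp, rule circ_ghom[OF g h], simp)
 show "coch (n + m - 2) ?H"
  using ghom_diff[OF ghom_sneg[OF 1(1), of "m + 1"] ghom_sneg[OF 1(2), of "(n - 1) * (m - 1)"]] by simp
 fix x assume x: "x : carrier Q"
 have s: "coch n (%x. f' x \<oplus> h (d x))" using ghom_plus[OF hdc f'] by simp
 show "br n m f g x = br n m f' g x \<oplus> ?H (d x)"
  using br_cong1[OF f s g eq x] br_plus1[OF f' hdc g x] br_coboundary[OF h g gd x] by simp
qed

lemma br_homotopic2:
 assumes g: "coch m g" and g': "coch m g'" and h: "coch (m - 1) h" and f: "coch n f"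
  and eq: "!!x. x : carrier Q ==> g x = g' x \<oplus> h (d x)"
  and fd: "!!x. x : carrier Q ==> f (d x) = \<zero>"
 shows "EX H. coch (n + m - 2) H & (ALL x:carrier Q. br n m f g x = br n m f g' x \<oplus> H (d x))"
proof -
 obtain H where H: "coch (m + n - 2) H" "!!x. x : carrier Q ==> br m n g f x = br m n g' f x \<oplus> H (d x)"
  using br_homotopic1[OF g g' h f eq fd] by blast
 let ?H = "%x. \<ominus> sneg A ((n - 1) * (m - 1)) (H x)"
 have H1: "coch (n + m - 2) H" using H(1) by (simp add: add.commute)
 have "coch (n + m - 2) ?H" using ghom_uminus[OF ghom_sneg[OF H1, of "(n - 1) * (m - 1)"]] by simp
 moreover have "br n m f g x = br n m f g' x \<oplus> ?H (d x)" if x: "x : carrier Q" for x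
 proof -
  note [simp] = ghomD(4)[OF H1, simplified] ghomD(4)[OF br_ghom[OF g' f refl], simplified] x
  show ?thesis
   unfolding br_swap[OF f g x] br_swap[OF f g' x] H(2)[OF x]
   by (cases "even ((n - 1) * (m - 1))"; simp add: sneg_def del: even_mult_iff;
     rule rep_eq[of A], (rule rep_rules rep_zero | (rule rep_atom, simp, simp) | simp)+)
 qed
 ultimately show ?thesis by blast
qed

end

section \<open>Comparison of the brackets of two complexes\<close>

context cplx begin

lemma lact_amap: "y : carrier Q ==> amap (regular A) Q (%a. a \<odot>\<^bsub>Q\<^esub> y)"
 by (intro amapI) (simp_all add: Q_bimod gab_group[OF regular_gab])
lemma ract_amap: "y : carrier Q ==> amap (regular A) Q (%a. rsmult Q y a)"
 by (intro amapI) (simp_all add: Q_bimod gab_group[OF regular_gab])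

lemmas [simp] = amapD(4-7)[OF lact_amap, simplified] amapD(4-7)[OF ract_amap, simplified]
 amap_minus[OF gab_smult[OF Q_gab]]

lemma d_mur: "z : carrier TQ ==> d (mur z) = mur (D z)"
 by (rule T.T_ext[of Q "%z. d (mur z)" "%z. mur (D z)"]) (intro Q_comp, intro Q_comp, simp_all)

lemma \<mu>_mur: "z : carrier TQ ==> \<mu> (mur z) = \<mu> (mul z)"
 by (rule T.T_ext[of "regular A" "%z. \<mu> (mur z)" "%z. \<mu> (mul z)"])
   (intro amap_comp[OF ghom_amap[OF \<mu>_ghom]] Q_comp ghom_amap[OF mul_ghom] ghom_amap[OF mur_ghom],
   intro amap_comp[OF ghom_amap[OF \<mu>_ghom]] Q_comp ghom_amap[OF mul_ghom] ghom_amap[OF mur_ghom], simp_all)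

lemma cap_zero:
 assumes g: "ghom A Q (regular A) s g" and 0: "!!x. x : carrier Q ==> g x = \<zero>" and z: "z : carrier TQ"
 shows "cap g z = \<zero>\<^bsub>Q\<^esub>"
proof (rule T.T_ext[OF ghom_amap[OF cap_ghom[OF g]] amap_const_zero[OF T_gp Q_gp] _ z])
 show "cap g (x \<otimes>\<^sub>Q y) = \<zero>\<^bsub>Q\<^esub>" if "x : carrier Q" "y : carrier Q" for x y
  using that 0 by (simp add: cap_val[OF g])
qed

end

context bdata begin

lemma d\<psi>: "x : carrier Q ==> d (\<psi> x) = \<psi> (d x)"
 using d_mur[of "\<Delta> x"] by simp

lemma \<mu>\<psi> [simp]: "x : carrier Q ==> \<mu> (\<psi> x) = \<mu> x"
 using \<mu>_mur[of "\<Delta> x"] by simp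

lemma psi_d_cocycle:
 assumes g: "coch m g" and gd: "!!x. x : carrier Q ==> g (d x) = \<zero>" and x: "x : carrier Q"
 shows "d (psi m g x) = \<psi> (G g x) \<ominus>\<^bsub>Q\<^esub> Rm m g (\<Delta> x) \<ominus>\<^bsub>Q\<^esub> sneg Q m (psi m g (d x))"
proof -
 have gdc: "coch (m + 1) (%x. g (d x))" by (rule ghom_comp[OF g d_ghom]) simp
 show ?thesis
  using psi_d[OF g x] x ghomD(4)[OF G_ghom[OF g] x] ghomD(4)[OF Rm_ghom[OF g], of "\<Delta> x"]
  by (simp add: psi_zero[OF gdc gd x]) (simp add: sneg_def)
qed

end

text \<open>Only the target \<open>P\<close> needs the contraction \<open>h\<close> of its tensor
  square: it is used to compare two maps from \<open>B\<close> into that square.\<close>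

locale bcompare =
 P: bdata K A P d \<mu> \<Delta> \<phi> \<psi> + B: bdata K A B dB \<mu>B \<Delta>B \<phi>B id
 for K :: "'k ring" and A :: "('k, 'a) module" (structure) and P :: "('a, 'p) graded_bimodule" and d \<mu> \<Delta> \<phi> \<psi>
  and B :: "('a, 'b) graded_bimodule" and dB \<mu>B \<Delta>B \<phi>B +
 fixes h :: "('p, 'p) tens => ('p, 'p) tens" and \<Phi> :: "'b => 'p"
 assumes h_ghom: "ghom A P.TQ P.TQ 1 h"
  and Dh: "!!z. z : carrier P.TQ ==> P.D (h z) = z \<ominus>\<^bsub>P.TQ\<^esub> h (P.D z) \<ominus>\<^bsub>P.TQ\<^esub> \<Delta> (P.mul z)"
  and mul_h: "!!z. z : carrier P.TQ ==> P.mul (h z) = \<zero>\<^bsub>P\<^esub>"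
  and \<Phi>_ghom: "ghom A B P 0 \<Phi>" and d\<Phi>: "!!x. x : carrier B ==> d (\<Phi> x) = \<Phi> (dB x)"
  and \<mu>\<Phi>: "!!x. x : carrier B ==> \<mu> (\<Phi> x) = \<mu>B x"
begin

text \<open>The diagonals before and after \<open>\<Phi>\<close> are two lifts of
  \<open>\<Phi>\<close> along \<open>P.mul\<close>; \<open>u\<close> is the homotopy between them
  given by \<open>h\<close>. Applying \<open>P.mur\<close> gives \<open>v\<close>, a homotopy from
  \<open>\<Phi>\<close> to \<open>\<psi>\<close> after \<open>\<Phi>\<close>.\<close>

definition "\<Phi>2 = B.tmapV P \<Phi> \<Phi>"
definition "u x = h (\<Delta> (\<Phi> x) \<ominus>\<^bsub>P.TQ\<^esub> \<Phi>2 (\<Delta>B x))"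
definition "v x = P.mur (u x)"

lemma \<Phi>2_ghom: "ghom A B.TQ P.TQ 0 \<Phi>2"
 unfolding \<Phi>2_def by (rule B.tmapV_ghom[OF P.Q_graded \<Phi>_ghom \<Phi>_ghom]) simp
lemma \<Phi>2_val: "x : carrier B ==> y : carrier B ==> \<Phi>2 (pure_A A B B x y) = pure_A A P P (\<Phi> x) (\<Phi> y)"
 unfolding \<Phi>2_def by (rule B.tmapV_val[OF P.Q_graded \<Phi>_ghom \<Phi>_ghom refl])

lemmas [simp] = ghomD(4-8)[OF h_ghom] mul_h ghomD(4-8)[OF \<Phi>_ghom] ghomD(9,10)[OF \<Phi>_ghom] d\<Phi> \<mu>\<Phi> ghomD(4-8)[OF \<Phi>2_ghom] \<Phi>2_val

lemmas comps = P.Q_comp B.Q_comp amap_comp[OF ghom_amap[OF \<Phi>2_ghom]] amap_comp[OF ghom_amap[OF \<Phi>_ghom]]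
 ghom_amap[OF \<Phi>2_ghom] ghom_amap[OF P.\<psi>_ghom] amap_comp[OF ghom_amap[OF P.\<psi>_ghom]]

lemma \<Phi>\<sigma>: "x : carrier B ==> \<Phi> (B.\<sigma> m x) = P.\<sigma> m (\<Phi> x)"
 using ghom_sgnmap[OF B.Q_graded P.Q_graded \<Phi>_ghom] by (simp add: sneg_def)

lemma D_\<Phi>2: "z : carrier B.TQ ==> P.D (\<Phi>2 z) = \<Phi>2 (B.D z)"
 by (rule B.T.T_ext[of P.TQ "%z. P.D (\<Phi>2 z)" "%z. \<Phi>2 (B.D z)"]) (intro comps, intro comps, simp_all add: \<Phi>\<sigma>)

lemma mul_\<Phi>2 [simp]: "z : carrier B.TQ ==> P.mul (\<Phi>2 z) = \<Phi> (B.mul z)"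
 by (rule B.T.T_ext[of P "%z. P.mul (\<Phi>2 z)" "%z. \<Phi> (B.mul z)"]) (intro comps, intro comps, simp_all)

lemma mur_\<Phi>2 [simp]: "z : carrier B.TQ ==> P.mur (\<Phi>2 z) = \<Phi> (B.mur z)"
 by (rule B.T.T_ext[of P "%z. P.mur (\<Phi>2 z)" "%z. \<Phi> (B.mur z)"]) (intro comps, intro comps, simp_all)

lemma u_ghom: "ghom A B P.TQ 1 u"
 unfolding u_def
 by (rule ghom_comp[OF h_ghom ghom_diff[OF ghom_comp[OF P.\<Delta>_ghom \<Phi>_ghom refl] ghom_comp[OF \<Phi>2_ghom B.\<Delta>_ghom]]]) simp_all
lemma v_ghom: "ghom A B P 1 v"
 unfolding v_def by (rule ghom_comp[OF P.mur_ghom u_ghom]) simp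

lemmas [simp] = ghomD(4-8)[OF u_ghom] ghomD(4-8)[OF v_ghom] ghomD(9,10)[OF v_ghom]

lemma self_minus: "abelian_group G ==> x : carrier G ==> x \<ominus>\<^bsub>G\<^esub> x = \<zero>\<^bsub>G\<^esub>"
 by (simp add: a_minus_def abelian_group.r_neg)

text \<open>Both diagonals are sections of the left augmentations, so their difference is killed by
  \<open>P.mul\<close> and the last term of \<open>Dh\<close> disappears.\<close>

lemma Du: "x : carrier B ==> P.D (u x) = \<Delta> (\<Phi> x) \<ominus>\<^bsub>P.TQ\<^esub> \<Phi>2 (\<Delta>B x) \<ominus>\<^bsub>P.TQ\<^esub> u (dB x)"
proof -
 assume x: "x : carrier B"
 let ?w = "\<Delta> (\<Phi> x) \<ominus>\<^bsub>P.TQ\<^esub> \<Phi>2 (\<Delta>B x)"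
 have w: "?w : carrier P.TQ" "P.mul ?w = \<zero>\<^bsub>P\<^esub>" "P.D ?w = \<Delta> (\<Phi> (dB x)) \<ominus>\<^bsub>P.TQ\<^esub> \<Phi>2 (\<Delta>B (dB x))"
  using x by (simp_all add: D_\<Phi>2 self_minus)
 have "P.D (h ?w) = ?w \<ominus>\<^bsub>P.TQ\<^esub> h (\<Delta> (\<Phi> (dB x)) \<ominus>\<^bsub>P.TQ\<^esub> \<Phi>2 (\<Delta>B (dB x))) \<ominus>\<^bsub>P.TQ\<^esub> \<zero>\<^bsub>P.TQ\<^esub>"
  using Dh[OF w(1)] unfolding w(2,3) by simp
 then show ?thesis unfolding u_def using x by (simp add: a_minus_def)
qed

lemma mul_u [simp]: "x : carrier B ==> P.mul (u x) = \<zero>\<^bsub>P\<^esub>"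
 unfolding u_def by (simp add: self_minus)

lemma dv: "x : carrier B ==> d (v x) = \<psi> (\<Phi> x) \<ominus>\<^bsub>P\<^esub> \<Phi> x \<ominus>\<^bsub>P\<^esub> v (dB x)"
 unfolding v_def by (simp add: P.d_mur Du)

lemma \<mu>v [simp]: "x : carrier B ==> \<mu> (v x) = \<zero>"
 unfolding v_def by (simp add: P.\<mu>_mur)

section \<open>The correction terms attached to a cocycle\<close>

context
 fixes m :: int and g :: "'p => 'a"
 assumes g: "P.coch m g" and g_cocycle: "ALL x:carrier P. g (d x) = \<zero>"
begin

lemma gd: "x : carrier P ==> g (d x) = \<zero>" using g_cocycle by simp

definition "gB x = g (\<Phi> x)"

lemma gB: "B.coch m gB" unfolding gB_def by (rule ghom_comp[OF g \<Phi>_ghom]) simp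
lemma gBd: "x : carrier B ==> gB (dB x) = \<zero>" by (simp add: gB_def gd flip: d\<Phi>)
lemma gv: "B.coch (m - 1) (%x. g (v x))" by (rule ghom_comp[OF g v_ghom]) simp

text \<open>Comparing \<open>psi_d\<close> for \<open>P\<close> and for \<open>B\<close> leaves
  \<open>\<psi>\<close> in two places on the side of \<open>P\<close>: outside \<open>cap\<close>
  and inside \<open>Rm\<close>. \<open>pm\<close> and \<open>qm\<close> are the homotopies, made
  from \<open>v\<close>, that remove it; \<open>r0\<close> is the form of \<open>Rm\<close> reached
  after the removal.\<close>

definition "pm = B.capV P gB v"
definition "qm = B.rmapV P (%x. P.\<sigma> (m + 1) (\<Phi> x)) (%y. g (v y))"
definition "r0 = B.rmapV P (%x. P.\<sigma> m (\<Phi> x)) gB"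

lemma \<sigma>\<Phi>: "ghom A B P 0 (%x. P.\<sigma> k (\<Phi> x))" by (rule ghom_comp[OF P.\<sigma>_ghom \<Phi>_ghom]) simp

lemma pm_ghom: "ghom A B.TQ P (1 - m) pm"
 unfolding pm_def by (rule B.capV_ghom[OF P.Q_graded gB v_ghom]) simp
lemma qm_ghom: "ghom A B.TQ P (1 - m) qm"
 unfolding qm_def by (rule B.rmapV_ghom[OF P.Q_graded \<sigma>\<Phi> gv]) simp
lemma r0_ghom: "ghom A B.TQ P (- m) r0"
 unfolding r0_def by (rule B.rmapV_ghom[OF P.Q_graded \<sigma>\<Phi> gB]) simp

lemma pm_val: "x : carrier B ==> y : carrier B ==> pm (pure_A A B B x y) = gB x \<odot>\<^bsub>P\<^esub> v y"
 unfolding pm_def by (rule B.capV_val[OF P.Q_graded gB v_ghom refl])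
lemma qm_val: "x : carrier B ==> y : carrier B ==> qm (pure_A A B B x y) = rsmult P (P.\<sigma> (m + 1) (\<Phi> x)) (g (v y))"
 unfolding qm_def by (rule B.rmapV_val[OF P.Q_graded \<sigma>\<Phi> gv refl])
lemma r0_val: "x : carrier B ==> y : carrier B ==> r0 (pure_A A B B x y) = rsmult P (P.\<sigma> m (\<Phi> x)) (gB y)"
 unfolding r0_def by (rule B.rmapV_val[OF P.Q_graded \<sigma>\<Phi> gB refl])

lemmas [simp] = ghomD(4-8)[OF pm_ghom] ghomD(4-8)[OF qm_ghom] ghomD(4-8)[OF r0_ghom] pm_val qm_val r0_val
 ghomD(4-8)[OF g, simplified] ghomD(9,10)[OF g, simplified] ghomD(4-8)[OF gB, simplified] gd gBd
 ghomD(4-8)[OF P.cap_ghom[OF g]] ghomD(4-8)[OF P.Rm_ghom[OF g]] P.cap_val[OF g] P.Rm_val[OF g]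
 ghomD(4-8)[OF B.cap_ghom[OF gB]] ghomD(4-8)[OF B.Rm_ghom[OF gB]] B.cap_val[OF gB] B.Rm_val[OF gB]
 ghomD(4-8)[OF P.psi_ghom[OF g refl]] ghomD(4-8)[OF B.psi_ghom[OF gB refl]]
 ghomD(4-8)[OF P.G_ghom[OF g]] ghomD(4-8)[OF B.G_ghom[OF gB]]

lemmas gcomps = comps amap_comp[OF ghom_amap[OF pm_ghom]] amap_comp[OF ghom_amap[OF qm_ghom]]
 ghom_amap[OF r0_ghom] amap_comp[OF ghom_amap[OF P.cap_ghom[OF g]]] amap_comp[OF ghom_amap[OF P.Rm_ghom[OF g]]]
 ghom_amap[OF B.cap_ghom[OF gB]] ghom_amap[OF B.Rm_ghom[OF gB]] ghom_amap[OF pm_ghom] ghom_amap[OF qm_ghom]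
 ghom_amap[OF P.cap_ghom[OF g]] ghom_amap[OF P.Rm_ghom[OF g]]

lemma cap_D0: "z : carrier P.TQ ==> P.cap g (P.D z) = sneg P m (d (P.cap g z))"
proof -
 assume z: "z : carrier P.TQ"
 have "ghom A P (regular A) (- m - 1) (%x. g (d x))" by (rule ghom_comp[OF g P.d_ghom]) simp
 then show ?thesis using P.cap_D[OF g z] P.cap_zero[OF _ gd z] z by simp
qed

text \<open>In the second summand of \<open>D\<close> the cocycle is evaluated at
  \<open>\<psi> (d y)\<close>, which is the boundary of \<open>\<psi> y\<close>, so only the first
  summand survives.\<close>

lemma Rm_D: "z : carrier P.TQ ==> P.Rm m g (P.D z) = sneg P m (d (P.Rm m g z))"
 by (rule P.T.T_ext[of P "%z. P.Rm m g (P.D z)" "%z. sneg P m (d (P.Rm m g z))"])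
   (intro gcomps, intro gcomps, auto simp: P.d\<sigma> sneg_def simp flip: P.d\<psi>)

lemma pm_D: "z : carrier B.TQ ==> d (pm z) = \<psi> (P.cap g (\<Phi>2 z)) \<ominus>\<^bsub>P\<^esub> P.cap g (\<Phi>2 z) \<ominus>\<^bsub>P\<^esub> sneg P m (pm (B.D z))"
proof (rule B.T.T_ext[of P "%z. d (pm z)" "%z. \<psi> (P.cap g (\<Phi>2 z)) \<ominus>\<^bsub>P\<^esub> P.cap g (\<Phi>2 z) \<ominus>\<^bsub>P\<^esub> sneg P m (pm (B.D z))"])
 show "d (pm (pure_A A B B x y)) = \<psi> (P.cap g (\<Phi>2 (pure_A A B B x y))) \<ominus>\<^bsub>P\<^esub> P.cap g (\<Phi>2 (pure_A A B B x y)) \<ominus>\<^bsub>P\<^esub> sneg P m (pm (B.D (pure_A A B B x y)))"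
  if xy: "x : carrier B" "y : carrier B" for x y
 proof -
  have "gB (B.\<sigma> 1 x) = sneg A m (gB x)" using P.cochain_sgn[OF B.Q_graded gB] xy by simp
  then show ?thesis using xy by (cases "even m"; simp add: dv; simp add: sneg_def gB_def)
 qed
qed (intro gcomps, intro gcomps, simp_all)

lemma qm_D: "z : carrier B.TQ ==> P.Rm m g (\<Phi>2 z) = r0 z \<oplus>\<^bsub>P\<^esub> sneg P m (d (qm z)) \<oplus>\<^bsub>P\<^esub> qm (B.D z)"
proof (rule B.T.T_ext[of P "%z. P.Rm m g (\<Phi>2 z)" "%z. r0 z \<oplus>\<^bsub>P\<^esub> sneg P m (d (qm z)) \<oplus>\<^bsub>P\<^esub> qm (B.D z)"])
 show "P.Rm m g (\<Phi>2 (pure_A A B B x y)) = r0 (pure_A A B B x y) \<oplus>\<^bsub>P\<^esub> sneg P m (d (qm (pure_A A B B x y))) \<oplus>\<^bsub>P\<^esub> qm (B.D (pure_A A B B x y))"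
  if xy: "x : carrier B" "y : carrier B" for x y
 proof -
  \<comment> \<open>\<open>dv\<close> solved for the term containing \<open>\<psi>\<close>; the
    cocycle \<open>g\<close> then kills the boundary \<open>d (v y)\<close>.\<close>
  have "\<psi> (\<Phi> y) = \<Phi> y \<oplus>\<^bsub>P\<^esub> d (v y) \<oplus>\<^bsub>P\<^esub> v (dB y)"
   unfolding dv[OF xy(2)] by (rule rep_eq[of P], (rule rep_rules | (rule rep_atom, simp, simp add: xy))+, simp)
  then have e: "g (\<psi> (\<Phi> y)) = gB y \<oplus> g (v (dB y))" using xy by (simp add: gB_def)
  \<comment> \<open>The twist of \<open>qm\<close> and the one in \<open>D\<close> add up to
    \<open>m + 2\<close>, which has the parity of \<open>m\<close>.\<close>
  have s: "P.\<sigma> (m + 1) (P.\<sigma> 1 (\<Phi> x)) = P.\<sigma> m (\<Phi> x)"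
   using xy sgnmap_parity[of "m + 1 + 1" m P] by (simp add: P.\<sigma>\<sigma>)
  show ?thesis
   by (cases "even m"; simp add: xy e \<Phi>\<sigma> s P.d\<sigma>; simp add: sneg_def xy;
     rule rep_eq[of P], (rule rep_rules | (rule rep_atom, simp, simp add: xy))+, simp)
 qed
qed (intro gcomps, intro gcomps, simp_all)

lemma \<Phi>_cap: "z : carrier B.TQ ==> \<Phi> (B.cap gB z) = P.cap g (\<Phi>2 z)"
 by (rule B.T.T_ext[of P "%z. \<Phi> (B.cap gB z)" "%z. P.cap g (\<Phi>2 z)"])
   (intro gcomps, intro gcomps, simp_all add: gB_def)

lemma \<Phi>_Rm: "z : carrier B.TQ ==> \<Phi> (B.Rm m gB z) = r0 z"
 by (rule B.T.T_ext[of P "%z. \<Phi> (B.Rm m gB z)" "r0"])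
   (intro gcomps, intro gcomps, simp_all add: \<Phi>\<sigma>)

text \<open>The first two terms measure how far \<open>\<Phi>\<close> is from intertwining the maps
  \<open>psi\<close>. The two terms with \<open>u\<close> account for exchanging the diagonals, the
  two with \<open>pm\<close> and \<open>qm\<close> for replacing \<open>\<psi>\<close> by the
  identity. With them \<open>E\<close> commutes with the differentials up to a sign.\<close>

definition "E x = P.psi m g (\<Phi> x) \<ominus>\<^bsub>P\<^esub> \<Phi> (B.psi m gB x) \<ominus>\<^bsub>P\<^esub> sneg P m (\<psi> (P.cap g (u x)))
 \<oplus>\<^bsub>P\<^esub> sneg P m (P.Rm m g (u x)) \<ominus>\<^bsub>P\<^esub> pm (\<Delta>B x) \<oplus>\<^bsub>P\<^esub> sneg P m (qm (\<Delta>B x))"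

lemma E_ghom: "ghom A B P (1 - m) E"
proof -
 have 1: "ghom A B P (1 - m) (%x. P.psi m g (\<Phi> x))" by (rule ghom_comp[OF P.psi_ghom[OF g refl] \<Phi>_ghom]) simp
 have 2: "ghom A B P (1 - m) (%x. \<Phi> (B.psi m gB x))" by (rule ghom_comp[OF \<Phi>_ghom B.psi_ghom[OF gB refl]]) simp
 have 3: "ghom A B P (1 - m) (%x. \<psi> (P.cap g (u x)))"
  by (rule ghom_comp[OF P.\<psi>_ghom ghom_comp[OF P.cap_ghom[OF g] u_ghom refl]]) simp
 have 4: "ghom A B P (1 - m) (%x. P.Rm m g (u x))" by (rule ghom_comp[OF P.Rm_ghom[OF g] u_ghom]) simp
 have 5: "ghom A B P (1 - m) (%x. pm (\<Delta>B x))" by (rule ghom_comp[OF pm_ghom B.\<Delta>_ghom]) simp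
 have 6: "ghom A B P (1 - m) (%x. qm (\<Delta>B x))" by (rule ghom_comp[OF qm_ghom B.\<Delta>_ghom]) simp
 show ?thesis unfolding E_def
  by (rule ghom_plus[OF ghom_sneg[OF 6] ghom_diff[OF ghom_plus[OF ghom_sneg[OF 4]
     ghom_diff[OF ghom_diff[OF 1 2] ghom_sneg[OF 3]]] 5]])
qed

lemma E_d:
 assumes x: "x : carrier B" shows "d (E x) = sneg P (m + 1) (E (dB x))"
proof -
 note [simp] = x
 have 1: "d (P.psi m g (\<Phi> x)) = \<psi> (P.cap g (\<Delta> (\<Phi> x))) \<ominus>\<^bsub>P\<^esub> P.Rm m g (\<Delta> (\<Phi> x)) \<ominus>\<^bsub>P\<^esub> sneg P m (P.psi m g (\<Phi> (dB x)))"
  using P.psi_d_cocycle[OF g gd, of "\<Phi> x"] by (simp add: P.G_def)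
 have "dB (B.psi m gB x) = B.cap gB (\<Delta>B x) \<ominus>\<^bsub>B\<^esub> B.Rm m gB (\<Delta>B x) \<ominus>\<^bsub>B\<^esub> sneg B m (B.psi m gB (dB x))"
  using B.psi_d_cocycle[OF gB gBd x] by (simp add: B.G_def)
 moreover have "\<Phi> (sneg B m y) = sneg P m (\<Phi> y)" if "y : carrier B" for y using that by (simp add: sneg_def)
 ultimately have 2: "\<Phi> (dB (B.psi m gB x)) = P.cap g (\<Phi>2 (\<Delta>B x)) \<ominus>\<^bsub>P\<^esub> r0 (\<Delta>B x) \<ominus>\<^bsub>P\<^esub> sneg P m (\<Phi> (B.psi m gB (dB x)))"
  by (simp add: \<Phi>_cap \<Phi>_Rm)
 \<comment> \<open>\<open>Du\<close> solved for the diagonal of \<open>P\<close>. Under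
   \<open>cap\<close> and \<open>Rm\<close> the part \<open>P.D (u x)\<close> becomes a boundary by
   \<open>cap_D0\<close> and \<open>Rm_D\<close>.\<close>
 have w: "\<Delta> (\<Phi> x) = P.D (u x) \<oplus>\<^bsub>P.TQ\<^esub> u (dB x) \<oplus>\<^bsub>P.TQ\<^esub> \<Phi>2 (\<Delta>B x)"
  unfolding Du[OF x] by (rule rep_eq[of P.TQ], (rule rep_rules | (rule rep_atom, simp, simp))+, simp)
 have \<psi>s: "\<psi> (sneg P m y) = sneg P m (\<psi> y)" if "y : carrier P" for y using that by (simp add: sneg_def)
 have 3: "\<psi> (P.cap g (\<Delta> (\<Phi> x))) = sneg P m (d (\<psi> (P.cap g (u x)))) \<oplus>\<^bsub>P\<^esub> \<psi> (P.cap g (u (dB x))) \<oplus>\<^bsub>P\<^esub> \<psi> (P.cap g (\<Phi>2 (\<Delta>B x)))"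
  unfolding w by (simp add: cap_D0 \<psi>s P.d\<psi>)
 have 4: "P.Rm m g (\<Delta> (\<Phi> x)) = sneg P m (d (P.Rm m g (u x))) \<oplus>\<^bsub>P\<^esub> P.Rm m g (u (dB x)) \<oplus>\<^bsub>P\<^esub> P.Rm m g (\<Phi>2 (\<Delta>B x))"
  unfolding w by (simp add: Rm_D)
 have 5: "d (pm (\<Delta>B x)) = \<psi> (P.cap g (\<Phi>2 (\<Delta>B x))) \<ominus>\<^bsub>P\<^esub> P.cap g (\<Phi>2 (\<Delta>B x)) \<ominus>\<^bsub>P\<^esub> sneg P m (pm (\<Delta>B (dB x)))"
  by (simp add: pm_D)
 have 6: "P.Rm m g (\<Phi>2 (\<Delta>B x)) = r0 (\<Delta>B x) \<oplus>\<^bsub>P\<^esub> sneg P m (d (qm (\<Delta>B x))) \<oplus>\<^bsub>P\<^esub> qm (\<Delta>B (dB x))"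
  by (simp add: qm_D)
 have ds: "d (sneg P m y) = sneg P m (d y)" if "y : carrier P" for y using that by (simp add: sneg_def)
 show ?thesis
  unfolding E_def
  by (simp add: ds, unfold 1 2 3 4 5 6)
    (cases "even m"; simp add: sneg_def;
    rule rep_eq[of P], (rule rep_rules | (rule rep_atom, simp, simp))+, simp)
qed

text \<open>Only two of the six terms survive the augmentation: the one with \<open>cap\<close> of
  \<open>u\<close> and the one with \<open>qm\<close>. Both give \<open>g (v x)\<close>, with
  opposite signs.\<close>

lemma \<mu>_E:
 assumes x: "x : carrier B" shows "\<mu> (E x) = \<zero>"
proof -
 note [simp] = x
 have \<mu>s: "\<mu> (sneg P m y) = sneg A m (\<mu> y)" if "y : carrier P" for y using that by (simp add: sneg_def)
 have am: "amap P (regular A) \<mu>" by (rule ghom_amap[OF P.\<mu>_ghom])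
 have gm: "amap P (regular A) g" by (rule ghom_amap[OF g])
 have zm: "amap B.TQ (regular A) (%z. \<zero>)" using amap_const_zero[OF B.T_gp gab_group[OF P.regular_gab]] by simp
 have 1: "\<mu> (P.psi m g (\<Phi> x)) = \<zero>" by (simp add: P.\<mu>_psi[OF g])
 have 2: "\<mu> (\<Phi> (B.psi m gB x)) = \<zero>" by (simp add: B.\<mu>_psi[OF gB])
 have 3: "\<mu> (P.cap g (u x)) = g (v x)" by (simp add: P.\<mu>_cap[OF g] v_def)
 have 4: "\<mu> (P.Rm m g z) = g (\<psi> (P.mul z))" if "z : carrier P.TQ" for z
  by (rule P.T.T_ext[OF amap_comp[OF am ghom_amap[OF P.Rm_ghom[OF g]]]
     amap_comp[OF gm amap_comp[OF ghom_amap[OF P.\<psi>_ghom] ghom_amap[OF P.mul_ghom]]] _ that]) simp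
 have 5: "\<mu> (pm z) = \<zero>" if "z : carrier B.TQ" for z
  by (rule B.T.T_ext[OF amap_comp[OF am ghom_amap[OF pm_ghom]] zm _ that]) simp
 have 6: "\<mu> (qm z) = g (v (B.mul z))" if "z : carrier B.TQ" for z
  by (rule B.T.T_ext[OF amap_comp[OF am ghom_amap[OF qm_ghom]]
     amap_comp[OF gm amap_comp[OF ghom_amap[OF v_ghom] ghom_amap[OF B.mul_ghom]]] _ that]) simp
 have c: "g (v x) : carrier A" by simp
 show ?thesis
  unfolding E_def by (simp add: \<mu>s 1 2 3 4 5 6)
   (simp add: sneg_def a_minus_def P.A.l_neg P.A.r_neg)
qed

end

end

context bcompare begin

definition "W g f x = P.cup g (%y. f (\<psi> y)) (u x)"
definition "V g f x = B.cup (gB g) (%y. f (v y)) (\<Delta>B x)"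

lemma coch_v: "P.coch n f ==> B.coch (n - 1) (%x. f (v x))"
 by (rule ghom_comp[OF _ v_ghom]) simp_all

text \<open>The four corrections become cup products. Exchanging \<open>f\<close> and
  \<open>g\<close> permutes these four, which prepares their cancellation in the bracket.\<close>

lemma coch_E:
 assumes f: "P.coch n f" and fd: "ALL x:carrier P. f (d x) = \<zero>"
  and g: "P.coch m g" and gd: "ALL x:carrier P. g (d x) = \<zero>" and x: "x : carrier B"
 shows "f (E m g x) = P.circ m f g (\<Phi> x) \<ominus> B.circ m (gB f) (gB g) x \<ominus> sneg A m (W g f x)
  \<oplus> sneg A m (sneg A (n * m) (W f g x)) \<ominus> V g f x \<oplus> sneg A m (sneg A (n * (m + 1)) (V f g x))"
proof -
 note gB = gB[OF g gd] and fB = gB[OF f fd]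
 note fv = coch_v[OF f] and gv = coch_v[OF g]
 note pm = pm_ghom[OF g gd] and qm = qm_ghom[OF g gd]
 note [simp] = ghomD(4-8)[OF f, simplified] ghomD(4-8)[OF pm] ghomD(4-8)[OF qm]
  ghomD(4-8)[OF P.cap_ghom[OF g]] ghomD(4-8)[OF P.Rm_ghom[OF g]]
  ghomD(4)[OF P.psi_ghom[OF g refl]] ghomD(4)[OF B.psi_ghom[OF gB refl]] x
  ghomD(4)[OF f, simplified] ghomD(4)[OF g, simplified] ghomD(4)[OF gB, simplified] ghomD(4)[OF fB, simplified]
 have fs: "f (sneg P k y) = sneg A k (f y)" if "y : carrier P" for y k using that by (simp add: sneg_def)
 have 1: "f (pm g z) = B.cup (gB g) (%y. f (v y)) z" if "z : carrier B.TQ" for z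
 proof (rule B.T.T_ext[OF amap_comp[OF ghom_amap[OF f] ghom_amap[OF pm]] ghom_amap[OF B.cup_ghom[OF gB fv refl]] _ that])
  show "f (pm g (pure_A A B B x y)) = B.cup (gB g) (%y. f (v y)) (pure_A A B B x y)"
   if "x : carrier B" "y : carrier B" for x y
   using that by (simp add: pm_val[OF g gd] B.cup_val[OF gB fv] ghomD(9)[OF f, simplified])
 qed
 have 2: "f (qm m g z) = sneg A (n * (m + 1)) (B.cup (gB f) (%y. g (v y)) z)" if "z : carrier B.TQ" for z
 proof (rule B.T.T_ext[OF amap_comp[OF ghom_amap[OF f] ghom_amap[OF qm]] _ _ that])
  show "amap B.TQ (regular A) (%z. sneg A (n * (m + 1)) (B.cup (gB f) (%y. g (v y)) z))"
   using amap_sneg[OF ghom_amap[OF B.cup_ghom[OF fB gv refl]]] by simp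
  show "f (qm m g (pure_A A B B x y)) = sneg A (n * (m + 1)) (B.cup (gB f) (%y. g (v y)) (pure_A A B B x y))"
   if "x : carrier B" "y : carrier B" for x y
   using that
   by (simp add: qm_val[OF g gd] B.cup_val[OF fB gv] ghomD(10)[OF f, simplified] P.cochain_sgn[OF P.Q_graded f])
     (simp add: sneg_def P.A.l_minus gB_def[OF f fd])
 qed
 show ?thesis
  unfolding E_def[OF g gd] W_def V_def P.circ_def B.circ_def
  by (simp add: fs 1 2 P.coch_cap[OF f g] P.coch_Rm[OF f g] gB_def[OF f fd])
qed

text \<open>The correction terms \<open>W\<close> and \<open>V\<close> cancel in the graded commutator.\<close>

lemma br_compare:
 assumes f: "P.coch n f" and fd: "ALL x:carrier P. f (d x) = \<zero>"
  and g: "P.coch m g" and gd: "ALL x:carrier P. g (d x) = \<zero>"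
  and null: "!!s E. [|ghom A B P s E; !!x. x : carrier B ==> d (E x) = sneg P s (E (dB x));
    !!x. x : carrier B ==> \<mu> (E x) = \<zero>|] ==>
   EX k. ghom A B P (s + 1) k & (ALL x:carrier B. E x = d (k x) \<oplus>\<^bsub>P\<^esub> sneg P s (k (dB x)))"
 shows "EX H. B.coch (n + m - 2) H &
  (ALL x:carrier B. P.br n m f g (\<Phi> x) = B.br n m (%x. f (\<Phi> x)) (%x. g (\<Phi> x)) x \<oplus> H (dB x))"
proof -
 \<comment> \<open>\<open>E\<close> is null-homotopic and \<open>f\<close> vanishes on boundaries,
   so \<open>f\<close> composed with \<open>E\<close> is a coboundary.\<close>
 have nl: "EX H. B.coch (n + m - 2) H & (ALL x:carrier B. f (E m g x) = H (dB x))"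
  if f: "P.coch n f" and fd: "ALL x:carrier P. f (d x) = \<zero>"
   and g: "P.coch m g" and gd: "ALL x:carrier P. g (d x) = \<zero>" for n m f g
 proof -
  \<comment> \<open>\<open>E\<close> has degree \<open>1 - m\<close>, and its commutation sign
    \<open>m + 1\<close> has the same parity; \<open>null\<close> asks for the sign of the
    degree.\<close>
  have "sneg P (m + 1) = sneg P (1 - m)" by (simp add: fun_eq_iff sneg_def)
  then obtain k where k: "ghom A B P (1 - m + 1) k" "!!x. x : carrier B ==> E m g x = d (k x) \<oplus>\<^bsub>P\<^esub> sneg P (1 - m) (k (dB x))"
   using null[OF E_ghom[OF g gd]] E_d[OF g gd] \<mu>_E[OF g gd] by auto
  have fk: "B.coch (n + m - 2) (%x. f (k x))" by (rule ghom_comp[OF f k(1)]) simp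
  note [simp] = ghomD(4-8)[OF f, simplified] fd ghomD(4)[OF k(1)] ghomD(4)[OF fk, simplified]
  have "f (E m g x) = sneg A (1 - m) (f (k (dB x)))" if "x : carrier B" for x
   using that by (simp add: k(2)) (simp add: sneg_def)
  then show ?thesis using ghom_sneg[OF fk, of "1 - m"] by auto
 qed
 obtain H1 where H1: "B.coch (n + m - 2) H1" "!!x. x : carrier B ==> f (E m g x) = H1 (dB x)"
  using nl[OF f fd g gd] by blast
 obtain H2 where H2: "B.coch (m + n - 2) H2" "!!x. x : carrier B ==> g (E n f x) = H2 (dB x)"
  using nl[OF g gd f fd] by blast
 have H2': "B.coch (n + m - 2) H2" using H2(1) by (simp add: add.commute)
 let ?H = "%x. H1 x \<ominus> sneg A ((n - 1) * (m - 1)) (H2 x)"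
 have H: "B.coch (n + m - 2) ?H" using ghom_diff[OF H1(1) ghom_sneg[OF H2', of "(n - 1) * (m - 1)"]] by simp
 note gB = gB[OF g gd] and fB = gB[OF f fd]
 have eB: "gB f = (%x. f (\<Phi> x))" "gB g = (%x. g (\<Phi> x))" by (simp_all add: fun_eq_iff gB_def[OF f fd] gB_def[OF g gd])
 have "P.br n m f g (\<Phi> x) = B.br n m (gB f) (gB g) x \<oplus> ?H (dB x)" if x: "x : carrier B" for x
 proof -
  have c: "P.circ m f g (\<Phi> x) : carrier A" "P.circ n g f (\<Phi> x) : carrier A"
   "B.circ m (gB f) (gB g) x : carrier A" "B.circ n (gB g) (gB f) x : carrier A"
   "W f g x : carrier A" "W g f x : carrier A" "V f g x : carrier A" "V g f x : carrier A"
   unfolding W_def V_def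
   using x P.circ_closed[OF f g] P.circ_closed[OF g f] B.circ_closed[OF fB gB] B.circ_closed[OF gB fB]
    ghomD(4)[OF P.cup_ghom[OF f P.gpsi_ghom[OF g] refl]] ghomD(4)[OF P.cup_ghom[OF g P.gpsi_ghom[OF f] refl]]
    ghomD(4)[OF B.cup_ghom[OF fB coch_v[OF g] refl]] ghomD(4)[OF B.cup_ghom[OF gB coch_v[OF f] refl]]
   by simp_all
  show ?thesis
   unfolding P.br_def B.br_def H1(2)[OF x, symmetric] H2(2)[OF x, symmetric]
    coch_E[OF f fd g gd x] coch_E[OF g gd f fd x]
   by (cases "even n"; cases "even m"; simp add: sneg_def c;
     rule rep_eq[of A], (rule rep_rules | (rule rep_atom, simp, simp add: c))+, simp)
 qed
 then show ?thesis using H unfolding eB by blast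
qed

end

section \<open>Chain maps and null homotopies\<close>

text \<open>A bimodule map between single components, so that chain maps and homotopies can be built
  degree by degree and glued with \<open>assemble\<close> afterwards.\<close>

definition chom ::
 "('k, 'a) module => ('a, 'm) graded_bimodule => ('a, 'n) graded_bimodule => int => int => ('m => 'n) => bool" where
 "chom A M N i j f \<longleftrightarrow> (ALL x:grade M i. f x : grade N j & (ALL y:grade M i. f (x \<oplus>\<^bsub>M\<^esub> y) = f x \<oplus>\<^bsub>N\<^esub> f y) &
   (ALL a:carrier A. f (a \<odot>\<^bsub>M\<^esub> x) = a \<odot>\<^bsub>N\<^esub> f x & f (rsmult M x a) = rsmult N (f x) a))"

lemma chomI:
 assumes "!!x. x : grade M i ==> f x : grade N j"
  "!!x y. x : grade M i ==> y : grade M i ==> f (x \<oplus>\<^bsub>M\<^esub> y) = f x \<oplus>\<^bsub>N\<^esub> f y"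
  "!!x a. x : grade M i ==> a : carrier A ==> f (a \<odot>\<^bsub>M\<^esub> x) = a \<odot>\<^bsub>N\<^esub> f x"
  "!!x a. x : grade M i ==> a : carrier A ==> f (rsmult M x a) = rsmult N (f x) a"
 shows "chom A M N i j f"
 using assms by (simp add: chom_def)

lemma chomD:
 assumes "chom A M N i j f"
 shows "!!x. x : grade M i ==> f x : grade N j"
  "!!x y. x : grade M i ==> y : grade M i ==> f (x \<oplus>\<^bsub>M\<^esub> y) = f x \<oplus>\<^bsub>N\<^esub> f y"
  "!!x a. x : grade M i ==> a : carrier A ==> f (a \<odot>\<^bsub>M\<^esub> x) = a \<odot>\<^bsub>N\<^esub> f x"
  "!!x a. x : grade M i ==> a : carrier A ==> f (rsmult M x a) = rsmult N (f x) a"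
 using assms by (simp_all add: chom_def)

lemma chom_ghom: "ghom A M N s f ==> j = i + s ==> chom A M N i j f"
 by (rule chomI) (auto simp: ghomD gab_grade[OF ghomD(1)] ghom_degree)

lemma chom_zero:
 assumes M: "gab A M" and N: "gab A N" and f: "chom A M N i j f"
 shows "f \<zero>\<^bsub>M\<^esub> = \<zero>\<^bsub>N\<^esub>"
proof -
 interpret M: abelian_group M by (rule gab_group[OF M])
 interpret N: abelian_group N by (rule gab_group[OF N])
 have z: "\<zero>\<^bsub>M\<^esub> : grade M i" by (rule gab_grade_zero[OF M])
 have "f \<zero>\<^bsub>M\<^esub> \<oplus>\<^bsub>N\<^esub> f \<zero>\<^bsub>M\<^esub> = f \<zero>\<^bsub>M\<^esub>" using chomD(2)[OF f z z] by simp
 then show ?thesis using gab_grade[OF N chomD(1)[OF f z]] N.add.l_cancel_one' by metis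
qed

text \<open>What the comparison theorem needs of a pair of complexes. It is verified for two kinds
  of sources, the bar complex by freeness on words and a resolution by projectivity; the targets are
  contracted.\<close>

locale lifting = S: cplx K A M dM \<mu>M + N: cplx K A N dN \<mu>N
 for K :: "'k ring" and A :: "('k, 'a) module" (structure) and M :: "('a, 'm) graded_bimodule" and dM \<mu>M
  and N :: "('a, 'n) graded_bimodule" and dN \<mu>N +
 assumes lift_cycle: "!!i j z. [|chom A M N i j z; ALL x:grade M i. dN (z x) = \<zero>\<^bsub>N\<^esub> & \<mu>N (z x) = \<zero>|] ==>
   EX k. chom A M N i (j + 1) k & (ALL x:grade M i. dN (k x) = z x & \<mu>N (k x) = \<zero>)"
  and lift_aug: "!!\<alpha>. chom A M (regular A) 0 0 \<alpha> ==> EX k. chom A M N 0 0 k & (ALL x:grade M 0. \<mu>N (k x) = \<alpha> x)"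
begin

lemmas [simp] = gab_grade[OF S.Q_gab] gab_grade[OF N.Q_gab]

lemma assemble_family:
 assumes k: "!!n. chom A M N (int n) (int n + s) (k n)"
 shows "ghom A M N s (assemble M N (%i. if i < 0 then (%x. \<zero>\<^bsub>N\<^esub>) else k (nat i)))" (is "ghom A M N s ?k")
  and "x : grade M (int n) ==> assemble M N (%i. if i < 0 then (%x. \<zero>\<^bsub>N\<^esub>) else k (nat i)) x = k n x"
proof -
 let ?\<kappa> = "%i. if i < 0 then (%x. \<zero>\<^bsub>N\<^esub>) else k (nat i)"
 have c: "chom A M N i (i + s) (?\<kappa> i)" for i
 proof (cases "i < 0")
  case True
  then show ?thesis
   by (auto intro!: chomI gab_grade_zero[OF N.Q_gab])
 next
  case False
  then show ?thesis using k[of "nat i"] by simp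
 qed
 show "ghom A M N s ?k"
  by (rule assemble_ghom[OF S.Q_graded N.Q_gab]) (use chomD[OF c] in blast)+
 have v: "assemble M N ?\<kappa> x = ?\<kappa> i x" if x: "x : grade M i" for x i
  by (rule assemble_val[OF S.Q_graded gab_group[OF N.Q_gab] _ _ x])
    (use chomD(1,2)[OF c] gab_grade[OF N.Q_gab] in blast)+
 show "x : grade M (int n) ==> assemble M N ?\<kappa> x = k n x" using v[of x "int n"] by simp
qed

lemma null_homotopy:
 assumes E: "ghom A M N s E" and dE: "!!x. x : carrier M ==> dN (E x) = sneg N s (E (dM x))"
  and \<mu>E: "!!x. x : carrier M ==> \<mu>N (E x) = \<zero>"
 shows "EX k. ghom A M N (s + 1) k & (ALL x:carrier M. E x = dN (k x) \<oplus>\<^bsub>N\<^esub> sneg N s (k (dM x)))"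
proof -
 interpret N': abelian_group N by simp
 note [simp] = ghomD(4-8)[OF E]
 \<comment> \<open>The invariant may mention only the map in degree \<open>n\<close>, whereas the
   homotopy identity relates two consecutive maps and is therefore recorded in \<open>J\<close>. The
   identity on cycles is enough to continue: in the next degree \<open>k\<close> is evaluated at
   \<open>dM x\<close> only.\<close>
 define Q where "Q n k \<longleftrightarrow> chom A M N (int n) (int n + (s + 1)) k &
  (ALL x:grade M (int n). (dM x = \<zero>\<^bsub>M\<^esub> --> dN (k x) = E x) & \<mu>N (k x) = \<zero>)" for n k
 define J where "J n k k' \<longleftrightarrow> (ALL x:grade M (int (Suc n)). dN (k' x) = E x \<ominus>\<^bsub>N\<^esub> sneg N s (k (dM x)))" for n k k'
 have "EX k. ALL n. Q n (k n) & J n (k n) (k (Suc n))"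
 proof (rule dependent_nat_choice)
  have b: "dM x = \<zero>\<^bsub>M\<^esub>" if "x : grade M 0" for x
   using S.neg_grade[of "-1" "dM x"] ghom_degree[OF S.d_ghom that, of "-1"] by simp
  have "EX k. chom A M N 0 (0 + s + 1) k & (ALL x:grade M 0. dN (k x) = E x & \<mu>N (k x) = \<zero>)"
   by (rule lift_cycle[OF chom_ghom[OF E refl]])
     (auto simp: dE \<mu>E b sneg_def)
  then show "EX k. Q 0 k" by (auto simp: Q_def add.assoc)
 next
  fix k n assume k: "Q n k"
  have kc: "chom A M N (int n) (int n + (s + 1)) k" and kd: "!!x. x : grade M (int n) ==> dM x = \<zero>\<^bsub>M\<^esub> ==> dN (k x) = E x"
   and k\<mu>: "!!x. x : grade M (int n) ==> \<mu>N (k x) = \<zero>" using k by (auto simp: Q_def)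
  have dg: "dM x : grade M (int n)" if "x : grade M (int (Suc n))" for x
   by (rule ghom_degree[OF S.d_ghom that]) simp
  let ?z = "%x. E x \<ominus>\<^bsub>N\<^esub> sneg N s (k (dM x))"
  have kg: "k (dM x) : grade N (int (Suc n) + s)" if "x : grade M (int (Suc n))" for x
   using chomD(1)[OF kc dg[OF that]] by (simp add: algebra_simps)
  have kcar: "k (dM x) : carrier N" if "x : grade M (int (Suc n))" for x
   by (rule gab_grade[OF N.Q_gab kg[OF that]])
  have z: "chom A M N (int (Suc n)) (int (Suc n) + s) ?z"
  proof (rule chomI)
   fix x assume x: "x : grade M (int (Suc n))"
   have "sneg N s (k (dM x)) : grade N (int (Suc n) + s)"
    using kg[OF x] by (simp add: sneg_def gab_grade_neg[OF N.Q_gab])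
   then show "?z x : grade N (int (Suc n) + s)"
    by (rule gab_grade_minus[OF N.Q_gab ghom_degree[OF E x refl]])
   fix y assume y: "y : grade M (int (Suc n))"
   have "k (dM (x \<oplus>\<^bsub>M\<^esub> y)) = k (dM x) \<oplus>\<^bsub>N\<^esub> k (dM y)"
    using chomD(2)[OF kc dg[OF x] dg[OF y]] gab_grade[OF S.Q_gab x] gab_grade[OF S.Q_gab y] by simp
   then show "?z (x \<oplus>\<^bsub>M\<^esub> y) = ?z x \<oplus>\<^bsub>N\<^esub> ?z y"
    using kcar[OF x] kcar[OF y] gab_grade[OF S.Q_gab x] gab_grade[OF S.Q_gab y]
    by (auto simp: sneg_def N'.minus_add a_minus_def N'.a_ac)
  next
   fix x a assume x: "x : grade M (int (Suc n))" and a: "a : carrier A"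
   have xc: "x : carrier M" by (rule gab_grade[OF S.Q_gab x])
   have "k (dM (a \<odot>\<^bsub>M\<^esub> x)) = a \<odot>\<^bsub>N\<^esub> k (dM x)" "k (dM (rsmult M x a)) = rsmult N (k (dM x)) a"
    using chomD(3,4)[OF kc dg[OF x] a] ghomD(9,10)[OF S.d_ghom a xc] by simp_all
   then show "?z (a \<odot>\<^bsub>M\<^esub> x) = a \<odot>\<^bsub>N\<^esub> ?z x" "?z (rsmult M x a) = rsmult N (?z x) a"
    using kcar[OF x] xc a ghomD(9,10)[OF E a xc]
     amap_minus[OF gab_smult[OF N.Q_gab a]] amap_minus[OF gab_rsmult[OF N.Q_gab a]]
    by (auto simp: sneg_def)
  qed
  \<comment> \<open>As \<open>dM x\<close> is a cycle, the invariant gives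
    \<open>dN (k (dM x)) = E (dM x)\<close>, and this cancels \<open>dN (E x)\<close> by the
    commutation rule for \<open>E\<close>.\<close>
  have "ALL x:grade M (int (Suc n)). dN (?z x) = \<zero>\<^bsub>N\<^esub> & \<mu>N (?z x) = \<zero>"
  proof
   fix x assume x: "x : grade M (int (Suc n))"
   have xc: "x : carrier M" by (rule gab_grade[OF S.Q_gab x])
   have "dN (k (dM x)) = E (dM x)" "\<mu>N (k (dM x)) = \<zero>" using kd[OF dg[OF x]] k\<mu>[OF dg[OF x]] xc by simp_all
   then show "dN (?z x) = \<zero>\<^bsub>N\<^esub> & \<mu>N (?z x) = \<zero>"
    using xc kcar[OF x] by (auto simp: dE \<mu>E sneg_def a_minus_def N'.r_neg N'.l_neg)
  qed
  from lift_cycle[OF z this] obtain k' where k': "chom A M N (int (Suc n)) (int (Suc n) + s + 1) k'"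
   "!!x. x : grade M (int (Suc n)) ==> dN (k' x) = ?z x & \<mu>N (k' x) = \<zero>" by blast
  have k0: "k \<zero>\<^bsub>M\<^esub> = \<zero>\<^bsub>N\<^esub>" by (rule chom_zero[OF S.Q_gab N.Q_gab kc])
  have "E x \<ominus>\<^bsub>N\<^esub> sneg N s \<zero>\<^bsub>N\<^esub> = E x" if "x : grade M (int (Suc n))" for x
   using gab_grade[OF S.Q_gab that] by (simp add: sneg_def a_minus_def)
  then have "Q (Suc n) k'" "J n k k'"
   using k' by (simp_all add: Q_def J_def k0 add.assoc)
  then show "EX k'. Q (Suc n) k' & J n k k'" by blast
 qed
 then obtain k where k: "!!n. Q n (k n)" "!!n. J n (k n) (k (Suc n))" by blast
 have kc: "chom A M N (int n) (int n + (s + 1)) (k n)" for n using k(1)[of n] by (simp add: Q_def)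
 define h where "h = assemble M N (%i. if i < 0 then (%x. \<zero>\<^bsub>N\<^esub>) else k (nat i))"
 have h: "ghom A M N (s + 1) h" and hv: "!!x n. x : grade M (int n) ==> h x = k n x"
  unfolding h_def by (rule assemble_family[OF kc])+
 note [simp] = ghomD(4-8)[OF h]
 have "E x = dN (h x) \<oplus>\<^bsub>N\<^esub> sneg N s (h (dM x))" if "x : carrier M" for x
 proof (rule graded_ext[OF S.Q_graded ghom_amap[OF E] _ _ that])
  show "amap M N (%x. dN (h x) \<oplus>\<^bsub>N\<^esub> sneg N s (h (dM x)))"
   by (intro amap_plus amap_sneg amap_comp[OF ghom_amap[OF N.d_ghom]] amap_comp[OF ghom_amap[OF h]]
     ghom_amap[OF h] ghom_amap[OF S.d_ghom])
  fix i x assume x: "x : grade M i"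
  have xc: "x : carrier M" by (rule gab_grade[OF S.Q_gab x])
  consider "i < 0" | "i = 0" | m where "i = int (Suc m)"
   by (metis Suc_pred' int_nat_eq linorder_less_linear nat_0_iff zero_less_iff_neq_zero not_less_iff_gr_or_eq int_one_le_iff_zero_less zero_less_imp_eq_int gr0_conv_Suc)
  then show "E x = dN (h x) \<oplus>\<^bsub>N\<^esub> sneg N s (h (dM x))"
  proof cases
   case 1 then show ?thesis using S.neg_grade[OF 1 x] by (simp add: sneg_def)
  next
   case 2
   have b: "dM x = \<zero>\<^bsub>M\<^esub>" using S.neg_grade[of "-1" "dM x"] ghom_degree[OF S.d_ghom x, of "-1"] 2 by simp
   have "dN (k 0 x) = E x" using k(1)[of 0] b x 2 by (simp add: Q_def)
   then show ?thesis using hv[of x 0] x 2 b xc by (simp add: sneg_def)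
  next
   case (3 m)
   have "dM x : grade M (int m)" by (rule ghom_degree[OF S.d_ghom x]) (simp add: 3)
   then have "h (dM x) = k m (dM x)" by (rule hv)
   moreover have "dN (h x) = E x \<ominus>\<^bsub>N\<^esub> sneg N s (k m (dM x))" using k(2)[of m] x hv[of x "Suc m"] 3 by (simp add: J_def)
   ultimately have "dN (h x) = E x \<ominus>\<^bsub>N\<^esub> sneg N s (h (dM x))" by simp
   then show ?thesis using xc by (simp add: a_minus_def N'.a_assoc N'.l_neg)
  qed
 qed
 then show ?thesis using h by blast
qed

text \<open>The scheme of \<open>null_homotopy\<close>: degree 0 lifts the augmentation, and each
  later degree lifts \<open>k (dM x)\<close>, which is a cycle because the invariant controls
  \<open>k\<close> on cycles.\<close>

lemma comparison_exists:
 "EX k. ghom A M N 0 k & (ALL x:carrier M. dN (k x) = k (dM x) & \<mu>N (k x) = \<mu>M x)"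
proof -
 interpret N': abelian_group N by simp
 define Q where "Q n k \<longleftrightarrow> chom A M N (int n) (int n) k &
  (ALL x:grade M (int n). (dM x = \<zero>\<^bsub>M\<^esub> --> dN (k x) = \<zero>\<^bsub>N\<^esub>) & \<mu>N (k x) = \<mu>M x)" for n k
 define J where "J n k k' \<longleftrightarrow> (ALL x:grade M (int (Suc n)). dN (k' x) = k (dM x))" for n k k'
 have "EX k. ALL n. Q n (k n) & J n (k n) (k (Suc n))"
 proof (rule dependent_nat_choice)
  have "chom A M (regular A) 0 0 \<mu>M" by (rule chom_ghom[OF S.\<mu>_ghom]) simp
  from lift_aug[OF this] obtain k where k: "chom A M N 0 0 k" "!!x. x : grade M 0 ==> \<mu>N (k x) = \<mu>M x" by blast
  have "dN (k x) = \<zero>\<^bsub>N\<^esub>" if "x : grade M 0" for x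
   using N.neg_grade[of "-1" "dN (k x)"] ghom_degree[OF N.d_ghom chomD(1)[OF k(1) that], of "-1"] by simp
  then show "EX k. Q 0 k" using k by (auto simp: Q_def)
 next
  fix k n assume k: "Q n k"
  have kc: "chom A M N (int n) (int n) k" using k by (simp add: Q_def)
  have dg: "dM x : grade M (int n)" if "x : grade M (int (Suc n))" for x
   by (rule ghom_degree[OF S.d_ghom that]) simp
  have z: "chom A M N (int (Suc n)) (int n) (%x. k (dM x))"
  proof (rule chomI)
   fix x assume x: "x : grade M (int (Suc n))"
   show "k (dM x) : grade N (int n)" by (rule chomD(1)[OF kc dg[OF x]])
   fix y assume y: "y : grade M (int (Suc n))"
   show "k (dM (x \<oplus>\<^bsub>M\<^esub> y)) = k (dM x) \<oplus>\<^bsub>N\<^esub> k (dM y)"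
    using chomD(2)[OF kc dg[OF x] dg[OF y]] gab_grade[OF S.Q_gab x] gab_grade[OF S.Q_gab y] by simp
  next
   fix x a assume x: "x : grade M (int (Suc n))" and a: "a : carrier A"
   show "k (dM (a \<odot>\<^bsub>M\<^esub> x)) = a \<odot>\<^bsub>N\<^esub> k (dM x)" "k (dM (rsmult M x a)) = rsmult N (k (dM x)) a"
    using chomD(3,4)[OF kc dg[OF x] a] ghomD(9,10)[OF S.d_ghom a gab_grade[OF S.Q_gab x]] by simp_all
  qed
  have "ALL x:grade M (int (Suc n)). dN (k (dM x)) = \<zero>\<^bsub>N\<^esub> & \<mu>N (k (dM x)) = \<zero>"
   using k dg gab_grade[OF S.Q_gab] by (simp add: Q_def)
  from lift_cycle[OF z this] obtain k' where k': "chom A M N (int (Suc n)) (int n + 1) k'"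
   "!!x. x : grade M (int (Suc n)) ==> dN (k' x) = k (dM x) & \<mu>N (k' x) = \<zero>" by blast
  have k0: "k \<zero>\<^bsub>M\<^esub> = \<zero>\<^bsub>N\<^esub>" by (rule chom_zero[OF S.Q_gab N.Q_gab kc])
  have "\<mu>M x = \<zero>" if "x : grade M (int (Suc n))" for x
   using ghom_degree[OF S.\<mu>_ghom that refl] by simp
  then have "Q (Suc n) k'" "J n k k'"
   using k' by (auto simp: Q_def J_def k0 add.commute)
  then show "EX k'. Q (Suc n) k' & J n k k'" by blast
 qed
 then obtain k where k: "!!n. Q n (k n)" "!!n. J n (k n) (k (Suc n))" by blast
 have kc: "chom A M N (int n) (int n + 0) (k n)" for n using k(1)[of n] by (simp add: Q_def)
 define h where "h = assemble M N (%i. if i < 0 then (%x. \<zero>\<^bsub>N\<^esub>) else k (nat i))"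
 have h: "ghom A M N 0 h" and hv: "!!x n. x : grade M (int n) ==> h x = k n x"
  unfolding h_def by (rule assemble_family[OF kc])+
 note [simp] = ghomD(4-8)[OF h]
 have cs: "i < 0 | i = 0 | (EX m. i = int (Suc m))" for i
  by (metis Suc_pred' linorder_less_linear zero_less_imp_eq_int)
 have "dN (h x) = h (dM x)" if "x : carrier M" for x
 proof (rule graded_ext[OF S.Q_graded _ _ _ that])
  show "amap M N (%x. dN (h x))" "amap M N (%x. h (dM x))"
   by (intro amap_comp[OF ghom_amap[OF N.d_ghom]] amap_comp[OF ghom_amap[OF h]] ghom_amap[OF h] ghom_amap[OF S.d_ghom])+
  fix i x assume x: "x : grade M i"
  consider "i < 0" | "i = 0" | m where "i = int (Suc m)" using cs[of i] by blast
  then show "dN (h x) = h (dM x)"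
  proof cases
   case 1 then show ?thesis using S.neg_grade[OF 1 x] by simp
  next
   case 2
   have b: "dM x = \<zero>\<^bsub>M\<^esub>" using S.neg_grade[of "-1" "dM x"] ghom_degree[OF S.d_ghom x, of "-1"] 2 by simp
   have "dN (k 0 x) = \<zero>\<^bsub>N\<^esub>" using k(1)[of 0] b x 2 by (simp add: Q_def)
   then show ?thesis using hv[of x 0] x 2 b by simp
  next
   case (3 m)
   have "dM x : grade M (int m)" by (rule ghom_degree[OF S.d_ghom x]) (simp add: 3)
   then have "h (dM x) = k m (dM x)" by (rule hv)
   then show ?thesis using k(2)[of m] x hv[of x "Suc m"] 3 by (simp add: J_def)
  qed
 qed
 moreover have "\<mu>N (h x) = \<mu>M x" if "x : carrier M" for x
 proof (rule graded_ext[OF S.Q_graded amap_comp[OF ghom_amap[OF N.\<mu>_ghom] ghom_amap[OF h]] ghom_amap[OF S.\<mu>_ghom] _ that])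
  fix i x assume x: "x : grade M i"
  show "\<mu>N (h x) = \<mu>M x"
  proof (cases "i < 0")
   case True then show ?thesis using S.neg_grade[OF True x] by simp
  next
   case False
   then obtain n where "i = int n" by (metis nat_0_le linorder_not_less)
   then show ?thesis using k(1)[of n] hv[of x n] x by (simp add: Q_def)
  qed
 qed
 ultimately show ?thesis using h by blast
qed

end

section \<open>The bar construction\<close>

context alg begin

abbreviation "gen == bar_gen K A"

abbreviation "Bar == bar K A"
abbreviation "BL == bar_lists A"

lemma relators_keys: "c : bar_relators K A ==> Poly_Mapping.keys c <= BL"
proof -
 have m: "c \<odot> x : carrier A" if "c : carrier K" "x : carrier A" for c x
  using that algebra module.smult_closed[of K A c x] by (simp add: assoc_algebra_def)
 show "c : bar_relators K A ==> Poly_Mapping.keys c <= BL"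
  unfolding bar_relators_def
  by (elim UnE CollectE exE conjE; hypsubst; intro frag_keys) (auto simp: bar_lists_def m)
qed

lemma K_smult: "c : carrier K ==> x : carrier A ==> c \<odot> x : carrier A"
 using algebra module.smult_closed[of K A c x] by (simp add: assoc_algebra_def)

lemma K_mult:
 assumes "c : carrier K" "x : carrier A" "y : carrier A"
 shows "(c \<odot> x) \<otimes> y = c \<odot> (x \<otimes> y)" "x \<otimes> (c \<odot> y) = c \<odot> (x \<otimes> y)"
 using assms algebra by (simp_all add: assoc_algebra_def)

lemma scalar_mult2: "c : carrier K ==> x : carrier A ==> x \<otimes> (c \<odot> \<one>) = c \<odot> x"
 by (simp add: K_mult)

sublocale bp: presentation BL "bar_relators K A"
 by unfold_locales (rule relators_keys)

lemma Bar_simps: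
 "carrier Bar = carrier bp.G" "add Bar = add bp.G" "\<zero>\<^bsub>Bar\<^esub> = \<zero>\<^bsub>bp.G\<^esub>"
 by (simp_all add: bar_def Let_def)

lemma Bar_group: "abelian_group Bar"
 by (rule abelian_group_cong[OF bp.G_group Bar_simps])

sublocale Bar: abelian_group Bar by (rule Bar_group)

lemma gen_closed: "l : BL ==> gen l : carrier Bar"
 by (simp add: bar_gen_def Bar_simps bp.gen_closed)

lemma gen_add:
 assumes "as @ [x] @ bs : BL" "y : carrier A"
 shows "gen (as @ [x \<oplus> y] @ bs) = gen (as @ [x] @ bs) \<oplus>\<^bsub>Bar\<^esub> gen (as @ [y] @ bs)"
proof -
 have l: "as @ [x \<oplus> y] @ bs : BL" "as @ [y] @ bs : BL" using assms by (auto simp: bar_lists_def)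
 have "frag_of (as @ [x \<oplus> y] @ bs) - (frag_of (as @ [x] @ bs) + frag_of (as @ [y] @ bs)) : bar_relators K A"
  using assms unfolding bar_relators_def diff_diff_eq[symmetric] by blast
 then show ?thesis
  using bp.cls_diff_rel[of "frag_of (as @ [x \<oplus> y] @ bs)" "frag_of (as @ [x] @ bs) + frag_of (as @ [y] @ bs)"] assms(1) l
  by (simp add: bar_gen_def pres_gen_cls Bar_simps bp.G_add frag_keys)
qed

lemma gen_scal:
 assumes "as @ [x, y] @ bs : BL" "c : carrier K"
 shows "gen (as @ [c \<odot> x, y] @ bs) = gen (as @ [x, c \<odot> y] @ bs)"
proof -
 have l: "as @ [c \<odot> x, y] @ bs : BL" "as @ [x, c \<odot> y] @ bs : BL"
  using assms by (auto simp: bar_lists_def K_smult)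
 have "frag_of (as @ [c \<odot> x, y] @ bs) - frag_of (as @ [x, c \<odot> y] @ bs) : bar_relators K A"
  using assms unfolding bar_relators_def by blast
 then show ?thesis
  using bp.cls_diff_rel[of "frag_of (as @ [c \<odot> x, y] @ bs)" "frag_of (as @ [x, c \<odot> y] @ bs)"] l
  by (simp add: bar_gen_def pres_gen_cls frag_keys)
qed

lemma bar_ext:
 assumes "amap Bar H f" "amap Bar H g" "!!l. l : BL ==> f (gen l) = g (gen l)" "z : carrier Bar"
 shows "f z = g z"
proof (rule bp.gen_ext)
 show "amap bp.G H f" "amap bp.G H g" using assms(1,2) amap_record_cong[of Bar H _ bp.G] Bar_simps by auto
 show "z : carrier bp.G" using assms(4) by (simp add: Bar_simps)
 show "f (pres_gen BL (bar_relators K A) x) = g (pres_gen BL (bar_relators K A) x)" if "x : BL" for x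
  using that assms(3) by (simp add: bar_gen_def)
qed

lemma bar_induct [consumes 1, case_names zero gen diff]:
 assumes "z : carrier Bar" "Q \<zero>\<^bsub>Bar\<^esub>" "!!l. l : BL ==> Q (gen l)"
  "!!x y. [|x : carrier Bar; y : carrier Bar; Q x; Q y|] ==> Q (x \<ominus>\<^bsub>Bar\<^esub> y)"
 shows "Q z"
proof -
 have "z : carrier bp.G" using assms(1) by (simp add: Bar_simps)
 then show ?thesis
 proof (induction rule: bp.gen_induct)
  case zero then show ?case using assms(2) by (simp add: Bar_simps)
 next
  case (gen x) then show ?case using assms(3) by (auto simp: bar_gen_def)
 next
  case (diff x y)
  then show ?case using assms(4)[of x y] a_inv_record_cong[of Bar bp.G] Bar_simps by (simp add: a_minus_def)
 qed
qed

lemma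
 assumes H: "abelian_group H" and cl: "!!l. l : BL ==> b l : carrier H"
  and ad: "!!as bs x y. as @ [x] @ bs : BL ==> y : carrier A ==>
   b (as @ [x \<oplus> y] @ bs) = b (as @ [x] @ bs) \<oplus>\<^bsub>H\<^esub> b (as @ [y] @ bs)"
  and sc: "!!as bs x y c. as @ [x, y] @ bs : BL ==> c : carrier K ==>
   b (as @ [c \<odot> x, y] @ bs) = b (as @ [x, c \<odot> y] @ bs)"
 shows bar_lift_amap: "amap Bar H (pres_lift H b)"
  and bar_lift_gen: "l : BL ==> pres_lift H b (gen l) = b l"
proof -
 interpret H: abelian_group H by (rule H)
 have 0: "flift H b c = \<zero>\<^bsub>H\<^esub>" if "c : bar_relators K A" for c
 proof -
  from that consider as bs x y where "c = frag_of (as @ [x \<oplus> y] @ bs) - frag_of (as @ [x] @ bs) - frag_of (as @ [y] @ bs)"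
    "as @ [x] @ bs : BL" "y : carrier A"
   | as bs k x y where "c = frag_of (as @ [k \<odot> x, y] @ bs) - frag_of (as @ [x, k \<odot> y] @ bs)"
    "as @ [x, y] @ bs : BL" "k : carrier K"
   unfolding bar_relators_def by blast
  then show ?thesis
  proof cases
   case (1 as bs x y)
   then have l: "as @ [x \<oplus> y] @ bs : BL" "as @ [y] @ bs : BL" by (auto simp: bar_lists_def)
   have "flift H b c = b (as @ [x \<oplus> y] @ bs) \<ominus>\<^bsub>H\<^esub> b (as @ [x] @ bs) \<ominus>\<^bsub>H\<^esub> b (as @ [y] @ bs)"
    using 1(2) l cl unfolding 1(1) by (simp add: H.flift_diff[where U = BL] H.flift_frag_of frag_keys)
   also have "\<dots> = \<zero>\<^bsub>H\<^esub>"
    unfolding ad[OF 1(2,3)]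
    by (rule rep_eq[of H], (rule rep_rules rep_zero | rule rep_atom | rule H | rule cl 1(2) l)+, simp)
   finally show ?thesis .
  next
   case (2 as bs k x y)
   then have l: "as @ [k \<odot> x, y] @ bs : BL" "as @ [x, k \<odot> y] @ bs : BL"
    by (auto simp: bar_lists_def K_smult)
   then show ?thesis
    using sc[OF 2(2,3)] cl unfolding 2(1)
    by (simp add: H.flift_diff[where U = BL] H.flift_frag_of frag_keys a_minus_def H.r_neg)
  qed
 qed
 show "amap Bar H (pres_lift H b)"
  by (rule amap_record_cong[OF bp.pres_lift_amap[OF H cl 0] Bar_simps])
 show "l : BL ==> pres_lift H b (gen l) = b l"
  unfolding bar_gen_def by (rule bp.pres_lift_gen[OF H cl 0])
qed

lemma BL_nil [simp]: "[] \<notin> BL"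
 by (simp add: bar_lists_def)

lemma BL_cons: "x # bs : BL \<longleftrightarrow> x : carrier A & set bs <= carrier A & bs ~= []"
 by (cases bs) (auto simp: bar_lists_def)

lemma BL_simps: "as @ x # bs : BL \<longleftrightarrow> set as <= carrier A & x : carrier A & set bs <= carrier A & (as ~= [] | bs ~= [])"
 by (cases as; cases bs) (auto simp: bar_lists_def)

lemma BL_snoc: "as @ [x] : BL \<longleftrightarrow> set as <= carrier A & x : carrier A & as ~= []"
 using BL_simps[of as x "[]"] by auto

lemmas gen_add' = gen_add[simplified] and gen_scal' = gen_scal[simplified]

lemma
 assumes a: "a : carrier A"
 shows Bar_smult_amap: "amap Bar Bar (%z. a \<odot>\<^bsub>Bar\<^esub> z)" and Bar_rsmult_amap: "amap Bar Bar (%z. rsmult Bar z a)"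
  and Bar_smult: "[|x : carrier A; set l <= carrier A; l ~= []|] ==> a \<odot>\<^bsub>Bar\<^esub> gen (x # l) = gen ((a \<otimes> x) # l)"
  and Bar_rsmult: "[|x : carrier A; set l <= carrier A; l ~= []|] ==> rsmult Bar (gen (l @ [x])) a = gen (l @ [x \<otimes> a])"
proof -
 have H: "abelian_group bp.G" by (rule bp.G_group)
 have toB: "amap Bar Bar f" if "amap Bar bp.G f" for f
  by (rule amap_record_cong2[OF that Bar_simps])
 let ?b = "%as. gen ((a \<otimes> hd as) # tl as)"
 let ?c = "%as. gen (butlast as @ [last as \<otimes> a])"
 have e: "(%z. a \<odot>\<^bsub>Bar\<^esub> z) = pres_lift bp.G ?b" "(%z. rsmult Bar z a) = pres_lift bp.G ?c"
  by (simp_all add: bar_def Let_def)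
 have cl: "?b l : carrier bp.G" if "l : BL" for l
  using gen_closed[of "(a \<otimes> hd l) # tl l"] that a by (cases l) (auto simp: Bar_simps BL_cons)
 have ad: "?b (as @ [x \<oplus> y] @ bs) = ?b (as @ [x] @ bs) \<oplus>\<^bsub>bp.G\<^esub> ?b (as @ [y] @ bs)"
  if "as @ [x] @ bs : BL" "y : carrier A" for as bs x y
  using that a gen_add'[of "[]" "a \<otimes> x" bs "a \<otimes> y"] gen_add'[of "(a \<otimes> hd as) # tl as" x bs y]
  by (cases as) (auto simp: BL_cons BL_simps A.r_distr Bar_simps)
 have sc: "?b (as @ [c \<odot> x, y] @ bs) = ?b (as @ [x, c \<odot> y] @ bs)"
  if "as @ [x, y] @ bs : BL" "c : carrier K" for as bs x y c
  using that a gen_scal'[of "[]" "a \<otimes> x" y bs c] gen_scal'[of "(a \<otimes> hd as) # tl as" x y bs c]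
  by (cases as) (auto simp: BL_cons BL_simps K_mult)
 have cl2: "?c l : carrier bp.G" if "l : BL" for l
  using gen_closed[of "butlast l @ [last l \<otimes> a]"] that a
  by (cases l rule: rev_cases) (auto simp: Bar_simps BL_snoc)
 have ad2: "?c (as @ [x \<oplus> y] @ bs) = ?c (as @ [x] @ bs) \<oplus>\<^bsub>bp.G\<^esub> ?c (as @ [y] @ bs)"
  if "as @ [x] @ bs : BL" "y : carrier A" for as bs x y
  using that a gen_add'[of as "x \<otimes> a" "[]" "y \<otimes> a"] gen_add'[of as x "butlast bs @ [last bs \<otimes> a]" y]
  by (cases bs rule: rev_cases) (auto simp: BL_snoc BL_simps A.l_distr Bar_simps butlast_append)
 have sc2: "?c (as @ [k \<odot> x, y] @ bs) = ?c (as @ [x, k \<odot> y] @ bs)"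
  if "as @ [x, y] @ bs : BL" "k : carrier K" for as bs x y k
  using that a gen_scal'[of as x "y \<otimes> a" "[]" k] gen_scal'[of as x y "butlast bs @ [last bs \<otimes> a]" k]
  by (cases bs rule: rev_cases) (auto simp: BL_snoc BL_simps K_mult butlast_append)
 show "amap Bar Bar (%z. a \<odot>\<^bsub>Bar\<^esub> z)" unfolding e by (rule toB[OF bar_lift_amap[OF H cl ad sc]])
 show "amap Bar Bar (%z. rsmult Bar z a)" unfolding e by (rule toB[OF bar_lift_amap[OF H cl2 ad2 sc2]])
 show "[|x : carrier A; set l <= carrier A; l ~= []|] ==> a \<odot>\<^bsub>Bar\<^esub> gen (x # l) = gen ((a \<otimes> x) # l)"
  using bar_lift_gen[OF H cl ad sc, of "x # l"] fun_cong[OF e(1)] by (simp add: BL_cons)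
 show "[|x : carrier A; set l <= carrier A; l ~= []|] ==> rsmult Bar (gen (l @ [x])) a = gen (l @ [x \<otimes> a])"
  using bar_lift_gen[OF H cl2 ad2 sc2, of "l @ [x]"] fun_cong[OF e(2)] by (simp add: BL_snoc)
qed

text \<open>The relators move a scalar only between neighbours; induction on the word in between
  carries it any distance.\<close>

lemma gen_scal_far:
 assumes "set as <= carrier A" "x : carrier A" "set bs <= carrier A" "y : carrier A" "set cs <= carrier A" "c : carrier K"
 shows "gen (as @ (c \<odot> x) # bs @ y # cs) = gen (as @ x # bs @ (c \<odot> y) # cs)"
 using assms
proof (induction bs arbitrary: as x)
 case Nil
 then show ?case using gen_scal'[of as x y cs c] by (simp add: BL_simps)
next
 case (Cons b bs)
 have "gen (as @ (c \<odot> x) # b # bs @ y # cs) = gen (as @ x # (c \<odot> b) # bs @ y # cs)"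
  using Cons.prems gen_scal'[of as x b "bs @ y # cs" c] by (simp add: BL_simps)
 also have "\<dots> = gen (as @ x # b # bs @ (c \<odot> y) # cs)"
  using Cons.IH[of "as @ [x]" b] Cons.prems by simp
 finally show ?case by simp
qed

lemma BL_cases:
 assumes "l : BL" obtains x bs y where "l = x # bs @ [y]" "x : carrier A" "set bs <= carrier A" "y : carrier A"
proof -
 obtain x l' where l: "l = x # l'" "l' ~= []" using assms by (cases l; cases "tl l") (auto simp: bar_lists_def)
 then obtain bs y where "l' = bs @ [y]" by (cases l' rule: rev_cases) auto
 then show ?thesis using that assms l by (auto simp: bar_lists_def)
qed

lemma Bar_bimod: "bimod K A Bar"
proof -
 note lm = Bar_smult_amap and rm = Bar_rsmult_amap
 have d: "amap Bar Bar (%z. a \<odot>\<^bsub>Bar\<^esub> z \<oplus>\<^bsub>Bar\<^esub> b \<odot>\<^bsub>Bar\<^esub> z)" "amap Bar Bar (%z. rsmult Bar z a \<oplus>\<^bsub>Bar\<^esub> rsmult Bar z b)"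
  if "a : carrier A" "b : carrier A" for a b by (intro amap_plus lm rm that)+
 note v = Bar_smult[of _ _ "_ @ [_]", simplified] Bar_rsmult[of _ _ "_ # _", simplified]
 have g: "gen ((x \<oplus> x') # bs @ [y]) = gen (x # bs @ [y]) \<oplus>\<^bsub>Bar\<^esub> gen (x' # bs @ [y])"
  "gen (y # bs @ [x \<oplus> x']) = gen (y # bs @ [x]) \<oplus>\<^bsub>Bar\<^esub> gen (y # bs @ [x'])"
  if "x : carrier A" "x' : carrier A" "set bs <= carrier A" "y : carrier A" for x x' bs y
  using that gen_add'[of "[]" x "bs @ [y]" x'] gen_add'[of "y # bs" x "[]" x'] by (auto simp: BL_cons BL_simps)
 show ?thesis
  unfolding bimod_def
 proof (intro conjI ballI)
  fix a b x assume a: "a : carrier A" and b: "b : carrier A" and x: "x : carrier Bar"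
  have ab: "a \<oplus> b : carrier A" "a \<otimes> b : carrier A" using a b by auto
  show "(a \<oplus> b) \<odot>\<^bsub>Bar\<^esub> x = a \<odot>\<^bsub>Bar\<^esub> x \<oplus>\<^bsub>Bar\<^esub> b \<odot>\<^bsub>Bar\<^esub> x"
   by (rule bar_ext[OF lm[OF ab(1)] d(1)[OF a b] _ x]) (elim BL_cases, simp add: v a b ab g A.l_distr)
  show "rsmult Bar x (a \<oplus> b) = rsmult Bar x a \<oplus>\<^bsub>Bar\<^esub> rsmult Bar x b"
   by (rule bar_ext[OF rm[OF ab(1)] d(2)[OF a b] _ x]) (elim BL_cases, simp add: v a b ab g A.r_distr)
  show "(a \<otimes> b) \<odot>\<^bsub>Bar\<^esub> x = a \<odot>\<^bsub>Bar\<^esub> (b \<odot>\<^bsub>Bar\<^esub> x)"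
   by (rule bar_ext[OF lm[OF ab(2)] amap_comp[OF lm[OF a] lm[OF b]] _ x]) (elim BL_cases, simp add: v a b ab A.m_assoc)
  show "rsmult Bar x (a \<otimes> b) = rsmult Bar (rsmult Bar x a) b"
   by (rule bar_ext[OF rm[OF ab(2)] amap_comp[OF rm[OF b] rm[OF a]] _ x]) (elim BL_cases, simp add: v a b ab A.m_assoc)
  show "rsmult Bar (a \<odot>\<^bsub>Bar\<^esub> x) b = a \<odot>\<^bsub>Bar\<^esub> rsmult Bar x b"
   by (rule bar_ext[OF amap_comp[OF rm[OF b] lm[OF a]] amap_comp[OF lm[OF a] rm[OF b]] _ x])
     (elim BL_cases, simp add: v a b ab)
 next
  fix x assume x: "x : carrier Bar"
  show "\<one> \<odot>\<^bsub>Bar\<^esub> x = x" by (rule bar_ext[OF lm amap_id[OF Bar_group] _ x]) (simp, elim BL_cases, simp add: v)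
  show "rsmult Bar x \<one> = x" by (rule bar_ext[OF rm amap_id[OF Bar_group] _ x]) (simp, elim BL_cases, simp add: v)
 next
  fix c x assume c: "c : carrier K" and x: "x : carrier Bar"
  note s = scalar_closed[OF c]
  show "(c \<odot> \<one>) \<odot>\<^bsub>Bar\<^esub> x = rsmult Bar x (c \<odot> \<one>)"
   by (rule bar_ext[OF lm[OF s] rm[OF s] _ x])
     (elim BL_cases, use gen_scal_far[of "[]" _ _ _ "[]"] c in "simp add: v s scalar_mult scalar_mult2")
 qed (use amapD[OF lm] amapD[OF rm] Bar_group in auto)
qed

section \<open>Multilinear functions on words and maps out of the bar groups\<close>

definition klin :: "('a, 'n) graded_bimodule => ('a => 'n) => bool" where
 "klin Y f \<longleftrightarrow> amap A Y f & (ALL c:carrier K. ALL x:carrier A. f (c \<odot> x) = (c \<odot> \<one>) \<odot>\<^bsub>Y\<^esub> f x)"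

text \<open>Linearity in every slot of words of every positive length, including single letters,
  because recursions on words pass through those.\<close>

definition mlin :: "('a, 'n) graded_bimodule => ('a list => 'n) => bool" where
 "mlin Y b \<longleftrightarrow> (ALL as bs. set as <= carrier A & set bs <= carrier A --> klin Y (%x. b (as @ x # bs)))"

lemma mlinD: "mlin Y b ==> set as <= carrier A ==> set bs <= carrier A ==> klin Y (%x. b (as @ x # bs))"
 by (simp add: mlin_def)

lemma klin_zero: "gab A Y ==> klin Y (%x. \<zero>\<^bsub>Y\<^esub>)"
 using amap_zero[OF gab_smult[of A Y, OF _ scalar_closed]]
 by (simp add: klin_def amap_const_zero[OF A.abelian_group_axioms] gab_group)

lemma klin_if: "klin Y f ==> klin Y g ==> klin Y (%x. if P then f x else g x)"
 by (cases P) simp_all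

lemma mlin_closed: "mlin Y b ==> set l <= carrier A ==> l ~= [] ==> b l : carrier Y"
 using mlinD[of Y b "[]" "tl l"] by (cases l) (auto simp: klin_def dest: amap_closed)

text \<open>\<open>b\<close> is the function in the definition at hand. \<open>b'\<close> is a
  version of it that is multilinear on all words and agrees with \<open>b\<close> where generators
  exist.\<close>

lemma
 assumes Y: "gab A Y" and b': "mlin Y b'" and eq: "!!l. l : BL ==> b l = b' l"
 shows blift_amap: "amap Bar Y (pres_lift Y b)"
  and blift_gen: "l : BL ==> pres_lift Y b (gen l) = b' l"
proof -
 have ad: "b (as @ [x \<oplus> y] @ bs) = b (as @ [x] @ bs) \<oplus>\<^bsub>Y\<^esub> b (as @ [y] @ bs)"
  if "as @ [x] @ bs : BL" "y : carrier A" for as bs x y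
 proof -
  have "klin Y (%x. b' (as @ x # bs))" using that by (intro mlinD[OF b']) (auto simp: BL_simps)
  then show ?thesis using that by (auto simp: klin_def BL_simps eq dest: amap_add)
 qed
 have sc: "b (as @ [c \<odot> x, y] @ bs) = b (as @ [x, c \<odot> y] @ bs)"
  if "as @ [x, y] @ bs : BL" "c : carrier K" for as bs x y c
 proof -
  have "klin Y (%x. b' (as @ x # y # bs))" "klin Y (%y. b' ((as @ [x]) @ y # bs))"
   using that by (intro mlinD[OF b']; auto simp: BL_simps)+
  then show ?thesis using that K_smult by (auto simp: klin_def BL_simps eq)
 qed
 have cl: "b l : carrier Y" if "l : BL" for l
  using mlin_closed[OF b', of l] that eq[OF that] by (cases l) (auto simp: bar_lists_def)
 show "amap Bar Y (pres_lift Y b)" by (rule bar_lift_amap[OF gab_group[OF Y] cl ad sc])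
 show "l : BL ==> pres_lift Y b (gen l) = b' l"
  using bar_lift_gen[OF gab_group[OF Y] cl ad sc] eq by simp
qed

text \<open>Generators extended by zero to words shorter than 2, so that recursions on words need no
  separate treatment of the ends.\<close>

definition bg :: "'a list => 'a bar" where
 "bg l = (if 2 <= length l then gen l else \<zero>\<^bsub>Bar\<^esub>)"

lemma bg_BL [simp]: "l : BL ==> bg l = gen l"
 by (simp add: bg_def bar_lists_def)

lemma bg_closed: "set l <= carrier A ==> bg l : carrier Bar"
 by (auto simp: bg_def bar_lists_def intro!: gen_closed)

section \<open>The grading of the bar groups\<close>

lemma grade_Bar: "grade Bar n = generate (add_monoid Bar) {gen as | as. as : BL & int (length as) = n + 2}"
 by (simp add: bar_def Let_def) (rule generate_record_cong; simp)

lemma gen_grade: "l : BL ==> n = int (length l) - 2 ==> gen l : grade Bar n"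
 unfolding grade_Bar by (rule generate.incl) auto

lemma Bar_gab: "gab A Bar"
proof -
 have s: "{gen as | as. as : BL & int (length as) = n + 2} <= carrier Bar" for n
  by (auto simp: gen_closed)
 have sub: "subgroup (grade Bar n) (add_monoid Bar)" for n
  unfolding grade_Bar by (rule Bar.add.generate_is_subgroup[simplified]) (use s in simp)
 show ?thesis
  unfolding gab_def
  using Bar_group Bar_smult_amap Bar_rsmult_amap subgroup.subset[OF sub] subgroup.one_closed[OF sub]
   subgroup.m_closed[OF sub] subgroup.m_inv_closed[OF sub]
  by (auto simp: a_inv_def)
qed

lemma grade_Bar_induct [consumes 1, case_names zero gen neg add]:
 assumes z: "z : grade Bar n" and 0: "Q \<zero>\<^bsub>Bar\<^esub>"
  and p: "!!l. l : BL ==> int (length l) = n + 2 ==> Q (gen l)"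
  and ng: "!!z. z : grade Bar n ==> Q z ==> Q (\<ominus>\<^bsub>Bar\<^esub> z)"
  and ad: "!!z w. [|z : grade Bar n; w : grade Bar n; Q z; Q w|] ==> Q (z \<oplus>\<^bsub>Bar\<^esub> w)"
 shows "Q z"
proof -
 define W where "W = {gen as | as. as : BL & int (length as) = n + 2}"
 have g: "grade Bar n = generate (add_monoid Bar) W" unfolding W_def by (rule grade_Bar)
 have W: "h : grade Bar n & Q h" if "h : W" for h using that p by (auto simp: W_def intro!: gen_grade)
 have "z : grade Bar n & Q z"
  using z unfolding g
 proof (induction rule: generate.induct)
  case one then show ?case using 0 gab_grade_zero[OF Bar_gab] by (simp flip: g)
 next
  case (incl h) then show ?case using W by (simp flip: g)
 next
  case (inv h)
  then show ?case using W ng[of h] gab_grade_neg[OF Bar_gab, of h n] by (simp add: a_inv_def flip: g)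
 next
  case (eng h1 h2) then show ?case using ad gab_grade_add[OF Bar_gab] by (simp flip: g)
 qed
 then show ?thesis by simp
qed

lemma Bar_grade_amap:
 assumes f: "amap Bar Y f" and Y: "gab A Y" and z: "z : grade Bar n"
  and p: "!!l. l : BL ==> int (length l) = n + 2 ==> f (gen l) : grade Y k"
 shows "f z : grade Y k"
 using z by (induction rule: grade_Bar_induct)
  (use p gab_grade[OF Bar_gab] in "auto simp: amap_zero[OF f] amap_neg[OF f] amap_add[OF f]
   gab_grade_zero[OF Y] gab_grade_neg[OF Y] gab_grade_add[OF Y]")

text \<open>A scalar in any slot can be moved to the first letter, where it is the left action of
  \<open>c \<odot> \<one>\<close>.\<close>

lemma klin_bg:
 assumes "set as <= carrier A" "set bs <= carrier A" shows "klin Bar (%x. bg (as @ x # bs))"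
proof (cases "as = [] & bs = []")
 case True
 then show ?thesis using klin_zero[OF Bar_gab] by (simp add: bg_def)
next
 case False
 then have b: "bg (as @ x # bs) = gen (as @ x # bs)" for x by (cases as; cases bs) (auto simp: bg_def)
 have l: "as @ x # bs : BL" if "x : carrier A" for x using that assms False by (simp add: BL_simps)
 have "gen (as @ (c \<odot> x) # bs) = (c \<odot> \<one>) \<odot>\<^bsub>Bar\<^esub> gen (as @ x # bs)"
  if c: "c : carrier K" and x: "x : carrier A" for c x
 proof (cases as)
  case Nil
  then show ?thesis using assms False c x by (simp add: Bar_smult scalar_closed scalar_mult)
 next
  case (Cons a as')
  then show ?thesis using assms c x gen_scal_far[of "[]" a as' x bs c] by (simp add: Bar_smult scalar_closed scalar_mult)
 qed
 moreover have "amap A Bar (%x. gen (as @ x # bs))"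
  by (rule amapI[OF A.abelian_group_axioms Bar_group]) (use l gen_closed gen_add' in auto)
 ultimately show ?thesis by (simp add: klin_def b)
qed

lemma mlin_bg: "mlin Bar bg"
 by (simp add: mlin_def klin_bg)

text \<open>The projection to degree \<open>n\<close>. It is well defined since the relators
  preserve the length of words.\<close>

definition bproj :: "int => 'a bar => 'a bar" where
 "bproj n = pres_lift Bar (%l. if int (length l) = n + 2 then bg l else \<zero>\<^bsub>Bar\<^esub>)"

lemma
 shows bproj_amap: "amap Bar Bar (bproj n)"
  and bproj_gen: "l : BL ==> bproj n (gen l) = (if int (length l) = n + 2 then gen l else \<zero>\<^bsub>Bar\<^esub>)"
proof -
 have m: "mlin Bar (%l. if int (length l) = n + 2 then bg l else \<zero>\<^bsub>Bar\<^esub>)"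
  using klin_bg klin_zero[OF Bar_gab] by (simp add: mlin_def klin_if)
 show "amap Bar Bar (bproj n)" unfolding bproj_def by (rule blift_amap[OF Bar_gab m refl])
 show "l : BL ==> bproj n (gen l) = (if int (length l) = n + 2 then gen l else \<zero>\<^bsub>Bar\<^esub>)"
  unfolding bproj_def by (subst blift_gen[OF Bar_gab m refl]) auto
qed

lemma bproj_grade: "z : grade Bar m ==> bproj n z = (if m = n then z else \<zero>\<^bsub>Bar\<^esub>)"
 by (induction rule: grade_Bar_induct)
   (auto simp: bproj_gen amap_zero[OF bproj_amap] amap_neg[OF bproj_amap] amap_add[OF bproj_amap] gab_grade[OF Bar_gab])

text \<open>The components are the values of the projections \<open>bproj\<close>. Existence of a
  decomposition is shown by induction over generators; uniqueness follows by applying a projection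
  to any given decomposition.\<close>

lemma Bar_graded: "graded_bimod K A Bar"
proof -
 have gr: "grade Bar n <= carrier Bar" for n using gab_grade[OF Bar_gab] by blast
 have act: "a \<odot>\<^bsub>Bar\<^esub> x : grade Bar n" "rsmult Bar x a : grade Bar n" if a: "a : carrier A" and x: "x : grade Bar n" for a x n
  by (rule Bar_grade_amap[OF Bar_smult_amap[OF a] Bar_gab x] Bar_grade_amap[OF Bar_rsmult_amap[OF a] Bar_gab x];
    elim BL_cases; use a in \<open>auto simp: Bar_smult Bar_rsmult[of _ _ "_ # _", simplified] BL_cons intro!: gen_grade\<close>)+
 have cmp: "bimod K A (component Bar n)" for n
 proof -
  have inv: "EX y:grade Bar n. x \<oplus>\<^bsub>Bar\<^esub> y = \<zero>\<^bsub>Bar\<^esub>" if "x : grade Bar n" for x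
   using that gab_grade_neg[OF Bar_gab that] gab_grade[OF Bar_gab that] Bar.r_neg by blast
  have "abelian_group (component Bar n)"
   by (rule abelian_groupI)
     (use gr[of n] gab_grade_zero[OF Bar_gab] gab_grade_add[OF Bar_gab] inv in
     \<open>auto simp: component_def Bar.a_ac subset_iff\<close>)
  then show ?thesis
   using bimodD[OF Bar_bimod] act gr[of n] unfolding bimod_def by (auto simp: component_def subset_iff)
 qed
 have pg: "bproj n z : grade Bar n" if "z : carrier Bar" for n z
  using that
  by (induction rule: bar_induct)
    (auto simp: amap_zero[OF bproj_amap] amap_minus[OF bproj_amap] bproj_gen gab_grade_zero[OF Bar_gab]
     gab_grade_minus[OF Bar_gab] gen_grade)
 have sup: "finsum Bar (%n. bproj n z) S = finsum Bar (%n. bproj n z) S'"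
  if "finite S'" "S <= S'" "!!n. n \<notin> S ==> bproj n z = \<zero>\<^bsub>Bar\<^esub>" "z : carrier Bar" for S S' z
  by (rule Bar.add.finprod_mono_neutral_cong_left) (use that amap_closed[OF bproj_amap] in auto)
 have ex: "EX S. finite S & (ALL n. n \<notin> S --> bproj n z = \<zero>\<^bsub>Bar\<^esub>) & z = finsum Bar (%n. bproj n z) S" if "z : carrier Bar" for z
  using that
 proof (induction rule: bar_induct)
  case zero
  then show ?case by (intro exI[of _ "{}"]) (simp add: amap_zero[OF bproj_amap])
 next
  case (gen l)
  then show ?case
   by (intro exI[of _ "{int (length l) - 2}"]) (auto simp: bproj_gen gen_closed)
 next
  case (diff x y)
  then obtain S S' where S: "finite S" "!!n. n \<notin> S ==> bproj n x = \<zero>\<^bsub>Bar\<^esub>" "x = finsum Bar (%n. bproj n x) S"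
   and S': "finite S'" "!!n. n \<notin> S' ==> bproj n y = \<zero>\<^bsub>Bar\<^esub>" "y = finsum Bar (%n. bproj n y) S'" by blast
  have c: "bproj n x : carrier Bar" "bproj n y : carrier Bar" for n
   using diff amap_closed[OF bproj_amap] by auto
  have x: "x = finsum Bar (%n. bproj n x) (S \<union> S')" using sup[of "S \<union> S'" S x] S S' diff by auto
  have y: "y = finsum Bar (%n. bproj n y) (S \<union> S')" using sup[of "S \<union> S'" S' y] S S' diff by auto
  have ny: "\<ominus>\<^bsub>Bar\<^esub> y = finsum Bar (%n. \<ominus>\<^bsub>Bar\<^esub> bproj n y) (S \<union> S')"
   using amap_finsum[OF amap_uminus[OF amap_id[OF Bar_group]], of "S \<union> S'" "%n. bproj n y"] S S' c y by simp
  have dm: "bproj n (x \<ominus>\<^bsub>Bar\<^esub> y) = bproj n x \<oplus>\<^bsub>Bar\<^esub> \<ominus>\<^bsub>Bar\<^esub> bproj n y" for n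
   by (subst amap_minus[OF bproj_amap diff(1,2)]) (rule a_minus_def)
  have "finsum Bar (%n. bproj n (x \<ominus>\<^bsub>Bar\<^esub> y)) (S \<union> S') =
    finsum Bar (%n. bproj n x \<oplus>\<^bsub>Bar\<^esub> \<ominus>\<^bsub>Bar\<^esub> bproj n y) (S \<union> S')"
   unfolding dm ..
  also have "\<dots> = x \<ominus>\<^bsub>Bar\<^esub> y"
   using c by (subst Bar.finsum_addf) (auto simp: a_minus_def simp flip: x ny)
  finally have "x \<ominus>\<^bsub>Bar\<^esub> y = finsum Bar (%n. bproj n (x \<ominus>\<^bsub>Bar\<^esub> y)) (S \<union> S')" ..
  moreover have "bproj n (x \<ominus>\<^bsub>Bar\<^esub> y) = \<zero>\<^bsub>Bar\<^esub>" if "n \<notin> S \<union> S'" for n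
   using that S(2)[of n] S'(2)[of n] by (simp add: dm)
  ultimately show ?case using S(1) S'(1) by (intro exI[of _ "S \<union> S'"]) blast
 qed
 have "EX! c. homogeneous_decomp Bar z c" if z: "z : carrier Bar" for z
 proof (rule ex1I)
  obtain S where S: "finite S" "!!n. n \<notin> S ==> bproj n z = \<zero>\<^bsub>Bar\<^esub>" "z = finsum Bar (%n. bproj n z) S" using ex[OF z] by blast
  show "homogeneous_decomp Bar z (%n. bproj n z)"
   by (rule homogeneous_decompI[OF Bar_gab pg[OF z] S])
  fix c assume c: "homogeneous_decomp Bar z c"
  then have cg: "c n : grade Bar n" and cf: "finite {n. c n ~= \<zero>\<^bsub>Bar\<^esub>}" and cz: "z = finsum Bar c {n. c n ~= \<zero>\<^bsub>Bar\<^esub>}" for n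
   by (auto simp: homogeneous_decomp_def)
  have cc: "c n : carrier Bar" for n using cg gr by blast
  have "bproj n z = c n" for n
  proof -
   have "bproj n z = finsum Bar (%m. bproj n (c m)) {n. c n ~= \<zero>\<^bsub>Bar\<^esub>}"
    by (subst cz, rule amap_finsum[OF bproj_amap cf cc])
   also have "\<dots> = finsum Bar (%m. bproj n (c m)) {n}"
   proof (cases "c n = \<zero>\<^bsub>Bar\<^esub>")
    case True
    then show ?thesis
     by (subst Bar.add.finprod_one_eqI, use bproj_grade[OF cg] in auto)
   next
    case False
    then show ?thesis
     by (intro Bar.add.finprod_mono_neutral_cong_right) (use cf bproj_grade[OF cg] cc in auto)
   qed
   also have "\<dots> = c n" using cc bproj_grade[OF cg, of n n] by simp
   finally show ?thesis .
  qed
  then show "c = (%n. bproj n z)" by auto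
 qed
 then show ?thesis using Bar_bimod gr cmp by (simp add: graded_bimod_def)
qed

end

subsection \<open>The bar complex\<close>

context alg begin

lemma klin_amap: "klin Y f ==> amap A Y f"
 by (simp add: klin_def)

lemma klin_mult:
 assumes "klin Y f" "y : carrier A"
 shows "klin Y (%x. f (x \<otimes> y))" "klin Y (%x. f (y \<otimes> x))"
proof -
 have "amap A A (%x. x \<otimes> y)" "amap A A (%x. y \<otimes> x)"
  using assms(2) by (auto intro!: amapI A.abelian_group_axioms simp: A.l_distr A.r_distr)
 then show "klin Y (%x. f (x \<otimes> y))" "klin Y (%x. f (y \<otimes> x))"
  using assms amap_comp[of A Y f A] by (simp_all add: klin_def K_mult)
qed

lemma klin_plus:
 assumes Y: "gab A Y" and f: "klin Y f" and g: "klin Y g" shows "klin Y (%x. f x \<oplus>\<^bsub>Y\<^esub> g x)"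
 using assms amap_closed[OF klin_amap[OF f]] amap_closed[OF klin_amap[OF g]]
 by (simp add: klin_def amap_plus amap_add[OF gab_smult[OF Y scalar_closed]])

lemma klin_minus:
 assumes Y: "gab A Y" and f: "klin Y f" and g: "klin Y g" shows "klin Y (%x. f x \<ominus>\<^bsub>Y\<^esub> g x)"
 using assms amap_closed[OF klin_amap[OF f]] amap_closed[OF klin_amap[OF g]]
 by (simp add: klin_def amap_diff amap_minus[OF gab_smult[OF Y scalar_closed]])

lemma klin_sneg:
 assumes Y: "gab A Y" and f: "klin Y f" shows "klin Y (%x. sneg Y m (f x))"
 using assms amap_closed[OF klin_amap[OF f]]
 by (cases "even m") (simp_all add: sneg_def klin_def amap_uminus amap_neg[OF gab_smult[OF Y scalar_closed]])

lemma klin_comp: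
 assumes f: "klin Y f" and F: "amap Y Z F"
  and s: "!!c y. c : carrier K ==> y : carrier Y ==> F ((c \<odot> \<one>) \<odot>\<^bsub>Y\<^esub> y) = (c \<odot> \<one>) \<odot>\<^bsub>Z\<^esub> F y"
 shows "klin Z (%x. F (f x))"
 using f amap_comp[OF F klin_amap[OF f]] s amap_closed[OF klin_amap[OF f]] by (simp add: klin_def)

section \<open>Alternating sums over neighbours and sums over cuts of a word\<close>

definition bok :: "('h, 'e) ring_scheme => ('a list => 'h) => bool" where
 "bok Y b \<longleftrightarrow> (ALL l. set l <= carrier A & l ~= [] --> b l : carrier Y)"

lemma bokI: "(!!l. set l <= carrier A ==> l ~= [] ==> b l : carrier Y) ==> bok Y b"
 by (simp add: bok_def)

lemma bok_cons: "bok Y b ==> x : carrier A ==> bok Y (%l. b (x # l))"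
 by (simp add: bok_def)

text \<open>
  The alternating sum of the values of \<open>b\<close> on the lists obtained by multiplying two neighbours. A
  prefix of the list is stored in \<open>b\<close>, which makes inductions on the list possible.
\<close>

fun bdl :: "('h, 'e) ring_scheme => ('a list => 'h) => 'a list => 'h" where
 "bdl Y b (x # y # zs) = b ((x \<otimes> y) # zs) \<ominus>\<^bsub>Y\<^esub> bdl Y (%l. b (x # l)) (y # zs)"
| "bdl Y b [x] = \<zero>\<^bsub>Y\<^esub>"
| "bdl Y b [] = \<zero>\<^bsub>Y\<^esub>"

text \<open>The sum over all cuts of a word into a prefix closed by \<open>\<one>\<close> and a
  suffix opened by \<open>\<one>\<close>, the shape of the diagonal. As in \<open>bdl\<close>, the
  prefix already read is stored in the function.\<close>

fun spl :: "('h, 'e) ring_scheme => ('a list => 'a list => 'h) => 'a list => 'h" where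
 "spl Y \<beta> (x # y # zs) = \<beta> [x, \<one>] (\<one> # y # zs) \<oplus>\<^bsub>Y\<^esub> spl Y (%l r. \<beta> (x # l) r) (y # zs)"
| "spl Y \<beta> [x] = \<zero>\<^bsub>Y\<^esub>"
| "spl Y \<beta> [] = \<zero>\<^bsub>Y\<^esub>"

lemma bdl_closed:
 assumes Y: "abelian_group Y" and "bok Y b" "set l <= carrier A" shows "bdl Y b l : carrier Y"
 using assms(2,3)
 by (induction l arbitrary: b rule: induct_list012) (auto simp: ag_simps[OF Y] bok_cons bok_def)

definition bok2 :: "('h, 'e) ring_scheme => ('a list => 'a list => 'h) => bool" where
 "bok2 Y \<beta> \<longleftrightarrow> (ALL l r. set l <= carrier A & l ~= [] & set r <= carrier A & r ~= [] --> \<beta> l r : carrier Y)"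

lemma bok2_cons: "bok2 Y \<beta> ==> x : carrier A ==> bok2 Y (%l. \<beta> (x # l))"
 by (simp add: bok2_def)

lemma spl_closed:
 assumes Y: "abelian_group Y" and "bok2 Y \<beta>" "set l <= carrier A" shows "spl Y \<beta> l : carrier Y"
 using assms(2,3)
 by (induction l arbitrary: \<beta> rule: induct_list012) (auto simp: ag_simps[OF Y] bok2_cons bok2_def)

lemma bdl_cong:
 assumes "!!l'. set l' <= carrier A ==> length l' = length l - 1 ==> l' ~= [] ==> b l' = b' l'" "set l <= carrier A"
 shows "bdl Y b l = bdl Y b' l"
 using assms
proof (induction l arbitrary: b b' rule: induct_list012)
 case (3 x y zs)
 have "bdl Y (%l. b (x # l)) (y # zs) = bdl Y (%l. b' (x # l)) (y # zs)"
  using 3(3)[of "x # _"] 3(4) by (intro 3(2)) auto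
 then show ?case using 3(3)[of "(x \<otimes> y) # zs"] 3(4) by simp
qed simp_all

lemma spl_cong:
 assumes "!!l' r. set l' <= carrier A ==> set r <= carrier A ==> 2 <= length l' ==> 2 <= length r ==>
   length l' + length r = length l + 2 ==> \<beta> l' r = \<beta>' l' r" "set l <= carrier A"
 shows "spl Y \<beta> l = spl Y \<beta>' l"
 using assms
proof (induction l arbitrary: \<beta> \<beta>' rule: induct_list012)
 case (3 x y zs)
 have "spl Y (%l. \<beta> (x # l)) (y # zs) = spl Y (%l. \<beta>' (x # l)) (y # zs)"
  using 3(3)[of "x # _"] 3(4) by (intro 3(2)) auto
 then show ?case using 3(3)[of "[x, \<one>]" "\<one> # y # zs"] 3(4) by simp
qed simp_all

lemma bdl_amap:
 assumes F: "amap Y Z F" and "bok Y b" "set l <= carrier A"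
 shows "F (bdl Y b l) = bdl Z (%l. F (b l)) l"
 using assms(2,3)
proof (induction l arbitrary: b rule: induct_list012)
 case (3 x y zs)
 have "F (bdl Y (%l. b (x # l)) (y # zs)) = bdl Z (%l. F (b (x # l))) (y # zs)"
  using 3 by (intro 3(2)) (auto intro: bok_cons)
 moreover have "bdl Y (%l. b (x # l)) (y # zs) : carrier Y" "b ((x \<otimes> y) # zs) : carrier Y"
  using 3(3,4) by (auto intro!: bdl_closed amapD(1)[OF F] bok_cons, auto simp: bok_def)
 ultimately show ?case by (simp add: amap_minus[OF F])
qed (simp_all add: amap_zero[OF F])

lemma spl_amap:
 assumes F: "amap Y Z F" and "bok2 Y \<beta>" "set l <= carrier A"
 shows "F (spl Y \<beta> l) = spl Z (%l r. F (\<beta> l r)) l"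
 using assms(2,3)
proof (induction l arbitrary: \<beta> rule: induct_list012)
 case (3 x y zs)
 have "F (spl Y (%l. \<beta> (x # l)) (y # zs)) = spl Z (%l r. F (\<beta> (x # l) r)) (y # zs)"
  using 3 by (intro 3(2)) (auto intro: bok2_cons)
 moreover have "spl Y (%l. \<beta> (x # l)) (y # zs) : carrier Y" "\<beta> [x, \<one>] (\<one> # y # zs) : carrier Y"
  using 3(3,4) by (auto intro!: spl_closed amapD(1)[OF F] bok2_cons, auto simp: bok2_def)
 ultimately show ?case by (simp add: amap_add[OF F])
qed (simp_all add: amap_zero[OF F])

lemma bdl_lmult:
 assumes "a : carrier A" "x : carrier A" "set t <= carrier A"
 shows "bdl Y b ((a \<otimes> x) # t) = bdl Y (%l. b ((a \<otimes> hd l) # tl l)) (x # t)"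
 using assms by (cases t) (auto simp: A.m_assoc)

lemma spl_lmult: "spl Y \<beta> ((a \<otimes> x) # t) = spl Y (%l. \<beta> ((a \<otimes> hd l) # tl l)) (x # t)"
 by (cases t) auto

lemma bdl_rmult:
 assumes a: "a : carrier A" and "set l <= carrier A" "y : carrier A"
 shows "bdl Y b (l @ [y \<otimes> a]) = bdl Y (%l. b (butlast l @ [last l \<otimes> a])) (l @ [y])"
 using assms(2,3)
proof (induction l arbitrary: b rule: induct_list012)
 case (2 x) then show ?case using a by (simp add: A.m_assoc)
next
 case (3 x x' zs)
 have "bdl Y (%l. b (x # l)) ((x' # zs) @ [y \<otimes> a]) =
   bdl Y (%l. b (x # butlast l @ [last l \<otimes> a])) ((x' # zs) @ [y])"
  using 3 by (intro 3(2)) auto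
 also have "\<dots> = bdl Y (%l. b (butlast (x # l) @ [last (x # l) \<otimes> a])) ((x' # zs) @ [y])"
  by (rule bdl_cong) (use 3 in auto)
 finally show ?case by simp
qed simp

lemma spl_rmult:
 shows "spl Y \<beta> (l @ [y \<otimes> a]) = spl Y (%l r. \<beta> l (butlast r @ [last r \<otimes> a])) (l @ [y])"
 by (induction l arbitrary: \<beta> rule: induct_list012) simp_all

lemma bdl_minus:
 assumes Y: "abelian_group Y" and "bok Y f" "bok Y g" "set l <= carrier A"
 shows "bdl Y (%l. f l \<ominus>\<^bsub>Y\<^esub> g l) l = bdl Y f l \<ominus>\<^bsub>Y\<^esub> bdl Y g l"
 using assms(2-)
proof (induction l arbitrary: f g rule: induct_list012)
 case (3 x y zs)
 have c: "f ((x \<otimes> y) # zs) : carrier Y" "g ((x \<otimes> y) # zs) : carrier Y"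
  "bdl Y (%l. f (x # l)) (y # zs) : carrier Y" "bdl Y (%l. g (x # l)) (y # zs) : carrier Y"
  using 3(3-5) bdl_closed[OF Y bok_cons[OF 3(3)], of x "y # zs"] bdl_closed[OF Y bok_cons[OF 3(4)], of x "y # zs"]
  by (auto simp: bok_def)
 have i: "bdl Y (%l. f (x # l) \<ominus>\<^bsub>Y\<^esub> g (x # l)) (y # zs) = bdl Y (%l. f (x # l)) (y # zs) \<ominus>\<^bsub>Y\<^esub> bdl Y (%l. g (x # l)) (y # zs)"
  using 3(3-5) by (intro 3(2)) (auto intro: bok_cons)
 show ?case unfolding bdl.simps i
  by (rule rep_eq[of Y], (rule rep_rules | rule rep_atom | rule Y | rule c)+, simp)
qed (simp_all add: a_minus_def ag_simps[OF Y])

lemma spl_minus: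
 assumes Y: "abelian_group Y" and "bok2 Y f" "bok2 Y g" "set l <= carrier A"
 shows "spl Y (%l r. f l r \<ominus>\<^bsub>Y\<^esub> g l r) l = spl Y f l \<ominus>\<^bsub>Y\<^esub> spl Y g l"
 using assms(2-)
proof (induction l arbitrary: f g rule: induct_list012)
 case (3 x y zs)
 have c: "f [x, \<one>] (\<one> # y # zs) : carrier Y" "g [x, \<one>] (\<one> # y # zs) : carrier Y"
  "spl Y (%l. f (x # l)) (y # zs) : carrier Y" "spl Y (%l. g (x # l)) (y # zs) : carrier Y"
  using 3(3-5) spl_closed[OF Y bok2_cons[OF 3(3)], of x "y # zs"] spl_closed[OF Y bok2_cons[OF 3(4)], of x "y # zs"]
  by (auto simp: bok2_def)
 have i: "spl Y (%l r. f (x # l) r \<ominus>\<^bsub>Y\<^esub> g (x # l) r) (y # zs) = spl Y (%l. f (x # l)) (y # zs) \<ominus>\<^bsub>Y\<^esub> spl Y (%l. g (x # l)) (y # zs)"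
  using 3(3-5) by (intro 3(2)) (auto intro: bok2_cons)
 show ?case unfolding spl.simps i
  by (rule rep_eq[of Y], (rule rep_rules | rule rep_atom | rule Y | rule c)+, simp)
qed (simp_all add: a_minus_def ag_simps[OF Y])

lemma bdl_plus:
 assumes Y: "abelian_group Y" and f: "bok Y f" and g: "bok Y g" and l: "set l <= carrier A"
 shows "bdl Y (%l. f l \<oplus>\<^bsub>Y\<^esub> g l) l = bdl Y f l \<oplus>\<^bsub>Y\<^esub> bdl Y g l"
proof -
 interpret Y: abelian_group Y by (rule Y)
 have n: "bok Y (%l. \<ominus>\<^bsub>Y\<^esub> g l)" using g by (simp add: bok_def)
 have e: "\<ominus>\<^bsub>Y\<^esub> bdl Y g l = bdl Y (%l. \<ominus>\<^bsub>Y\<^esub> g l) l"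
  by (rule bdl_amap[OF amap_uminus[OF amap_id[OF Y]] g l])
 have "bdl Y (%l. f l \<oplus>\<^bsub>Y\<^esub> g l) l = bdl Y (%l. f l \<ominus>\<^bsub>Y\<^esub> \<ominus>\<^bsub>Y\<^esub> g l) l"
  by (rule bdl_cong[OF _ l]) (use g in "auto simp: a_minus_def bok_def Y.minus_minus")
 also have "\<dots> = bdl Y f l \<ominus>\<^bsub>Y\<^esub> \<ominus>\<^bsub>Y\<^esub> bdl Y g l" unfolding e by (rule bdl_minus[OF Y f n l])
 also have "\<dots> = bdl Y f l \<oplus>\<^bsub>Y\<^esub> bdl Y g l"
  using bdl_closed[OF Y g l] by (simp add: a_minus_def Y.minus_minus)
 finally show ?thesis .
qed

text \<open>Applied to a word with head \<open>x\<close>, the inner sum splits into the term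
  multiplying \<open>x\<close> into the next letter and the terms keeping \<open>x\<close>. The
  former cancel against the first summand of the outer sum, the latter vanish by induction.\<close>

lemma bdl_bdl:
 assumes Y: "abelian_group Y" and "bok Y b" "set l <= carrier A"
 shows "bdl Y (bdl Y b) l = \<zero>\<^bsub>Y\<^esub>"
 using assms(2,3)
proof (induction l arbitrary: b rule: induct_list012)
 case (3 x y zs)
 interpret Y: abelian_group Y by (rule Y)
 let ?m = "%l. b ((x \<otimes> hd l) # tl l)" and ?p = "%l. bdl Y (%l. b (x # l)) l"
 have x: "x : carrier A" and yz: "set (y # zs) <= carrier A" using 3 by auto
 have m: "bok Y ?m"
 proof (rule bokI)
  fix l :: "'a list" assume "set l <= carrier A" "l ~= []"
  then show "?m l : carrier Y" using 3(3) x by (cases l) (auto simp: bok_def)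
 qed
 have p: "bok Y ?p" using bdl_closed[OF Y bok_cons[OF 3(3) x]] by (simp add: bok_def)
 have "bdl Y (%l. bdl Y b (x # l)) (y # zs) = bdl Y (%l. ?m l \<ominus>\<^bsub>Y\<^esub> ?p l) (y # zs)"
 proof (rule bdl_cong[OF _ yz])
  fix l' :: "'a list" assume "l' ~= []"
  then show "bdl Y b (x # l') = ?m l' \<ominus>\<^bsub>Y\<^esub> ?p l'" by (cases l') auto
 qed
 also have "\<dots> = bdl Y ?m (y # zs) \<ominus>\<^bsub>Y\<^esub> bdl Y ?p (y # zs)"
  by (rule bdl_minus[OF Y m p yz])
 also have "bdl Y ?p (y # zs) = \<zero>\<^bsub>Y\<^esub>" using 3 x by (intro 3(2)) (auto intro: bok_cons)
 also have "bdl Y ?m (y # zs) = bdl Y b ((x \<otimes> y) # zs)"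
  using bdl_lmult[of x y zs Y b] x yz by simp
 finally have e: "bdl Y (%l. bdl Y b (x # l)) (y # zs) = bdl Y b ((x \<otimes> y) # zs) \<ominus>\<^bsub>Y\<^esub> \<zero>\<^bsub>Y\<^esub>" .
 have "bdl Y b ((x \<otimes> y) # zs) : carrier Y" using bdl_closed[OF Y 3(3)] x yz by simp
 then show ?case by (simp only: bdl.simps(1)[of Y "bdl Y b"] e) (simp add: a_minus_def Y.r_neg ag_simps(8)[OF Y])
qed simp_all

text \<open>The Leibniz rule behind the compatibility of diagonal and differential, in a form that
  survives the induction. The two extra terms have a single letter as one argument, so they
  disappear when \<open>\<beta>\<close> is built from \<open>bg\<close>. Balancing moves a letter
  across the cut when the inserted \<open>\<one>\<close> is multiplied with it.\<close>

lemma bdl_spl: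
 assumes Y: "abelian_group Y" and "bok2 Y \<beta>"
  and bal: "!!l y r. [|set l <= carrier A; l ~= []; y : carrier A; set r <= carrier A; r ~= []|] ==>
   \<beta> (l @ [y]) (\<one> # r) = \<beta> (l @ [\<one>]) (y # r)"
  and "x : carrier A" "set M <= carrier A" "M ~= []"
 shows "bdl Y (spl Y \<beta>) (x # M) \<oplus>\<^bsub>Y\<^esub> \<beta> [x] (\<one> # M) =
  spl Y (%l r. bdl Y (%l'. \<beta> l' r) l \<oplus>\<^bsub>Y\<^esub> sneg Y (int (length l)) (bdl Y (\<beta> l) r)) (x # M)
  \<oplus>\<^bsub>Y\<^esub> sneg Y (int (length M)) (\<beta> (butlast (x # M) @ [\<one>]) [last (x # M)])"
 using assms(2-)
proof (induction M arbitrary: \<beta> x)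
 case (Cons y zs)
 interpret Y: abelian_group Y by (rule Y)
 note \<beta> = Cons.prems(1) and bal = Cons.prems(2)
 have x: "x : carrier A" and y: "y : carrier A" and zs: "set zs <= carrier A" using Cons.prems by auto
 show ?case
 proof (cases "zs = []")
  case True
  have c: "\<beta> [x] [\<one>, y] : carrier Y" "\<beta> [x, \<one>] [y] : carrier Y" using \<beta> x y by (auto simp: bok2_def)
  show ?thesis unfolding True using x y c
   by (simp add: sneg_def a_minus_def Y.a_assoc Y.r_neg ag_simps[OF Y])
 next
  case False
  let ?F = "%\<beta> l r. bdl Y (%l'. \<beta> l' r) l \<oplus>\<^bsub>Y\<^esub> sneg Y (int (length l)) (bdl Y (\<beta> l) r)"
  let ?\<beta>x = "%l. \<beta> (x # l)" and ?m = "%l. \<beta> ((x \<otimes> hd l) # tl l)"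
  let ?e = "\<beta> (butlast (x # y # zs) @ [\<one>]) [last (x # y # zs)]"
  have yzs: "set (y # zs) <= carrier A" using y zs by simp
  have b1: "bok Y (%l'. f l' r)" if "bok2 Y f" "set r <= carrier A" "r ~= []" for f r using that by (auto simp: bok2_def bok_def)
  have b2: "bok Y (f l)" if "bok2 Y f" "set l <= carrier A" "l ~= []" for f l using that by (auto simp: bok2_def bok_def)
  have \<beta>x: "bok2 Y ?\<beta>x" by (rule bok2_cons[OF \<beta> x])
  have F: "bok2 Y (?F f)" if f: "bok2 Y f" for f
   unfolding bok2_def
   using bdl_closed[OF Y b1[OF f]] bdl_closed[OF Y b2[OF f]] by (auto simp: sneg_closed[OF Y])
  have m: "bok2 Y ?m"
   unfolding bok2_def
  proof (intro allI impI)
   fix l r assume "set l <= carrier A & l ~= [] & set r <= carrier A & r ~= []"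
   then show "?m l r : carrier Y" using \<beta> x by (cases l) (auto simp: bok2_def)
  qed
  have s\<beta>x: "bok Y (spl Y ?\<beta>x)" using spl_closed[OF Y \<beta>x] by (simp add: bok_def)
  have bq: "bok Y (%l. \<beta> [x, \<one>] (\<one> # l))" using \<beta> x by (auto simp: bok_def bok2_def)
  have ih: "bdl Y (spl Y ?\<beta>x) (y # zs) \<oplus>\<^bsub>Y\<^esub> \<beta> [x, y] (\<one> # zs) =
    spl Y (?F ?\<beta>x) (y # zs) \<oplus>\<^bsub>Y\<^esub> sneg Y (int (length zs)) ?e"
   using Cons.IH[OF \<beta>x _ y zs False] bal[of "x # _"] x False by simp
  have bl: "\<beta> [x, y] (\<one> # zs) = \<beta> [x, \<one>] (y # zs)"
   using bal[of "[x]" y zs] x y zs False by simp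
  have 1: "bdl Y (%l. spl Y \<beta> (x # l)) (y # zs) = bdl Y (%l. \<beta> [x, \<one>] (\<one> # l)) (y # zs) \<oplus>\<^bsub>Y\<^esub> bdl Y (spl Y ?\<beta>x) (y # zs)"
  proof -
   have "spl Y \<beta> (x # l') = \<beta> [x, \<one>] (\<one> # l') \<oplus>\<^bsub>Y\<^esub> spl Y ?\<beta>x l'" if "l' ~= []" for l' using that by (cases l') auto
   then show ?thesis unfolding bdl_plus[OF Y bq s\<beta>x yzs, symmetric] by (intro bdl_cong[OF _ yzs])
  qed
  \<comment> \<open>Restoring the head \<open>x\<close> makes the left word longer by one, hence the
    opposite sign of \<open>?F ?\<beta>x\<close>; the products of \<open>x\<close> with its
    neighbour make up \<open>?m\<close>.\<close>
  have 2: "spl Y (%l r. ?F \<beta> (x # l) r) (y # zs) = spl Y \<beta> ((x \<otimes> y) # zs) \<ominus>\<^bsub>Y\<^esub> spl Y (?F ?\<beta>x) (y # zs)"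
  proof -
   have "?F \<beta> (x # l') r = ?m l' r \<ominus>\<^bsub>Y\<^esub> ?F ?\<beta>x l' r" if l': "set l' <= carrier A" "set r <= carrier A" "2 <= length l'" "2 <= length r" for l' r
   proof -
    obtain h t where l: "l' = h # t" using l' by (cases l') auto
    have ne: "l' ~= []" "r ~= []" using l' by auto
    have "?m l' r : carrier Y" using m l' ne unfolding bok2_def by blast
    then have c: "\<beta> ((x \<otimes> h) # t) r : carrier Y" "bdl Y (%l'. \<beta> (x # l') r) l' : carrier Y"
     "bdl Y (\<beta> (x # l')) r : carrier Y"
     using l' ne bdl_closed[OF Y b1[OF \<beta>x l'(2) ne(2)] l'(1)] bdl_closed[OF Y b2[OF \<beta>, of "x # l'"] l'(2)] x
     by (simp_all add: l)
    have arr: "u \<ominus>\<^bsub>Y\<^esub> v \<oplus>\<^bsub>Y\<^esub> sneg Y (int (Suc k)) w = u \<ominus>\<^bsub>Y\<^esub> (v \<oplus>\<^bsub>Y\<^esub> sneg Y (int k) w)"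
     if uvw: "u : carrier Y" "v : carrier Y" "w : carrier Y" for u v w k
     by (cases "even k"; simp add: sneg_def;
       rule rep_eq[of Y], (rule rep_rules | rule rep_atom | rule Y | rule uvw)+, simp)
    show ?thesis using arr[OF c, of "length l'"] unfolding l by simp
   qed
   then have "spl Y (%l r. ?F \<beta> (x # l) r) (y # zs) = spl Y (%l r. ?m l r \<ominus>\<^bsub>Y\<^esub> ?F ?\<beta>x l r) (y # zs)"
    by (intro spl_cong[OF _ yzs]) auto
   then show ?thesis unfolding spl_minus[OF Y m F[OF \<beta>x] yzs] spl_lmult .
  qed
  have cS: "spl Y \<beta> ((x \<otimes> y) # zs) : carrier Y" "spl Y (?F ?\<beta>x) (y # zs) : carrier Y"
   using spl_closed[OF Y \<beta>, of "(x \<otimes> y) # zs"] spl_closed[OF Y F[OF \<beta>x] yzs] x y zs by auto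
  have cB: "bdl Y (%l. \<beta> [x, \<one>] (\<one> # l)) (y # zs) : carrier Y" "bdl Y (spl Y ?\<beta>x) (y # zs) : carrier Y"
   using bdl_closed[OF Y bq yzs] bdl_closed[OF Y s\<beta>x yzs] by auto
  have "set (butlast (x # y # zs)) <= carrier A" "last (x # y # zs) : carrier A"
   using x y zs False by (auto dest!: in_set_butlastD)
  then have ce: "?e : carrier Y" "\<beta> [x] (\<one> # y # zs) : carrier Y" "\<beta> [x, \<one>] (y # zs) : carrier Y"
   using \<beta> x y zs unfolding bok2_def by auto
  define e where "e = ?e"
  define T where "T = bdl Y (spl Y ?\<beta>x) (y # zs)"
  define V where "V = spl Y (?F ?\<beta>x) (y # zs)"
  define Bd where "Bd = bdl Y (%l. \<beta> [x, \<one>] (\<one> # l)) (y # zs)"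
  note cs = cS[folded V_def] cB[folded Bd_def T_def] ce[folded e_def]
  have "T = T \<oplus>\<^bsub>Y\<^esub> \<beta> [x, \<one>] (y # zs) \<ominus>\<^bsub>Y\<^esub> \<beta> [x, \<one>] (y # zs)"
   by (rule rep_eq[of Y], (rule rep_rules | rule rep_atom | rule Y | rule cs)+, simp)
  then have T: "T = V \<oplus>\<^bsub>Y\<^esub> sneg Y (int (length zs)) e \<ominus>\<^bsub>Y\<^esub> \<beta> [x, \<one>] (y # zs)"
   using ih unfolding bl by (fold T_def V_def e_def) simp
  have "bdl Y (spl Y \<beta>) (x # y # zs) = spl Y \<beta> ((x \<otimes> y) # zs) \<ominus>\<^bsub>Y\<^esub> (Bd \<oplus>\<^bsub>Y\<^esub> T)"
   by (simp only: bdl.simps(1)[of Y "spl Y \<beta>"] 1 Bd_def T_def)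
  moreover have "spl Y (?F \<beta>) (x # y # zs) = (\<beta> [x] (\<one> # y # zs) \<ominus>\<^bsub>Y\<^esub> \<zero>\<^bsub>Y\<^esub> \<oplus>\<^bsub>Y\<^esub> (\<beta> [x, \<one>] (y # zs) \<ominus>\<^bsub>Y\<^esub> Bd))
    \<oplus>\<^bsub>Y\<^esub> (spl Y \<beta> ((x \<otimes> y) # zs) \<ominus>\<^bsub>Y\<^esub> V)"
   unfolding spl.simps(1)[of Y "?F \<beta>"] 2 V_def Bd_def using x y by (simp add: sneg_def)
  moreover have "bdl Y (spl Y \<beta>) (x # y # zs) \<oplus>\<^bsub>Y\<^esub> \<beta> [x] (\<one> # y # zs) =
    spl Y (?F \<beta>) (x # y # zs) \<oplus>\<^bsub>Y\<^esub> sneg Y (int (length (y # zs))) e"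
   unfolding calculation T
   by (cases "even (length zs)"; simp add: sneg_def cs;
     rule rep_eq[of Y], (rule rep_rules rep_zero | rule rep_atom | rule Y | rule cs)+, simp)
  ultimately show ?thesis by (simp only: e_def)
 qed
qed simp

lemma bdl_finsum:
 assumes Y: "abelian_group Y" and "bok Y b" "set l <= carrier A" "2 <= length l"
 shows "bdl Y b l = finsum Y (%i. [koszul_sign (int i)] \<cdot>\<^bsub>Y\<^esub> b (take i l @ [l ! i \<otimes> l ! Suc i] @ drop (i + 2) l)) {0..length l - 2}"
 using assms(2-)
proof (induction l arbitrary: b rule: induct_list012)
 case (3 x y zs)
 interpret Y: abelian_group Y by (rule Y)
 let ?f = "%i. [koszul_sign (int i)] \<cdot>\<^bsub>Y\<^esub> b (take i (x # y # zs) @ [(x # y # zs) ! i \<otimes> (x # y # zs) ! Suc i] @ drop (i + 2) (x # y # zs))"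
 have cl: "b (take i (x # y # zs) @ [(x # y # zs) ! i \<otimes> (x # y # zs) ! Suc i] @ drop (i + 2) (x # y # zs)) : carrier Y"
  if "i <= length zs" for i
 proof -
  have "(x # y # zs) ! i : set (x # y # zs)" "(x # y # zs) ! Suc i : set (x # y # zs)"
   using that by (intro nth_mem; simp)+
  moreover have "set (take i (x # y # zs)) <= carrier A" "set (drop (i + 2) (x # y # zs)) <= carrier A"
   using 3(4) set_take_subset set_drop_subset by (meson order_trans)+
  moreover have "(x # y # zs) ! i \<otimes> (x # y # zs) ! Suc i : carrier A"
   using calculation(1,2) 3(4) by (intro A.m_closed) blast+
  ultimately show ?thesis by (intro 3(3)[unfolded bok_def, rule_format]) simp
 qed
 show ?case
 proof (cases zs)
  case Nil
  then show ?thesis using cl[of 0] by (simp add: koszul_pow[OF Y] a_minus_def)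
 next
  case (Cons z zs')
  let ?g = "%i. [koszul_sign (int i)] \<cdot>\<^bsub>Y\<^esub> b (x # take i (y # zs) @ [(y # zs) ! i \<otimes> (y # zs) ! Suc i] @ drop (i + 2) (y # zs))"
  have n: "length (x # y # zs) - 2 = Suc (length (y # zs) - 2)" using Cons by simp
  have gc: "?g i : carrier Y" if "i <= length zs'" for i
   using cl[of "Suc i"] that Cons by (intro Y.int_pow_closed) simp
  have fg: "?f (Suc i) = \<ominus>\<^bsub>Y\<^esub> ?g i" if "i <= length zs'" for i
   using cl[of "Suc i"] that Cons by (simp add: koszul_pow[OF Y] Y.minus_minus)
  have "finsum Y ?f {0..length (x # y # zs) - 2} = finsum Y (%i. ?f (Suc i)) {..length zs'} \<oplus>\<^bsub>Y\<^esub> ?f 0"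
   unfolding n atLeast0AtMost using Cons cl by (subst Y.finsum_Suc2) (auto intro!: Y.int_pow_closed)
  also have "finsum Y (%i. ?f (Suc i)) {..length zs'} = finsum Y (%i. \<ominus>\<^bsub>Y\<^esub> ?g i) {..length zs'}"
   by (rule Y.finsum_cong') (use fg gc in auto)
  also have "\<dots> = \<ominus>\<^bsub>Y\<^esub> finsum Y ?g {..length zs'}"
   by (rule amap_finsum[OF amap_uminus[OF amap_id[OF Y]], symmetric]) (use gc in auto)
  also have "finsum Y ?g {..length zs'} = bdl Y (%l. b (x # l)) (y # zs)"
   using 3(2)[of "%l. b (x # l)"] 3(3,4) Cons by (simp add: bok_cons atLeast0AtMost)
  finally have "finsum Y ?f {0..length (x # y # zs) - 2} = \<ominus>\<^bsub>Y\<^esub> bdl Y (%l. b (x # l)) (y # zs) \<oplus>\<^bsub>Y\<^esub> ?f 0" .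
  moreover have "?f 0 = b ((x \<otimes> y) # zs)" using cl[of 0] by (simp add: koszul_pow[OF Y])
  ultimately show ?thesis
   using cl[of 0] bdl_closed[OF Y bok_cons[OF 3(3)], of x "y # zs"] 3(4) by (simp add: a_minus_def Y.a_comm)
 qed
qed simp_all

lemma bdl_grade:
 assumes "gab A Y" "!!l'. set l' <= carrier A ==> l' ~= [] ==> length l' = length l - 1 ==> b l' : grade Y k" "set l <= carrier A"
 shows "bdl Y b l : grade Y k"
 using assms(2-)
proof (induction l arbitrary: b rule: induct_list012)
 case (3 x y zs)
 have "bdl Y (%l. b (x # l)) (y # zs) : grade Y k" using 3(3)[of "x # _"] 3(4) by (intro 3(2)) auto
 then show ?case using 3(3)[of "(x \<otimes> y) # zs"] 3(4) by (auto intro!: gab_grade_minus[OF assms(1)])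
qed (simp_all add: gab_grade_zero[OF assms(1)])

lemma spl_grade:
 assumes "gab A Y" "!!l' r. set l' <= carrier A ==> set r <= carrier A ==> 2 <= length l' ==> 2 <= length r ==>
   length l' + length r = length l + 2 ==> \<beta> l' r : grade Y k" "set l <= carrier A"
 shows "spl Y \<beta> l : grade Y k"
 using assms(2-)
proof (induction l arbitrary: \<beta> rule: induct_list012)
 case (3 x y zs)
 have "spl Y (%l. \<beta> (x # l)) (y # zs) : grade Y k" using 3(3)[of "x # _"] 3(4) by (intro 3(2)) auto
 then show ?case using 3(3)[of "[x, \<one>]" "\<one> # y # zs"] 3(4) by (auto intro!: gab_grade_add[OF assms(1)])
qed (simp_all add: gab_grade_zero[OF assms(1)])

lemma bdl_klin:
 assumes Y: "gab A Y" and "!!l. set l <= carrier A ==> l ~= [] ==> klin Y (%x. b x l)" "set l <= carrier A"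
 shows "klin Y (%x. bdl Y (b x) l)"
 using assms(2-)
proof (induction l arbitrary: b rule: induct_list012)
 case (3 x y zs)
 have "klin Y (%v. bdl Y (%l. b v (x # l)) (y # zs))" using 3(3)[of "x # _"] 3(4) by (intro 3(2)) auto
 then show ?case using 3(3)[of "(x \<otimes> y) # zs"] 3(4) by (auto intro!: klin_minus[OF Y])
qed (simp_all add: klin_zero[OF Y])

lemma spl_klin:
 assumes Y: "gab A Y" and "!!l r. set l <= carrier A ==> l ~= [] ==> set r <= carrier A ==> r ~= [] ==> klin Y (%x. \<beta> x l r)" "set l <= carrier A"
 shows "klin Y (%x. spl Y (\<beta> x) l)"
 using assms(2-)
proof (induction l arbitrary: \<beta> rule: induct_list012)
 case (3 x y zs)
 have "klin Y (%v. spl Y (%l. \<beta> v (x # l)) (y # zs))" using 3(3)[of "x # _"] 3(4) by (intro 3(2)) auto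
 then show ?case using 3(3)[of "[x, \<one>]" "\<one> # y # zs"] 3(4) by (auto intro!: klin_plus[OF Y])
qed (simp_all add: klin_zero[OF Y])

lemma mlin_cons: "mlin Y b ==> a : carrier A ==> mlin Y (%l. b (a # l))"
 using mlinD[of Y b "a # _"] by (simp add: mlin_def)

lemma mlin_head: "mlin Y b ==> set l <= carrier A ==> klin Y (%x. b (x # l))"
 using mlinD[of Y b "[]" l] by simp

lemma mlin_bdl:
 assumes Y: "gab A Y" and b: "mlin Y b" shows "mlin Y (bdl Y b)"
 unfolding mlin_def
proof (intro allI impI, elim conjE)
 fix as bs assume "set as <= carrier A" and bs: "set bs <= carrier A"
 then show "klin Y (%x. bdl Y b (as @ x # bs))" using b
 proof (induction as arbitrary: b rule: induct_list012)
  case 1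
  show ?case
  proof (cases bs)
   case Nil then show ?thesis by (simp add: klin_zero[OF Y])
  next
   case (Cons y zs)
   have "klin Y (%x. bdl Y (%l. b (x # l)) (y # zs))"
    by (rule bdl_klin[OF Y]) (use mlin_head[OF 1(3)] bs Cons in auto)
   then show ?thesis
    using bs Cons klin_mult(1)[OF mlin_head[OF 1(3)], of zs y] by (simp add: klin_minus[OF Y])
  qed
 next
  case (2 a)
  have "klin Y (%x. bdl Y (%l. b (a # l)) (x # bs))"
  proof (cases bs)
   case Nil then show ?thesis by (simp add: klin_zero[OF Y])
  next
   case (Cons y zs)
   have m: "mlin Y (%l. b (a # l))" using 2 by (intro mlin_cons) auto
   have "klin Y (%x. bdl Y (%l. b (a # x # l)) (y # zs))"
    by (rule bdl_klin[OF Y]) (use mlin_head[OF m] bs Cons in auto)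
   then show ?thesis
    using bs Cons klin_mult(1)[OF mlin_head[OF m], of zs y] by (simp add: klin_minus[OF Y])
  qed
  then show ?case using 2 klin_mult(2)[OF mlin_head[OF 2(3)], of bs a] by (simp add: klin_minus[OF Y])
 next
  case (3 a a' as)
  have "klin Y (%x. bdl Y (%l. b (a # l)) ((a' # as) @ x # bs))"
   using 3(3,4,5) by (intro 3(2) mlin_cons) auto
  moreover have "klin Y (%x. b (((a \<otimes> a') # as) @ x # bs))" using 3(3,4) by (intro mlinD[OF 3(5)]) auto
  ultimately show ?case by (simp add: klin_minus[OF Y])
 qed
qed

definition mlin2 :: "('a, 'n) graded_bimodule => ('a list => 'a list => 'n) => bool" where
 "mlin2 Y \<beta> \<longleftrightarrow> (ALL r. set r <= carrier A & r ~= [] --> mlin Y (%l. \<beta> l r)) & (ALL l. set l <= carrier A & l ~= [] --> mlin Y (\<beta> l))"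

lemma mlin_spl:
 assumes Y: "gab A Y" and b: "mlin2 Y \<beta>" shows "mlin Y (spl Y \<beta>)"
 unfolding mlin_def
proof (intro allI impI, elim conjE)
 fix as bs assume "set as <= carrier A" and bs: "set bs <= carrier A"
 then show "klin Y (%x. spl Y \<beta> (as @ x # bs))" using b
 proof (induction as arbitrary: \<beta>)
  case Nil
  show ?case
  proof (cases bs)
   case Nil then show ?thesis by (simp add: klin_zero[OF Y])
  next
   case (Cons y zs)
   have "klin Y (%x. spl Y (%l. \<beta> (x # l)) (y # zs))"
   proof (rule spl_klin[OF Y])
    show "klin Y (%x. \<beta> (x # l) r)" if "set l <= carrier A" "set r <= carrier A" "r ~= []" for l r
     using Nil(3) that mlin_head[of Y "%l. \<beta> l r" l] by (simp add: mlin2_def)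
   qed (use bs Cons in auto)
   moreover have "klin Y (%x. \<beta> [x, \<one>] (\<one> # y # zs))"
    using Nil bs Cons mlin_head[of Y "%l. \<beta> l (\<one> # y # zs)" "[\<one>]"] by (simp add: mlin2_def)
   ultimately show ?thesis using Cons by (simp add: klin_plus[OF Y])
  qed
 next
  case (Cons a as)
  have a: "a : carrier A" using Cons by simp
  have "mlin2 Y (%l. \<beta> (a # l))" using Cons(4) a by (auto simp: mlin2_def intro: mlin_cons)
  then have 1: "klin Y (%x. spl Y (%l. \<beta> (a # l)) (as @ x # bs))" using Cons by simp
  have "mlin Y (\<beta> [a, \<one>])" using Cons(4) a by (simp add: mlin2_def)
  then have 2: "klin Y (%x. \<beta> [a, \<one>] ((\<one> # as) @ x # bs))" using Cons(2) bs by (intro mlinD) auto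
  have "spl Y \<beta> ((a # as) @ x # bs) = \<beta> [a, \<one>] ((\<one> # as) @ x # bs) \<oplus>\<^bsub>Y\<^esub> spl Y (%l. \<beta> (a # l)) (as @ x # bs)" for x
   by (cases as) auto
  then show ?case using klin_plus[OF Y 2 1] by simp
 qed
qed

end

lemma pres_lift_record_cong:
 fixes b :: "'x => 'g"
 assumes "carrier T = carrier G" "add T = add G" "\<zero>\<^bsub>T\<^esub> = \<zero>\<^bsub>G\<^esub>"
 shows "pres_lift T b = pres_lift G b"
proof -
 have "a_inv T = a_inv G" by (rule a_inv_record_cong[OF assms])
 then have "m_inv (add_monoid T) = m_inv (add_monoid G)" by (simp add: a_inv_def)
 then have p: "[(k::int)] \<cdot>\<^bsub>T\<^esub> x = [k] \<cdot>\<^bsub>G\<^esub> x" for k x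
  using assms by (simp add: add_pow_def int_pow_def nat_pow_def Let_def m_inv_def)
 have f: "finsum T h S = finsum G h S" for h and S :: "'x set"
  using assms by (simp add: finsum_def finprod_def)
 show ?thesis by (simp add: pres_lift_def fun_eq_iff p f)
qed

section \<open>Differential and augmentation of the bar complex\<close>

context alg begin

abbreviation "dB == bar_diff K A"
abbreviation "\<mu>B == bar_aug K A"

lemma bok_bg: "bok Bar bg"
 by (simp add: bok_def bg_closed)

lemma bg_lmult: "a : carrier A ==> x : carrier A ==> set l <= carrier A ==> a \<odot>\<^bsub>Bar\<^esub> bg (x # l) = bg ((a \<otimes> x) # l)"
 by (cases l) (simp_all add: bg_def amap_zero[OF Bar_smult_amap] Bar_smult)

lemma bg_rmult: "a : carrier A ==> x : carrier A ==> set l <= carrier A ==> rsmult Bar (bg (l @ [x])) a = bg (l @ [x \<otimes> a])"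
 by (cases l) (simp_all add: bg_def amap_zero[OF Bar_rsmult_amap] Bar_rsmult[of _ _ "_ # _", simplified])

lemma bg_grade: "set l <= carrier A ==> n = int (length l) - 2 ==> bg l : grade Bar n"
 by (auto simp: bg_def gab_grade_zero[OF Bar_gab] bar_lists_def intro!: gen_grade)

lemma
 shows dB_amap: "amap Bar Bar dB"
  and dB_gen: "l : BL ==> dB (gen l) = bdl Bar bg l"
proof -
 have e: "(if length l = 2 then \<zero>\<^bsub>Bar\<^esub> else finsum Bar (%i. [koszul_sign (int i)] \<cdot>\<^bsub>Bar\<^esub>
    gen (take i l @ [l ! i \<otimes> l ! Suc i] @ drop (i + 2) l)) {0..length l - 2}) = bdl Bar bg l"
  if l: "l : BL" for l
 proof (cases "length l = 2")
  \<comment> \<open>On a word of length 2 the recursion reaches a single letter, which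
    \<open>bg\<close> sends to zero; this is the separate case in \<open>bar_diff\<close>.\<close>
  case True
  then obtain x y where "l = [x, y]" by (auto simp: numeral_2_eq_2 length_Suc_conv)
  then show ?thesis by (simp add: bg_def a_minus_def ag_simps(8)[OF Bar_group])
 next
  case False
  then have n: "3 <= length l" "set l <= carrier A" using l by (auto simp: bar_lists_def)
  have bgen: "gen (take i l @ [l ! i \<otimes> l ! Suc i] @ drop (i + 2) l) = bg (take i l @ [l ! i \<otimes> l ! Suc i] @ drop (i + 2) l)"
   for i using n by (auto simp: bg_def)
  show ?thesis using n False unfolding bgen by (simp add: bdl_finsum[OF Bar_group bok_bg])
 qed
 note m = mlin_bdl[OF Bar_gab mlin_bg]
 show "amap Bar Bar dB" unfolding bar_diff_def by (rule blift_amap[OF Bar_gab m e])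
 show "l : BL ==> dB (gen l) = bdl Bar bg l" unfolding bar_diff_def by (rule blift_gen[OF Bar_gab m e])
qed

lemma dB_bg: "set l <= carrier A ==> l ~= [] ==> dB (bg l) = bdl Bar bg l"
proof -
 assume l: "set l <= carrier A" "l ~= []"
 show ?thesis
 proof (cases "2 <= length l")
  case True then show ?thesis using dB_gen[of l] l by (simp add: bg_def bar_lists_def)
 next
  case False
  then obtain x where "l = [x]" using l by (cases l; cases "tl l") auto
  then show ?thesis by (simp add: bg_def amap_zero[OF dB_amap])
 qed
qed

lemma dB_ghom: "ghom A Bar Bar (- 1) dB"
proof (rule ghomI[OF Bar_gab Bar_gab dB_amap])
 fix a z assume a: "a : carrier A" and z: "z : carrier Bar"
 show "dB (a \<odot>\<^bsub>Bar\<^esub> z) = a \<odot>\<^bsub>Bar\<^esub> dB z"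
 proof (rule bar_ext[OF amap_comp[OF dB_amap Bar_smult_amap[OF a]] amap_comp[OF Bar_smult_amap[OF a] dB_amap] _ z])
  fix l assume "l : BL"
  then obtain x t where l: "l = x # t" "x : carrier A" "set t <= carrier A" "t ~= []" by (cases l) (auto simp: BL_cons)
  have "a \<odot>\<^bsub>Bar\<^esub> bdl Bar bg l = bdl Bar (%l. a \<odot>\<^bsub>Bar\<^esub> bg l) l"
   by (rule bdl_amap[OF Bar_smult_amap[OF a] bok_bg]) (use l in auto)
  also have "\<dots> = bdl Bar (%l. bg ((a \<otimes> hd l) # tl l)) l"
  proof (rule bdl_cong)
   fix l' :: "'a list" assume "set l' <= carrier A" "l' ~= []"
   then show "a \<odot>\<^bsub>Bar\<^esub> bg l' = bg ((a \<otimes> hd l') # tl l')" by (cases l') (auto simp: bg_lmult a)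
  qed (use l in auto)
  finally show "dB (a \<odot>\<^bsub>Bar\<^esub> gen l) = a \<odot>\<^bsub>Bar\<^esub> dB (gen l)"
   using l a bdl_lmult[of a x t Bar bg] by (simp add: Bar_smult dB_gen BL_cons)
 qed
 show "dB (rsmult Bar z a) = rsmult Bar (dB z) a"
 proof (rule bar_ext[OF amap_comp[OF dB_amap Bar_rsmult_amap[OF a]] amap_comp[OF Bar_rsmult_amap[OF a] dB_amap] _ z])
  fix l assume "l : BL"
  then obtain x t where l: "l = t @ [x]" "x : carrier A" "set t <= carrier A" "t ~= []"
   by (cases l rule: rev_cases) (auto simp: BL_snoc)
  have "rsmult Bar (bdl Bar bg l) a = bdl Bar (%l. rsmult Bar (bg l) a) l"
   by (rule bdl_amap[OF Bar_rsmult_amap[OF a] bok_bg]) (use l in auto)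
  also have "\<dots> = bdl Bar (%l. bg (butlast l @ [last l \<otimes> a])) l"
  proof (rule bdl_cong)
   fix l' :: "'a list" assume "set l' <= carrier A" "l' ~= []"
   then show "rsmult Bar (bg l') a = bg (butlast l' @ [last l' \<otimes> a])"
    by (cases l' rule: rev_cases) (auto simp: bg_rmult a)
  qed (use l in auto)
  finally show "dB (rsmult Bar (gen l) a) = rsmult Bar (dB (gen l)) a"
   using l a bdl_rmult[of a t x Bar bg] by (simp add: Bar_rsmult dB_gen BL_snoc)
 qed
next
 fix n z assume "z : grade Bar n"
 then show "dB z : grade Bar (n + - 1)"
 proof (rule Bar_grade_amap[OF dB_amap Bar_gab])
  fix l assume l: "l : BL" "int (length l) = n + 2"
  then show "dB (gen l) : grade Bar (n + - 1)"
   unfolding dB_gen[OF l(1)] by (intro bdl_grade[OF Bar_gab] bg_grade) (auto simp: bar_lists_def of_nat_diff)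
 qed
qed

lemma dB_dB: "z : carrier Bar ==> dB (dB z) = \<zero>\<^bsub>Bar\<^esub>"
proof (rule bar_ext[OF amap_comp[OF dB_amap dB_amap] amap_const_zero[OF Bar_group Bar_group]])
 fix l assume l: "l : BL"
 then have ls: "set l <= carrier A" by (simp add: bar_lists_def)
 have "dB (bdl Bar bg l) = bdl Bar (%l. dB (bg l)) l" by (rule bdl_amap[OF dB_amap bok_bg ls])
 also have "\<dots> = bdl Bar (bdl Bar bg) l" by (rule bdl_cong[OF _ ls]) (simp add: dB_bg)
 finally show "dB (dB (gen l)) = \<zero>\<^bsub>Bar\<^esub>"
  using l by (simp add: dB_gen bdl_bdl[OF Bar_group bok_bg ls])
qed

lemma pres_lift_regular: "pres_lift A b = pres_lift (regular A) b"
 by (rule pres_lift_record_cong) simp_all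

lemma klin_id: "klin (regular A) (%x. x)"
 using amap_id[OF A.abelian_group_axioms] by (simp add: klin_def amap_def gab_group[OF regular_gab] scalar_mult)

lemma
 shows \<mu>B_amap: "amap Bar (regular A) \<mu>B"
  and \<mu>B_gen: "l : BL ==> \<mu>B (gen l) = (if length l = 2 then l ! 0 \<otimes> l ! 1 else \<zero>)"
proof -
 let ?b = "%l. if length l = 2 then l ! 0 \<otimes> l ! 1 else \<zero>"
 have m: "mlin (regular A) ?b"
  unfolding mlin_def
 proof (intro allI impI, elim conjE)
  fix as bs assume as: "set as <= carrier A" and bs: "set bs <= carrier A"
  consider a where "as = [a]" "bs = []" | b where "as = []" "bs = [b]" | "length as + length bs ~= 1"
   by (cases as; cases bs; cases "tl as"; cases "tl bs") auto
  then show "klin (regular A) (%x. ?b (as @ x # bs))"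
  proof cases
   case 3
   then have "length (as @ x # bs) ~= 2" for x by simp
   then show ?thesis using klin_zero[OF regular_gab] by (simp del: length_append)
  qed (use as bs klin_mult[OF klin_id] in simp_all)
 qed
 show "amap Bar (regular A) \<mu>B" unfolding bar_aug_def pres_lift_regular by (rule blift_amap[OF regular_gab m refl])
 show "l : BL ==> \<mu>B (gen l) = ?b l"
  unfolding bar_aug_def pres_lift_regular by (rule blift_gen[OF regular_gab m refl])
qed

lemma \<mu>B_bg: "set l <= carrier A ==> \<mu>B (bg l) = (if length l = 2 then l ! 0 \<otimes> l ! 1 else \<zero>)"
 using \<mu>B_gen[of l] amap_zero[OF \<mu>B_amap] by (auto simp: bg_def bar_lists_def)

lemma BL_length2: "l : BL ==> length l = 2 ==> EX x:carrier A. EX y:carrier A. l = [x, y]"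
 by (auto simp: numeral_2_eq_2 length_Suc_conv bar_lists_def)

lemma \<mu>B_ghom: "ghom A Bar (regular A) 0 \<mu>B"
proof (rule ghomI[OF Bar_gab regular_gab \<mu>B_amap])
 fix a z assume a: "a : carrier A" and z: "z : carrier Bar"
 show "\<mu>B (a \<odot>\<^bsub>Bar\<^esub> z) = a \<odot>\<^bsub>regular A\<^esub> \<mu>B z"
  by (rule bar_ext[OF amap_comp[OF \<mu>B_amap Bar_smult_amap[OF a]] amap_comp[OF gab_smult[OF regular_gab a] \<mu>B_amap] _ z],
    elim BL_cases) (use a in "auto simp: Bar_smult \<mu>B_gen BL_cons A.m_assoc nth_append")
 show "\<mu>B (rsmult Bar z a) = rsmult (regular A) (\<mu>B z) a"
  by (rule bar_ext[OF amap_comp[OF \<mu>B_amap Bar_rsmult_amap[OF a]] amap_comp[OF gab_rsmult[OF regular_gab a] \<mu>B_amap] _ z],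
    elim BL_cases) (use a in \<open>auto simp: Bar_rsmult[of _ _ "_ # _", simplified] \<mu>B_gen BL_cons A.m_assoc nth_append\<close>)
next
 fix n z assume "z : grade Bar n"
 then show "\<mu>B z : grade (regular A) (n + 0)"
 proof (rule Bar_grade_amap[OF \<mu>B_amap regular_gab])
  fix l assume l: "l : BL" "int (length l) = n + 2"
  have "\<mu>B (gen l) : carrier A" using amap_closed[OF \<mu>B_amap gen_closed[OF l(1)]] by simp
  then show "\<mu>B (gen l) : grade (regular A) (n + 0)" using l by (auto simp: \<mu>B_gen)
 qed
qed

text \<open>Only words of length 3 matter, where the claim is associativity; for all others the
  degree forces zero.\<close>

lemma \<mu>B_dB: "z : carrier Bar ==> \<mu>B (dB z) = \<zero>"
proof (rule bar_ext[of "regular A" "%z. \<mu>B (dB z)" "%z. \<zero>"])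
 show "amap Bar (regular A) (%z. \<mu>B (dB z))" by (rule amap_comp[OF \<mu>B_amap dB_amap])
 show "amap Bar (regular A) (%z. \<zero>)" using amap_const_zero[OF Bar_group gab_group[OF regular_gab]] by simp
 fix l assume l: "l : BL"
 show "\<mu>B (dB (gen l)) = \<zero>"
 proof (cases "length l = 3")
  case True
  then obtain x y z where xyz: "l = [x, y, z]" by (auto simp: numeral_3_eq_3 length_Suc_conv)
  then have c: "x : carrier A" "y : carrier A" "z : carrier A" using l by (auto simp: bar_lists_def)
  have "\<mu>B (bdl Bar bg l) = bdl (regular A) (%l. \<mu>B (bg l)) l"
   by (rule bdl_amap[OF \<mu>B_amap bok_bg]) (use c xyz in auto)
  also have "\<dots> = \<zero>" using c unfolding xyz
   by (simp add: \<mu>B_bg A.m_assoc a_minus_def A.r_neg)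
  finally show ?thesis using l by (simp add: dB_gen)
 next
  case False
  have "\<mu>B (dB (gen l)) : grade (regular A) (int (length l) - 2 + - 1 + 0)"
   by (rule ghom_degree[OF \<mu>B_ghom ghom_degree[OF dB_ghom gen_grade[OF l refl] refl] refl])
  then show ?thesis using False by (simp split: if_splits)
 qed
qed

lemma Bar_neg: "n < 0 ==> z : grade Bar n ==> z = \<zero>\<^bsub>Bar\<^esub>"
 by (rotate_tac, induction rule: grade_Bar_induct) (auto simp: bar_lists_def ag_simps[OF Bar_group])

lemma Bar_cplx: "cplx K A Bar dB \<mu>B"
 by (intro cplx.intro gbm.intro cplx_axioms.intro gbm_axioms.intro alg_axioms)
   (use Bar_graded dB_ghom dB_dB Bar_neg \<mu>B_ghom \<mu>B_dB in auto)

end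

locale bar_alg = alg K A for K :: "'k ring" and A :: "('k, 'a) module" (structure)

sublocale bar_alg \<subseteq> Bc: cplx K A Bar dB \<mu>B
 by (rule Bar_cplx)

subsection \<open>Diagonal and product of the bar complex\<close>

context bar_alg begin

abbreviation "TB == tensor_A A Bar Bar"
abbreviation "tB == pure_A A Bar Bar"

lemma tB_scalar: "c : carrier K ==> x : carrier Bar ==> y : carrier Bar ==>
  tB ((c \<odot> \<one>) \<odot>\<^bsub>Bar\<^esub> x) y = (c \<odot> \<one>) \<odot>\<^bsub>TB\<^esub> tB x y"
 "c : carrier K ==> x : carrier Bar ==> y : carrier Bar ==>
  tB x ((c \<odot> \<one>) \<odot>\<^bsub>Bar\<^esub> y) = (c \<odot> \<one>) \<odot>\<^bsub>TB\<^esub> tB x y"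
proof -
 assume h: "c : carrier K" "x : carrier Bar" "y : carrier Bar"
 note s = scalar_closed[OF h(1)]
 show 1: "tB ((c \<odot> \<one>) \<odot>\<^bsub>Bar\<^esub> x) y = (c \<odot> \<one>) \<odot>\<^bsub>TB\<^esub> tB x y"
  using Bc.T.T_smult[OF s h(2,3)] by simp
 show "tB x ((c \<odot> \<one>) \<odot>\<^bsub>Bar\<^esub> y) = (c \<odot> \<one>) \<odot>\<^bsub>TB\<^esub> tB x y"
  using Bc.T.pt_bal[OF h(2) s h(3)] 1 bimodD(13)[OF Bar_bimod h(1,2)] by simp
qed

lemma tB_mlin2: "mlin2 TB (%l r. tB (bg l) (bg r))"
 unfolding mlin2_def mlin_def
 by (auto intro!: klin_comp[OF klin_bg Bc.T.pt_amap_l] klin_comp[OF klin_bg Bc.T.pt_amap_r] simp: bg_closed tB_scalar)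

lemma tB_bok2: "bok2 TB (%l r. tB (bg l) (bg r))"
 by (simp add: bok2_def bg_closed)

definition \<Delta>B :: "'a bar => ('a bar, 'a bar) tens" where
 "\<Delta>B = pres_lift TB (spl TB (%l r. tB (bg l) (bg r)))"

lemmas spl_mlin = mlin_spl[OF Bc.T.T_gab tB_mlin2]

lemma \<Delta>B_amap: "amap Bar TB \<Delta>B"
 unfolding \<Delta>B_def by (rule blift_amap[OF Bc.T.T_gab spl_mlin refl])

lemma \<Delta>B_gen: "l : BL ==> \<Delta>B (gen l) = spl TB (%l r. tB (bg l) (bg r)) l"
 unfolding \<Delta>B_def by (rule blift_gen[OF Bc.T.T_gab spl_mlin refl])

lemma \<Delta>B_bg: "set l <= carrier A ==> l ~= [] ==> \<Delta>B (bg l) = spl TB (%l r. tB (bg l) (bg r)) l"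
proof -
 assume l: "set l <= carrier A" "l ~= []"
 show ?thesis
 proof (cases "2 <= length l")
  case True then show ?thesis using \<Delta>B_gen[of l] l by (simp add: bg_def bar_lists_def)
 next
  case False
  then obtain x where "l = [x]" using l by (cases l; cases "tl l") auto
  then show ?thesis by (simp add: bg_def amap_zero[OF \<Delta>B_amap])
 qed
qed

lemma \<Delta>B_ghom: "ghom A Bar TB 0 \<Delta>B"
proof (rule ghomI[OF Bar_gab Bc.T.T_gab \<Delta>B_amap])
 fix a z assume a: "a : carrier A" and z: "z : carrier Bar"
 show "\<Delta>B (a \<odot>\<^bsub>Bar\<^esub> z) = a \<odot>\<^bsub>TB\<^esub> \<Delta>B z"
 proof (rule bar_ext[OF amap_comp[OF \<Delta>B_amap Bar_smult_amap[OF a]] amap_comp[OF Bc.T.T_smult_amap[OF a] \<Delta>B_amap] _ z])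
  fix l assume "l : BL"
  then obtain x t where l: "l = x # t" "x : carrier A" "set t <= carrier A" "t ~= []" by (cases l) (auto simp: BL_cons)
  have "a \<odot>\<^bsub>TB\<^esub> spl TB (%l r. tB (bg l) (bg r)) l = spl TB (%l r. a \<odot>\<^bsub>TB\<^esub> tB (bg l) (bg r)) l"
   by (rule spl_amap[OF Bc.T.T_smult_amap[OF a] tB_bok2]) (use l in auto)
  also have "\<dots> = spl TB (%l r. tB (bg ((a \<otimes> hd l) # tl l)) (bg r)) l"
  proof (rule spl_cong)
   fix l' r :: "'a list" assume h: "set l' <= carrier A" "set r <= carrier A" "2 <= length l'"
   then show "a \<odot>\<^bsub>TB\<^esub> tB (bg l') (bg r) = tB (bg ((a \<otimes> hd l') # tl l')) (bg r)"
    by (cases l') (auto simp: bg_lmult a Bc.T.T_smult bg_closed)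
  qed (use l in auto)
  finally show "\<Delta>B (a \<odot>\<^bsub>Bar\<^esub> gen l) = a \<odot>\<^bsub>TB\<^esub> \<Delta>B (gen l)"
   using l a spl_lmult[of TB "%l r. tB (bg l) (bg r)" a x t] by (simp add: Bar_smult \<Delta>B_gen BL_cons)
 qed
 show "\<Delta>B (rsmult Bar z a) = rsmult TB (\<Delta>B z) a"
 proof (rule bar_ext[OF amap_comp[OF \<Delta>B_amap Bar_rsmult_amap[OF a]] amap_comp[OF Bc.T.T_rsmult_amap[OF a] \<Delta>B_amap] _ z])
  fix l assume "l : BL"
  then obtain x t where l: "l = t @ [x]" "x : carrier A" "set t <= carrier A" "t ~= []"
   by (cases l rule: rev_cases) (auto simp: BL_snoc)
  have "rsmult TB (spl TB (%l r. tB (bg l) (bg r)) l) a = spl TB (%l r. rsmult TB (tB (bg l) (bg r)) a) l"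
   by (rule spl_amap[OF Bc.T.T_rsmult_amap[OF a] tB_bok2]) (use l in auto)
  also have "\<dots> = spl TB (%l r. tB (bg l) (bg (butlast r @ [last r \<otimes> a]))) l"
  proof (rule spl_cong)
   fix l' r :: "'a list" assume h: "set l' <= carrier A" "set r <= carrier A" "2 <= length r"
   then show "rsmult TB (tB (bg l') (bg r)) a = tB (bg l') (bg (butlast r @ [last r \<otimes> a]))"
    by (cases r rule: rev_cases) (auto simp: bg_rmult a Bc.T.T_rsmult bg_closed)
  qed (use l in auto)
  finally show "\<Delta>B (rsmult Bar (gen l) a) = rsmult TB (\<Delta>B (gen l)) a"
   using l a spl_rmult[of TB "%l r. tB (bg l) (bg r)" t x a] by (simp add: Bar_rsmult \<Delta>B_gen BL_snoc)
 qed
next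
 fix n z assume "z : grade Bar n"
 then show "\<Delta>B z : grade TB (n + 0)"
 proof (rule Bar_grade_amap[OF \<Delta>B_amap Bc.T.T_gab])
  fix l assume l: "l : BL" "int (length l) = n + 2"
  show "\<Delta>B (gen l) : grade TB (n + 0)"
   unfolding \<Delta>B_gen[OF l(1)]
  proof (rule spl_grade[OF Bc.T.T_gab])
   fix l' r :: "'a list" assume "set l' <= carrier A" "set r <= carrier A" "length l' + length r = length l + 2"
   then show "tB (bg l') (bg r) : grade TB (n + 0)"
    using l(2) by (intro Bc.T.pt_grade[OF bg_grade[OF _ refl] bg_grade[OF _ refl]]) auto
  qed (use l in "auto simp: bar_lists_def")
 qed
qed

lemma spl_zero:
 assumes Y: "abelian_group Y" shows "spl Y (%l r. \<zero>\<^bsub>Y\<^esub>) l = \<zero>\<^bsub>Y\<^esub>"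
 by (induction l rule: induct_list012) (simp_all add: ag_simps[OF Y])

text \<open>The augmentation sees words of length 2 only, so just the first cut, with prefix
  \<open>[x, \<one>]\<close>, contributes.\<close>

lemma mul_\<Delta>B: "z : carrier Bar ==> Bc.mul (\<Delta>B z) = z"
proof (rule bar_ext[OF amap_comp[OF ghom_amap[OF Bc.mul_ghom] \<Delta>B_amap] amap_id[OF Bar_group]])
 fix l assume l: "l : BL"
 then obtain x y zs where xyz: "l = x # y # zs" "x : carrier A" "y : carrier A" "set zs <= carrier A"
  by (cases l; cases "tl l") (auto simp: bar_lists_def)
 have "Bc.mul (\<Delta>B (gen l)) = spl Bar (%l r. Bc.mul (tB (bg l) (bg r))) l"
  unfolding \<Delta>B_gen[OF l] by (rule spl_amap[OF ghom_amap[OF Bc.mul_ghom] tB_bok2]) (use xyz in auto)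
 also have "\<dots> = spl Bar (%l r. \<mu>B (bg l) \<odot>\<^bsub>Bar\<^esub> bg r) l"
  by (rule spl_cong) (use xyz in "auto simp: bg_closed")
 also have "\<dots> = gen l \<oplus>\<^bsub>Bar\<^esub> spl Bar (%l r. \<mu>B (bg (x # l)) \<odot>\<^bsub>Bar\<^esub> bg r) (y # zs)"
  using xyz by (simp add: \<mu>B_bg bg_lmult) (simp add: bg_def)
 also have "spl Bar (%l r. \<mu>B (bg (x # l)) \<odot>\<^bsub>Bar\<^esub> bg r) (y # zs) = spl Bar (%l r. \<zero>\<^bsub>Bar\<^esub>) (y # zs)"
  by (rule spl_cong) (use xyz in "auto simp: bg_closed \<mu>B_bg amap_zero[OF Bc.lact_amap, simplified]")
 finally show "Bc.mul (\<Delta>B (gen l)) = gen l"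
  using gen_closed[OF l] by (simp add: spl_zero[OF Bar_group])
qed

text \<open>Dually, only the last cut contributes. The prefix \<open>p\<close> collects the letters
  already passed in the induction.\<close>

lemma spl_mur:
 assumes "set p <= carrier A" "set l <= carrier A" "2 <= length l"
 shows "spl Bar (%l r. rsmult Bar (bg (p @ l)) (\<mu>B (bg r))) l = bg (p @ l)"
 using assms
proof (induction l arbitrary: p rule: induct_list012)
 case (3 x y zs)
 show ?case
 proof (cases zs)
  case Nil
  then show ?thesis using 3 bg_rmult[of y "\<one>" "p @ [x]"] by (simp add: \<mu>B_bg bg_closed)
 next
  case (Cons z zs')
  have "spl Bar (%l r. rsmult Bar (bg ((p @ [x]) @ l)) (\<mu>B (bg r))) (y # zs) = bg ((p @ [x]) @ y # zs)"
   using 3(3,4) Cons by (intro 3(2)) auto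
  then show ?thesis using 3(3,4) Cons by (simp add: \<mu>B_bg bg_closed amap_zero[OF Bc.ract_amap, simplified])
 qed
qed simp_all

lemma mur_\<Delta>B: "z : carrier Bar ==> Bc.mur (\<Delta>B z) = z"
proof (rule bar_ext[OF amap_comp[OF ghom_amap[OF Bc.mur_ghom] \<Delta>B_amap] amap_id[OF Bar_group]])
 fix l assume l: "l : BL"
 then have ls: "set l <= carrier A" "2 <= length l" by (auto simp: bar_lists_def)
 have "Bc.mur (\<Delta>B (gen l)) = spl Bar (%l r. Bc.mur (tB (bg l) (bg r))) l"
  unfolding \<Delta>B_gen[OF l] by (rule spl_amap[OF ghom_amap[OF Bc.mur_ghom] tB_bok2 ls(1)])
 also have "\<dots> = spl Bar (%l r. rsmult Bar (bg ([] @ l)) (\<mu>B (bg r))) l"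
  by (rule spl_cong) (use ls in "auto simp: bg_closed")
 also have "\<dots> = bg ([] @ l)" by (rule spl_mur) (use ls in auto)
 finally show "Bc.mur (\<Delta>B (gen l)) = gen l" using l by simp
qed

lemma \<sigma>_bg: "set l <= carrier A ==> sgnmap Bar 1 (bg l) = sneg Bar (int (length l)) (bg l)"
proof -
 assume l: "set l <= carrier A"
 have "sgnmap Bar 1 (bg l) = sneg Bar ((int (length l) - 2) * 1) (bg l)"
  by (rule sgnmap_val[OF Bar_graded bg_grade[OF l refl]])
 then show ?thesis by (simp add: sneg_def)
qed

lemma D_\<Delta>B: "z : carrier Bar ==> Bc.D (\<Delta>B z) = \<Delta>B (dB z)"
proof (rule bar_ext[OF amap_comp[OF ghom_amap[OF Bc.D_ghom] \<Delta>B_amap] amap_comp[OF \<Delta>B_amap dB_amap]])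
 fix L assume L: "L : BL"
 then have Ls: "set L <= carrier A" "2 <= length L" by (auto simp: bar_lists_def)
 then obtain x M where xM: "L = x # M" "M ~= []" "x : carrier A" "set M <= carrier A" by (cases L; cases "tl L") auto
 let ?b = "%l r. tB (bg l) (bg r)"
 have "Bc.D (\<Delta>B (gen L)) = spl TB (%l r. Bc.D (?b l r)) L"
  unfolding \<Delta>B_gen[OF L] by (rule spl_amap[OF ghom_amap[OF Bc.D_ghom] tB_bok2 Ls(1)])
 also have "\<dots> = spl TB (%l r. bdl TB (%l'. ?b l' r) l \<oplus>\<^bsub>TB\<^esub> sneg TB (int (length l)) (bdl TB (?b l) r)) L"
 proof (rule spl_cong[OF _ Ls(1)])
  fix l r :: "'a list" assume lr: "set l <= carrier A" "set r <= carrier A" "2 <= length l" "2 <= length r"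
  then have ne: "l ~= []" "r ~= []" by auto
  have 1: "tB (bdl Bar bg l) (bg r) = bdl TB (%l'. ?b l' r) l"
   by (rule bdl_amap[OF Bc.T.pt_amap_l[OF bg_closed[OF lr(2)]] bok_bg lr(1)])
  have 2: "tB (bg l) (bdl Bar bg r) = bdl TB (?b l) r"
   by (rule bdl_amap[OF Bc.T.pt_amap_r[OF bg_closed[OF lr(1)]] bok_bg lr(2)])
  have "tB (sneg Bar k u) v = sneg TB k (tB u v)" if "u : carrier Bar" "v : carrier Bar" for k u v
   using that by (simp add: sneg_def)
  then show "Bc.D (?b l r) = bdl TB (%l'. ?b l' r) l \<oplus>\<^bsub>TB\<^esub> sneg TB (int (length l)) (bdl TB (?b l) r)"
   using lr ne bdl_closed[OF Bar_group bok_bg] by (simp add: bg_closed \<sigma>_bg dB_bg 1 2)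
 qed
 also have "\<dots> = bdl TB (spl TB ?b) L"
 proof -
  \<comment> \<open>Because of this the two extra terms of \<open>bdl_spl\<close> drop out.\<close>
  have z: "bg [a] = \<zero>\<^bsub>Bar\<^esub>" for a by (simp add: bg_def)
  have "set (butlast L) <= carrier A" "last L : carrier A"
   using Ls by (auto dest: in_set_butlastD) (use last_in_set[of L] xM in auto)
  then have c: "bg (butlast L @ [\<one>]) : carrier Bar" "bg (\<one> # M) : carrier Bar"
   using xM by (auto intro!: bg_closed)
  have bal: "?b (l @ [y]) (\<one> # r) = ?b (l @ [\<one>]) (y # r)"
   if "set l <= carrier A" "l ~= []" "y : carrier A" "set r <= carrier A" for l y r
   using that bg_rmult[of y "\<one>" l] bg_lmult[of y "\<one>" r]
    Bc.T.pt_bal[of "bg (l @ [\<one>])" y "bg (\<one> # r)"] by (simp add: bg_closed)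
  have "bdl TB (spl TB ?b) L : carrier TB" "spl TB (%l r. bdl TB (%l'. ?b l' r) l \<oplus>\<^bsub>TB\<^esub> sneg TB (int (length l)) (bdl TB (?b l) r)) L : carrier TB"
  proof -
   show "bdl TB (spl TB ?b) L : carrier TB"
    using spl_closed[OF Bc.T_gp tB_bok2] Ls by (intro bdl_closed[OF Bc.T_gp]) (auto simp: bok_def)
   have "bok2 TB (%l r. bdl TB (%l'. ?b l' r) l \<oplus>\<^bsub>TB\<^esub> sneg TB (int (length l)) (bdl TB (?b l) r))"
    unfolding bok2_def
    by (intro allI impI ag_simps(1)[OF Bc.T_gp] sneg_closed[OF Bc.T_gp] bdl_closed[OF Bc.T_gp])
      (auto simp: bok_def bg_closed)
   then show "spl TB (%l r. bdl TB (%l'. ?b l' r) l \<oplus>\<^bsub>TB\<^esub> sneg TB (int (length l)) (bdl TB (?b l) r)) L : carrier TB"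
    by (rule spl_closed[OF Bc.T_gp _ Ls(1)])
  qed
  moreover have "sneg TB k \<zero>\<^bsub>TB\<^esub> = \<zero>\<^bsub>TB\<^esub>" for k by (simp add: sneg_def)
  ultimately show ?thesis
   using bdl_spl[OF Bc.T_gp tB_bok2 bal xM(3,4,2)] c unfolding xM(1)[symmetric] z
   by simp
 qed
 also have "\<dots> = bdl TB (%l. \<Delta>B (bg l)) L" by (rule bdl_cong[OF _ Ls(1)]) (simp add: \<Delta>B_bg)
 also have "\<dots> = \<Delta>B (bdl Bar bg L)" by (rule bdl_amap[OF \<Delta>B_amap bok_bg Ls(1), symmetric])
 finally show "Bc.D (\<Delta>B (gen L)) = \<Delta>B (dB (gen L))" by (simp add: dB_gen[OF L])
qed

section \<open>The product of the bar complex\<close>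

definition lst :: "'a list => 'a list => 'a list" where
 "lst l r = butlast l @ (last l \<otimes> hd r) # tl r"

text \<open>Concatenation with the two inner ends multiplied. Words of degrees p and q have lengths
  p + 2 and q + 2 and give one of length p + q + 3, hence a product of degree 1. The length of the
  left word has the parity of its degree, which is the sign that the relation with the differential
  requires.\<close>

definition star :: "'a list => 'a list => 'a bar" where
 "star l r = sneg Bar (int (length l)) (bg (lst l r))"

definition phi2 :: "'a bar => 'a bar => 'a bar" where
 "phi2 x y = pres_lift Bar (%l. pres_lift Bar (star l) y) x"

lemma lst_cons: "l ~= [] ==> lst (x # l) r = x # lst l r"
 by (simp add: lst_def)

lemma lst_set: "set l <= carrier A ==> l ~= [] ==> set r <= carrier A ==> r ~= [] ==> set (lst l r) <= carrier A"
proof -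
 assume h: "set l <= carrier A" "l ~= []" "set r <= carrier A" "r ~= []"
 then have "last l : carrier A" "hd r : carrier A" "set (butlast l) <= carrier A" "set (tl r) <= carrier A"
  using last_in_set[of l] hd_in_set[of r] by (auto dest: in_set_butlastD list.set_sel(2))
 then show ?thesis by (simp add: lst_def)
qed

lemma lst_length: "l ~= [] ==> r ~= [] ==> length (lst l r) = length l + length r - 1"
 by (cases l rule: rev_cases; cases r) (auto simp: lst_def)

lemma star_klin_r:
 assumes l: "set l <= carrier A" "l ~= []" shows "mlin Bar (star l)"
 unfolding mlin_def star_def
proof (intro allI impI klin_sneg[OF Bar_gab])
 fix as bs assume "set as <= carrier A & set bs <= carrier A"
 moreover have "last l : carrier A" "set (butlast l) <= carrier A"
  using l last_in_set[of l] by (auto dest: in_set_butlastD)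
 ultimately show "klin Bar (%x. bg (lst l (as @ x # bs)))"
  using klin_mult(2)[OF klin_bg, of "butlast l" bs "last l"] klin_bg[of "butlast l @ (last l \<otimes> hd as) # tl as" bs]
  by (cases as) (auto simp: lst_def)
qed

lemma star_klin_l:
 assumes r: "set r <= carrier A" "r ~= []" and as: "set as <= carrier A" "set bs <= carrier A"
 shows "klin Bar (%x. star (as @ x # bs) r)"
proof -
 have "hd r : carrier A" "set (tl r) <= carrier A" using r by (cases r; auto)+
 then have "klin Bar (%x. bg (lst (as @ x # bs) r))"
  using as klin_mult(1)[OF klin_bg, of as "tl r" "hd r"] klin_bg[of as "butlast bs @ (last bs \<otimes> hd r) # tl r"]
  by (cases bs rule: rev_cases) (auto simp: lst_def butlast_append)
 then show ?thesis unfolding star_def by (simp add: klin_sneg[OF Bar_gab])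
qed

lemma
 assumes l: "set l <= carrier A" "l ~= []"
 shows P_amap: "amap Bar Bar (pres_lift Bar (star l))"
  and P_gen: "r : BL ==> pres_lift Bar (star l) (gen r) = star l r"
 using blift_amap[OF Bar_gab star_klin_r[OF l] refl] blift_gen[OF Bar_gab star_klin_r[OF l] refl] by auto

lemma P_mlin: "y : carrier Bar ==> mlin Bar (%l. pres_lift Bar (star l) y)"
 unfolding mlin_def
proof (intro allI impI, elim conjE)
 fix as bs assume y: "y : carrier Bar" and as: "set as <= carrier A" and bs: "set bs <= carrier A"
 let ?P = "%x. pres_lift Bar (star (as @ x # bs))"
 have Pa: "amap Bar Bar (?P x)" if "x : carrier A" for x using as bs that by (intro P_amap) auto
 have Pg: "?P x (gen r) = star (as @ x # bs) r" if "x : carrier A" "r : BL" for x r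
  using as bs that by (intro P_gen) auto
 have k: "klin Bar (%x. star (as @ x # bs) r)" if "r : BL" for r
  using that as bs by (intro star_klin_l) (auto simp: bar_lists_def)
 have "?P (x \<oplus> x') y = ?P x y \<oplus>\<^bsub>Bar\<^esub> ?P x' y" if x: "x : carrier A" "x' : carrier A" for x x'
  by (rule bar_ext[OF Pa amap_plus[OF Pa Pa] _ y]) (use x k in "auto simp: Pg klin_def dest: amap_add")
 moreover have "?P (c \<odot> x) y = (c \<odot> \<one>) \<odot>\<^bsub>Bar\<^esub> ?P x y" if c: "c : carrier K" "x : carrier A" for c x
  by (rule bar_ext[OF Pa amap_comp[OF Bar_smult_amap[OF scalar_closed[OF c(1)]] Pa] _ y])
    (use c k K_smult in "auto simp: Pg klin_def")
 ultimately show "klin Bar (%x. ?P x y)"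
  using amap_closed[OF Pa y] by (auto simp: klin_def intro!: amapI A.abelian_group_axioms Bar_group)
qed

lemma phi2_amap_l: "y : carrier Bar ==> amap Bar Bar (%x. phi2 x y)"
 unfolding phi2_def by (rule blift_amap[OF Bar_gab P_mlin refl])

lemma phi2_gen1: "y : carrier Bar ==> l : BL ==> phi2 (gen l) y = pres_lift Bar (star l) y"
 unfolding phi2_def by (rule blift_gen[OF Bar_gab P_mlin refl])

lemma BL_D: "l : BL ==> set l <= carrier A" "l : BL ==> l ~= []"
 by (auto simp: bar_lists_def)

lemma phi2_gen: "l : BL ==> r : BL ==> phi2 (gen l) (gen r) = star l r"
 using P_gen[OF BL_D(1)[of l] BL_D(2)[of l], of r] by (simp add: phi2_gen1 gen_closed)

lemma phi2_amap_r: "x : carrier Bar ==> amap Bar Bar (phi2 x)"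
proof (rule amapI[OF Bar_group Bar_group])
 fix y y' assume x: "x : carrier Bar" and y: "y : carrier Bar"
 show "phi2 x y : carrier Bar" by (rule amap_closed[OF phi2_amap_l[OF y] x])
 assume y': "y' : carrier Bar"
 have yy: "y \<oplus>\<^bsub>Bar\<^esub> y' : carrier Bar" using y y' by simp
 show "phi2 x (y \<oplus>\<^bsub>Bar\<^esub> y') = phi2 x y \<oplus>\<^bsub>Bar\<^esub> phi2 x y'"
  by (rule bar_ext[OF phi2_amap_l[OF yy] amap_plus[OF phi2_amap_l[OF y] phi2_amap_l[OF y']] _ x])
    (simp add: phi2_gen1 y y' yy amap_add[OF P_amap] BL_D)
qed

lemma bar_ext2:
 assumes f: "!!y. y : carrier Bar ==> amap Bar H (%x. f x y)" "!!x. x : carrier Bar ==> amap Bar H (f x)"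
  and g: "!!y. y : carrier Bar ==> amap Bar H (%x. g x y)" "!!x. x : carrier Bar ==> amap Bar H (g x)"
  and eq: "!!l r. l : BL ==> r : BL ==> f (gen l) (gen r) = g (gen l) (gen r)"
  and xy: "x : carrier Bar" "y : carrier Bar"
 shows "f x y = g x y"
proof (rule bar_ext[OF f(1) g(1) _ xy(1)])
 fix l assume l: "l : BL"
 show "f (gen l) y = g (gen l) y"
  by (rule bar_ext[OF f(2) g(2) eq[OF l] xy(2)]) (rule gen_closed[OF l])+
qed (rule xy(2))+

lemma star_lmult: "a : carrier A ==> x : carrier A ==> set t <= carrier A ==> t ~= [] ==> r : BL ==>
  star ((a \<otimes> x) # t) r = a \<odot>\<^bsub>Bar\<^esub> star (x # t) r"
 using lst_set[of t r] bg_lmult[of a x "lst t r"]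
 by (simp add: star_def lst_cons BL_D sneg_def amap_neg[OF Bar_smult_amap] bg_closed)

lemma star_rmult: "a : carrier A ==> x : carrier A ==> set t <= carrier A ==> t ~= [] ==> l : BL ==>
  star l (t @ [x \<otimes> a]) = rsmult Bar (star l (t @ [x])) a"
proof -
 assume h: "a : carrier A" "x : carrier A" "set t <= carrier A" "t ~= []" "l : BL"
 have e: "lst l (t @ [u]) = lst l t @ [u]" for u using h by (cases t) (auto simp: lst_def)
 show ?thesis
  using h lst_set[of l t] bg_rmult[of a x "lst l t"]
  by (simp add: star_def e BL_D sneg_def amap_neg[OF Bar_rsmult_amap] bg_closed)
qed

lemma star_bal: "a : carrier A ==> x : carrier A ==> set t <= carrier A ==> y : carrier A ==>
  star (t @ [x \<otimes> a]) (y # r) = star (t @ [x]) ((a \<otimes> y) # r)"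
 by (simp add: star_def lst_def A.m_assoc)

definition \<phi>B :: "('a bar, 'a bar) tens => 'a bar" where "\<phi>B = Bc.tl Bar phi2"

lemma star_grade: "l : BL ==> r : BL ==> n = int (length l) + int (length r) - 3 ==> star l r : grade Bar n"
proof -
 assume h: "l : BL" "r : BL" "n = int (length l) + int (length r) - 3"
 have "2 <= length l" "2 <= length r" using h by (simp_all add: bar_lists_def)
 then have "n = int (length (lst l r)) - 2"
  using lst_length[of l r] BL_D(2)[OF h(1)] BL_D(2)[OF h(2)] h(3) by simp
 then have "bg (lst l r) : grade Bar n"
  using bg_grade[OF lst_set[OF BL_D(1)[OF h(1)] BL_D(2)[OF h(1)] BL_D(1)[OF h(2)] BL_D(2)[OF h(2)]] refl] by simp
 then show ?thesis by (simp add: star_def sneg_def gab_grade_neg[OF Bar_gab])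
qed

lemma phi2_bal: "x : carrier Bar ==> a : carrier A ==> y : carrier Bar ==> phi2 (rsmult Bar x a) y = phi2 x (a \<odot>\<^bsub>Bar\<^esub> y)"
proof (rule bar_ext2[where f = "%x y. phi2 (rsmult Bar x a) y" and g = "%x y. phi2 x (a \<odot>\<^bsub>Bar\<^esub> y)"])
 assume a: "a : carrier A"
 note rm = Bar_rsmult_amap[OF a] and lm = Bar_smult_amap[OF a]
 fix l r assume l: "l : BL" and r: "r : BL"
 obtain t x where lx: "l = t @ [x]" "x : carrier A" "set t <= carrier A" "t ~= []" using l by (cases l rule: rev_cases) (auto simp: BL_snoc)
 obtain y s where ry: "r = y # s" "y : carrier A" "set s <= carrier A" "s ~= []" using r by (cases r) (auto simp: BL_cons)
 show "phi2 (rsmult Bar (gen l) a) (gen r) = phi2 (gen l) (a \<odot>\<^bsub>Bar\<^esub> gen r)"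
  using l r lx ry a by (simp add: Bar_rsmult Bar_smult phi2_gen BL_snoc BL_cons star_bal)
next
 assume a: "a : carrier A"
 note rm = Bar_rsmult_amap[OF a] and lm = Bar_smult_amap[OF a]
 show "amap Bar Bar (%x. phi2 (rsmult Bar x a) y)" if "y : carrier Bar" for y by (rule amap_comp[OF phi2_amap_l[OF that] rm])
 show "amap Bar Bar (phi2 (rsmult Bar x a))" if "x : carrier Bar" for x by (rule phi2_amap_r[OF amap_closed[OF rm that]])
 show "amap Bar Bar (%x. phi2 x (a \<odot>\<^bsub>Bar\<^esub> y))" if "y : carrier Bar" for y by (rule phi2_amap_l[OF amap_closed[OF lm that]])
 show "amap Bar Bar (%y. phi2 x (a \<odot>\<^bsub>Bar\<^esub> y))" if "x : carrier Bar" for x by (rule amap_comp[OF phi2_amap_r[OF that] lm])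
qed

lemma phi2_smult: "x : carrier Bar ==> a : carrier A ==> y : carrier Bar ==> phi2 (a \<odot>\<^bsub>Bar\<^esub> x) y = a \<odot>\<^bsub>Bar\<^esub> phi2 x y"
proof (rule bar_ext2[where f = "%x y. phi2 (a \<odot>\<^bsub>Bar\<^esub> x) y" and g = "%x y. a \<odot>\<^bsub>Bar\<^esub> phi2 x y"])
 assume a: "a : carrier A"
 note lm = Bar_smult_amap[OF a]
 fix l r assume l: "l : BL" and r: "r : BL"
 obtain y s where ry: "l = y # s" "y : carrier A" "set s <= carrier A" "s ~= []" using l by (cases l) (auto simp: BL_cons)
 show "phi2 (a \<odot>\<^bsub>Bar\<^esub> gen l) (gen r) = a \<odot>\<^bsub>Bar\<^esub> phi2 (gen l) (gen r)"
  using l r ry a by (simp add: Bar_smult phi2_gen BL_cons star_lmult)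
next
 assume a: "a : carrier A"
 note lm = Bar_smult_amap[OF a]
 show "amap Bar Bar (%x. phi2 (a \<odot>\<^bsub>Bar\<^esub> x) y)" if "y : carrier Bar" for y by (rule amap_comp[OF phi2_amap_l[OF that] lm])
 show "amap Bar Bar (phi2 (a \<odot>\<^bsub>Bar\<^esub> x))" if "x : carrier Bar" for x by (rule phi2_amap_r[OF amap_closed[OF lm that]])
 show "amap Bar Bar (%x. a \<odot>\<^bsub>Bar\<^esub> phi2 x y)" if "y : carrier Bar" for y by (rule amap_comp[OF lm phi2_amap_l[OF that]])
 show "amap Bar Bar (%y. a \<odot>\<^bsub>Bar\<^esub> phi2 x y)" if "x : carrier Bar" for x by (rule amap_comp[OF lm phi2_amap_r[OF that]])
qed

lemma phi2_rsmult: "x : carrier Bar ==> a : carrier A ==> y : carrier Bar ==> phi2 x (rsmult Bar y a) = rsmult Bar (phi2 x y) a"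
proof (rule bar_ext2[where f = "%x y. phi2 x (rsmult Bar y a)" and g = "%x y. rsmult Bar (phi2 x y) a"])
 assume a: "a : carrier A"
 fix l r assume l: "l : BL" and r: "r : BL"
 obtain t x where lx: "r = t @ [x]" "x : carrier A" "set t <= carrier A" "t ~= []" using r by (cases r rule: rev_cases) (auto simp: BL_snoc)
 show "phi2 (gen l) (rsmult Bar (gen r) a) = rsmult Bar (phi2 (gen l) (gen r)) a"
  using l r lx a by (simp add: Bar_rsmult phi2_gen BL_snoc star_rmult)
next
 assume a: "a : carrier A"
 note rm = Bar_rsmult_amap[OF a]
 show "amap Bar Bar (%x. phi2 x (rsmult Bar y a))" if "y : carrier Bar" for y by (rule phi2_amap_l[OF amap_closed[OF rm that]])
 show "amap Bar Bar (%y. phi2 x (rsmult Bar y a))" if "x : carrier Bar" for x by (rule amap_comp[OF phi2_amap_r[OF that] rm])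
 show "amap Bar Bar (%x. rsmult Bar (phi2 x y) a)" if "y : carrier Bar" for y by (rule amap_comp[OF rm phi2_amap_l[OF that]])
 show "amap Bar Bar (%y. rsmult Bar (phi2 x y) a)" if "x : carrier Bar" for x by (rule amap_comp[OF rm phi2_amap_r[OF that]])
qed

lemma phi2_grade: "x : grade Bar i ==> y : grade Bar j ==> phi2 x y : grade Bar (i + j + 1)"
proof -
 assume x: "x : grade Bar i" and y: "y : grade Bar j"
 show ?thesis
 proof (rule Bar_grade_amap[OF phi2_amap_l[OF gab_grade[OF Bar_gab y]] Bar_gab x])
  fix l assume l: "l : BL" "int (length l) = i + 2"
  show "phi2 (gen l) y : grade Bar (i + j + 1)"
   by (rule Bar_grade_amap[OF phi2_amap_r[OF gen_closed[OF l(1)]] Bar_gab y])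
     (use l in "auto simp: phi2_gen intro!: star_grade")
 qed
qed

lemma \<phi>B_ghom: "ghom A TB Bar 1 \<phi>B"
 unfolding \<phi>B_def
 by (rule Bc.tl_ghom[OF Bar_gab phi2_amap_l phi2_amap_r]) (simp_all add: phi2_bal phi2_smult phi2_rsmult phi2_grade)

lemma \<phi>B_val: "x : carrier Bar ==> y : carrier Bar ==> \<phi>B (tB x y) = phi2 x y"
 unfolding \<phi>B_def
 by (rule Bc.tl_val[OF Bar_gab phi2_amap_l phi2_amap_r, where s = 1]) (simp_all add: phi2_bal phi2_smult phi2_rsmult phi2_grade)

lemma minus_sneg:
 assumes Y: "abelian_group Y" and uvw: "u : carrier Y" "v : carrier Y" "w : carrier Y"
 shows "u \<ominus>\<^bsub>Y\<^esub> (v \<oplus>\<^bsub>Y\<^esub> sneg Y (int k) w) = u \<ominus>\<^bsub>Y\<^esub> v \<oplus>\<^bsub>Y\<^esub> sneg Y (int (Suc k)) w"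
 by (cases "even k"; simp add: sneg_def;
   rule rep_eq[of Y], (rule rep_rules | rule rep_atom | rule Y | rule uvw)+, simp)

text \<open>Every neighbour product of the concatenation belongs to the left or to the right word;
  those involving the joint letter fit by associativity. The sign is the position of the
  joint.\<close>

lemma bdl_lst:
 assumes Y: "abelian_group Y" and "bok Y b" and "set l <= carrier A" "l ~= []" and r: "set r <= carrier A" "r ~= []"
 shows "bdl Y b (lst l r) = bdl Y (%l'. b (lst l' r)) l \<oplus>\<^bsub>Y\<^esub> sneg Y (int (length l - 1)) (bdl Y (%r'. b (lst l r')) r)"
 using assms(2-4)
proof (induction l arbitrary: b rule: induct_list012)
 case (2 x)
 obtain h t where ht: "r = h # t" using r by (cases r) auto
 have x: "x : carrier A" using 2 by simp
 have e: "lst [x] s = (x \<otimes> hd s) # tl s" for s by (simp add: lst_def)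
 have "bok Y (%s. b (lst [x] s))" using 2 lst_set[of "[x]"] by (auto simp: bok_def lst_def)
 then have "bdl Y (%s. b (lst [x] s)) r : carrier Y" by (rule bdl_closed[OF Y _ r(1)])
 then show ?case using bdl_lmult[of x h t Y b] x r ht by (simp add: e sneg_def ag_simps[OF Y])
next
 case (3 x x' l')
 have x: "x : carrier A" "x' : carrier A" "set l' <= carrier A" using 3 by auto
 obtain y zs where w: "lst (x' # l') r = y # zs" by (cases "lst (x' # l') r") (auto simp: lst_def)
 have yz: "set (y # zs) <= carrier A" using lst_set[of "x' # l'" r] x r w by simp
 have h: "hd r : carrier A" using r by (cases r) auto
 have e: "lst ((x \<otimes> x') # l') r = (x \<otimes> y) # zs"
  using w x h by (cases "l' = []") (auto simp: lst_def A.m_assoc)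
 have ih: "bdl Y (%l. b (x # l)) (y # zs) = bdl Y (%l''. b (x # lst l'' r)) (x' # l')
   \<oplus>\<^bsub>Y\<^esub> sneg Y (int (length l')) (bdl Y (%r'. b (x # lst (x' # l') r')) r)"
  using 3(2)[OF bok_cons[OF 3(3) x(1)]] x w by simp
 have c1: "bdl Y (%l''. b (lst (x # l'') r)) (x' # l') = bdl Y (%l''. b (x # lst l'' r)) (x' # l')"
  by (rule bdl_cong) (use x in "auto simp: lst_cons")
 have "bok Y (%l''. b (x # lst l'' r))" "bok Y (%r'. b (x # lst (x' # l') r'))"
  using 3(3) x lst_set r lst_set[of "x' # l'"] by (auto simp: bok_def)
 note bb = this
 have "set (x' # l') <= carrier A" using x by simp
 note cl = bdl_closed[OF Y bb(1) this] bdl_closed[OF Y bb(2) r(1)]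
 have c2: "b ((x \<otimes> y) # zs) : carrier Y" using 3(3) x yz by (auto simp: bok_def)
 show ?case
  using minus_sneg[OF Y c2 cl, of "length l'"] by (simp add: lst_cons w ih e c1)
qed simp

text \<open>Products inside the left word give \<phi>B of the differential of that word, unless it
  has length 2: then its differential is zero, and its only product is absorbed into the right word,
  which is the term with \<open>Bc.mul\<close>. In the same way a right word of length 2 yields the
  term with \<open>Bc.mur\<close>.\<close>

lemma d_\<phi>B_gen:
 assumes l: "l : BL" and r: "r : BL"
 shows "dB (phi2 (gen l) (gen r)) =
  Bc.mul (tB (gen l) (gen r)) \<ominus>\<^bsub>Bar\<^esub> Bc.mur (tB (gen l) (gen r))
  \<ominus>\<^bsub>Bar\<^esub> \<phi>B (Bc.D (tB (gen l) (gen r)))"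
proof -
 note ls = BL_D[OF l] and rs = BL_D[OF r] and gl = gen_closed[OF l] and gr = gen_closed[OF r]
 have l2: "2 <= length l" "2 <= length r" using l r by (auto simp: bar_lists_def)
 let ?X = "bdl Bar (%l'. bg (lst l' r)) l" and ?Y = "bdl Bar (%r'. bg (lst l r')) r"
 have sa: "amap Bar Bar (%x. sneg Bar k x)" for k by (rule amap_sneg[OF amap_id[OF Bar_group]])
 have Xc: "?X : carrier Bar" "?Y : carrier Bar"
  by (rule bdl_closed[OF Bar_group _ ls(1)] bdl_closed[OF Bar_group _ rs(1)],
    use lst_set ls rs in "auto simp: bok_def intro!: bg_closed")+
 have 1: "dB (phi2 (gen l) (gen r)) = sneg Bar (int (length l)) (?X \<oplus>\<^bsub>Bar\<^esub> sneg Bar (int (length l - 1)) ?Y)"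
 proof -
  have "lst l r ~= []" by (simp add: lst_def)
  then have "dB (bg (lst l r)) = ?X \<oplus>\<^bsub>Bar\<^esub> sneg Bar (int (length l - 1)) ?Y"
   using lst_set[OF ls rs] by (simp add: dB_bg bdl_lst[OF Bar_group bok_bg ls rs])
  moreover have "dB (sneg Bar k z) = sneg Bar k (dB z)" if "z : carrier Bar" for k z
   using that by (simp add: sneg_def)
  ultimately show ?thesis using lst_set[OF ls rs] by (simp add: phi2_gen l r star_def bg_closed)
 qed
 have L: "sneg Bar (int (length l)) ?X = Bc.mul (tB (gen l) (gen r)) \<ominus>\<^bsub>Bar\<^esub> \<phi>B (tB (dB (gen l)) (gen r))"
 proof (cases "length l = 2")
  case True
  then obtain x y where xy: "l = [x, y]" "x : carrier A" "y : carrier A" using BL_length2[OF l] by auto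
  obtain h t where ht: "r = h # t" "h : carrier A" "set t <= carrier A" "t ~= []" using r by (cases r) (auto simp: BL_cons)
  have "dB (gen l) = \<zero>\<^bsub>Bar\<^esub>" using l xy by (simp add: dB_gen bg_def a_minus_def)
  moreover have "\<mu>B (gen l) = x \<otimes> y" using \<mu>B_gen[OF l] xy by simp
  moreover have b: "(x \<otimes> y \<otimes> h) # t : BL" using xy ht by (simp add: BL_cons)
  moreover have X: "?X = gen ((x \<otimes> y \<otimes> h) # t)"
   using xy ht b gen_closed[OF b] by (simp add: lst_def a_minus_def bg_closed ag_simps[OF Bar_group])
  moreover have "phi2 \<zero>\<^bsub>Bar\<^esub> (gen r) = \<zero>\<^bsub>Bar\<^esub>" by (rule amap_zero[OF phi2_amap_l[OF gr]])
  ultimately show ?thesis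
   using True xy(2,3) ht gr gl gen_closed[OF b] unfolding X
   by (simp add: sneg_def Bar_smult \<phi>B_val a_minus_def ghomD(6)[OF \<phi>B_ghom])
 next
  case False
  have "phi2 (bdl Bar bg l) (gen r) = bdl Bar (%l'. phi2 (bg l') (gen r)) l"
   by (rule bdl_amap[OF phi2_amap_l[OF gr] bok_bg ls(1)])
  also have "\<dots> = bdl Bar (%l'. sneg Bar (int (length l) - 1) (bg (lst l' r))) l"
  proof (rule bdl_cong[OF _ ls(1)])
   fix l' :: "'a list" assume h: "set l' <= carrier A" "length l' = length l - 1"
   then have "l' : BL" using False l2 by (auto simp: bar_lists_def)
   then show "phi2 (bg l') (gen r) = sneg Bar (int (length l) - 1) (bg (lst l' r))"
    using h l2 r by (simp add: phi2_gen star_def of_nat_diff)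
  qed
  also have "\<dots> = sneg Bar (int (length l) - 1) ?X"
   by (rule bdl_amap[OF sa _ ls(1), symmetric]) (use lst_set rs in "auto simp: bok_def intro!: bg_closed")
  finally have e: "phi2 (dB (gen l)) (gen r) = sneg Bar (int (length l) - 1) ?X" by (simp add: dB_gen l)
  have "\<mu>B (gen l) = \<zero>" using \<mu>B_gen[OF l] False by simp
  then show ?thesis using gl gr Xc by (simp add: \<phi>B_val e) (simp add: sneg_def a_minus_def)
 qed
 have R: "?Y = Bc.mur (tB (gen l) (gen r)) \<oplus>\<^bsub>Bar\<^esub> \<phi>B (tB (sgnmap Bar 1 (gen l)) (dB (gen r)))"
 proof (cases "length r = 2")
  case True
  then obtain x y where xy: "r = [x, y]" "x : carrier A" "y : carrier A" using BL_length2[OF r] by auto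
  obtain h t where ht: "l = t @ [h]" "h : carrier A" "set t <= carrier A" "t ~= []" using l by (cases l rule: rev_cases) (auto simp: BL_snoc)
  have "dB (gen r) = \<zero>\<^bsub>Bar\<^esub>" using r xy by (simp add: dB_gen bg_def a_minus_def)
  moreover have "\<mu>B (gen r) = x \<otimes> y" using \<mu>B_gen[OF r] xy by simp
  moreover have b: "t @ [h \<otimes> (x \<otimes> y)] : BL" using ht xy by (simp add: BL_snoc)
  moreover have Y: "?Y = gen (t @ [h \<otimes> (x \<otimes> y)])"
   using xy ht b gen_closed[OF b] by (simp add: lst_def a_minus_def bg_closed ag_simps[OF Bar_group])
  ultimately show ?thesis
   using True xy(2,3) ht gr gl gen_closed[OF b] unfolding Y
   by (simp add: Bar_rsmult \<phi>B_val ghomD(6)[OF \<phi>B_ghom])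
 next
  case False
  have s: "sgnmap Bar 1 (gen l) = sneg Bar (int (length l)) (gen l)" using \<sigma>_bg[OF ls(1)] l by simp
  have "phi2 (sneg Bar (int (length l)) (gen l)) (bdl Bar bg r) = bdl Bar (%r'. phi2 (sneg Bar (int (length l)) (gen l)) (bg r')) r"
   by (rule bdl_amap[OF phi2_amap_r bok_bg rs(1)]) (use gl in simp)
  also have "\<dots> = ?Y"
  proof (rule bdl_cong[OF _ rs(1)])
   fix r' :: "'a list" assume h: "set r' <= carrier A" "length r' = length r - 1"
   then have r': "r' : BL" using False l2 by (auto simp: bar_lists_def)
   have "phi2 (sneg Bar k (gen l)) (gen r') = sneg Bar k (phi2 (gen l) (gen r'))" for k
    using gl gen_closed[OF r'] by (simp add: sneg_def amap_neg[OF phi2_amap_l])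
   then show "phi2 (sneg Bar (int (length l)) (gen l)) (bg r') = bg (lst l r')"
    using l r' lst_set[OF ls BL_D[OF r']] by (simp add: phi2_gen star_def) (simp add: sneg_def bg_closed)
  qed
  finally have e: "phi2 (sneg Bar (int (length l)) (gen l)) (dB (gen r)) = ?Y" by (simp add: dB_gen r)
  have "\<mu>B (gen r) = \<zero>" using \<mu>B_gen[OF r] False by simp
  then show ?thesis using gl gr Xc by (simp add: \<phi>B_val s e)
 qed
 define a where "a = Bc.mul (tB (gen l) (gen r))"
 define b where "b = Bc.mur (tB (gen l) (gen r))"
 define u where "u = \<phi>B (tB (dB (gen l)) (gen r))"
 define w where "w = \<phi>B (tB (sgnmap Bar 1 (gen l)) (dB (gen r)))"
 note fc = ghomD(4)[OF \<phi>B_ghom]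
 have c: "a : carrier Bar" "b : carrier Bar" "u : carrier Bar" "w : carrier Bar"
  using gl gr by (simp_all add: a_def b_def u_def w_def fc del: Bc.mul_val Bc.mur_val)
 have "dB (phi2 (gen l) (gen r)) = sneg Bar (int (length l)) ?X \<ominus>\<^bsub>Bar\<^esub> ?Y"
  unfolding 1 using Xc l2 by (cases "even (length l)"; simp add: sneg_def a_minus_def Bar.minus_add Bar.minus_minus)
 also have "\<dots> = (a \<ominus>\<^bsub>Bar\<^esub> u) \<ominus>\<^bsub>Bar\<^esub> (b \<oplus>\<^bsub>Bar\<^esub> w)" unfolding L R a_def b_def u_def w_def ..
 also have "\<dots> = a \<ominus>\<^bsub>Bar\<^esub> b \<ominus>\<^bsub>Bar\<^esub> (u \<oplus>\<^bsub>Bar\<^esub> w)"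
  by (rule rep_eq[of Bar], (rule rep_rules | rule rep_atom | rule Bar_group | rule c)+, simp)
 also have "u \<oplus>\<^bsub>Bar\<^esub> w = \<phi>B (Bc.D (tB (gen l) (gen r)))"
  using gl gr by (simp add: u_def w_def ghomD(5)[OF \<phi>B_ghom])
 finally show ?thesis unfolding a_def b_def .
qed

lemma bar_bdata: "bdata K A Bar dB \<mu>B \<Delta>B \<phi>B id"
proof (intro bdata.intro Bc.cplx_axioms bdata_axioms.intro)
 show "dB (\<phi>B z) = id (Bc.mul z) \<ominus>\<^bsub>Bar\<^esub> Bc.mur z \<ominus>\<^bsub>Bar\<^esub> \<phi>B (Bc.D z)" if z: "z : carrier TB" for z
 proof (rule Bc.T.T_ext[OF _ _ _ z])
  note p = ghom_amap[OF \<phi>B_ghom]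
  show f: "amap TB Bar (%z. dB (\<phi>B z))" by (rule amap_comp[OF dB_amap p])
  show g: "amap TB Bar (%z. id (Bc.mul z) \<ominus>\<^bsub>Bar\<^esub> Bc.mur z \<ominus>\<^bsub>Bar\<^esub> \<phi>B (Bc.D z))"
   unfolding id_apply by (intro amap_diff ghom_amap[OF Bc.mul_ghom] ghom_amap[OF Bc.mur_ghom] amap_comp[OF p ghom_amap[OF Bc.D_ghom]])
  note pl = Bc.T.pt_amap_l and pr = Bc.T.pt_amap_r
  show "dB (\<phi>B (tB x y)) = id (Bc.mul (tB x y)) \<ominus>\<^bsub>Bar\<^esub> Bc.mur (tB x y) \<ominus>\<^bsub>Bar\<^esub> \<phi>B (Bc.D (tB x y))"
   if "x : carrier Bar" "y : carrier Bar" for x y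
   by (rule bar_ext2[where f = "%x y. dB (\<phi>B (tB x y))" and g = "%x y. id (Bc.mul (tB x y)) \<ominus>\<^bsub>Bar\<^esub> Bc.mur (tB x y) \<ominus>\<^bsub>Bar\<^esub> \<phi>B (Bc.D (tB x y))",
      OF amap_comp[OF f pl] amap_comp[OF f pr] amap_comp[OF g pl] amap_comp[OF g pr] _ that])
     (simp_all only: \<phi>B_val gen_closed id_apply d_\<phi>B_gen)
 qed
qed (use \<Delta>B_ghom D_\<Delta>B \<phi>B_ghom ghom_id[OF Bar_gab] mul_\<Delta>B mur_\<Delta>B in "auto simp: id_def")

end

section \<open>Lifting from the bar complex and from projectives\<close>

text \<open>Linearity over the field is the common ground of the two contractions used: that of the
  resolution is linear for the left action, that of the bar complex, which prepends
  \<open>\<one>\<close>, is not.\<close>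

locale contracted = cplx K A Q d \<mu> for K :: "'k ring" and A :: "('k, 'a) module" (structure) and Q :: "('a, 'q) graded_bimodule"
  and d \<mu> +
 fixes t :: "'q => 'q" and \<eta> :: "'a => 'q"
 assumes t_amap: "amap Q Q t"
  and t_scal: "!!c y. c : carrier K ==> y : carrier Q ==> t ((c \<odot> \<one>) \<odot>\<^bsub>Q\<^esub> y) = (c \<odot> \<one>) \<odot>\<^bsub>Q\<^esub> t y"
  and t_grade: "!!n y. y : grade Q n ==> t y : grade Q (n + 1)"
  and t_split: "!!y. y : carrier Q ==> d y = \<zero>\<^bsub>Q\<^esub> ==> \<mu> y = \<zero> ==> d (t y) = y"
  and \<eta>_amap: "amap (regular A) Q \<eta>"
  and \<eta>_scal: "!!c a. c : carrier K ==> a : carrier A ==> \<eta> ((c \<odot> \<one>) \<otimes> a) = (c \<odot> \<one>) \<odot>\<^bsub>Q\<^esub> \<eta> a"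
  and \<eta>_grade: "!!a. a : carrier A ==> \<eta> a : grade Q 0"
  and \<mu>\<eta>: "!!a. a : carrier A ==> \<mu> (\<eta> a) = a"
begin

lemma \<mu>t: "y : grade Q j ==> \<mu> (t y) = \<zero>"
proof (cases "j + 1 = 0")
 case True
 assume "y : grade Q j"
 then have "y = \<zero>\<^bsub>Q\<^esub>" using neg_grade[of j y] True by simp
 then show ?thesis using amap_zero[OF t_amap] by simp
next
 case False
 assume "y : grade Q j"
 then have "\<mu> (t y) : grade (regular A) (j + 1 + 0)" by (rule chomD(1)[OF chom_ghom[OF \<mu>_ghom refl] t_grade])
 then show ?thesis using False by simp
qed

end

lemma chom_neg:
 assumes M: "gab A M" and N: "gab A N" and f: "chom A M N i j f" and x: "x : grade M i"
 shows "f (\<ominus>\<^bsub>M\<^esub> x) = \<ominus>\<^bsub>N\<^esub> f x"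
proof -
 interpret M: abelian_group M by (rule gab_group[OF M])
 interpret N: abelian_group N by (rule gab_group[OF N])
 note nx = gab_grade_neg[OF M x]
 have "f (\<ominus>\<^bsub>M\<^esub> x) \<oplus>\<^bsub>N\<^esub> f x = f (\<ominus>\<^bsub>M\<^esub> x \<oplus>\<^bsub>M\<^esub> x)" using chomD(2)[OF f nx x] by simp
 also have "\<dots> = \<zero>\<^bsub>N\<^esub>" using chom_zero[OF M N f] gab_grade[OF M x] by (simp add: M.l_neg)
 finally show ?thesis
  using N.minus_equality[of "f (\<ominus>\<^bsub>M\<^esub> x)" "f x"] gab_grade[OF N chomD(1)[OF f x]] gab_grade[OF N chomD(1)[OF f nx]] by simp
qed

context bar_alg begin

lemma klin_smult_arg:
 assumes N: "bimod K A N" and y: "y : carrier N"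
 shows "klin N (%x. x \<odot>\<^bsub>N\<^esub> y)" "klin N (%x. rsmult N y x)"
proof -
 have 1: "amap A N (%x. x \<odot>\<^bsub>N\<^esub> y)" "amap A N (%x. rsmult N y x)"
  by (rule amapI[OF A.abelian_group_axioms bimodD(1)[OF N]]; simp add: y bimodD(2,3,6,7)[OF N])+
 have "(c \<odot> x) \<odot>\<^bsub>N\<^esub> y = (c \<odot> \<one>) \<odot>\<^bsub>N\<^esub> (x \<odot>\<^bsub>N\<^esub> y)"
  "rsmult N y (c \<odot> x) = (c \<odot> \<one>) \<odot>\<^bsub>N\<^esub> rsmult N y x" if c: "c : carrier K" and x: "x : carrier A" for c x
  unfolding scalar_mult[OF c x, symmetric]
  using y x scalar_closed[OF c] by (simp_all add: bimodD(8,9)[OF N] bimodD(13)[OF N c, symmetric] bimodD(10)[OF N])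
 then show "klin N (%x. x \<odot>\<^bsub>N\<^esub> y)" "klin N (%x. rsmult N y x)" using 1 by (simp_all add: klin_def)
qed

text \<open>In degree \<open>i\<close> the bar complex is the free bimodule on the tensor power of
  length \<open>i\<close>, so a bimodule map may be prescribed on the words with outer letters
  \<open>\<one>\<close>, linearly over the field. \<open>F\<close> is allowed to ignore the bimodule
  structure, as a contraction does.\<close>

lemma bar_chom:
 fixes N :: "('a, 'n) graded_bimodule"
 assumes N: "graded_bimod K A N"
  and F: "!!x. x : grade Bar i ==> F x : grade N j"
  and F_add: "!!x y. x : grade Bar i ==> y : grade Bar i ==> F (x \<oplus>\<^bsub>Bar\<^esub> y) = F x \<oplus>\<^bsub>N\<^esub> F y"
  and F_scal: "!!c x. c : carrier K ==> x : grade Bar i ==> F ((c \<odot> \<one>) \<odot>\<^bsub>Bar\<^esub> x) = (c \<odot> \<one>) \<odot>\<^bsub>N\<^esub> F x"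
 shows "EX k. chom A Bar N i j k & (ALL a:carrier A. ALL b:carrier A. ALL m. set m <= carrier A & int (length m) = i -->
   k (gen (a # m @ [b])) = a \<odot>\<^bsub>N\<^esub> rsmult N (F (bg (\<one> # m @ [\<one>]))) b)"
proof -
 note Nb = graded_bimodD[OF N] and Ng = gab_graded_bimod[OF N]
 define b where "b l = (if 2 <= length l & int (length l) = i + 2
  then hd l \<odot>\<^bsub>N\<^esub> rsmult N (F (bg (\<one> # butlast (tl l) @ [\<one>]))) (last l) else \<zero>\<^bsub>N\<^esub>)" for l
 have Fg: "F (bg (\<one> # m @ [\<one>])) : grade N j" if "set m <= carrier A" "int (length m) = i" for m
  using that by (intro F bg_grade) auto
 note Fc = gab_grade[OF Ng Fg]
 have m: "mlin N b"
  unfolding mlin_def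
 proof (intro allI impI, elim conjE)
  fix p q assume p: "set p <= carrier A" and q: "set q <= carrier A"
  show "klin N (%x. b (p @ x # q))"
  proof (cases "2 <= length (p @ \<one> # q) & int (length (p @ \<one> # q)) = i + 2")
   case False
   then have "b (p @ x # q) = \<zero>\<^bsub>N\<^esub>" for x unfolding b_def by (intro if_not_P) simp
   then show ?thesis using klin_zero[OF Ng] by simp
  next
   case True
   \<comment> \<open>The varying slot is the left end, the right end, or an inner letter; only in
     the last case does it pass through \<open>F\<close>.\<close>
   consider (h) m y where "p = []" "q = m @ [y]" | (l) y m where "p = y # m" "q = []"
    | (m) y m z m' where "p = y # m" "q = m' @ [z]"
    using True by (cases p; cases q rule: rev_cases) auto
   then show ?thesis
   proof cases
    case h
    then have "(%x. b (p @ x # q)) = (%x. x \<odot>\<^bsub>N\<^esub> rsmult N (F (bg (\<one> # m @ [\<one>]))) y)"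
     using True by (simp add: b_def fun_eq_iff)
    then show ?thesis using h q True by (simp add: klin_smult_arg[OF Nb] bimodD(3)[OF Nb] Fc)
   next
    case l
    then have "(%x. b (p @ x # q)) = (%x. y \<odot>\<^bsub>N\<^esub> rsmult N (F (bg (\<one> # m @ [\<one>]))) x)"
     using True by (simp add: b_def fun_eq_iff)
    moreover have "klin N (%x. y \<odot>\<^bsub>N\<^esub> rsmult N (F (bg (\<one> # m @ [\<one>]))) x)"
    proof (rule klin_comp[OF klin_smult_arg(2)[OF Nb] gab_smult[OF Ng]])
     show "F (bg (\<one> # m @ [\<one>])) : carrier N" "y : carrier A" using l p True by (auto intro!: Fc)
     then show "y \<odot>\<^bsub>N\<^esub> ((c \<odot> \<one>) \<odot>\<^bsub>N\<^esub> z) = (c \<odot> \<one>) \<odot>\<^bsub>N\<^esub> (y \<odot>\<^bsub>N\<^esub> z)" if "c : carrier K" "z : carrier N" for c z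
      using that scalar_closed by (simp add: bimodD(8)[OF Nb, symmetric] scalar_central)
    qed
    ultimately show ?thesis by simp
   next
    case m
    let ?g = "%x. F (bg ((\<one> # m) @ x # (m' @ [\<one>])))"
    have e: "(%x. b (p @ x # q)) = (%x. y \<odot>\<^bsub>N\<^esub> rsmult N (?g x) z)"
     using True m by (simp add: b_def fun_eq_iff butlast_append)
    have kb: "klin Bar (%x. bg ((\<one> # m) @ x # (m' @ [\<one>])))" by (rule klin_bg) (use m p q in auto)
    have gr: "bg ((\<one> # m) @ x # (m' @ [\<one>])) : grade Bar i" if "x : carrier A" for x
     by (rule bg_grade) (use that m p q True in auto)
    have "?g x : carrier N" if "x : carrier A" for x by (rule gab_grade[OF Ng F[OF gr[OF that]]])
    note gcl = this
    have "?g (u \<oplus> v) = ?g u \<oplus>\<^bsub>N\<^esub> ?g v" if "u : carrier A" "v : carrier A" for u v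
     using amap_add[OF klin_amap[OF kb] that] F_add[OF gr gr, OF that] by simp
    then have "amap A N ?g" using gcl by (intro amapI A.abelian_group_axioms gab_group[OF Ng])
    moreover have "?g (c \<odot> u) = (c \<odot> \<one>) \<odot>\<^bsub>N\<^esub> ?g u" if "c : carrier K" "u : carrier A" for c u
     using kb that F_scal[OF that(1) gr[OF that(2)]] by (simp add: klin_def)
    ultimately have gk: "klin N ?g" by (simp add: klin_def)
    have y: "y : carrier A" "z : carrier A" using m p q by auto
    have "klin N (%x. y \<odot>\<^bsub>N\<^esub> rsmult N (?g x) z)"
    proof (rule klin_comp[OF gk])
     show "amap N N (%w. y \<odot>\<^bsub>N\<^esub> rsmult N w z)" by (rule amap_comp[OF gab_smult[OF Ng y(1)] gab_rsmult[OF Ng y(2)]])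
     show "y \<odot>\<^bsub>N\<^esub> rsmult N ((c \<odot> \<one>) \<odot>\<^bsub>N\<^esub> w) z = (c \<odot> \<one>) \<odot>\<^bsub>N\<^esub> (y \<odot>\<^bsub>N\<^esub> rsmult N w z)"
      if "c : carrier K" "w : carrier N" for c w
      using that y scalar_closed by (simp add: bimodD(10)[OF Nb] bimodD(8)[OF Nb, symmetric] bimodD(3)[OF Nb] scalar_central)
    qed
    then show ?thesis using e by simp
   qed
  qed
 qed
 let ?k = "pres_lift N b"
 note ka = blift_amap[OF Ng m refl] and kg = blift_gen[OF Ng m refl]
 have val: "b (a # m @ [c]) = a \<odot>\<^bsub>N\<^esub> rsmult N (F (bg (\<one> # m @ [\<one>]))) c" if "int (length m) = i" for a m c
  using that by (simp add: b_def)
 have "chom A Bar N i j ?k"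
 proof (rule chomI)
  note Bc' = gab_grade[OF Bar_gab]
  fix x assume x: "x : grade Bar i"
  show "?k x : grade N j"
  proof (rule Bar_grade_amap[OF ka Ng x])
   fix l assume l: "l : BL" "int (length l) = i + 2"
   obtain a m c where a: "l = a # m @ [c]" "a : carrier A" "set m <= carrier A" "c : carrier A" by (rule BL_cases[OF l(1)])
   have "b l : grade N j" using a l(2) Fg[of m] by (simp add: val graded_bimod_smult[OF N])
   then show "?k (gen l) : grade N j" by (simp add: kg l)
  qed
  show "?k (x \<oplus>\<^bsub>Bar\<^esub> y) = ?k x \<oplus>\<^bsub>N\<^esub> ?k y" if "y : grade Bar i" for y
   by (rule amap_add[OF ka Bc'[OF x] Bc'[OF that]])
  fix a assume a: "a : carrier A"
  have bc: "b l : carrier N" if "l : BL" for l using amap_closed[OF ka gen_closed[OF that]] kg[OF that] by simp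
  show "?k (a \<odot>\<^bsub>Bar\<^esub> x) = a \<odot>\<^bsub>N\<^esub> ?k x"
  proof (rule bar_ext[OF amap_comp[OF ka Bar_smult_amap[OF a]] amap_comp[OF gab_smult[OF Ng a] ka] _ Bc'[OF x]])
   fix l assume l: "l : BL"
   then obtain u m c where u: "l = u # m @ [c]" "u : carrier A" "set m <= carrier A" "c : carrier A" by (rule BL_cases)
   then have "b ((a \<otimes> u) # m @ [c]) = a \<odot>\<^bsub>N\<^esub> b l"
    using a Fc[of m] by (cases "int (length m) = i") (simp_all add: b_def bimodD(8)[OF Nb] bimodD(3)[OF Nb] amap_zero[OF gab_smult[OF Ng a]])
   then show "?k (a \<odot>\<^bsub>Bar\<^esub> gen l) = a \<odot>\<^bsub>N\<^esub> ?k (gen l)"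
    using l u a by (simp add: Bar_smult kg BL_cons)
  qed
  show "?k (rsmult Bar x a) = rsmult N (?k x) a"
  proof (rule bar_ext[OF amap_comp[OF ka Bar_rsmult_amap[OF a]] amap_comp[OF gab_rsmult[OF Ng a] ka] _ Bc'[OF x]])
   fix l assume l: "l : BL"
   then obtain u m c where u: "l = u # m @ [c]" "u : carrier A" "set m <= carrier A" "c : carrier A" by (rule BL_cases)
   then have "b ((u # m) @ [c \<otimes> a]) = rsmult N (b l) a"
    using a Fc[of m] by (cases "int (length m) = i") (simp_all add: b_def bimodD(9,10)[OF Nb] bimodD(3)[OF Nb] amap_zero[OF gab_rsmult[OF Ng a]])
   moreover have "(u # m) @ [c \<otimes> a] : BL" "u # m @ [c] : BL" using u a by (auto simp: BL_snoc BL_cons)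
   moreover have "rsmult Bar (gen ((u # m) @ [c])) a = gen ((u # m) @ [c \<otimes> a])"
    using u a by (intro Bar_rsmult) (auto simp: BL_snoc)
   ultimately show "?k (rsmult Bar (gen l) a) = rsmult N (?k (gen l)) a"
    using u(1) by (simp add: kg)
  qed
 qed
 moreover have "?k (gen (a # m @ [c])) = a \<odot>\<^bsub>N\<^esub> rsmult N (F (bg (\<one> # m @ [\<one>]))) c"
  if "a : carrier A" "c : carrier A" "set m <= carrier A" "int (length m) = i" for a m c
  using kg[of "a # m @ [c]"] val[of m a c] that by (simp add: BL_cons)
 ultimately show ?thesis by blast
qed

lemma chom_gen:
 assumes z: "chom A Bar N i j z" and "a : carrier A" "b : carrier A" "set m <= carrier A" "int (length m) = i"
 shows "a \<odot>\<^bsub>N\<^esub> rsmult N (z (bg (\<one> # m @ [\<one>]))) b = z (gen (a # m @ [b]))"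
proof -
 have g: "bg (\<one> # m @ [\<one>]) : grade Bar i" "bg (\<one> # m @ [b]) : grade Bar i"
  using assms by (auto intro!: bg_grade)
 have "rsmult Bar (bg (\<one> # m @ [\<one>])) b = bg (\<one> # m @ [b])"
  using bg_rmult[of b "\<one>" "\<one> # m"] assms by simp
 moreover have "a \<odot>\<^bsub>Bar\<^esub> bg (\<one> # m @ [b]) = gen (a # m @ [b])"
  using bg_lmult[of a "\<one>" "m @ [b]"] assms by (simp add: BL_cons)
 ultimately show ?thesis using chomD(3)[OF z g(2) assms(2)] chomD(4)[OF z g(1) assms(3)] by simp
qed

text \<open>The lift is prescribed by the contraction of the target on words with outer letters
  \<open>\<one>\<close>. The splitting property makes it a lift there, and bimodule linearity does
  the rest.\<close>

lemma bar_lifting: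
 fixes N :: "('a, 'n) graded_bimodule"
 assumes C: "contracted K A N dN \<mu>N t \<eta>"
 shows "lifting K A Bar dB \<mu>B N dN \<mu>N"
proof -
 interpret N: contracted K A N dN \<mu>N t \<eta> by (rule C)
 note Ng = N.Q_gab and Nb = graded_bimodD[OF N.Q_graded] and gr = gab_grade[OF N.Q_gab]
 show ?thesis
 proof (intro lifting.intro Bc.cplx_axioms N.cplx_axioms lifting_axioms.intro)
  fix i j z assume z: "chom A Bar N i j z" and zz: "ALL x:grade Bar i. dN (z x) = \<zero>\<^bsub>N\<^esub> & \<mu>N (z x) = \<zero>"
  note zc = gr[OF chomD(1)[OF z]]
  have "t (z (x \<oplus>\<^bsub>Bar\<^esub> y)) = t (z x) \<oplus>\<^bsub>N\<^esub> t (z y)" if "x : grade Bar i" "y : grade Bar i" for x y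
   using that zc by (simp add: chomD(2)[OF z] amap_add[OF N.t_amap])
  moreover have "t (z ((c \<odot> \<one>) \<odot>\<^bsub>Bar\<^esub> x)) = (c \<odot> \<one>) \<odot>\<^bsub>N\<^esub> t (z x)" if "c : carrier K" "x : grade Bar i" for c x
   using that zc by (simp add: chomD(3)[OF z] scalar_closed N.t_scal)
  ultimately obtain k where k: "chom A Bar N i (j + 1) k"
   and kv: "ALL a:carrier A. ALL b:carrier A. ALL m. set m <= carrier A & int (length m) = i -->
    k (gen (a # m @ [b])) = a \<odot>\<^bsub>N\<^esub> rsmult N (t (z (bg (\<one> # m @ [\<one>])))) b"
   using bar_chom[OF N.Q_graded, of i "%x. t (z x)" "j + 1"] N.t_grade[OF chomD(1)[OF z]] by blast
  have kc: "k x : carrier N" "z x : carrier N" if "x : grade Bar i" for x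
   using chomD(1)[OF k that] chomD(1)[OF z that] gr by auto
  have "dN (k x) = z x & \<mu>N (k x) = \<zero>" if "x : grade Bar i" for x
   using that
  proof (induction rule: grade_Bar_induct)
   case zero
   then show ?case by (simp add: chom_zero[OF Bar_gab Ng k] chom_zero[OF Bar_gab Ng z])
  next
   case (gen l)
   obtain a m c where l: "l = a # m @ [c]" "a : carrier A" "set m <= carrier A" "c : carrier A" by (rule BL_cases[OF gen(1)])
   have ml: "int (length m) = i" using gen(2) l by simp
   have g: "bg (\<one> # m @ [\<one>]) : grade Bar i" using l ml by (auto intro!: bg_grade)
   have cl: "t (z (bg (\<one> # m @ [\<one>]))) : carrier N" by (rule gr[OF N.t_grade[OF chomD(1)[OF z g]]])
   have kk: "k (gen l) = a \<odot>\<^bsub>N\<^esub> rsmult N (t (z (bg (\<one> # m @ [\<one>])))) c" using kv l ml by simp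
   have "dN (k (gen l)) = a \<odot>\<^bsub>N\<^esub> rsmult N (z (bg (\<one> # m @ [\<one>]))) c"
    unfolding kk using l(2,4) cl zz g kc(2)[OF g] by (simp add: bimodD(3)[OF Nb] N.t_split)
   also have "\<dots> = z (gen l)" using chom_gen[OF z l(2,4,3) ml] l by simp
   finally show ?case using l(2,4) cl N.\<mu>t[OF chomD(1)[OF z g]] unfolding kk by (simp add: bimodD(3)[OF Nb])
  next
   case (neg x)
   then show ?case by (simp add: chom_neg[OF Bar_gab Ng k] chom_neg[OF Bar_gab Ng z] kc A.minus_zero)
  next
   case (add x y)
   then show ?case by (simp add: chomD(2)[OF k] chomD(2)[OF z] kc)
  qed
  with k show "EX k. chom A Bar N i (j + 1) k & (ALL x:grade Bar i. dN (k x) = z x & \<mu>N (k x) = \<zero>)" by blast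
 next
  fix \<alpha> assume a: "chom A Bar (regular A) 0 0 \<alpha>"
  have ac: "\<alpha> x : carrier A" if "x : grade Bar 0" for x using chomD(1)[OF a that] by simp
  have "\<eta> (\<alpha> (x \<oplus>\<^bsub>Bar\<^esub> y)) = \<eta> (\<alpha> x) \<oplus>\<^bsub>N\<^esub> \<eta> (\<alpha> y)" if "x : grade Bar 0" "y : grade Bar 0" for x y
   using that ac amap_add[OF N.\<eta>_amap, of "\<alpha> x" "\<alpha> y"] by (simp add: chomD(2)[OF a])
  moreover have "\<eta> (\<alpha> ((c \<odot> \<one>) \<odot>\<^bsub>Bar\<^esub> x)) = (c \<odot> \<one>) \<odot>\<^bsub>N\<^esub> \<eta> (\<alpha> x)" if "c : carrier K" "x : grade Bar 0" for c x
   using that ac by (simp add: chomD(3)[OF a] scalar_closed N.\<eta>_scal)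
  ultimately obtain k where k: "chom A Bar N 0 0 k"
   and kv: "ALL a:carrier A. ALL b:carrier A. ALL m. set m <= carrier A & int (length m) = 0 -->
    k (gen (a # m @ [b])) = a \<odot>\<^bsub>N\<^esub> rsmult N (\<eta> (\<alpha> (bg (\<one> # m @ [\<one>])))) b"
   using bar_chom[OF N.Q_graded, of 0 "%x. \<eta> (\<alpha> x)" 0] N.\<eta>_grade[OF ac] by blast
  have kc: "k x : carrier N" if "x : grade Bar 0" for x using chomD(1)[OF k that] gr by auto
  have "\<mu>N (k x) = \<alpha> x" if "x : grade Bar 0" for x
   using that
  proof (induction rule: grade_Bar_induct)
   case zero
   then show ?case using chom_zero[OF Bar_gab regular_gab a] by (simp add: chom_zero[OF Bar_gab Ng k])
  next
   case (gen l)
   obtain u m c where l: "l = u # m @ [c]" "u : carrier A" "set m <= carrier A" "c : carrier A" by (rule BL_cases[OF gen(1)])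
   have ml: "int (length m) = 0" using gen(2) l by simp
   have g: "bg (\<one> # m @ [\<one>]) : grade Bar 0" using l ml by (auto intro!: bg_grade)
   have cl: "\<eta> (\<alpha> (bg (\<one> # m @ [\<one>]))) : carrier N" by (rule gr[OF N.\<eta>_grade[OF ac[OF g]]])
   have kk: "k (gen l) = u \<odot>\<^bsub>N\<^esub> rsmult N (\<eta> (\<alpha> (bg (\<one> # m @ [\<one>])))) c" using kv l ml by simp
   have "\<mu>N (k (gen l)) = u \<otimes> (\<alpha> (bg (\<one> # m @ [\<one>])) \<otimes> c)"
    unfolding kk using l(2,4) cl ac[OF g] by (simp add: bimodD(3)[OF Nb] N.\<mu>\<eta>)
   also have "\<dots> = \<alpha> (gen l)" using chom_gen[OF a l(2,4,3) ml] l by simp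
   finally show ?case .
  next
   case (neg x)
   then show ?case using chom_neg[OF Bar_gab regular_gab a] by (simp add: chom_neg[OF Bar_gab Ng k] kc)
  next
   case (add x y)
   then show ?case using chomD(2)[OF a] by (simp add: chomD(2)[OF k] kc)
  qed
  with k show "EX k. chom A Bar N 0 0 k & (ALL x:grade Bar 0. \<mu>N (k x) = \<alpha> x)" by blast
 qed
qed

end

section \<open>Free bimodules and the lifting property of projectives\<close>

locale free_bimodule = alg K A for K :: "'k ring" and A :: "('k, 'a) module" (structure) +
 fixes Q :: "('a, 'm) graded_bimodule"
 assumes Q: "bimod K A Q"
begin

definition "U = carrier A \<times> carrier Q \<times> carrier A"

text \<open>Nothing is imposed on the middle entry: this presents the free bimodule on the
  underlying set of \<open>Q\<close>. The last family makes the field act centrally.\<close>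

definition Rl :: "('a \<times> 'm \<times> 'a \<Rightarrow>\<^sub>0 int) set" where
 "Rl =
  {frag_of (a \<oplus> a', x, b) - frag_of (a, x, b) - frag_of (a', x, b) | a a' x b.
   a : carrier A & a' : carrier A & x : carrier Q & b : carrier A} \<union>
  {frag_of (a, x, b \<oplus> b') - frag_of (a, x, b) - frag_of (a, x, b') | a x b b'.
   a : carrier A & x : carrier Q & b : carrier A & b' : carrier A} \<union>
  {frag_of ((c \<odot> \<one>) \<otimes> a, x, b) - frag_of (a, x, b \<otimes> (c \<odot> \<one>)) | c a x b.
   c : carrier K & a : carrier A & x : carrier Q & b : carrier A}"

definition "F = pres_group U Rl"

abbreviation "g a x b == pres_gen U Rl (a, x, b)"

lemma keys: "c : Rl ==> Poly_Mapping.keys c <= U"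
 unfolding Rl_def
 by (elim UnE CollectE exE conjE; hypsubst; intro frag_keys) (auto simp: U_def scalar_closed)

interpretation p: presentation U Rl by unfold_locales (rule keys)

lemma Fg: "abelian_group F" unfolding F_def by (rule p.G_group)

interpretation F: abelian_group F by (rule Fg)

lemma U_mem: "(a, x, b) : U \<longleftrightarrow> a : carrier A & x : carrier Q & b : carrier A" by (simp add: U_def)

lemma gc: "a : carrier A ==> x : carrier Q ==> b : carrier A ==> g a x b : carrier F"
 unfolding F_def by (intro p.gen_closed) (simp add: U_def)

lemma rel3:
 assumes "frag_of u - frag_of v - frag_of w : Rl" "u : U" "v : U" "w : U"
 shows "pres_gen U Rl u = pres_gen U Rl v \<oplus>\<^bsub>F\<^esub> pres_gen U Rl w"
 using p.cls_diff_rel[of "frag_of u" "frag_of v + frag_of w"] assms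
 by (simp add: F_def pres_gen_cls p.G_add diff_diff_eq subset_trans[OF keys_add])

lemma g_l: "a : carrier A ==> a' : carrier A ==> x : carrier Q ==> b : carrier A ==>
  g (a \<oplus> a') x b = g a x b \<oplus>\<^bsub>F\<^esub> g a' x b"
 by (rule rel3, unfold Rl_def, blast) (simp_all add: U_mem)

lemma g_r: "a : carrier A ==> x : carrier Q ==> b : carrier A ==> b' : carrier A ==>
  g a x (b \<oplus> b') = g a x b \<oplus>\<^bsub>F\<^esub> g a x b'"
 by (rule rel3, unfold Rl_def, blast) (simp_all add: U_mem)

lemma g_s: "a : carrier A ==> c : carrier K ==> x : carrier Q ==> b : carrier A ==>
  g ((c \<odot> \<one>) \<otimes> a) x b = g a x (b \<otimes> (c \<odot> \<one>))"
proof -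
 assume h: "a : carrier A" "c : carrier K" "x : carrier Q" "b : carrier A"
 have "frag_of ((c \<odot> \<one>) \<otimes> a, x, b) - frag_of (a, x, b \<otimes> (c \<odot> \<one>)) : Rl"
  unfolding Rl_def using h by blast
 then show ?thesis
  unfolding pres_gen_cls using h scalar_closed[OF h(2)] by (intro p.cls_diff_rel) (simp_all add: U_mem)
qed

lemma lift:
 assumes H: "abelian_group H" and cl: "!!a x b. a : carrier A ==> x : carrier Q ==> b : carrier A ==> \<beta> a x b : carrier H"
  and bl: "!!a a' x b. a : carrier A ==> a' : carrier A ==> x : carrier Q ==> b : carrier A ==>
    \<beta> (a \<oplus> a') x b = \<beta> a x b \<oplus>\<^bsub>H\<^esub> \<beta> a' x b"
  and br: "!!a x b b'. a : carrier A ==> x : carrier Q ==> b : carrier A ==> b' : carrier A ==>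
    \<beta> a x (b \<oplus> b') = \<beta> a x b \<oplus>\<^bsub>H\<^esub> \<beta> a x b'"
  and bs: "!!a c x b. a : carrier A ==> c : carrier K ==> x : carrier Q ==> b : carrier A ==>
    \<beta> ((c \<odot> \<one>) \<otimes> a) x b = \<beta> a x (b \<otimes> (c \<odot> \<one>))"
 shows "amap F H (pres_lift H (%(a, x, b). \<beta> a x b)) &
   (ALL a:carrier A. ALL x:carrier Q. ALL b:carrier A. pres_lift H (%(a, x, b). \<beta> a x b) (g a x b) = \<beta> a x b)"
proof -
  interpret H: abelian_group H by (rule H)
  let ?b = "%(a, x, b). \<beta> a x b"
  have 1: "?b z : carrier H" if "z : U" for z using that cl by (auto simp: U_def)
  have fl: "flift H ?b (frag_of z - frag_of w) = ?b z \<ominus>\<^bsub>H\<^esub> ?b w" if "z : U" "w : U" for z w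
   using that 1 by (simp_all add: H.flift_diff[where U = U] H.flift_frag_of frag_keys)
  have fl2: "flift H ?b (frag_of z - frag_of w - frag_of v) = ?b z \<ominus>\<^bsub>H\<^esub> ?b w \<ominus>\<^bsub>H\<^esub> ?b v"
   if "z : U" "w : U" "v : U" for z w v
   using that 1 by (simp_all add: H.flift_diff[where U = U] H.flift_frag_of frag_keys)
  have cancel: "u \<oplus>\<^bsub>H\<^esub> v \<ominus>\<^bsub>H\<^esub> u \<ominus>\<^bsub>H\<^esub> v = \<zero>\<^bsub>H\<^esub>" if "u : carrier H" "v : carrier H" for u v
   by (rule rep_eq[of H], (rule rep_rules rep_zero | rule rep_atom | rule H.abelian_group_axioms | rule that)+, simp)
  have cancel2: "u \<ominus>\<^bsub>H\<^esub> u = \<zero>\<^bsub>H\<^esub>" if "u : carrier H" for u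
   using that by (simp add: a_minus_def H.r_neg)
  have 2: "flift H ?b c = \<zero>\<^bsub>H\<^esub>" if "c : Rl" for c
   using that unfolding Rl_def
   by (elim UnE CollectE exE conjE; hypsubst)
     (subst fl2 fl; simp add: U_def bl br bs cl cancel cancel2 scalar_closed)+
  show ?thesis
   using p.pres_lift_amap[OF H 1 2] p.pres_lift_gen[OF H 1 2] unfolding F_def by (auto simp: U_def)
qed

text \<open>The free bimodule as a plain record, of exactly the type at which
  \<open>projective_bimod\<close> tests lifting.\<close>

definition M :: "('a, ('a \<times> 'm \<times> 'a \<Rightarrow>\<^sub>0 int) set) bimodule" where
 "M = \<lparr>carrier = carrier F, monoid.mult = undefined, one = undefined, ring.zero = \<zero>\<^bsub>F\<^esub>, ring.add = add F,
   smult = (%u. pres_lift F (%(a, x, b). g (u \<otimes> a) x b)),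
   rsmult = (%z u. pres_lift F (%(a, x, b). g a x (b \<otimes> u)) z)\<rparr>"

lemma MF: "carrier M = carrier F" "\<zero>\<^bsub>M\<^esub> = \<zero>\<^bsub>F\<^esub>" "add M = add F" by (simp_all add: M_def)

lemma
 assumes u: "u : carrier A"
 shows sm: "amap F F (%z. u \<odot>\<^bsub>M\<^esub> z)"
  and sm_g: "a : carrier A ==> x : carrier Q ==> b : carrier A ==> u \<odot>\<^bsub>M\<^esub> g a x b = g (u \<otimes> a) x b"
proof -
 have "amap F F (pres_lift F (%(a, x, b). g (u \<otimes> a) x b)) &
   (ALL a:carrier A. ALL x:carrier Q. ALL b:carrier A. pres_lift F (%(a, x, b). g (u \<otimes> a) x b) (g a x b) = g (u \<otimes> a) x b)"
 proof (rule lift[OF Fg])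
  fix a c x b assume h: "a : carrier A" "c : carrier K" "x : carrier Q" "b : carrier A"
  note s = scalar_closed[OF h(2)]
  have "u \<otimes> ((c \<odot> \<one>) \<otimes> a) = (u \<otimes> (c \<odot> \<one>)) \<otimes> a" using h u s by (simp only: A.m_assoc)
  also have "\<dots> = (c \<odot> \<one>) \<otimes> (u \<otimes> a)" using h u s by (simp only: scalar_central[OF h(2) u, symmetric] A.m_assoc)
  finally show "g (u \<otimes> ((c \<odot> \<one>) \<otimes> a)) x b = g (u \<otimes> a) x (b \<otimes> (c \<odot> \<one>))"
   using g_s[of "u \<otimes> a" c x b] h u by simp
 qed (use u in "simp_all add: gc g_l g_r A.r_distr")
 then show "amap F F (%z. u \<odot>\<^bsub>M\<^esub> z)" "a : carrier A ==> x : carrier Q ==> b : carrier A ==> u \<odot>\<^bsub>M\<^esub> g a x b = g (u \<otimes> a) x b"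
  by (simp_all add: M_def)
qed

lemma
 assumes u: "u : carrier A"
 shows rs: "amap F F (%z. rsmult M z u)"
  and rs_g: "a : carrier A ==> x : carrier Q ==> b : carrier A ==> rsmult M (g a x b) u = g a x (b \<otimes> u)"
proof -
 have "amap F F (pres_lift F (%(a, x, b). g a x (b \<otimes> u))) &
   (ALL a:carrier A. ALL x:carrier Q. ALL b:carrier A. pres_lift F (%(a, x, b). g a x (b \<otimes> u)) (g a x b) = g a x (b \<otimes> u))"
 proof (rule lift[OF Fg])
  fix a c x b assume h: "a : carrier A" "c : carrier K" "x : carrier Q" "b : carrier A"
  note s = scalar_closed[OF h(2)]
  have "b \<otimes> (c \<odot> \<one>) \<otimes> u = b \<otimes> u \<otimes> (c \<odot> \<one>)"
   using h u s by (simp only: scalar_central[OF h(2) u] A.m_assoc)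
  then show "g ((c \<odot> \<one>) \<otimes> a) x (b \<otimes> u) = g a x (b \<otimes> (c \<odot> \<one>) \<otimes> u)"
   using g_s[of a c x "b \<otimes> u"] h u by simp
 qed (use u in "simp_all add: gc g_l g_r A.l_distr")
 then show "amap F F (%z. rsmult M z u)" "a : carrier A ==> x : carrier Q ==> b : carrier A ==> rsmult M (g a x b) u = g a x (b \<otimes> u)"
  by (simp_all add: M_def)
qed

lemma ext:
 assumes "amap F H f" "amap F H f'" "z : carrier F"
  "!!a x b. a : carrier A ==> x : carrier Q ==> b : carrier A ==> f (g a x b) = f' (g a x b)"
 shows "f z = f' z"
proof (rule p.gen_ext)
 show "amap p.G H f" "amap p.G H f'" "z : carrier p.G" using assms(1-3) by (simp_all add: F_def)
 fix w assume "w : U" then show "f (pres_gen U Rl w) = f' (pres_gen U Rl w)" using assms(4) by (cases w) (simp add: U_mem)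
qed

lemma M_bimod: "bimod K A M"
proof -
 have cl: "u \<odot>\<^bsub>M\<^esub> z : carrier F" "rsmult M z u : carrier F" if "u : carrier A" "z : carrier F" for u z
  using amap_closed[OF sm] amap_closed[OF rs] that by auto
 show ?thesis
  unfolding bimod_def MF
 proof (intro conjI ballI)
  show "abelian_group M" by (rule abelian_group_cong[OF Fg MF(1,3,2)])
  fix a b x y assume a: "a : carrier A" and x: "x : carrier F"
  show "a \<odot>\<^bsub>M\<^esub> x : carrier F" "rsmult M x a : carrier F" using a x cl by simp_all
  show "a \<odot>\<^bsub>M\<^esub> (x \<oplus>\<^bsub>F\<^esub> y) = a \<odot>\<^bsub>M\<^esub> x \<oplus>\<^bsub>F\<^esub> a \<odot>\<^bsub>M\<^esub> y" "rsmult M (x \<oplus>\<^bsub>F\<^esub> y) a = rsmult M x a \<oplus>\<^bsub>F\<^esub> rsmult M y a"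
   if "y : carrier F" using amap_add[OF sm[OF a] x that] amap_add[OF rs[OF a] x that] by simp_all
  assume b: "b : carrier A"
  show "(a \<oplus> b) \<odot>\<^bsub>M\<^esub> x = a \<odot>\<^bsub>M\<^esub> x \<oplus>\<^bsub>F\<^esub> b \<odot>\<^bsub>M\<^esub> x"
   by (rule ext[OF sm amap_plus[OF sm sm] x]) (use a b in "simp_all add: sm_g A.l_distr g_l")
  show "rsmult M x (a \<oplus> b) = rsmult M x a \<oplus>\<^bsub>F\<^esub> rsmult M x b"
   by (rule ext[OF rs amap_plus[OF rs rs] x]) (use a b in "simp_all add: rs_g A.r_distr g_r")
  show "(a \<otimes> b) \<odot>\<^bsub>M\<^esub> x = a \<odot>\<^bsub>M\<^esub> (b \<odot>\<^bsub>M\<^esub> x)"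
   by (rule ext[OF sm amap_comp[OF sm sm] x]) (use a b in "simp_all add: sm_g A.m_assoc")
  show "rsmult M x (a \<otimes> b) = rsmult M (rsmult M x a) b"
   by (rule ext[OF rs amap_comp[OF rs rs] x]) (use a b in "simp_all add: rs_g A.m_assoc")
  show "rsmult M (a \<odot>\<^bsub>M\<^esub> x) b = a \<odot>\<^bsub>M\<^esub> rsmult M x b"
   by (rule ext[OF amap_comp[OF rs sm] amap_comp[OF sm rs] x]) (use a b in "simp_all add: sm_g rs_g")
 next
  fix x assume x: "x : carrier F"
  note id = amap_id[OF Fg]
  show "\<one> \<odot>\<^bsub>M\<^esub> x = x" by (rule ext[OF sm id x]) (simp_all add: sm_g)
  show "rsmult M x \<one> = x" by (rule ext[OF rs id x]) (simp_all add: rs_g)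
 next
  fix c x assume c: "c : carrier K" and x: "x : carrier F"
  note s = scalar_closed[OF c]
  show "(c \<odot> \<one>) \<odot>\<^bsub>M\<^esub> x = rsmult M x (c \<odot> \<one>)"
   by (rule ext[OF sm[OF s] rs[OF s] x]) (simp add: sm_g[OF s] rs_g[OF s] g_s c)
 qed
qed

text \<open>The universal property: \<open>E\<close> is an arbitrary function, and the target may
  have any type.\<close>

lemma to_bimod:
 fixes Y :: "('a, 'h) graded_bimodule"
 assumes Y: "bimod K A Y" and E: "!!x. x : carrier Q ==> E x : carrier Y"
 shows "EX f. bimod_hom A M Y f & amap F Y f & (ALL a:carrier A. ALL x:carrier Q. ALL b:carrier A. f (g a x b) = a \<odot>\<^bsub>Y\<^esub> rsmult Y (E x) b)"
proof -
  note Yg = bimodD(1)[OF Y]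
  note bs = bimodD(2-10)[OF Y]
  let ?f = "pres_lift Y (%(a, x, b). a \<odot>\<^bsub>Y\<^esub> rsmult Y (E x) b)"
  have f: "amap F Y ?f & (ALL a:carrier A. ALL x:carrier Q. ALL b:carrier A. ?f (g a x b) = a \<odot>\<^bsub>Y\<^esub> rsmult Y (E x) b)"
  proof (rule lift[OF Yg])
   fix a c x b assume h: "a : carrier A" "c : carrier K" "x : carrier Q" "b : carrier A"
   have "((c \<odot> \<one>) \<otimes> a) \<odot>\<^bsub>Y\<^esub> rsmult Y (E x) b = a \<odot>\<^bsub>Y\<^esub> ((c \<odot> \<one>) \<odot>\<^bsub>Y\<^esub> rsmult Y (E x) b)"
    using h E scalar_closed[OF h(2)] by (simp add: scalar_central[OF h(2)] bs)
   also have "\<dots> = a \<odot>\<^bsub>Y\<^esub> rsmult Y (E x) (b \<otimes> (c \<odot> \<one>))"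
    using h E scalar_closed[OF h(2)] bimodD(13)[OF Y h(2), of "rsmult Y (E x) b"] by (simp add: bs)
   finally show "((c \<odot> \<one>) \<otimes> a) \<odot>\<^bsub>Y\<^esub> rsmult Y (E x) b = a \<odot>\<^bsub>Y\<^esub> rsmult Y (E x) (b \<otimes> (c \<odot> \<one>))" .
  qed (use E bs in simp_all)
  have ysm: "amap Y Y (%y. a \<odot>\<^bsub>Y\<^esub> y)" "amap Y Y (%y. rsmult Y y a)" if "a : carrier A" for a
   using that bs Yg by (auto intro!: amapI)
  have "?f (a \<odot>\<^bsub>M\<^esub> z) = a \<odot>\<^bsub>Y\<^esub> ?f z" if a: "a : carrier A" and z: "z : carrier F" for a z
   by (rule ext[OF amap_comp[OF conjunct1[OF f] sm[OF a]] amap_comp[OF ysm(1)[OF a] conjunct1[OF f]] z])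
     (use a f E bs in "simp add: sm_g")
  moreover have "?f (rsmult M z a) = rsmult Y (?f z) a" if a: "a : carrier A" and z: "z : carrier F" for a z
   by (rule ext[OF amap_comp[OF conjunct1[OF f] rs[OF a]] amap_comp[OF ysm(2)[OF a] conjunct1[OF f]] z])
     (use a f E bs in "simp add: rs_g")
  ultimately have "bimod_hom A M Y ?f"
   using amap_closed[OF conjunct1[OF f]] amap_add[OF conjunct1[OF f]] by (auto simp: bimod_hom_def left_hom_def MF)
  then show ?thesis using f by blast
qed

lemmas F_induct [consumes 1, case_names zero gen diff] = p.gen_induct[folded F_def]

end

context alg begin

text \<open>Since HOL cannot quantify over bimodules, the last condition on the lift \<open>k\<close> is a rule: whatever
  holds of the pairs \<open>(a x b, a (G x) b)\<close> and is preserved by differences holds of \<open>(x, k x)\<close>.\<close>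

lemma projective_lift:
 fixes Q :: "('a, 'm) graded_bimodule" and N :: "('a, 'n) graded_bimodule"
 assumes pr: "projective_bimod K A Q" and N: "bimod K A N" and G: "!!x. x : carrier Q ==> G x : carrier N"
 shows "EX k. bimod_hom A Q N k & (ALL R. R \<zero>\<^bsub>Q\<^esub> \<zero>\<^bsub>N\<^esub> -->
   (ALL a:carrier A. ALL x:carrier Q. ALL b:carrier A. R (a \<odot>\<^bsub>Q\<^esub> rsmult Q x b) (a \<odot>\<^bsub>N\<^esub> rsmult N (G x) b)) -->
   (ALL x:carrier Q. ALL x':carrier Q. ALL y:carrier N. ALL y':carrier N. R x y --> R x' y' --> R (x \<ominus>\<^bsub>Q\<^esub> x') (y \<ominus>\<^bsub>N\<^esub> y')) -->
   (ALL x:carrier Q. R x (k x)))"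
proof -
 have Q: "bimod K A Q" using pr by (simp add: projective_bimod_def)
 interpret f: free_bimodule K A Q by unfold_locales (rule Q)
 obtain \<epsilon> where e: "bimod_hom A f.M Q \<epsilon>" "amap f.F Q \<epsilon>" "ALL a:carrier A. ALL x:carrier Q. ALL b:carrier A. \<epsilon> (f.g a x b) = a \<odot>\<^bsub>Q\<^esub> rsmult Q x b"
  using f.to_bimod[OF Q, of "%x. x"] by auto
 obtain T where T: "bimod_hom A f.M N T" "amap f.F N T" "ALL a:carrier A. ALL x:carrier Q. ALL b:carrier A. T (f.g a x b) = a \<odot>\<^bsub>N\<^esub> rsmult N (G x) b"
  using f.to_bimod[OF N, of G] G by blast
 \<comment> \<open>The lifting property speaks of plain bimodule records, so the additional fields
   of \<open>Q\<close> are dropped.\<close>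
 define Q' where "Q' = bimodule.truncate Q"
 have Q': "bimod K A Q'" "carrier Q' = carrier Q"
  using Q by (simp_all add: Q'_def bimodule.defs bimod_def abelian_group_cong[of Q])
 have e': "bimod_hom A f.M Q' \<epsilon>" "bimod_hom A Q Q' (%x. x)"
  using e(1) by (auto simp: Q'_def bimodule.defs bimod_hom_def left_hom_def)
 have "\<epsilon> ` carrier f.M = carrier Q'"
 proof
  show "\<epsilon> ` carrier f.M <= carrier Q'" using amap_closed[OF e(2)] Q'(2) by (auto simp: f.MF)
  show "carrier Q' <= \<epsilon> ` carrier f.M"
  proof
   fix x assume x: "x : carrier Q'"
   then have "\<epsilon> (f.g \<one> x \<one>) = x" using e(3) Q'(2) by (simp add: bimodD(11,12)[OF Q])
   then show "x : \<epsilon> ` carrier f.M" using f.gc[of "\<one>" x "\<one>"] x Q'(2) by (metis A.one_closed f.MF(1) image_eqI)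
  qed
 qed
 \<comment> \<open>Projectivity splits the surjection from the free bimodule. The target
   \<open>N\<close> need not have one of the tested types, so it is reached by composing the
   splitting with \<open>T\<close>.\<close>
 then obtain h where h: "bimod_hom A Q f.M h" "ALL x:carrier Q. \<epsilon> (h x) = x"
  using pr f.M_bimod Q'(1) e' unfolding projective_bimod_def by blast
 have kk: "bimod_hom A Q N (%x. T (h x))"
  using h(1) T(1) by (auto simp: bimod_hom_def left_hom_def Pi_iff)
 have RR: "R x (T (h x))" if R: "R \<zero>\<^bsub>Q\<^esub> \<zero>\<^bsub>N\<^esub>"
   "ALL a:carrier A. ALL x:carrier Q. ALL b:carrier A. R (a \<odot>\<^bsub>Q\<^esub> rsmult Q x b) (a \<odot>\<^bsub>N\<^esub> rsmult N (G x) b)"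
   "ALL x:carrier Q. ALL x':carrier Q. ALL y:carrier N. ALL y':carrier N. R x y --> R x' y' --> R (x \<ominus>\<^bsub>Q\<^esub> x') (y \<ominus>\<^bsub>N\<^esub> y')"
   and x: "x : carrier Q" for R x
 proof -
  have "h x : carrier f.F" using h(1) x by (auto simp: bimod_hom_def left_hom_def f.MF Pi_iff)
  then have "R (\<epsilon> (h x)) (T (h x))"
  proof (induction rule: f.F_induct)
   case zero
   then show ?case using R(1) amap_zero[OF e(2)] amap_zero[OF T(2)] by simp
  next
   case (gen w)
   then obtain a y b where "w = (a, y, b)" "a : carrier A" "y : carrier Q" "b : carrier A" by (cases w) (auto simp: f.U_mem)
   then show ?case using R(2) e(3) T(3) by simp
  next
   case (diff u v)
   then show ?case
    using diff(1-4) R(3) amap_minus[OF e(2), of u v] amap_minus[OF T(2), of u v] amap_closed[OF e(2)] amap_closed[OF T(2)]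
    by simp
  qed
  then show ?thesis using h(2) x by simp
 qed
 show ?thesis
  by (rule exI[of _ "%x. T (h x)"], rule conjI[OF kk], intro allI impI ballI, rule RR)
qed

end

section \<open>The resolution as a contracted complex\<close>

lemma shift_simps [simp]:
 "carrier (shift s N) = carrier N" "add (shift s N) = add N" "\<zero>\<^bsub>shift s N\<^esub> = \<zero>\<^bsub>N\<^esub>"
 "smult (shift s N) = smult N" "rsmult (shift s N) = rsmult N" "grade (shift s N) n = grade N (s + n)"
 by (simp_all add: shift_def)

lemma graded_hom_ghom:
 assumes "gab A M" "gab A N"
 shows "graded_hom A M (shift s N) f \<longleftrightarrow> ghom A M N s f"
proof
 assume "graded_hom A M (shift s N) f"
 then show "ghom A M N s f"
  using assms gab_group[OF assms(1)] gab_group[OF assms(2)] by (intro ghomI amapI) (auto simp: graded_hom_def bimod_hom_def left_hom_def Pi_iff image_subset_iff add.commute)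
next
 assume "ghom A M N s f"
 note h = this
 show "graded_hom A M (shift s N) f"
  using ghom_degree[OF h] by (auto simp: graded_hom_def bimod_hom_def left_hom_def ghomD[OF h] add.commute)
qed

lemma shift_0: "shift 0 N = N" by (simp add: shift_def)

lemma graded_hom_ghom0:
 assumes "gab A M" "gab A N"
 shows "graded_hom A M N f \<longleftrightarrow> ghom A M N 0 f"
 using graded_hom_ghom[OF assms, of 0 f] by (simp add: shift_0)

lemma component_simps [simp]:
 "carrier (component P n) = grade P n" "add (component P n) = add P" "\<zero>\<^bsub>component P n\<^esub> = \<zero>\<^bsub>P\<^esub>"
 "smult (component P n) = smult P" "rsmult (component P n) = rsmult P"
 by (simp_all add: component_def)

lemma component_minus:
 assumes P: "graded_bimod K A P" and x: "x : grade P n" and y: "y : grade P n"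
 shows "x \<ominus>\<^bsub>component P n\<^esub> y = x \<ominus>\<^bsub>P\<^esub> y"
proof -
 note g = gab_graded_bimod[OF P]
 interpret P: abelian_group P by (rule gab_group[OF g])
 interpret C: abelian_group "component P n" using P by (simp add: graded_bimod_def bimod_def)
 have "\<ominus>\<^bsub>component P n\<^esub> y = \<ominus>\<^bsub>P\<^esub> y"
  using y gab_grade[OF g y] gab_grade_neg[OF g y] by (intro C.minus_equality) (simp_all add: P.l_neg)
 then show ?thesis by (simp add: a_minus_def)
qed

locale resolution = alg K A for K :: "'k ring" and A :: "('k, 'a) module" (structure) +
 fixes P :: "('a, 'p) graded_bimodule" and d :: "'p => 'p" and \<mu> :: "'p => 'a" and t :: "'p => 'p" and \<eta> :: "'a => 'p"
 assumes pr: "projective_resolution K A P d \<mu>" and lch: "left_contracting_homotopy A P d \<mu> t \<eta>"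
begin

lemma P_graded: "graded_bimod K A P" using pr by (simp add: projective_resolution_def bimod_complex_def)

lemmas P_gab = gab_graded_bimod[OF P_graded] and P_bimod = graded_bimodD[OF P_graded]

lemma P_contracted: "contracted K A P d \<mu> t \<eta>"
proof -
 interpret P: abelian_group P by (rule gab_group[OF P_gab])
 note gr = gab_grade[OF P_gab]
 have dg: "ghom A P P (- 1) d"
  using pr graded_hom_ghom[OF P_gab P_gab] by (simp add: projective_resolution_def bimod_complex_def)
 have mg: "ghom A P (regular A) 0 \<mu>"
  using pr graded_hom_ghom0[OF P_gab regular_gab] by (simp add: projective_resolution_def)
 have neg: "x = \<zero>\<^bsub>P\<^esub>" if "n < 0" "x : grade P n" for n x
  using pr that by (simp add: projective_resolution_def)
 have r0: "amap P (regular A) (%x. \<zero>)"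
  by (rule amapI[OF P.abelian_group_axioms gab_group[OF regular_gab]]) simp_all
 have md: "\<mu> (d x) = \<zero>" if "x : carrier P" for x
 proof (rule graded_ext[OF P_graded amap_comp[OF ghom_amap[OF mg] ghom_amap[OF dg]] r0 _ that])
  fix n x assume x: "x : grade P n"
  show "\<mu> (d x) = \<zero>"
  proof (cases "n = 1")
   case True
   then have "d x : {x : grade P 0. \<mu> x = \<zero>}" using x pr by (simp add: projective_resolution_def)
   then show ?thesis by simp
  next
   case False
   have "\<mu> (d x) : grade (regular A) (n - 1)"
    by (rule ghom_degree[OF mg ghom_degree[OF dg x refl]]) simp
   then show ?thesis using False by simp
  qed
 qed
 have c: "cplx K A P d \<mu>"
  by (unfold_locales) (use P_graded dg mg md neg pr in "auto simp: projective_resolution_def bimod_complex_def")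
 interpret cplx K A P d \<mu> by (rule c)
 note l = lch[unfolded left_contracting_homotopy_def left_hom_def]
 have tc: "t x : carrier P" if "x : carrier P" for x using l that by auto
 have ec: "\<eta> a : carrier P" if "a : carrier A" for a using l that by auto
 have ta: "amap P P t" using l by (intro amapI P.abelian_group_axioms) auto
 have ea: "amap (regular A) P \<eta>" using l by (intro amapI P.abelian_group_axioms gab_group[OF regular_gab]) auto
 have hm: "d (t x) \<oplus>\<^bsub>P\<^esub> t (d x) \<oplus>\<^bsub>P\<^esub> \<eta> (\<mu> x) = x" if "x : carrier P" for x using l that by auto
 show ?thesis
 proof (intro contracted.intro contracted_axioms.intro c ta ea)
  show "t ((c \<odot> \<one>) \<odot>\<^bsub>P\<^esub> y) = (c \<odot> \<one>) \<odot>\<^bsub>P\<^esub> t y" if "c : carrier K" "y : carrier P" for c y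
   using l that scalar_closed by simp
  show "t y : grade P (n + 1)" if "y : grade P n" for n y using l that by blast
  show "d (t y) = y" if "y : carrier P" "d y = \<zero>\<^bsub>P\<^esub>" "\<mu> y = \<zero>" for y
   using hm[OF that(1)] that amap_zero[OF ta] amap_zero[OF ea] tc by simp
  show "\<eta> ((c \<odot> \<one>) \<otimes> a) = (c \<odot> \<one>) \<odot>\<^bsub>P\<^esub> \<eta> a" if "c : carrier K" "a : carrier A" for c a
   using l that scalar_closed by simp
  show "\<eta> a : grade P 0" if "a : carrier A" for a using l that by blast
  show "\<mu> (\<eta> a) = a" if "a : carrier A" for a
  proof -
   have "a : \<mu> ` grade P 0" using pr that by (simp add: projective_resolution_def)
   \<comment> \<open>In degree 0 the homotopy identity reads \<open>x = d (t x) + \<eta> a\<close>;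
     applying \<open>\<mu>\<close> gives the claim, since \<open>\<mu>\<close> kills
     boundaries.\<close>
   then obtain x where x: "x : grade P 0" "\<mu> x = a" by auto
   have "d x = \<zero>\<^bsub>P\<^esub>" by (rule neg[of "- 1"]) (use ghom_degree[OF dg x(1), of "- 1"] in simp_all)
   then have "d (t x) \<oplus>\<^bsub>P\<^esub> \<eta> a = x" using hm[OF gr[OF x(1)]] x tc gr amap_zero[OF ta] by simp
   then have "\<mu> (d (t x) \<oplus>\<^bsub>P\<^esub> \<eta> a) = a" using x by simp
   then show ?thesis using tc[OF gr[OF x(1)]] ec[OF that] by simp
  qed
 qed
qed

sublocale contracted K A P d \<mu> t \<eta> by (rule P_contracted)

lemma projective_lifting:
 fixes N :: "('a, 'n) graded_bimodule"
 assumes C: "contracted K A N dN \<mu>N t' \<eta>'"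
 shows "lifting K A P d \<mu> N dN \<mu>N"
proof -
 interpret N: contracted K A N dN \<mu>N t' \<eta>' by (rule C)
 note Ng = N.Q_gab and gr = gab_grade[OF N.Q_gab]
 have cN: "bimod K A (component N j)" for j using N.Q_graded by (simp add: graded_bimod_def)
 have cP: "projective_bimod K A (component P i)" for i using pr by (simp add: projective_resolution_def)
 have ch: "chom A P N i j k" if "bimod_hom A (component P i) (component N j) k" for i j k
  using that by (intro chomI) (auto simp: bimod_hom_def left_hom_def Pi_iff)
 show ?thesis
 proof (intro lifting.intro cplx_axioms N.cplx_axioms lifting_axioms.intro)
  fix i j z assume z: "chom A P N i j z" and zz: "ALL x:grade P i. dN (z x) = \<zero>\<^bsub>N\<^esub> & \<mu>N (z x) = \<zero>"
  \<comment> \<open>The property handed to \<open>projective_lift\<close>: \<open>y\<close> is an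
    admissible lift of \<open>z x\<close>. It holds for the contraction on generators and is
    inherited by actions and differences. The degree of \<open>x\<close> is included because
    \<open>z\<close> is additive only there.\<close>
  define R where "R x y \<longleftrightarrow> x : grade P i & y : grade N (j + 1) & dN y = z x & \<mu>N y = \<zero>" for x y
  have G: "t' (z x) : carrier (component N (j + 1))" if "x : carrier (component P i)" for x
   using that by (simp add: N.t_grade chomD(1)[OF z])
  show "EX k. chom A P N i (j + 1) k & (ALL x:grade P i. dN (k x) = z x & \<mu>N (k x) = \<zero>)"
  proof (rule exE[OF projective_lift[OF cP[of i] cN[of "j + 1"], where G = "%x. t' (z x)"]], goal_cases)
  case (1 x)
  then show ?case by (rule G)
  next
  case (2 k)
  note k = conjunct1[OF 2] and kR = spec[OF conjunct2[OF 2], of R, unfolded component_simps]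
  have "R x (k x)" if "x : grade P i" for x
  proof (rule kR[rule_format])
   show "R \<zero>\<^bsub>P\<^esub> \<zero>\<^bsub>N\<^esub>" using chom_zero[OF P_gab Ng z] by (simp add: R_def gab_grade_zero[OF P_gab] gab_grade_zero[OF Ng])
  next
   fix a x b assume h: "a : carrier A" "x : grade P i" "b : carrier A"
   have zx: "z x : carrier N" "t' (z x) : grade N (j + 1)" "t' (z x) : carrier N"
    using gr[OF chomD(1)[OF z h(2)]] N.t_grade[OF chomD(1)[OF z h(2)]] gr[OF N.t_grade[OF chomD(1)[OF z h(2)]]] by simp_all
   have g: "rsmult P x b : grade P i" by (rule graded_bimod_smult(2)[OF P_graded h(3,2)])
   then show "R (a \<odot>\<^bsub>P\<^esub> rsmult P x b) (a \<odot>\<^bsub>N\<^esub> rsmult N (t' (z x)) b)"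
    using h zx zz N.\<mu>t[OF chomD(1)[OF z h(2)]]
    by (simp add: R_def graded_bimod_smult[OF P_graded] graded_bimod_smult[OF N.Q_graded] N.Q_bimod(3)
      N.t_split chomD(3)[OF z g] chomD(4)[OF z])
  next
   fix x x' y y' assume h: "x : grade P i" "x' : grade P i" "y : grade N (j + 1)" "y' : grade N (j + 1)" "R x y" "R x' y'"
   have n: "\<ominus>\<^bsub>P\<^esub> x' : grade P i" "\<ominus>\<^bsub>N\<^esub> y' : grade N (j + 1)" using gab_grade_neg[OF P_gab h(2)] gab_grade_neg[OF Ng h(4)] by simp_all
   have "z (x \<ominus>\<^bsub>P\<^esub> x') = z x \<ominus>\<^bsub>N\<^esub> z x'"
    using h n by (simp add: a_minus_def chomD(2)[OF z] chom_neg[OF P_gab Ng z])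
   moreover have "x \<ominus>\<^bsub>P\<^esub> x' : grade P i" "y \<ominus>\<^bsub>N\<^esub> y' : grade N (j + 1)"
    using gab_grade_minus[OF P_gab h(1,2)] gab_grade_minus[OF Ng h(3,4)] by simp_all
   ultimately show "R (x \<ominus>\<^bsub>component P i\<^esub> x') (y \<ominus>\<^bsub>component N (j + 1)\<^esub> y')"
    using h gr[OF h(3)] gr[OF h(4)] by (simp add: R_def component_minus[OF P_graded] component_minus[OF N.Q_graded] A.minus_zero a_minus_def[of A])
  qed (rule that)
  then show ?case using ch[OF k] by (auto simp: R_def)
  qed
 next
  fix \<alpha> assume a: "chom A P (regular A) 0 0 \<alpha>"
  have ac: "\<alpha> x : carrier A" if "x : grade P 0" for x using chomD(1)[OF a that] by simp
  define R where "R x y \<longleftrightarrow> x : grade P 0 & y : grade N 0 & \<mu>N y = \<alpha> x" for x y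
  have G: "\<eta>' (\<alpha> x) : carrier (component N 0)" if "x : carrier (component P 0)" for x
   using that ac by (simp add: N.\<eta>_grade)
  show "EX k. chom A P N 0 0 k & (ALL x:grade P 0. \<mu>N (k x) = \<alpha> x)"
  proof (rule exE[OF projective_lift[OF cP[of 0] cN[of 0], where G = "%x. \<eta>' (\<alpha> x)"]], goal_cases)
  case (1 x)
  then show ?case by (rule G)
  next
  case (2 k)
  note k = conjunct1[OF 2] and kR = spec[OF conjunct2[OF 2], of R, unfolded component_simps]
  have "R x (k x)" if "x : grade P 0" for x
  proof (rule kR[rule_format])
   show "R \<zero>\<^bsub>P\<^esub> \<zero>\<^bsub>N\<^esub>" using chom_zero[OF P_gab regular_gab a] by (simp add: R_def gab_grade_zero[OF P_gab] gab_grade_zero[OF Ng])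
  next
   fix u x b assume h: "u : carrier A" "x : grade P 0" "b : carrier A"
   have zx: "\<alpha> x : carrier A" "\<eta>' (\<alpha> x) : grade N 0" "\<eta>' (\<alpha> x) : carrier N"
    using ac[OF h(2)] N.\<eta>_grade[OF ac[OF h(2)]] gr[OF N.\<eta>_grade[OF ac[OF h(2)]]] by simp_all
   have g: "rsmult P x b : grade P 0" by (rule graded_bimod_smult(2)[OF P_graded h(3,2)])
   then show "R (u \<odot>\<^bsub>P\<^esub> rsmult P x b) (u \<odot>\<^bsub>N\<^esub> rsmult N (\<eta>' (\<alpha> x)) b)"
    using h zx chomD(3)[OF a g] chomD(4)[OF a h(2)]
    by (simp add: R_def graded_bimod_smult[OF P_graded] graded_bimod_smult[OF N.Q_graded] N.Q_bimod(3) N.\<mu>\<eta>)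
  next
   fix x x' y y' assume h: "x : grade P 0" "x' : grade P 0" "y : grade N 0" "y' : grade N 0" "R x y" "R x' y'"
   have n: "\<ominus>\<^bsub>P\<^esub> x' : grade P 0" "\<ominus>\<^bsub>N\<^esub> y' : grade N 0" using gab_grade_neg[OF P_gab h(2)] gab_grade_neg[OF Ng h(4)] by simp_all
   have "\<alpha> (x \<ominus>\<^bsub>P\<^esub> x') = \<alpha> x \<ominus> \<alpha> x'"
    using h n chomD(2)[OF a] chom_neg[OF P_gab regular_gab a] by (simp add: a_minus_def)
   moreover have "x \<ominus>\<^bsub>P\<^esub> x' : grade P 0" "y \<ominus>\<^bsub>N\<^esub> y' : grade N 0"
    using gab_grade_minus[OF P_gab h(1,2)] gab_grade_minus[OF Ng h(3,4)] by simp_all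
   ultimately show "R (x \<ominus>\<^bsub>component P 0\<^esub> x') (y \<ominus>\<^bsub>component N 0\<^esub> y')"
    using h gr[OF h(3)] gr[OF h(4)] by (simp add: R_def component_minus[OF P_graded] component_minus[OF N.Q_graded])
  qed (rule that)
  then show ?case using ch[OF k] by (auto simp: R_def)
  qed
 qed
qed

end

section \<open>The perturbed contraction of the tensor square\<close>

lemma (in alg) tbimod_K:
 assumes M: "graded_bimod K A M" and N: "graded_bimod K A N"
 shows "tbimod (carrier K) (%x c. (c \<odot> \<one>) \<odot>\<^bsub>M\<^esub> x) (%c y. (c \<odot> \<one>) \<odot>\<^bsub>N\<^esub> y) M N A"
proof -
 note m = bimodD[OF graded_bimodD[OF M]] and n = bimodD[OF graded_bimodD[OF N]]
 have "a \<odot>\<^bsub>M\<^esub> ((c \<odot> \<one>) \<odot>\<^bsub>M\<^esub> x) = (c \<odot> \<one>) \<odot>\<^bsub>M\<^esub> (a \<odot>\<^bsub>M\<^esub> x)"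
  if "a : carrier A" "x : carrier M" "c : carrier K" for a x c
  using that scalar_closed[OF that(3)] by (simp add: m(8)[symmetric] scalar_central)
 then show ?thesis
  by (intro tbimod.intro tprod.intro tbimod_axioms.intro)
   (simp_all add: gab_graded_bimod[OF M] gab_graded_bimod[OF N] m(1-3) n(1-3,10) scalar_closed)
qed

text \<open>For right factors that are themselves tensor products, where commuting actions and
  additivity are what is known.\<close>

lemma (in alg) tbimod_gab:
 assumes M: "graded_bimod K A M" and N: "gab A N"
  and c: "!!s a y. s : carrier A ==> a : carrier A ==> y : carrier N ==> rsmult N (s \<odot>\<^bsub>N\<^esub> y) a = s \<odot>\<^bsub>N\<^esub> rsmult N y a"
 shows "tbimod (carrier A) (rsmult M) (smult N) M N A"
 by (intro tbimod.intro tprod.intro tbimod_axioms.intro)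
  (simp_all add: gab_graded_bimod[OF M] N c gab_group[OF N] bimodD[OF graded_bimodD[OF M]] amap_closed[OF gab_smult[OF N]])

lemma (in tbimod) T_bi: "s : carrier A ==> a : carrier A ==> z : carrier T ==> rsmult T (s \<odot>\<^bsub>T\<^esub> z) a = s \<odot>\<^bsub>T\<^esub> rsmult T z a"
proof -
 assume s: "s : carrier A" and a: "a : carrier A" and z: "z : carrier T"
 show ?thesis
  by (rule T_ext[OF amap_comp[OF T_rsmult_amap[OF a] T_smult_amap[OF s]] amap_comp[OF T_smult_amap[OF s] T_rsmult_amap[OF a]] _ z])
    (use s a in "simp add: T_smult T_rsmult amap_closed[OF gab_smult[OF M_gab]] amap_closed[OF gab_rsmult[OF N_gab]]")
qed

locale split_resolution = resolution K A P d \<mu> t \<eta> for K :: "'k ring" and A :: "('k, 'a) module" (structure) and P :: "('a, 'p) graded_bimodule"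
  and d \<mu> t \<eta> +
 fixes \<iota> :: "'p => ('a, 'p) tens"
 assumes \<iota>_graded: "graded_hom A P (tensor_K K A (regular A) P) \<iota>" and \<pi>\<iota>: "ALL x:carrier P. left_action_map P (\<iota> x) = x"
begin

abbreviation tens_P (infixl "\<otimes>\<^sub>P" 70) where "x \<otimes>\<^sub>P y == pure_A A P P x y"
abbreviation "AP == tensor_K K A (regular A) P"
abbreviation "PP == tensor_K K A P P"
abbreviation "pa == pure_K K A (regular A) P"
abbreviation "pp == pure_K K A P P"

sublocale AK: tbimod "carrier K" "%x c. (c \<odot> \<one>) \<odot>\<^bsub>regular A\<^esub> x" "%c y. (c \<odot> \<one>) \<odot>\<^bsub>P\<^esub> y" "regular A" P A
 rewrites "tensor (balancing_relators (carrier K) (%x c. (c \<odot> \<one>) \<odot>\<^bsub>regular A\<^esub> x) (%c y. (c \<odot> \<one>) \<odot>\<^bsub>P\<^esub> y) (regular A) P) (regular A) P = AP"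
  and "pure_tensor (balancing_relators (carrier K) (%x c. (c \<odot> \<one>) \<odot>\<^bsub>regular A\<^esub> x) (%c y. (c \<odot> \<one>) \<odot>\<^bsub>P\<^esub> y) (regular A) P) (regular A) P = pa"
 by (rule tbimod_K[OF regular_graded P_graded]) (simp_all only: tensor_K_def pure_K_def relators_K_def)

sublocale PK: tbimod "carrier K" "%x c. (c \<odot> \<one>) \<odot>\<^bsub>P\<^esub> x" "%c y. (c \<odot> \<one>) \<odot>\<^bsub>P\<^esub> y" P P A
 rewrites "tensor (balancing_relators (carrier K) (%x c. (c \<odot> \<one>) \<odot>\<^bsub>P\<^esub> x) (%c y. (c \<odot> \<one>) \<odot>\<^bsub>P\<^esub> y) P P) P P = PP"
  and "pure_tensor (balancing_relators (carrier K) (%x c. (c \<odot> \<one>) \<odot>\<^bsub>P\<^esub> x) (%c y. (c \<odot> \<one>) \<odot>\<^bsub>P\<^esub> y) P P) P P = pp"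
 by (rule tbimod_K[OF P_graded P_graded]) (simp_all only: tensor_K_def pure_K_def relators_K_def)

abbreviation "TA == tensor_A A P AP"
abbreviation "pA == pure_A A P AP"

sublocale TA: tbimod "carrier A" "rsmult P" "smult AP" P AP A
 rewrites "tensor (balancing_relators (carrier A) (rsmult P) (smult AP) P AP) P AP = TA"
  and "pure_tensor (balancing_relators (carrier A) (rsmult P) (smult AP) P AP) P AP = pA"
 by (rule tbimod_gab[OF P_graded AK.T_gab AK.T_bi], assumption+) (simp_all only: tensor_A_def pure_A_def relators_A_def)

sublocale TT: tbimod "carrier A" "rsmult P" "smult TQ" P TQ A
 rewrites "tensor (balancing_relators (carrier A) (rsmult P) (smult TQ) P TQ) P TQ = tensor_A A P TQ"
  and "pure_tensor (balancing_relators (carrier A) (rsmult P) (smult TQ) P TQ) P TQ = pure_A A P TQ"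
 by (rule tbimod_gab[OF P_graded T.T_gab T.T_bi], assumption+) (simp_all only: tensor_A_def pure_A_def relators_A_def)

sublocale PA: tbimod "carrier A" "rsmult P" "smult (regular A)" P "regular A" A
 rewrites "tensor (balancing_relators (carrier A) (rsmult P) (smult (regular A)) P (regular A)) P (regular A) = tensor_A A P (regular A)"
  and "pure_tensor (balancing_relators (carrier A) (rsmult P) (smult (regular A)) P (regular A)) P (regular A) = pure_A A P (regular A)"
 by (rule tbimod_A[OF P_graded regular_graded]) (simp_all only: tensor_A_def pure_A_def relators_A_def)

sublocale LA: tbimod "carrier A" "rsmult (regular A)" "smult P" "regular A" P A
 rewrites "tensor (balancing_relators (carrier A) (rsmult (regular A)) (smult P) (regular A) P) (regular A) P = tensor_A A (regular A) P"
  and "pure_tensor (balancing_relators (carrier A) (rsmult (regular A)) (smult P) (regular A) P) (regular A) P = pure_A A (regular A) P"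
 by (rule tbimod_A[OF regular_graded P_graded]) (simp_all only: tensor_A_def pure_A_def relators_A_def)

lemmas rg = gab_group[OF regular_gab]

lemma \<iota>_ghom: "ghom A P AP 0 \<iota>"
 using \<iota>_graded graded_hom_ghom0[OF P_gab AK.T_gab] by simp

lemmas \<iota>s = ghomD(4)[OF \<iota>_ghom] ghomD(9,10)[OF \<iota>_ghom]

lemma sg0: "sgnmap M 0 x = x" by (simp add: sgnmap_even)

section \<open>The constituents of \<open>t_L\<close> and \<open>eta_L\<close> on pure
  tensors\<close>

lemma m1: "amap TQ TA (tensor_map_A A P P AP 0 id \<iota>)"
  "x : carrier P ==> y : carrier P ==> tensor_map_A A P P AP 0 id \<iota> (x \<otimes>\<^sub>P y) = pA x (\<iota> y)"
proof -
 have l: "amap P TA (%x. pA (id x) (\<iota> y))" if "y : carrier P" for y using TA.pt_amap_l[OF \<iota>s(1)[OF that]] by simp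
 have r: "amap P TA (%y. pA (id x) (\<iota> y))" if "x : carrier P" for x
  using amap_comp[OF TA.pt_amap_r[OF that] ghom_amap[OF \<iota>_ghom]] by simp
 have b: "pA (id (sgnmap P 0 (rsmult P x s))) (\<iota> y) = pA (id (sgnmap P 0 x)) (\<iota> (s \<odot>\<^bsub>P\<^esub> y))"
  if "x : carrier P" "s : carrier A" "y : carrier P" for x s y
  using that TA.pt_bal[of x s "\<iota> y"] by (simp add: sg0 \<iota>s)
 show "amap TQ TA (tensor_map_A A P P AP 0 id \<iota>)"
  unfolding tensor_map_A_def by (rule T.tensor_map_amap[where p = "pA" and f = "id" and g = "\<iota>" and m = 0, OF P_graded l r b TA.T_group])
 show "x : carrier P ==> y : carrier P ==> tensor_map_A A P P AP 0 id \<iota> (x \<otimes>\<^sub>P y) = pA x (\<iota> y)"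
  unfolding tensor_map_A_def using T.tensor_map_pure[where p = "pA" and f = "id" and g = "\<iota>" and m = 0, OF P_graded l r b TA.T_group] by (simp add: sg0)
qed

text \<open>\<open>contract_mid\<close> is a lift of lifts; this is the inner one, for a fixed left
  factor.\<close>

definition "c1 x = pres_lift PP (%(a, y). pp (rsmult P x a) y)"

lemma
 assumes x: "x : carrier P"
 shows c1_amap: "amap AP PP (c1 x)"
  and c1_val: "a : carrier A ==> y : carrier P ==> c1 x (pa a y) = pp (rsmult P x a) y"
proof -
 have b: "balanced (carrier K) (%x c. (c \<odot> \<one>) \<odot>\<^bsub>regular A\<^esub> x) (%c y. (c \<odot> \<one>) \<odot>\<^bsub>P\<^esub> y) (regular A) P PP (%a y. pp (rsmult P x a) y)"
 proof (rule balancedI)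
  show "amap (regular A) PP (%a. pp (rsmult P x a) y)" if "y : carrier P" for y
   by (rule amap_comp[OF PK.pt_amap_l[OF that] ract_amap[OF x]])
  show "amap P PP (pp (rsmult P x a))" if "a : carrier (regular A)" for a
   using that x by (intro PK.pt_amap_r) simp
  fix a c y assume h: "a : carrier (regular A)" "c : carrier K" "y : carrier P"
  note s = scalar_closed[OF h(2)]
  have "rsmult P x ((c \<odot> \<one>) \<otimes> a) = (c \<odot> \<one>) \<odot>\<^bsub>P\<^esub> rsmult P x a"
   using h x s by (simp add: Q_bimod(9) Q_bimod(13)[symmetric] Q_bimod(10))
  then show "pp (rsmult P x ((c \<odot> \<one>) \<odot>\<^bsub>regular A\<^esub> a)) y = pp (rsmult P x a) ((c \<odot> \<one>) \<odot>\<^bsub>P\<^esub> y)"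
   using PK.pt_bal[of "rsmult P x a" c y] h x by simp
 qed
 show "amap AP PP (c1 x)" unfolding c1_def by (rule AK.tlift_amap[OF b PK.T_group])
 show "a : carrier A ==> y : carrier P ==> c1 x (pa a y) = pp (rsmult P x a) y"
  unfolding c1_def using AK.tlift_pure[OF b PK.T_group] by simp
qed

lemma contract: "amap TA PP (contract_mid K A P)"
  "x : carrier P ==> w : carrier AP ==> contract_mid K A P (pA x w) = c1 x w"
proof -
 have b: "balanced (carrier A) (rsmult P) (smult AP) P AP PP c1"
 proof (rule balancedI)
  show "amap P PP (%x. c1 x w)" if w: "w : carrier AP" for w
  proof (rule amapI[OF Q_gp PK.T_group])
   show "c1 x w : carrier PP" if "x : carrier P" for x by (rule amap_closed[OF c1_amap[OF that] w])
   show "c1 (x \<oplus>\<^bsub>P\<^esub> y) w = c1 x w \<oplus>\<^bsub>PP\<^esub> c1 y w" if h: "x : carrier P" "y : carrier P" for x y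
    by (rule AK.T_ext[OF c1_amap amap_plus[OF c1_amap[OF h(1)] c1_amap[OF h(2)]] _ w])
      (use h in "simp_all add: c1_val Q_bimod(5) PK.pt_add_l")
  qed
  show "amap AP PP (c1 x)" if "x : carrier P" for x by (rule c1_amap[OF that])
  show "c1 (rsmult P x s) w = c1 x (s \<odot>\<^bsub>AP\<^esub> w)" if h: "x : carrier P" "s : carrier A" and w: "w : carrier AP" for x s w
   by (rule AK.T_ext[OF c1_amap amap_comp[OF c1_amap AK.T_smult_amap] _ w])
     (use h in "simp_all add: c1_val AK.T_smult Q_bimod(9)")
 qed
 have e: "contract_mid K A P = pres_lift PP (%(x, w). c1 x w)" by (simp add: contract_mid_def c1_def)
 show "amap TA PP (contract_mid K A P)" unfolding e by (rule TA.tlift_amap[OF b PK.T_group])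
 show "x : carrier P ==> w : carrier AP ==> contract_mid K A P (pA x w) = c1 x w"
  unfolding e by (rule TA.tlift_pure[OF b PK.T_group])
qed

lemma tK: "amap PP PP (tensor_map_K K A P P P 0 t id)"
  "x : carrier P ==> y : carrier P ==> tensor_map_K K A P P P 0 t id (pp x y) = pp (t x) y"
proof -
 note tc = amap_closed[OF t_amap]
 have l: "amap P PP (%x. pp (t x) (id y))" if "y : carrier P" for y using amap_comp[OF PK.pt_amap_l[OF that] t_amap] by simp
 have r: "amap P PP (%y. pp (t x) (id y))" if "x : carrier P" for x using PK.pt_amap_r[OF tc[OF that]] by simp
 have b: "pp (t (sgnmap P 0 ((c \<odot> \<one>) \<odot>\<^bsub>P\<^esub> x))) (id y) = pp (t (sgnmap P 0 x)) (id ((c \<odot> \<one>) \<odot>\<^bsub>P\<^esub> y))"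
  if "x : carrier P" "c : carrier K" "y : carrier P" for x c y
  using that PK.pt_bal[of "t x" c y] tc by (simp add: sg0 t_scal)
 show "amap PP PP (tensor_map_K K A P P P 0 t id)"
  unfolding tensor_map_K_def by (rule PK.tensor_map_amap[where p = "pp" and f = "t" and g = "id" and m = 0, OF P_graded l r b PK.T_group])
 show "x : carrier P ==> y : carrier P ==> tensor_map_K K A P P P 0 t id (pp x y) = pp (t x) y"
  unfolding tensor_map_K_def using PK.tensor_map_pure[where p = "pp" and f = "t" and g = "id" and m = 0, OF P_graded l r b PK.T_group] by (simp add: sg0)
qed

lemma \<eta>K: "amap AP PP (tensor_map_K K A (regular A) P P 0 \<eta> id)"
  "a : carrier A ==> y : carrier P ==> tensor_map_K K A (regular A) P P 0 \<eta> id (pa a y) = pp (\<eta> a) y"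
proof -
 have ec: "\<eta> a : carrier P" if "a : carrier A" for a using amap_closed[OF \<eta>_amap] that by simp
 have l: "amap (regular A) PP (%x. pp (\<eta> x) (id y))" if "y : carrier P" for y using amap_comp[OF PK.pt_amap_l[OF that] \<eta>_amap] by simp
 have r: "amap P PP (%y. pp (\<eta> x) (id y))" if "x : carrier (regular A)" for x using PK.pt_amap_r[OF ec] that by simp
 have b: "pp (\<eta> (sgnmap (regular A) 0 ((c \<odot> \<one>) \<odot>\<^bsub>regular A\<^esub> x))) (id y) = pp (\<eta> (sgnmap (regular A) 0 x)) (id ((c \<odot> \<one>) \<odot>\<^bsub>P\<^esub> y))"
  if "x : carrier (regular A)" "c : carrier K" "y : carrier P" for x c y
  using that PK.pt_bal[of "\<eta> x" c y] ec by (simp add: sg0 \<eta>_scal)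
 show "amap AP PP (tensor_map_K K A (regular A) P P 0 \<eta> id)"
  unfolding tensor_map_K_def by (rule AK.tensor_map_amap[where p = "pp" and f = "\<eta>" and g = "id" and m = 0, OF regular_graded l r b PK.T_group])
 show "a : carrier A ==> y : carrier P ==> tensor_map_K K A (regular A) P P 0 \<eta> id (pa a y) = pp (\<eta> a) y"
  unfolding tensor_map_K_def using AK.tensor_map_pure[where p = "pp" and f = "\<eta>" and g = "id" and m = 0, OF regular_graded l r b PK.T_group] by (simp add: sg0)
qed

lemma lam: "amap AP P (left_action_map P)"
  "a : carrier A ==> y : carrier P ==> left_action_map P (pa a y) = a \<odot>\<^bsub>P\<^esub> y"
proof -
 have b: "balanced (carrier K) (%x c. (c \<odot> \<one>) \<odot>\<^bsub>regular A\<^esub> x) (%c y. (c \<odot> \<one>) \<odot>\<^bsub>P\<^esub> y) (regular A) P P (%a y. a \<odot>\<^bsub>P\<^esub> y)"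
 proof (rule balancedI)
  show "amap (regular A) P (%a. a \<odot>\<^bsub>P\<^esub> y)" if "y : carrier P" for y by (rule lact_amap[OF that])
  show "amap P P (smult P a)" if "a : carrier (regular A)" for a using gab_smult[OF P_gab, of a] that by simp
  fix a c y assume h: "a : carrier (regular A)" "c : carrier K" "y : carrier P"
  then show "((c \<odot> \<one>) \<odot>\<^bsub>regular A\<^esub> a) \<odot>\<^bsub>P\<^esub> y = a \<odot>\<^bsub>P\<^esub> ((c \<odot> \<one>) \<odot>\<^bsub>P\<^esub> y)"
   using scalar_closed[OF h(2)] by (simp add: scalar_central Q_bimod(8))
 qed
 show "amap AP P (left_action_map P)" unfolding left_action_map_def by (rule AK.tlift_amap[OF b Q_gp])
 show "a : carrier A ==> y : carrier P ==> left_action_map P (pa a y) = a \<odot>\<^bsub>P\<^esub> y"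
  unfolding left_action_map_def using AK.tlift_pure[OF b Q_gp] by simp
qed

lemma lam_smult: "a : carrier A ==> w : carrier AP ==> left_action_map P (a \<odot>\<^bsub>AP\<^esub> w) = a \<odot>\<^bsub>P\<^esub> left_action_map P w"
proof -
 assume a: "a : carrier A" and w: "w : carrier AP"
 show ?thesis
  by (rule AK.T_ext[OF amap_comp[OF lam(1) AK.T_smult_amap[OF a]] amap_comp[OF gab_smult[OF P_gab a] lam(1)] _ w])
    (use a in "simp add: AK.T_smult lam(2) Q_bimod(8)")
qed

lemma expand: "amap PP TA (expand_mid K A P)"
  "x : carrier P ==> y : carrier P ==> expand_mid K A P (pp x y) = pA x (pa \<one> y)"
proof -
 have c: "pa \<one> y : carrier AP" if "y : carrier P" for y using that by (intro AK.pt_closed) simp_all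
 have b: "balanced (carrier K) (%x c. (c \<odot> \<one>) \<odot>\<^bsub>P\<^esub> x) (%c y. (c \<odot> \<one>) \<odot>\<^bsub>P\<^esub> y) P P TA (%x y. pA x (pa \<one> y))"
 proof (rule balancedI)
  show "amap P TA (%x. pA x (pa \<one> y))" if "y : carrier P" for y by (rule TA.pt_amap_l[OF c[OF that]])
  show "amap P TA (%y. pA x (pa \<one> y))" if "x : carrier P" for x
   by (rule amap_comp[OF TA.pt_amap_r[OF that] AK.pt_amap_r]) simp
  fix x s y assume h: "x : carrier P" "s : carrier K" "y : carrier P"
  note sc = scalar_closed[OF h(2)]
  have "pA ((s \<odot> \<one>) \<odot>\<^bsub>P\<^esub> x) (pa \<one> y) = pA x ((s \<odot> \<one>) \<odot>\<^bsub>AP\<^esub> pa \<one> y)"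
   using TA.pt_bal[OF h(1) sc c[OF h(3)]] Q_bimod(13)[OF h(2,1)] by simp
  also have "(s \<odot> \<one>) \<odot>\<^bsub>AP\<^esub> pa \<one> y = pa \<one> ((s \<odot> \<one>) \<odot>\<^bsub>P\<^esub> y)"
   using AK.T_smult[OF sc, of "\<one>" y] AK.pt_bal[of "\<one>" s y] h by simp
  finally show "pA ((s \<odot> \<one>) \<odot>\<^bsub>P\<^esub> x) (pa \<one> y) = pA x (pa \<one> ((s \<odot> \<one>) \<odot>\<^bsub>P\<^esub> y))" .
 qed
 show "amap PP TA (expand_mid K A P)" unfolding expand_mid_def by (rule PK.tlift_amap[OF b TA.T_group])
 show "x : carrier P ==> y : carrier P ==> expand_mid K A P (pp x y) = pA x (pa \<one> y)"
  unfolding expand_mid_def by (rule PK.tlift_pure[OF b TA.T_group])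
qed

lemma m5: "amap TA TQ (tensor_map_A A P P P 0 id (left_action_map P))"
  "x : carrier P ==> w : carrier AP ==> tensor_map_A A P P P 0 id (left_action_map P) (pA x w) = x \<otimes>\<^sub>P left_action_map P w"
proof -
 note lc = amap_closed[OF lam(1)]
 have l: "amap P TQ (%x. id x \<otimes>\<^sub>P left_action_map P w)" if "w : carrier AP" for w using T.pt_amap_l[OF lc[OF that]] by simp
 have r: "amap AP TQ (%w. id x \<otimes>\<^sub>P left_action_map P w)" if "x : carrier P" for x
  using amap_comp[OF T.pt_amap_r[OF that] lam(1)] by simp
 have b: "id (sgnmap P 0 (rsmult P x s)) \<otimes>\<^sub>P left_action_map P w = id (sgnmap P 0 x) \<otimes>\<^sub>P left_action_map P (s \<odot>\<^bsub>AP\<^esub> w)"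
  if "x : carrier P" "s : carrier A" "w : carrier AP" for x s w
  using that T.pt_bal[of x s "left_action_map P w"] lc by (simp add: sg0 lam_smult)
 show "amap TA TQ (tensor_map_A A P P P 0 id (left_action_map P))"
  unfolding tensor_map_A_def by (rule TA.tensor_map_amap[where p = "pure_A A P P" and f = "id" and g = "left_action_map P" and m = 0, OF P_graded l r b T_gp])
 show "x : carrier P ==> w : carrier AP ==> tensor_map_A A P P P 0 id (left_action_map P) (pA x w) = x \<otimes>\<^sub>P left_action_map P w"
  unfolding tensor_map_A_def using TA.tensor_map_pure[where p = "pure_A A P P" and f = "id" and g = "left_action_map P" and m = 0, OF P_graded l r b T_gp] by (simp add: sg0)
qed

text \<open>The last two maps in \<open>t_L\<close> and \<open>eta_L\<close>. Their composite is the
  canonical map from the tensor square over the field to the one over \<open>A\<close>.\<close>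

definition "J z = tensor_map_A A P P P 0 id (left_action_map P) (expand_mid K A P z)"

lemma J_amap: "amap PP TQ J" unfolding J_def by (rule amap_comp[OF m5(1) expand(1)])

lemma J_val: "x : carrier P ==> y : carrier P ==> J (pp x y) = x \<otimes>\<^sub>P y"
 unfolding J_def by (simp add: expand(2) m5(2) AK.pt_closed lam(2) Q_bimod(11))

text \<open>\<open>t_L\<close> and \<open>eta_L\<close> with a general element \<open>w\<close> in
  place of the value of \<open>\<iota>\<close>. Values of \<open>\<iota>\<close> are not pure
  tensors, so identities are first proved for all \<open>w\<close>, where pure tensors
  suffice.\<close>

definition "th x w = J (tensor_map_K K A P P P 0 t id (c1 x w))"
definition "hh w = J (tensor_map_K K A (regular A) P P 0 \<eta> id w)"
abbreviation "tL == t_L K A P t \<iota>"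
abbreviation "eL == eta_L K A P \<eta> \<iota>"

lemma th_amap: "x : carrier P ==> amap AP TQ (th x)"
 unfolding th_def by (rule amap_comp[OF J_amap amap_comp[OF tK(1) c1_amap]])

lemma th_val: "x : carrier P ==> a : carrier A ==> y : carrier P ==> th x (pa a y) = t (rsmult P x a) \<otimes>\<^sub>P y"
 by (simp add: th_def c1_val tK(2) J_val amap_closed[OF t_amap])

lemma hh_amap: "amap AP TQ hh"
 unfolding hh_def by (rule amap_comp[OF J_amap \<eta>K(1)])

lemma \<eta>_closed: "a : carrier A ==> \<eta> a : carrier P" using amap_closed[OF \<eta>_amap] by simp

lemma hh_val: "a : carrier A ==> y : carrier P ==> hh (pa a y) = \<eta> a \<otimes>\<^sub>P y"
 by (simp add: hh_def \<eta>K(2) J_val \<eta>_closed)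

lemma tL_amap: "amap TQ TQ tL"
 using amap_comp[OF J_amap amap_comp[OF tK(1) amap_comp[OF contract(1) m1(1)]]]
 by (simp add: t_L_def J_def comp_def)

lemma tL_val: "x : carrier P ==> y : carrier P ==> tL (x \<otimes>\<^sub>P y) = th x (\<iota> y)"
 by (simp add: t_L_def th_def J_def m1(2) contract(2) \<iota>s)

lemma eL_val: "y : carrier P ==> eL y = hh (\<iota> y)"
 by (simp add: eta_L_def hh_def J_def)

end

lemma graded_induct:
 assumes Q: "graded_bimod K A Q" and x: "x : carrier Q" and 0: "R \<zero>\<^bsub>Q\<^esub>"
  and g: "!!n x. x : grade Q n ==> R x"
  and p: "!!x y. x : carrier Q ==> y : carrier Q ==> R x ==> R y ==> R (x \<oplus>\<^bsub>Q\<^esub> y)"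
 shows "R x"
proof -
 note gb = gab_graded_bimod[OF Q]
 interpret Q: abelian_group Q by (rule gab_group[OF gb])
 note h = hcomp_props[OF Q x]
 have c: "hcomp Q x i : carrier Q" for i by (rule gab_grade[OF gb h(1)])
 have "R (finsum Q (hcomp Q x) F)" if "finite F" for F
  using that by (induction F) (simp_all add: 0 p g[OF h(1)] c)
 from this[OF h(2)] show ?thesis by (simp add: h(3))
qed

context split_resolution begin

lemma t_left: "a : carrier A ==> x : carrier P ==> t (a \<odot>\<^bsub>P\<^esub> x) = a \<odot>\<^bsub>P\<^esub> t x"
 using lch by (simp add: left_contracting_homotopy_def left_hom_def)
lemma \<eta>_left: "a : carrier A ==> b : carrier A ==> \<eta> (a \<otimes> b) = a \<odot>\<^bsub>P\<^esub> \<eta> b"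
 using lch by (simp add: left_contracting_homotopy_def left_hom_def)
lemma t_homotopy: "x : carrier P ==> d (t x) \<oplus>\<^bsub>P\<^esub> t (d x) \<oplus>\<^bsub>P\<^esub> \<eta> (\<mu> x) = x"
 using lch by (simp add: left_contracting_homotopy_def)

lemmas [simp] = amap_closed[OF t_amap] \<eta>_closed \<mu>\<eta>

lemma \<mu>t0 [simp]: "x : carrier P ==> \<mu> (t x) = \<zero>"
 by (rule graded_ext[OF P_graded amap_comp[OF ghom_amap[OF \<mu>_ghom] t_amap] amap_const_zero[OF Q_gp rg] _, simplified])
   (simp_all add: \<mu>t)

lemma d\<eta> [simp]: "a : carrier A ==> d (\<eta> a) = \<zero>\<^bsub>P\<^esub>"
 by (rule neg_grade[of "- 1"]) (simp_all add: ghom_degree[OF d_ghom \<eta>_grade])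

section \<open>The two partial differentials and the contraction of the left one\<close>

definition "dL = tmapV P d (%x. x)"
definition "dR = tmapV P (\<sigma> 1) d"

lemma D_split: "D z = dL z \<oplus>\<^bsub>TQ\<^esub> dR z" by (simp add: D_def dL_def dR_def)

lemma dL_ghom: "ghom A TQ TQ (- 1) dL" unfolding dL_def by (rule tmapV_ghom[OF Q_graded d_ghom Q_id]) simp
lemma dR_ghom: "ghom A TQ TQ (- 1) dR" unfolding dR_def by (rule tmapV_ghom[OF Q_graded \<sigma>_ghom d_ghom]) simp
lemma dL_val [simp]: "x : carrier P ==> y : carrier P ==> dL (x \<otimes>\<^sub>P y) = d x \<otimes>\<^sub>P y"
 unfolding dL_def by (rule tmapV_val[OF Q_graded d_ghom Q_id refl])
lemma dR_val [simp]: "x : carrier P ==> y : carrier P ==> dR (x \<otimes>\<^sub>P y) = \<sigma> 1 x \<otimes>\<^sub>P d y"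
 unfolding dR_def by (rule tmapV_val[OF Q_graded \<sigma>_ghom d_ghom refl])

lemmas [simp] = ghomD(4-8)[OF dL_ghom] ghomD(4-8)[OF dR_ghom]

lemma d_R_eq: "z : carrier TQ ==> d_R A P d z = dR z"
proof -
 assume z: "z : carrier TQ"
 have l: "amap P TQ (%x. id x \<otimes>\<^sub>P d y)" if "y : carrier P" for y using T.pt_amap_l[of "d y"] that by simp
 have r: "amap P TQ (%y. id x \<otimes>\<^sub>P d y)" if "x : carrier P" for x using amap_comp[OF T.pt_amap_r[OF that] ghom_amap[OF d_ghom]] by simp
 have b: "id (sgnmap P (- 1) (rsmult P x s)) \<otimes>\<^sub>P d y = id (sgnmap P (- 1) x) \<otimes>\<^sub>P d (s \<odot>\<^bsub>P\<^esub> y)"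
  if "x : carrier P" "s : carrier A" "y : carrier P" for x s y
  using that T.pt_bal[of "sgnmap P (- 1) x" s "d y"] by simp
 have p: "sgnmap P (- 1) = \<sigma> 1" by (rule sgnmap_parity) simp
 show ?thesis
  unfolding d_R_def tensor_map_A_def
  by (rule T.T_ext[OF T.tensor_map_amap[where p = "pure_A A P P" and f = id and g = d and m = "- 1", OF P_graded l r b T_gp] ghom_amap[OF dR_ghom] _ z])
    (simp_all add: T.tensor_map_pure[where p = "pure_A A P P" and f = id and g = d and m = "- 1", OF P_graded l r b T_gp] p)
qed

lemma th_grade: "x : grade P i ==> w : grade AP j ==> th x w : grade TQ (i + j + 1)"
proof -
 assume x: "x : grade P i" and w: "w : grade AP j"
 note xc = gab_grade[OF P_gab x] and am = th_amap[OF gab_grade[OF P_gab x]] and Ac = gab_grade[OF AK.T_gab]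
 show ?thesis
  using w
 proof (induction rule: AK.grade_T_induct)
  case (pure a y i' j')
  have a: "a : carrier A" and y: "y : carrier P" using pure gab_grade[OF regular_gab pure(1)] gab_grade[OF P_gab pure(2)] by simp_all
  show ?case
  proof (cases "i' = 0")
   case True
   have "t (rsmult P x a) : grade P (i + 1)" by (rule t_grade[OF graded_bimod_smult(2)[OF P_graded a x]])
   then show ?thesis using T.pt_grade[OF _ pure(2)] pure(3) True by (simp add: th_val[OF xc a y])
  next
   case False
   then have "t (rsmult P x a) \<otimes>\<^sub>P y = \<zero>\<^bsub>TQ\<^esub>" using pure(1) xc y amap_zero[OF t_amap] by simp
   then show ?thesis by (simp add: th_val[OF xc a y] gab_grade_zero[OF T.T_gab])
  qed
 qed (simp_all add: amap_zero[OF am] amap_neg[OF am] amap_add[OF am] Ac gab_grade_zero[OF T.T_gab] gab_grade_neg[OF T.T_gab] gab_grade_add[OF T.T_gab])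
qed

lemma hh_grade: "w : grade AP j ==> hh w : grade TQ j"
proof -
 assume w: "w : grade AP j"
 note am = hh_amap and Ac = gab_grade[OF AK.T_gab]
 show ?thesis
  using w
 proof (induction rule: AK.grade_T_induct)
  case (pure a y i' j')
  have a: "a : carrier A" and y: "y : carrier P" using pure gab_grade[OF regular_gab pure(1)] gab_grade[OF P_gab pure(2)] by simp_all
  show ?case
  proof (cases "i' = 0")
   case True
   then show ?thesis using T.pt_grade[OF \<eta>_grade[OF a] pure(2)] pure(3) by (simp add: hh_val[OF a y])
  next
   case False
   then have "a = \<zero>" using pure(1) by simp
   then show ?thesis using y amap_zero[OF \<eta>_amap] by (simp add: hh_val gab_grade_zero[OF T.T_gab])
  qed
 qed (simp_all add: amap_zero[OF am] amap_neg[OF am] amap_add[OF am] Ac gab_grade_zero[OF T.T_gab] gab_grade_neg[OF T.T_gab] gab_grade_add[OF T.T_gab])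
qed

lemma th_bimod:
 assumes x: "x : carrier P" and a: "a : carrier A" and w: "w : carrier AP"
 shows "th (a \<odot>\<^bsub>P\<^esub> x) w = a \<odot>\<^bsub>TQ\<^esub> th x w" "th x (rsmult AP w a) = rsmult TQ (th x w) a"
proof -
 show "th (a \<odot>\<^bsub>P\<^esub> x) w = a \<odot>\<^bsub>TQ\<^esub> th x w"
  by (rule AK.T_ext[OF th_amap amap_comp[OF T.T_smult_amap[OF a] th_amap[OF x]] _ w])
    (use x a in "simp_all add: th_val Q_bimod(10) t_left T.T_smult")
 show "th x (rsmult AP w a) = rsmult TQ (th x w) a"
  by (rule AK.T_ext[OF amap_comp[OF th_amap[OF x] AK.T_rsmult_amap[OF a]] amap_comp[OF T.T_rsmult_amap[OF a] th_amap[OF x]] _ w])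
    (use x a in "simp_all add: th_val AK.T_rsmult T.T_rsmult")
qed

lemma hh_bimod:
 assumes a: "a : carrier A" and w: "w : carrier AP"
 shows "hh (a \<odot>\<^bsub>AP\<^esub> w) = a \<odot>\<^bsub>TQ\<^esub> hh w" "hh (rsmult AP w a) = rsmult TQ (hh w) a"
proof -
 show "hh (a \<odot>\<^bsub>AP\<^esub> w) = a \<odot>\<^bsub>TQ\<^esub> hh w"
  by (rule AK.T_ext[OF amap_comp[OF hh_amap AK.T_smult_amap[OF a]] amap_comp[OF T.T_smult_amap[OF a] hh_amap] _ w])
    (use a in "simp_all add: hh_val AK.T_smult \<eta>_left T.T_smult")
 show "hh (rsmult AP w a) = rsmult TQ (hh w) a"
  by (rule AK.T_ext[OF amap_comp[OF hh_amap AK.T_rsmult_amap[OF a]] amap_comp[OF T.T_rsmult_amap[OF a] hh_amap] _ w])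
    (use a in "simp_all add: hh_val AK.T_rsmult T.T_rsmult")
qed

lemma \<iota>_grade: "y : grade P j ==> \<iota> y : grade AP j" using ghom_degree[OF \<iota>_ghom, of y j j] by simp

lemma tL_ghom: "ghom A TQ TQ 1 tL"
 by (rule T.T_ghomI[OF tL_amap T.T_gab])
   (simp_all add: tL_val T.T_smult T.T_rsmult th_bimod \<iota>s gab_grade[OF P_gab] th_grade \<iota>_grade)

lemma eL_amap: "amap P TQ eL"
 using amap_comp[OF hh_amap ghom_amap[OF \<iota>_ghom]] by (simp add: eta_L_def hh_def J_def comp_def)

lemma eL_ghom: "ghom A P TQ 0 eL"
 by (rule ghomI[OF P_gab T.T_gab eL_amap]) (simp_all add: eL_val hh_bimod \<iota>s gab_grade[OF P_gab] hh_grade \<iota>_grade)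

lemmas [simp] = ghomD(4-8)[OF tL_ghom] ghomD(4-8)[OF eL_ghom]

lemmas tcomp = amap_comp[OF ghom_amap[OF tL_ghom]] amap_comp[OF ghom_amap[OF dL_ghom]] amap_comp[OF ghom_amap[OF dR_ghom]]
 amap_comp[OF eL_amap] amap_comp[OF ghom_amap[OF mul_ghom]]

text \<open>For general \<open>w\<close> the left side gives \<open>x\<close> tensored with the
  image of \<open>w\<close> under the action map: on \<open>w = pa a v\<close> this is the homotopy
  identity at \<open>rsmult P x a\<close>, moved across the tensor sign. Inserting
  \<open>\<iota> y\<close> and using that \<open>\<iota>\<close> is a section yields the
  claim.\<close>

lemma tL_homotopy: "z : carrier TQ ==> dL (tL z) \<oplus>\<^bsub>TQ\<^esub> tL (dL z) \<oplus>\<^bsub>TQ\<^esub> eL (mul z) = z"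
proof (rule T.T_ext[OF _ amap_id[OF T_gp]])
 show "amap TQ TQ (%z. dL (tL z) \<oplus>\<^bsub>TQ\<^esub> tL (dL z) \<oplus>\<^bsub>TQ\<^esub> eL (mul z))"
  by (intro amap_plus amap_comp[OF ghom_amap[OF dL_ghom] ghom_amap[OF tL_ghom]] amap_comp[OF ghom_amap[OF tL_ghom] ghom_amap[OF dL_ghom]]
    amap_comp[OF eL_amap ghom_amap[OF mul_ghom]])
 fix x y assume x: "x : carrier P" and y: "y : carrier P"
 have key: "dL (th x w) \<oplus>\<^bsub>TQ\<^esub> th (d x) w \<oplus>\<^bsub>TQ\<^esub> hh (\<mu> x \<odot>\<^bsub>AP\<^esub> w) = x \<otimes>\<^sub>P left_action_map P w" if w: "w : carrier AP" for w
 proof (rule AK.T_ext[OF _ amap_comp[OF T.pt_amap_r[OF x] lam(1)] _ w])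
  show "amap AP TQ (%w. dL (th x w) \<oplus>\<^bsub>TQ\<^esub> th (d x) w \<oplus>\<^bsub>TQ\<^esub> hh (\<mu> x \<odot>\<^bsub>AP\<^esub> w))"
   using x by (intro amap_plus amap_comp[OF ghom_amap[OF dL_ghom] th_amap] th_amap amap_comp[OF hh_amap AK.T_smult_amap]) simp_all
  fix a v assume a: "a : carrier (regular A)" and v: "v : carrier P"
  let ?u = "rsmult P x a"
  have u: "?u : carrier P" using a x by simp
  have "(d (t ?u) \<oplus>\<^bsub>P\<^esub> t (d ?u) \<oplus>\<^bsub>P\<^esub> \<eta> (\<mu> ?u)) \<otimes>\<^sub>P v = ?u \<otimes>\<^sub>P v" by (simp only: t_homotopy[OF u])
  then show "dL (th x (pa a v)) \<oplus>\<^bsub>TQ\<^esub> th (d x) (pa a v) \<oplus>\<^bsub>TQ\<^esub> hh (\<mu> x \<odot>\<^bsub>AP\<^esub> pa a v) = x \<otimes>\<^sub>P left_action_map P (pa a v)"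
   using a v x T.pt_bal[of x a v] u by (simp add: th_val hh_val AK.T_smult lam(2))
 qed
 show "dL (tL (x \<otimes>\<^sub>P y)) \<oplus>\<^bsub>TQ\<^esub> tL (dL (x \<otimes>\<^sub>P y)) \<oplus>\<^bsub>TQ\<^esub> eL (mul (x \<otimes>\<^sub>P y)) = x \<otimes>\<^sub>P y"
  using key[OF \<iota>s(1)[OF y]] x y \<pi>\<iota> by (simp add: tL_val eL_val \<iota>s)
qed

lemma mul_tL [simp]: "z : carrier TQ ==> mul (tL z) = \<zero>\<^bsub>P\<^esub>"
proof (rule T.T_ext[OF amap_comp[OF ghom_amap[OF mul_ghom] ghom_amap[OF tL_ghom]] amap_const_zero[OF T_gp Q_gp]])
 fix x y assume x: "x : carrier P" and y: "y : carrier P"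
 have "mul (th x w) = \<zero>\<^bsub>P\<^esub>" if w: "w : carrier AP" for w
  by (rule AK.T_ext[OF amap_comp[OF ghom_amap[OF mul_ghom] th_amap[OF x]] amap_const_zero[OF AK.T_group Q_gp] _ w])
    (use x in "simp add: th_val")
 then show "mul (tL (x \<otimes>\<^sub>P y)) = \<zero>\<^bsub>P\<^esub>" using x y by (simp add: tL_val \<iota>s)
qed

lemma mul_eL [simp]: "y : carrier P ==> mul (eL y) = y"
proof -
 assume y: "y : carrier P"
 have "mul (hh w) = left_action_map P w" if w: "w : carrier AP" for w
  by (rule AK.T_ext[OF amap_comp[OF ghom_amap[OF mul_ghom] hh_amap] lam(1) _ w]) (simp add: hh_val lam(2))
 then show ?thesis using y \<pi>\<iota> by (simp add: eL_val \<iota>s)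
qed

lemma dL_eL [simp]: "y : carrier P ==> dL (eL y) = \<zero>\<^bsub>TQ\<^esub>"
proof -
 assume y: "y : carrier P"
 have "dL (hh w) = \<zero>\<^bsub>TQ\<^esub>" if w: "w : carrier AP" for w
  by (rule AK.T_ext[OF amap_comp[OF ghom_amap[OF dL_ghom] hh_amap] amap_const_zero[OF AK.T_group T_gp] _ w]) (simp add: hh_val)
 then show ?thesis using y by (simp add: eL_val \<iota>s)
qed

text \<open>The differential lowers the degree by one, so it anticommutes with the twist in
  \<open>dR\<close>.\<close>

lemma dL_dR: "z : carrier TQ ==> dL (dR z) = \<ominus>\<^bsub>TQ\<^esub> dR (dL z)"
 by (rule T.T_ext[of TQ "%z. dL (dR z)" "%z. \<ominus>\<^bsub>TQ\<^esub> dR (dL z)"])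
   (intro amap_uminus amap_comp[OF ghom_amap[OF dL_ghom]] amap_comp[OF ghom_amap[OF dR_ghom]] ghom_amap[OF dR_ghom],
   intro amap_uminus amap_comp[OF ghom_amap[OF dR_ghom] ghom_amap[OF dL_ghom]], simp_all add: d\<sigma> sneg_def)

lemma dR_dR [simp]: "z : carrier TQ ==> dR (dR z) = \<zero>\<^bsub>TQ\<^esub>"
 by (rule T.T_ext[OF amap_comp[OF ghom_amap[OF dR_ghom] ghom_amap[OF dR_ghom]] amap_const_zero[OF T_gp T_gp]]) simp_all

lemma mul_dR [simp]: "z : carrier TQ ==> mul (dR z) = d (mul z)"
 by (rule T.T_ext[OF amap_comp[OF ghom_amap[OF mul_ghom] ghom_amap[OF dR_ghom]] amap_comp[OF ghom_amap[OF d_ghom] ghom_amap[OF mul_ghom]]]) simp_all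

section \<open>Local nilpotency of \<open>nil\<close> and bijectivity of \<open>u\<close>\<close>

definition "nil z = tL (dR z)"
definition "u z = z \<oplus>\<^bsub>TQ\<^esub> nil z"

lemma nil_ghom: "ghom A TQ TQ 0 nil" unfolding nil_def by (rule ghom_comp[OF tL_ghom dR_ghom]) simp
lemma u_ghom: "ghom A TQ TQ 0 u"
proof -
 have "ghom A TQ TQ 0 (%z. z \<oplus>\<^bsub>TQ\<^esub> nil z)" by (rule ghom_plus[OF nil_ghom ghom_id[OF T.T_gab]])
 then show ?thesis by (simp add: u_def[abs_def])
qed

lemmas [simp] = ghomD(4-8)[OF nil_ghom] ghomD(4-8)[OF u_ghom]

text \<open>The span of the tensors whose right factor has degree less than \<open>n\<close> (and whose total degree
  satisfies \<open>M\<close>): the perturbation lowers \<open>n\<close>.\<close>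

inductive_set Fil :: "(int => bool) => nat => ('p, 'p) tens set" for M n where
 zero: "\<zero>\<^bsub>TQ\<^esub> : Fil M n"
| pure: "x : grade P i ==> y : grade P j ==> j < int n ==> M (i + j) ==> x \<otimes>\<^sub>P y : Fil M n"
| neg: "z : Fil M n ==> \<ominus>\<^bsub>TQ\<^esub> z : Fil M n"
| add: "z : Fil M n ==> w : Fil M n ==> z \<oplus>\<^bsub>TQ\<^esub> w : Fil M n"

lemma Fil_closed: "z : Fil M n ==> z : carrier TQ"
 by (induction rule: Fil.induct) (simp_all add: gab_grade[OF P_gab])

lemma Fil_grade: "z : Fil (%k. k = m) n ==> z : grade TQ m"
 by (induction rule: Fil.induct)
   (simp_all add: gab_grade_zero[OF T.T_gab] gab_grade_neg[OF T.T_gab] gab_grade_add[OF T.T_gab] T.pt_grade)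

lemma Fil_0: "z : Fil M 0 ==> z = \<zero>\<^bsub>TQ\<^esub>"
 by (induction rule: Fil.induct) (auto simp: gab_grade[OF P_gab] dest: neg_grade)

lemma Fil_mono: "z : Fil M n ==> n <= n' ==> z : Fil M n'"
proof (induction rule: Fil.induct)
 case (pure x i y j)
 then show ?case by (intro Fil.pure) simp_all
qed (auto intro: Fil.intros)

lemma Fil_th: "x : grade P i ==> w : grade AP j ==> j < int n ==> M (i + 1 + j) ==> th x w : Fil M n"
proof -
 assume x: "x : grade P i" and w: "w : grade AP j" and j: "j < int n" "M (i + 1 + j)"
 note xc = gab_grade[OF P_gab x] and am = th_amap[OF gab_grade[OF P_gab x]] and Ac = gab_grade[OF AK.T_gab]
 show ?thesis
  using w
 proof (induction rule: AK.grade_T_induct)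
  case (pure a y i' j')
  have a: "a : carrier A" and y: "y : carrier P" using pure gab_grade[OF regular_gab pure(1)] gab_grade[OF P_gab pure(2)] by simp_all
  show ?case
  proof (cases "i' = 0")
   case True
   have "t (rsmult P x a) : grade P (i + 1)" by (rule t_grade[OF graded_bimod_smult(2)[OF P_graded a x]])
   then show ?thesis unfolding th_val[OF xc a y] using pure(2,3) True j by (intro Fil.pure) simp_all
  next
   case False
   then have "t (rsmult P x a) \<otimes>\<^sub>P y = \<zero>\<^bsub>TQ\<^esub>" using pure(1) xc y amap_zero[OF t_amap] by simp
   then show ?thesis by (simp add: th_val[OF xc a y] Fil.zero)
  qed
 qed (simp_all add: amap_zero[OF am] amap_neg[OF am] amap_add[OF am] Ac Fil.zero Fil.neg Fil.add)
qed

text \<open>The differential lowers the degree of the right factor by one. Neither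
  \<open>\<iota>\<close> nor \<open>th\<close> raises it again, since the algebra sits in degree 0;
  the left factor gains the degree that was lost.\<close>

lemma Fil_nil: "z : Fil M (Suc n) ==> nil z : Fil M n"
proof (induction rule: Fil.induct)
 case (pure x i y j)
 note c = gab_grade[OF P_gab pure(1)] gab_grade[OF P_gab pure(2)]
 have "\<sigma> 1 x : grade P i" using ghom_degree[OF \<sigma>_ghom pure(1), of i 1] by simp
 moreover have "\<iota> (d y) : grade AP (j - 1)" by (rule \<iota>_grade) (use ghom_degree[OF d_ghom pure(2), of "j - 1"] in simp)
 moreover have "j - 1 < int n" using pure(3) by linarith
 moreover have "i + 1 + (j - 1) = i + j" by linarith
 ultimately have "th (\<sigma> 1 x) (\<iota> (d y)) : Fil M n" using pure(4) Fil_th[of "\<sigma> 1 x" i "\<iota> (d y)" "j - 1" n M] by simp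
 then show ?case using c by (simp add: nil_def tL_val)
qed (auto simp: Fil_closed intro: Fil.intros)

lemma Fil_all: "z : carrier TQ ==> EX n. z : Fil (%_. True) n"
proof -
 have ad: "EX n. z \<oplus>\<^bsub>TQ\<^esub> w : Fil M n" if zw: "EX n. z : Fil M n" "EX n. w : Fil M n" for z w M
 proof -
  obtain n where n: "z : Fil M n" using zw(1) ..
  obtain n' where n': "w : Fil M n'" using zw(2) ..
  show ?thesis by (rule exI, rule Fil.add[OF Fil_mono[OF n le_add1] Fil_mono[OF n' le_add2]])
 qed
 assume "z : carrier TQ"
 then show ?thesis
 proof (induction rule: T.T_induct)
  case zero
  show ?case using Fil.zero by blast
 next
  case (pure x y)
  show ?case
  proof (rule graded_induct[OF P_graded pure(1), where R = "%x. EX n. x \<otimes>\<^sub>P y : Fil (%_. True) n"])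
   show "EX n. \<zero>\<^bsub>P\<^esub> \<otimes>\<^sub>P y : Fil (%_. True) n" using pure(2) Fil.zero by auto
   show "EX n. (u \<oplus>\<^bsub>P\<^esub> v) \<otimes>\<^sub>P y : Fil (%_. True) n"
    if "u : carrier P" "v : carrier P" "EX n. u \<otimes>\<^sub>P y : Fil (%_. True) n" "EX n. v \<otimes>\<^sub>P y : Fil (%_. True) n" for u v
    using ad[OF that(3,4)] that(1,2) pure(2) by simp
   fix i x assume x: "x : grade P i"
   note xc = gab_grade[OF P_gab x]
   show "EX n. x \<otimes>\<^sub>P y : Fil (%_. True) n"
   proof (rule graded_induct[OF P_graded pure(2), where R = "%y. EX n. x \<otimes>\<^sub>P y : Fil (%_. True) n"])
    show "EX n. x \<otimes>\<^sub>P \<zero>\<^bsub>P\<^esub> : Fil (%_. True) n" using xc Fil.zero by auto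
    show "EX n. x \<otimes>\<^sub>P (u \<oplus>\<^bsub>P\<^esub> v) : Fil (%_. True) n"
     if "u : carrier P" "v : carrier P" "EX n. x \<otimes>\<^sub>P u : Fil (%_. True) n" "EX n. x \<otimes>\<^sub>P v : Fil (%_. True) n" for u v
     using ad[OF that(3,4)] that(1,2) xc by simp
    fix j y assume y: "y : grade P j"
    have "x \<otimes>\<^sub>P y : Fil (%_. True) (nat (j + 1))" by (rule Fil.pure[OF x y]) simp_all
    then show "EX n. x \<otimes>\<^sub>P y : Fil (%_. True) n" by blast
   qed
  qed
 next
  case (diff z w)
  then have "EX n. \<ominus>\<^bsub>TQ\<^esub> w : Fil (%_. True) n" using Fil.neg by blast
  then show ?case using ad[OF diff(3)] by (simp add: a_minus_def)
 qed
qed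

lemma Fil_all_grade: "z : grade TQ m ==> EX n. z : Fil (%k. k = m) n"
proof (induction rule: T.grade_T_induct)
 case zero
 show ?case using Fil.zero by blast
next
 case (pure x y i j)
 have "x \<otimes>\<^sub>P y : Fil (%k. k = m) (nat (j + 1))" by (rule Fil.pure[OF pure(1,2)]) (simp_all add: pure(3))
 then show ?case by blast
next
 case (neg z)
 then show ?case using Fil.neg by blast
next
 case (add z w)
 obtain n where n: "z : Fil (%k. k = m) n" using add(3) ..
 obtain n' where n': "w : Fil (%k. k = m) n'" using add(4) ..
 show ?case by (rule exI, rule Fil.add[OF Fil_mono[OF n le_add1] Fil_mono[OF n' le_add2]])
qed

text \<open>In place of an alternating series: if \<open>w\<close> solves \<open>u w = nil z\<close>
  one filtration step lower, then \<open>z - w\<close> is a preimage of \<open>z\<close>.\<close>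

lemma u_surj: "z : Fil M n ==> EX w:Fil M n. u w = z"
proof (induction n arbitrary: z)
 case 0
 have "u \<zero>\<^bsub>TQ\<^esub> = z" using Fil_0[OF 0] by simp
 then show ?case by (rule bexI[OF _ Fil.zero])
next
 case (Suc n)
 obtain w where w: "w : Fil M n" "u w = nil z" using Suc.IH[OF Fil_nil[OF Suc.prems]] by blast
 note c = Fil_closed[OF Suc.prems] Fil_closed[OF w(1)]
 have "u (z \<ominus>\<^bsub>TQ\<^esub> w) = u z \<ominus>\<^bsub>TQ\<^esub> nil z" using c w(2) by simp
 also have "\<dots> = z" unfolding u_def
  by (rule rep_eq[of TQ], (rule rep_rules | (rule rep_atom, simp, simp add: c))+, simp)
 finally have "u (z \<ominus>\<^bsub>TQ\<^esub> w) = z" .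
 moreover have "z \<ominus>\<^bsub>TQ\<^esub> w : Fil M (Suc n)"
  unfolding a_minus_def by (rule Fil.add[OF Suc.prems Fil.neg[OF Fil_mono[OF w(1)]]]) simp
 ultimately show ?case by blast
qed

text \<open>An element of the kernel equals \<open>- nil z\<close>, so it lies one filtration step
  lower, and finally in step 0, which is zero.\<close>

lemma u_inj0: "z : Fil M n ==> u z = \<zero>\<^bsub>TQ\<^esub> ==> z = \<zero>\<^bsub>TQ\<^esub>"
proof (induction n)
 case 0
 then show ?case using Fil_0 by blast
next
 case (Suc n)
 interpret TG: abelian_group TQ by (rule T_gp)
 note c = Fil_closed[OF Suc.prems(1)]
 have "z = \<ominus>\<^bsub>TQ\<^esub> nil z" using Suc.prems(2) c TG.minus_equality[of z "nil z"] by (simp add: u_def)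
 then have "z : Fil M n" using Fil.neg[OF Fil_nil[OF Suc.prems(1)]] by simp
 then show ?case using Suc by blast
qed

lemma u_bij: "bij_betw u (carrier TQ) (carrier TQ)"
proof (rule bij_betw_imageI)
 interpret TG: abelian_group TQ by (rule T_gp)
 show "inj_on u (carrier TQ)"
 proof (rule inj_onI)
  fix z w assume z: "z : carrier TQ" and w: "w : carrier TQ" and e: "u z = u w"
  obtain n where "z \<ominus>\<^bsub>TQ\<^esub> w : Fil (%_. True) n" using Fil_all[of "z \<ominus>\<^bsub>TQ\<^esub> w"] z w by auto
  moreover have "u (z \<ominus>\<^bsub>TQ\<^esub> w) = \<zero>\<^bsub>TQ\<^esub>" using z w e by (simp add: a_minus_def TG.r_neg)
  ultimately have "z \<ominus>\<^bsub>TQ\<^esub> w = \<zero>\<^bsub>TQ\<^esub>" by (rule u_inj0)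
  moreover have "z = (z \<ominus>\<^bsub>TQ\<^esub> w) \<oplus>\<^bsub>TQ\<^esub> w"
   by (rule rep_eq[of TQ], (rule rep_rules | rule rep_atom | rule T_gp | rule z | rule w)+, simp)
  ultimately show "z = w" using w by simp
 qed
 show "u ` carrier TQ = carrier TQ"
 proof
  show "u ` carrier TQ <= carrier TQ" by auto
  show "carrier TQ <= u ` carrier TQ"
  proof
   fix z assume "z : carrier TQ"
   then obtain n where "z : Fil (%_. True) n" using Fil_all by blast
   then obtain w where w: "w : Fil (%_. True) n" "u w = z" using u_surj by blast
   show "z : u ` carrier TQ" using w(2) Fil_closed[OF w(1)] by blast
  qed
 qed
qed

abbreviation "S == S_map K A P d t \<iota>"

lemma S_eq: "S = inv_into (carrier TQ) (%z. z \<oplus>\<^bsub>TQ\<^esub> tL (d_R A P d z))" by (simp add: S_map_def)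

lemma u_eq: "z : carrier TQ ==> z \<oplus>\<^bsub>TQ\<^esub> tL (d_R A P d z) = u z" by (simp add: u_def nil_def d_R_eq)

lemma S_bij: "bij_betw (%z. z \<oplus>\<^bsub>TQ\<^esub> tL (d_R A P d z)) (carrier TQ) (carrier TQ)"
 using u_bij by (rule iffD2[OF bij_betw_cong, rotated]) (rule u_eq)

lemma S_closed [simp]: "z : carrier TQ ==> S z : carrier TQ"
 unfolding S_eq using S_bij by (simp add: bij_betw_def inv_into_into)

lemma uS [simp]: "z : carrier TQ ==> u (S z) = z"
 using bij_betw_inv_into_right[OF S_bij, of z] u_eq[OF S_closed[of z]] unfolding S_eq by simp

lemma Su [simp]: "z : carrier TQ ==> S (u z) = z"
 using bij_betw_inv_into_left[OF S_bij, of z] u_eq[of z] unfolding S_eq by simp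

text \<open>Linearity passes to the inverse. For the degree, the preimage is found inside the
  filtration restricted to one total degree, which is the reason for the parameter \<open>M\<close>
  of \<open>Fil\<close>.\<close>

lemma S_ghom: "ghom A TQ TQ 0 S"
proof (rule ghomI[OF T.T_gab T.T_gab])
 show "amap TQ TQ S"
 proof (rule amapI[OF T_gp T_gp])
  fix x y assume h: "x : carrier TQ" "y : carrier TQ"
  show "S x : carrier TQ" using h by simp
  show "S (x \<oplus>\<^bsub>TQ\<^esub> y) = S x \<oplus>\<^bsub>TQ\<^esub> S y" using Su[of "S x \<oplus>\<^bsub>TQ\<^esub> S y"] h by simp
 qed
 fix a x assume h: "a : carrier A" "x : carrier TQ"
 show "S (a \<odot>\<^bsub>TQ\<^esub> x) = a \<odot>\<^bsub>TQ\<^esub> S x"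
  using Su[of "a \<odot>\<^bsub>TQ\<^esub> S x"] h by (simp add: ghomD(9)[OF u_ghom] amap_closed[OF T.T_smult_amap])
 show "S (rsmult TQ x a) = rsmult TQ (S x) a"
  using Su[of "rsmult TQ (S x) a"] h by (simp add: ghomD(10)[OF u_ghom] amap_closed[OF T.T_rsmult_amap])
next
 fix n x assume x: "x : grade TQ n"
 obtain k where "x : Fil (%k. k = n) k" using Fil_all_grade[OF x] by blast
 then obtain w where "w : Fil (%k. k = n) k" "u w = x" using u_surj by blast
 then show "S x : grade TQ (n + 0)" using Fil_grade[of w n k] Fil_closed[of w] Su[of w] by simp
qed

lemmas [simp] = ghomD(5-8)[OF S_ghom]

lemma mulS [simp]: "z : carrier TQ ==> mul (S z) = mul z"
proof -
 assume z: "z : carrier TQ"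
 have "mul (u (S z)) = mul (S z)" using z S_closed[OF z] unfolding u_def nil_def by simp
 then show ?thesis using z by simp
qed

text \<open>The core of the perturbation argument: \<open>u\<close> carries the full differential to
  the left partial one, up to a term factoring through \<open>mul\<close>. It results from
  \<open>tL_homotopy\<close> at \<open>dR w\<close> and the anticommutation of the two partial
  differentials.\<close>

lemma uD: "w : carrier TQ ==> u (D w) = dL (u w) \<oplus>\<^bsub>TQ\<^esub> eL (d (mul (u w)))"
proof -
 assume w: "w : carrier TQ"
 define p q e a where "p = tL (dR (dL w))" "q = dL (tL (dR w))" "e = eL (d (mul w))" "a = dL w"
 note defs = this
 have c: "p : carrier TQ" "q : carrier TQ" "e : carrier TQ" "a : carrier TQ" using w by (simp_all add: defs)
 have "dR w = q \<ominus>\<^bsub>TQ\<^esub> p \<oplus>\<^bsub>TQ\<^esub> e"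
  using tL_homotopy[of "dR w"] w by (simp add: defs dL_dR a_minus_def)
 moreover have "u (D w) = a \<oplus>\<^bsub>TQ\<^esub> dR w \<oplus>\<^bsub>TQ\<^esub> p" using w by (simp add: u_def nil_def D_split defs)
 moreover have "mul (u w) = mul w" using w by (simp add: u_def nil_def)
 moreover have "dL (u w) = a \<oplus>\<^bsub>TQ\<^esub> q" using w by (simp add: u_def nil_def defs)
 moreover have "a \<oplus>\<^bsub>TQ\<^esub> (q \<ominus>\<^bsub>TQ\<^esub> p \<oplus>\<^bsub>TQ\<^esub> e) \<oplus>\<^bsub>TQ\<^esub> p = a \<oplus>\<^bsub>TQ\<^esub> q \<oplus>\<^bsub>TQ\<^esub> e"
  by (rule rep_eq[of TQ], (rule rep_rules | rule rep_atom | rule T_gp | rule c)+, simp)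
 ultimately show ?thesis by (simp add: defs(3))
qed

lemma DS: "z : carrier TQ ==> D (S z) = S (dL z) \<oplus>\<^bsub>TQ\<^esub> S (eL (d (mul z)))"
proof -
 assume z: "z : carrier TQ"
 have "u (D (S z)) = dL z \<oplus>\<^bsub>TQ\<^esub> eL (d (mul z))" using uD[OF S_closed[OF z]] z by simp
 then have "S (u (D (S z))) = S (dL z) \<oplus>\<^bsub>TQ\<^esub> S (eL (d (mul z)))" using z by simp
 moreover have "S (u (D (S z))) = D (S z)" by (rule Su) (use z in simp)
 ultimately show ?thesis by simp
qed

section \<open>The perturbed homotopy and diagonal\<close>

definition "hP z = S (tL z)"
definition "\<Delta>P y = S (eL y)"

lemma hP_ghom: "ghom A TQ TQ 1 hP" unfolding hP_def by (rule ghom_comp[OF S_ghom tL_ghom]) simp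
lemma \<Delta>P_ghom: "ghom A P TQ 0 \<Delta>P" unfolding \<Delta>P_def by (rule ghom_comp[OF S_ghom eL_ghom]) simp

lemmas [simp] = ghomD(4-8)[OF hP_ghom] ghomD(4-8)[OF \<Delta>P_ghom]

lemma D_\<Delta>P: "y : carrier P ==> D (\<Delta>P y) = \<Delta>P (d y)"
 by (simp add: \<Delta>P_def DS)

lemma mul_hP: "z : carrier TQ ==> mul (hP z) = \<zero>\<^bsub>P\<^esub>" by (simp add: hP_def)
lemma mul_\<Delta>P: "y : carrier P ==> mul (\<Delta>P y) = y" by (simp add: \<Delta>P_def)

lemma D_hP: "z : carrier TQ ==> D (hP z) = z \<ominus>\<^bsub>TQ\<^esub> hP (D z) \<ominus>\<^bsub>TQ\<^esub> \<Delta>P (mul z)"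
proof -
 assume z: "z : carrier TQ"
 define p q r s where "p = S (dL (tL z))" "q = S (tL (dL z))" "r = S (tL (dR z))" "s = S (eL (mul z))"
 note defs = this
 have c: "p : carrier TQ" "q : carrier TQ" "r : carrier TQ" "s : carrier TQ" using z by (simp_all add: defs)
 \<comment> \<open>By \<open>tL_homotopy\<close> the first three summands add up to
   \<open>z\<close>, so the argument of \<open>S\<close> is \<open>u z\<close>.\<close>
 have e0: "S (dL (tL z) \<oplus>\<^bsub>TQ\<^esub> tL (dL z) \<oplus>\<^bsub>TQ\<^esub> eL (mul z) \<oplus>\<^bsub>TQ\<^esub> tL (dR z)) = z"
  unfolding tL_homotopy[OF z] using Su[OF z] unfolding u_def nil_def .
 have e1: "S (dL (tL z) \<oplus>\<^bsub>TQ\<^esub> tL (dL z) \<oplus>\<^bsub>TQ\<^esub> eL (mul z) \<oplus>\<^bsub>TQ\<^esub> tL (dR z)) = p \<oplus>\<^bsub>TQ\<^esub> q \<oplus>\<^bsub>TQ\<^esub> s \<oplus>\<^bsub>TQ\<^esub> r"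
  using z by (simp add: defs)
 note e = trans[OF e0[symmetric] e1]
 have H: "D (hP z) = p" "hP (D z) = q \<oplus>\<^bsub>TQ\<^esub> r" "\<Delta>P (mul z) = s"
 proof -
  show "D (hP z) = p" using z by (simp add: hP_def DS defs)
  show "hP (D z) = q \<oplus>\<^bsub>TQ\<^esub> r" using z by (simp add: hP_def D_split defs)
  show "\<Delta>P (mul z) = s" by (simp add: \<Delta>P_def defs)
 qed
 have "p = p \<oplus>\<^bsub>TQ\<^esub> q \<oplus>\<^bsub>TQ\<^esub> s \<oplus>\<^bsub>TQ\<^esub> r \<ominus>\<^bsub>TQ\<^esub> (q \<oplus>\<^bsub>TQ\<^esub> r) \<ominus>\<^bsub>TQ\<^esub> s"
  by (rule rep_eq[of TQ], (rule rep_rules | rule rep_atom | rule T_gp | rule c)+, simp)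
 then show ?thesis unfolding H e[symmetric] .
qed

text \<open>The minus sign is the one in front of the circle product.\<close>

definition "\<phi>P z = \<ominus>\<^bsub>P\<^esub> mur (hP z)"
definition "\<psi>P y = mur (\<Delta>P y)"

lemma P_bdata: "bdata K A P d \<mu> \<Delta>P \<phi>P \<psi>P"
proof (intro bdata.intro cplx_axioms bdata_axioms.intro \<Delta>P_ghom)
 show "ghom A TQ P 1 \<phi>P" unfolding \<phi>P_def[abs_def] by (rule ghom_uminus[OF ghom_comp[OF mur_ghom hP_ghom]]) simp
 show "ghom A P P 0 \<psi>P" unfolding \<psi>P_def by (rule ghom_comp[OF mur_ghom \<Delta>P_ghom]) simp
 fix z assume z: "z : carrier TQ"
 define a b c where "a = mur z" "b = mur (hP (D z))" "c = mur (\<Delta>P (mul z))"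
 note defs = this
 have cl: "a : carrier P" "b : carrier P" "c : carrier P" using z by (simp_all add: defs)
 have "d (\<phi>P z) = \<ominus>\<^bsub>P\<^esub> (a \<ominus>\<^bsub>P\<^esub> b \<ominus>\<^bsub>P\<^esub> c)" using z by (simp add: \<phi>P_def d_mur D_hP defs)
 also have "\<dots> = c \<ominus>\<^bsub>P\<^esub> a \<ominus>\<^bsub>P\<^esub> (\<ominus>\<^bsub>P\<^esub> b)"
  by (rule rep_eq[of P], (rule rep_rules | rule rep_atom | rule Q_gp | rule cl)+, simp)
 finally show "d (\<phi>P z) = \<psi>P (mul z) \<ominus>\<^bsub>P\<^esub> mur z \<ominus>\<^bsub>P\<^esub> \<phi>P (D z)" by (simp add: \<phi>P_def \<psi>P_def defs)
qed (simp_all add: D_\<Delta>P mul_\<Delta>P \<psi>P_def)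

end

subsection \<open>The bracket of the resolution\<close>

context split_resolution begin

sublocale PB: bdata K A P d \<mu> \<Delta>P \<phi>P \<psi>P by (rule P_bdata)

lemma mu_R_eq: "z : carrier TQ ==> mu_R A P \<mu> z = mur z"
proof -
 assume z: "z : carrier TQ"
 have mc: "\<mu> y : carrier (regular A)" if "y : carrier P" for y using that by simp
 have l: "amap P (tensor_A A P (regular A)) (%x. pure_A A P (regular A) (id x) (\<mu> y))" if "y : carrier P" for y
  using PA.pt_amap_l[OF mc[OF that]] by simp
 have r: "amap P (tensor_A A P (regular A)) (%y. pure_A A P (regular A) (id x) (\<mu> y))" if "x : carrier P" for x
  using amap_comp[OF PA.pt_amap_r[OF that] ghom_amap[OF \<mu>_ghom]] by simp
 have b: "pure_A A P (regular A) (id (sgnmap P 0 (rsmult P x s))) (\<mu> y) = pure_A A P (regular A) (id (sgnmap P 0 x)) (\<mu> (s \<odot>\<^bsub>P\<^esub> y))"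
  if "x : carrier P" "s : carrier A" "y : carrier P" for x s y
  using that PA.pt_bal[of x s "\<mu> y"] by (simp add: sg0)
 note tm = T.tensor_map_amap[where p = "pure_A A P (regular A)" and f = id and g = \<mu> and m = 0, OF P_graded l r b PA.T_group]
  T.tensor_map_pure[where p = "pure_A A P (regular A)" and f = id and g = \<mu> and m = 0, OF P_graded l r b PA.T_group]
 have bb: "balanced (carrier A) (rsmult P) (smult (regular A)) P (regular A) P (%x a. rsmult P x a)"
  by (rule balancedI) (use gab_rsmult[OF P_gab] ract_amap in "simp_all add: Q_bimod(9)")
 note ra = PA.tlift_amap[OF bb Q_gp, folded right_action_map_def] PA.tlift_pure[OF bb Q_gp, folded right_action_map_def]
 show ?thesis
  unfolding mu_R_def tensor_map_A_def comp_def
  by (rule T.T_ext[OF amap_comp[OF ra(1) tm(1)] ghom_amap[OF mur_ghom] _ z]) (simp_all add: tm(2) ra(2) sg0)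
qed

lemma g1_eq:
 assumes g: "ghom A P (regular A) s g" and z: "z : carrier TQ"
 shows "(left_action_map P \<circ> tensor_map_A A P (regular A) P 0 g id) z = cap g z"
proof -
 note gs = ghomD(4)[OF g, simplified] ghomD(9,10)[OF g, simplified]
 have gc: "g x : carrier (regular A)" if "x : carrier P" for x using that gs by simp
 have l: "amap P (tensor_A A (regular A) P) (%x. pure_A A (regular A) P (g x) (id y))" if "y : carrier P" for y
  using amap_comp[OF LA.pt_amap_l[OF that] ghom_amap[OF g]] by simp
 have r: "amap P (tensor_A A (regular A) P) (%y. pure_A A (regular A) P (g x) (id y))" if "x : carrier P" for x
  using LA.pt_amap_r[OF gc[OF that]] by simp
 have b: "pure_A A (regular A) P (g (sgnmap P 0 (rsmult P x s))) (id y) = pure_A A (regular A) P (g (sgnmap P 0 x)) (id (s \<odot>\<^bsub>P\<^esub> y))"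
  if "x : carrier P" "s : carrier A" "y : carrier P" for x s y
  using that LA.pt_bal[of "g x" s y] gs by (simp add: sg0)
 note tm = T.tensor_map_amap[where p = "pure_A A (regular A) P" and f = g and g = id and m = 0, OF P_graded l r b LA.T_group]
  T.tensor_map_pure[where p = "pure_A A (regular A) P" and f = g and g = id and m = 0, OF P_graded l r b LA.T_group]
 have bb: "balanced (carrier A) (rsmult (regular A)) (smult P) (regular A) P P (%a x. a \<odot>\<^bsub>P\<^esub> x)"
  by (rule balancedI) (use gab_smult[OF P_gab] lact_amap in "simp_all add: Q_bimod(8)")
 note la = LA.tlift_amap[OF bb Q_gp, folded left_action_map_def] LA.tlift_pure[OF bb Q_gp, folded left_action_map_def]
 show ?thesis
  unfolding tensor_map_A_def comp_def
  by (rule T.T_ext[OF amap_comp[OF la(1) tm(1)] ghom_amap[OF cap_ghom[OF g]] _ z])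
    (use gs in "simp_all add: tm(2) la(2) sg0 cap_val[OF g]")
qed

text \<open>The threefold product occurs only between the two outer maps: the diagonal is inserted
  in the right factor and then contracted with \<open>g\<close>. The composite is 1 \<otimes>
  \<open>G g\<close>; the signs for \<open>- m\<close> and \<open>m\<close> agree by parity.\<close>

lemma ins_eq:
 assumes g: "ghom A P (regular A) s g" and z: "z : carrier TQ"
 shows "tensor_map_A A P P P (- m) id (left_action_map P \<circ> tensor_map_A A P (regular A) P 0 g id)
   (tensor_map_A A P P TQ 0 id (S \<circ> eL) z) = ins m (PB.G g) z"
proof -
 let ?g1 = "left_action_map P \<circ> tensor_map_A A P (regular A) P 0 g id"
 let ?pT = "pure_A A P TQ"
 note g1 = g1_eq[OF g]
 have SE: "S \<circ> eL = \<Delta>P" by (simp add: \<Delta>P_def fun_eq_iff)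
 have l: "amap P (tensor_A A P TQ) (%x. ?pT (id x) (\<Delta>P y))" if "y : carrier P" for y
  using TT.pt_amap_l[of "\<Delta>P y"] that by simp
 have r: "amap P (tensor_A A P TQ) (%y. ?pT (id x) (\<Delta>P y))" if "x : carrier P" for x
  using amap_comp[OF TT.pt_amap_r[OF that] ghom_amap[OF \<Delta>P_ghom]] by simp
 have b: "?pT (id (sgnmap P 0 (rsmult P x s))) (\<Delta>P y) = ?pT (id (sgnmap P 0 x)) (\<Delta>P (s \<odot>\<^bsub>P\<^esub> y))"
  if "x : carrier P" "s : carrier A" "y : carrier P" for x s y
  using that TT.pt_bal[of x s "\<Delta>P y"] by (simp add: sg0 ghomD(9)[OF \<Delta>P_ghom])
 note x1 = T.tensor_map_amap[where p = ?pT and f = id and g = \<Delta>P and m = 0, OF P_graded l r b TT.T_group]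
  T.tensor_map_pure[where p = ?pT and f = id and g = \<Delta>P and m = 0, OF P_graded l r b TT.T_group]
 have ca: "amap TQ P ?g1"
  using ghom_amap[OF cap_ghom[OF g]] g1 unfolding amap_def by (auto simp del: o_apply)
 have cc: "?g1 w : carrier P" if "w : carrier TQ" for w by (rule amap_closed[OF ca that])
 have l2: "amap P TQ (%x. id x \<otimes>\<^sub>P ?g1 w)" if "w : carrier TQ" for w
  using T.pt_amap_l[OF cc[OF that]] by simp
 have r2: "amap TQ TQ (%w. id x \<otimes>\<^sub>P ?g1 w)" if "x : carrier P" for x
  using amap_comp[OF T.pt_amap_r[OF that] ca] by simp
 have b2: "id (sgnmap P (- m) (rsmult P x s)) \<otimes>\<^sub>P ?g1 w = id (sgnmap P (- m) x) \<otimes>\<^sub>P ?g1 (s \<odot>\<^bsub>TQ\<^esub> w)"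
  if "x : carrier P" "s : carrier A" "w : carrier TQ" for x s w
 proof -
  have "?g1 (s \<odot>\<^bsub>TQ\<^esub> w) = s \<odot>\<^bsub>P\<^esub> ?g1 w"
   using g1[OF amap_closed[OF T.T_smult_amap[OF that(2)] that(3)]] g1[OF that(3)] ghomD(9)[OF cap_ghom[OF g] that(2,3)] by simp
  then show ?thesis using that T.pt_bal[of "sgnmap P (- m) x" s "?g1 w"] cc[OF that(3)] by simp
 qed
 note x2 = TT.tensor_map_amap[where p = "pure_A A P P" and f = id and g = ?g1 and m = "- m", OF P_graded l2 r2 b2 T_gp]
  TT.tensor_map_pure[where p = "pure_A A P P" and f = id and g = ?g1 and m = "- m", OF P_graded l2 r2 b2 T_gp]
 have p: "sgnmap P (- m) = \<sigma> m" by (rule sgnmap_parity) simp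
 note Gg = PB.G_ghom[OF g]
 show ?thesis
  unfolding tensor_map_A_def[of A P P P] tensor_map_A_def[of A P P TQ] SE
 proof (rule T.T_ext[OF amap_comp[OF x2(1) x1(1)] ghom_amap[OF ins_ghom[OF Gg]] _ z])
  fix x y assume x: "x : carrier P" and y: "y : carrier P"
  have 1: "tensor_map P (tensor_A A P TQ) ?pT 0 id \<Delta>P (x \<otimes>\<^sub>P y) = ?pT x (\<Delta>P y)"
   using x1(2) x y by (simp add: sg0)
  have 2: "tensor_map P TQ (pure_A A P P) (- m) id ?g1 (?pT x (\<Delta>P y)) = \<sigma> m x \<otimes>\<^sub>P ?g1 (\<Delta>P y)"
   using x2(2)[of x "\<Delta>P y"] x y by (simp add: p del: o_apply)
  show "tensor_map P TQ (pure_A A P P) (- m) id ?g1 (tensor_map P (tensor_A A P TQ) ?pT 0 id \<Delta>P (x \<otimes>\<^sub>P y)) = ins m (PB.G g) (x \<otimes>\<^sub>P y)"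
   unfolding 1 2 ins_val[OF Gg x y] using g1[of "\<Delta>P y"] y by (simp add: PB.G_def)
 qed simp_all
qed

lemma circle_eq:
 assumes f: "PB.coch n f" and g: "PB.coch m g" and x: "x : carrier P"
 shows "circle K A P d \<mu> t \<eta> \<iota> m f g x = PB.circ m f g x"
proof -
 let ?z = "ins m (PB.G g) (\<Delta>P x)"
 have z: "?z : carrier TQ" using ghomD(4)[OF ins_ghom[OF PB.G_ghom[OF g]]] x by simp
 have D: "(S \<circ> eL) x = \<Delta>P x" by (simp add: \<Delta>P_def)
 have "circle K A P d \<mu> t \<eta> \<iota> m f g x = \<ominus> f (mu_R A P \<mu> (S (tL (tensor_map_A A P P P (- m) id
   (left_action_map P \<circ> tensor_map_A A P (regular A) P 0 g id) (tensor_map_A A P P TQ 0 id (S \<circ> eL) ((S \<circ> eL) x))))))"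
  by (simp only: circle_def Let_def o_apply)
 also have "\<dots> = \<ominus> f (mur (hP ?z))"
  unfolding D using x z by (simp add: ins_eq[OF g] mu_R_eq hP_def)
 also have "\<dots> = f (\<phi>P ?z)" using z ghomD(7)[OF f] by (simp add: \<phi>P_def)
 finally show ?thesis by (simp add: PB.circ_def PB.psi_def)
qed

lemma bracket_eq:
 assumes f: "PB.coch n f" and g: "PB.coch m g" and x: "x : carrier P"
 shows "bracket K A P d \<mu> t \<eta> \<iota> n m f g x = PB.br n m f g x"
 using circle_eq[OF f g x] circle_eq[OF g f x] PB.circ_closed[OF g f x]
 by (simp add: bracket_def PB.br_def koszul_pow[OF A.abelian_group_axioms] sneg_def)

end

subsection \<open>The contraction of the bar complex\<close>

context bar_alg begin

text \<open>The extra degeneracy of the bar complex.\<close>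

definition "sB = pres_lift Bar (%l. bg (\<one> # l))"
definition "\<eta>B a = bg [\<one>, a]"

lemma sB_mlin: "mlin Bar (%l. bg (\<one> # l))" by (rule mlin_cons[OF mlin_bg A.one_closed])

lemma sB_amap: "amap Bar Bar sB" unfolding sB_def by (rule blift_amap[OF Bar_gab sB_mlin refl])
lemma sB_gen: "l : BL ==> sB (gen l) = bg (\<one> # l)" unfolding sB_def by (rule blift_gen[OF Bar_gab sB_mlin refl])

lemma \<eta>B_klin: "klin Bar \<eta>B" using klin_bg[of "[\<one>]" "[]"] by (simp add: \<eta>B_def[abs_def])

lemma \<eta>B_amap: "amap (regular A) Bar \<eta>B"
 using klin_amap[OF \<eta>B_klin] gab_group[OF regular_gab] by (simp add: amap_def)

text \<open>The first neighbour product of \<open>\<one> # l\<close> restores \<open>l\<close>, and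
  the others cancel against the differential taken first. On words of length 2 the latter
  contributes nothing, and the term through the augmentation takes its place.\<close>

lemma sB_homotopy: "z : carrier Bar ==> dB (sB z) \<oplus>\<^bsub>Bar\<^esub> sB (dB z) \<oplus>\<^bsub>Bar\<^esub> \<eta>B (\<mu>B z) = z"
proof (rule bar_ext[OF _ amap_id[OF Bar_group]])
 show "amap Bar Bar (%z. dB (sB z) \<oplus>\<^bsub>Bar\<^esub> sB (dB z) \<oplus>\<^bsub>Bar\<^esub> \<eta>B (\<mu>B z))"
  by (intro amap_plus amap_comp[OF dB_amap sB_amap] amap_comp[OF sB_amap dB_amap] amap_comp[OF \<eta>B_amap \<mu>B_amap])
 fix l assume l: "l : BL"
 then obtain x y zs where xyz: "l = x # y # zs" "x : carrier A" "y : carrier A" "set zs <= carrier A"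
  by (cases l; cases "tl l") (auto simp: bar_lists_def)
 let ?B = "bdl Bar (%l. bg (\<one> # l)) l"
 have gl: "gen l : carrier Bar" by (rule gen_closed[OF l])
 have Bc: "?B : carrier Bar"
  by (rule bdl_closed[OF Bar_group _ BL_D(1)[OF l]]) (auto simp: bok_def intro!: bg_closed)
 have s1: "set (\<one> # l) <= carrier A" using BL_D(1)[OF l] by simp
 have 1: "dB (sB (gen l)) = gen l \<ominus>\<^bsub>Bar\<^esub> ?B"
  using dB_bg[OF s1] l xyz by (simp add: sB_gen)
 have d: "sB (dB (gen l)) = bdl Bar (%l. sB (bg l)) l"
  unfolding dB_gen[OF l] by (rule bdl_amap[OF sB_amap bok_bg BL_D(1)[OF l]])
 show "dB (sB (gen l)) \<oplus>\<^bsub>Bar\<^esub> sB (dB (gen l)) \<oplus>\<^bsub>Bar\<^esub> \<eta>B (\<mu>B (gen l)) = gen l"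
 proof (cases "zs = []")
  case True
  have xy: "x \<otimes> y : carrier A" using xyz by simp
  have c: "bg [\<one>, x \<otimes> y] : carrier Bar" by (rule bg_closed) (use xy in simp)
  have z: "sB (bg [v]) = \<zero>\<^bsub>Bar\<^esub>" for v using amap_zero[OF sB_amap] by (simp add: bg_def)
  have "?B = bg [\<one>, x \<otimes> y]" using xyz True c by (simp add: a_minus_def ag_simps[OF Bar_group])
  moreover have "sB (dB (gen l)) = \<zero>\<^bsub>Bar\<^esub>" unfolding d using xyz True by (simp add: z a_minus_def ag_simps[OF Bar_group])
  moreover have "\<mu>B (gen l) = x \<otimes> y" using \<mu>B_gen[OF l] xyz True by simp
  moreover have "u \<ominus>\<^bsub>Bar\<^esub> v \<oplus>\<^bsub>Bar\<^esub> \<zero>\<^bsub>Bar\<^esub> \<oplus>\<^bsub>Bar\<^esub> v = u" if "u : carrier Bar" "v : carrier Bar" for u v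
   by (rule rep_eq[of Bar], (rule rep_rules rep_zero | rule rep_atom | rule Bar_group | rule that)+, simp)
  ultimately show ?thesis using c gl unfolding 1 \<eta>B_def by simp
 next
  case False
  have "sB (dB (gen l)) = ?B"
   unfolding d
  proof (rule bdl_cong[OF _ BL_D(1)[OF l]])
   fix l' assume "set l' <= carrier A" "length l' = length l - 1"
   then have "l' : BL" using xyz False by (cases zs) (simp_all add: bar_lists_def)
   then show "sB (bg l') = bg (\<one> # l')" by (simp add: sB_gen)
  qed
  moreover have "\<mu>B (gen l) = \<zero>" using \<mu>B_gen[OF l] xyz False by simp
  moreover have "\<eta>B \<zero> = \<zero>\<^bsub>Bar\<^esub>" using amap_zero[OF \<eta>B_amap] by simp
  moreover have "u \<ominus>\<^bsub>Bar\<^esub> v \<oplus>\<^bsub>Bar\<^esub> v \<oplus>\<^bsub>Bar\<^esub> \<zero>\<^bsub>Bar\<^esub> = u" if "u : carrier Bar" "v : carrier Bar" for u v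
   by (rule rep_eq[of Bar], (rule rep_rules rep_zero | rule rep_atom | rule Bar_group | rule that)+, simp)
  ultimately show ?thesis using Bc gl unfolding 1 by simp
 qed
qed

lemma bar_contracted: "contracted K A Bar dB \<mu>B sB \<eta>B"
proof (intro contracted.intro contracted_axioms.intro Bc.cplx_axioms sB_amap \<eta>B_amap)
 fix c y assume c: "c : carrier K" and y: "y : carrier Bar"
 note s = scalar_closed[OF c]
 show "sB ((c \<odot> \<one>) \<odot>\<^bsub>Bar\<^esub> y) = (c \<odot> \<one>) \<odot>\<^bsub>Bar\<^esub> sB y"
 proof (rule bar_ext[OF amap_comp[OF sB_amap Bar_smult_amap[OF s]] amap_comp[OF Bar_smult_amap[OF s] sB_amap] _ y])
  fix l assume l: "l : BL"
  then obtain x v where xv: "l = x # v" "x : carrier A" "set v <= carrier A" "v ~= []" by (cases l) (auto simp: BL_cons)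
  have "klin Bar (%x. bg ([\<one>] @ x # v))" by (rule klin_bg) (use xv in auto)
  then have "bg (\<one> # (c \<odot> x) # v) = (c \<odot> \<one>) \<odot>\<^bsub>Bar\<^esub> bg (\<one> # x # v)" using c xv by (simp add: klin_def)
  moreover have "((c \<odot> \<one>) \<otimes> x) # v : BL" using xv s by (simp add: BL_cons)
  ultimately show "sB ((c \<odot> \<one>) \<odot>\<^bsub>Bar\<^esub> gen l) = (c \<odot> \<one>) \<odot>\<^bsub>Bar\<^esub> sB (gen l)"
   using l s xv sB_gen[OF l] sB_gen[of "((c \<odot> \<one>) \<otimes> x) # v"] scalar_mult[OF c xv(2)] by (simp add: Bar_smult)
 qed
next
 fix n y assume y: "y : grade Bar n"
 show "sB y : grade Bar (n + 1)"
 proof (rule Bar_grade_amap[OF sB_amap Bar_gab y])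
  fix l assume l: "l : BL" "int (length l) = n + 2"
  show "sB (gen l) : grade Bar (n + 1)"
   unfolding sB_gen[OF l(1)] by (rule bg_grade) (use BL_D(1)[OF l(1)] l(2) in simp_all)
 qed
next
 fix y assume "y : carrier Bar" "dB y = \<zero>\<^bsub>Bar\<^esub>" "\<mu>B y = \<zero>"
 then show "dB (sB y) = y"
  using sB_homotopy[of y] amap_zero[OF sB_amap] amap_zero[OF \<eta>B_amap] amap_closed[OF amap_comp[OF dB_amap sB_amap], of y]
  by (simp add: ag_simps[OF Bar_group])
next
 fix c a assume "c : carrier K" "a : carrier A"
 then show "\<eta>B ((c \<odot> \<one>) \<otimes> a) = (c \<odot> \<one>) \<odot>\<^bsub>Bar\<^esub> \<eta>B a"
  using \<eta>B_klin by (simp add: klin_def scalar_mult)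
next
 fix a assume a: "a : carrier A"
 show "\<eta>B a : grade Bar 0" unfolding \<eta>B_def by (rule bg_grade) (use a in simp_all)
 have "[\<one>, a] : BL" using a by (simp add: BL_cons)
 then show "\<mu>B (\<eta>B a) = a" using \<mu>B_gen[of "[\<one>, a]"] a by (simp add: \<eta>B_def)
qed

end

subsection \<open>The Gerstenhaber bracket of the bar complex\<close>

context bar_alg begin

sublocale BB: bdata K A Bar dB \<mu>B \<Delta>B \<phi>B id by (rule bar_bdata)

lemma finsum_regular: "finite S ==> f : S \<rightarrow> carrier A ==> finsum (regular A) f S = finsum A f S"
proof (induction S rule: finite_induct)
 case empty
 interpret R: abelian_group "regular A" by (rule gab_group[OF regular_gab])
 show ?case using R.finsum_empty by simp
next
 case (insert x S)
 interpret R: abelian_group "regular A" by (rule gab_group[OF regular_gab])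
 have "f : S \<rightarrow> carrier (regular A)" "f x : carrier (regular A)" using insert.prems by auto
 then show ?case using insert R.finsum_insert[of S x f] by simp
qed

section \<open>Evaluation of the circle product on bar words\<close>

lemma spl_finsum:
 assumes Y: "abelian_group Y" and "bok2 Y b" "set l <= carrier A" "2 <= length l"
 shows "spl Y b l = finsum Y (%i. b (take (Suc i) l @ [\<one>]) (\<one> # drop (Suc i) l)) {..length l - 2}"
 using assms(2-)
proof (induction l arbitrary: b rule: induct_list012)
 case (3 x y zs)
 interpret Y: abelian_group Y by (rule Y)
 let ?f = "%i. b (take (Suc i) (x # y # zs) @ [\<one>]) (\<one> # drop (Suc i) (x # y # zs))"
 have cl: "?f i : carrier Y" for i
 proof -
  have "set (take (Suc i) (x # y # zs)) <= carrier A" "set (drop (Suc i) (x # y # zs)) <= carrier A"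
   by (rule order_trans[OF set_take_subset 3(4)], rule order_trans[OF set_drop_subset 3(4)])
  then show ?thesis by (intro 3(3)[unfolded bok2_def, rule_format]) simp
 qed
 show ?case
 proof (cases zs)
  case Nil
  then show ?thesis using cl[of 0] by simp
 next
  case (Cons z zs')
  have b: "bok2 Y (%l. b (x # l))" by (rule bok2_cons[OF 3(3)]) (use 3(4) in simp)
  have "spl Y (%l r. b (x # l) r) (y # zs) = finsum Y (%i. ?f (Suc i)) {..length zs'}"
   using 3(2)[OF b] 3(4) Cons by simp
  moreover have "finsum Y ?f {..Suc (length zs')} = finsum Y (%i. ?f (Suc i)) {..length zs'} \<oplus>\<^bsub>Y\<^esub> ?f 0"
   by (rule Y.finsum_Suc2) (use cl in blast)
  moreover have "finsum Y (%i. ?f (Suc i)) {..length zs'} : carrier Y" by (rule Y.finsum_closed) (use cl in blast)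
  ultimately show ?thesis using cl[of 0] Cons by (simp add: Y.a_comm)
 qed
qed simp_all

text \<open>Since \<open>g\<close> lives in degree \<open>m\<close>, only the cut after
  \<open>m\<close> inner letters contributes, and there is none if fewer letters are
  available.\<close>

lemma G_gen:
 fixes m :: nat
 assumes g: "BB.coch (int m) g" and s: "set s <= carrier A"
 shows "BB.G g (bg (\<one> # s @ [\<one>])) =
  (if m <= length s then bg (g (bg (\<one> # take m s @ [\<one>])) # drop m s @ [\<one>]) else \<zero>\<^bsub>Bar\<^esub>)"
proof -
 let ?L = "\<one> # s @ [\<one>]"
 have L: "set ?L <= carrier A" using s by simp
 note ca = ghom_amap[OF Bc.cap_ghom[OF g]]
 have st: "set (take i s) <= carrier A" "set (drop i s) <= carrier A" for i
  by (rule order_trans[OF set_take_subset s], rule order_trans[OF set_drop_subset s])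
 define V where "V i = bg (g (bg (\<one> # take i s @ [\<one>])) # drop i s @ [\<one>])" for i
 have c1: "bg (\<one> # take i s @ [\<one>]) : carrier Bar" "bg (\<one> # drop i s @ [\<one>]) : carrier Bar" for i
  by (rule bg_closed; simp add: st)+
 have gc: "g (bg (\<one> # take i s @ [\<one>])) : carrier A" for i using ghomD(4)[OF g c1(1)] by simp
 have Vc: "V i : carrier Bar" for i unfolding V_def by (rule bg_closed) (use gc st in simp)
 have "BB.G g (bg ?L) = spl Bar (%l r. Bc.cap g (tB (bg l) (bg r))) ?L"
  unfolding BB.G_def \<Delta>B_bg[OF L list.distinct(2)] by (rule spl_amap[OF ca tB_bok2 L])
 also have "\<dots> = finsum Bar (%i. Bc.cap g (tB (bg (take (Suc i) ?L @ [\<one>])) (bg (\<one> # drop (Suc i) ?L)))) {..length ?L - 2}"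
  by (rule spl_finsum[OF Bar_group _ L]) (simp_all add: bok2_def bg_closed amap_closed[OF ca])
 also have "\<dots> = finsum Bar (%i. if m = i then V i else \<zero>\<^bsub>Bar\<^esub>) {..length s}"
 proof (rule Bar.finsum_cong')
  show "{..length ?L - 2} = {..length s}" by simp
  show "(%i. if m = i then V i else \<zero>\<^bsub>Bar\<^esub>) : {..length s} \<rightarrow> carrier Bar" using Vc by simp
  fix i assume "i : {..length s}"
  then have i: "i <= length s" by simp
  have e: "take (Suc i) ?L @ [\<one>] = \<one> # take i s @ [\<one>]" "\<one> # drop (Suc i) ?L = \<one> # drop i s @ [\<one>]" using i by simp_all
  have "Bc.cap g (tB (bg (\<one> # take i s @ [\<one>])) (bg (\<one> # drop i s @ [\<one>]))) =
    g (bg (\<one> # take i s @ [\<one>])) \<odot>\<^bsub>Bar\<^esub> bg (\<one> # drop i s @ [\<one>])"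
   by (rule Bc.cap_val[OF g c1])
  also have "\<dots> = V i" unfolding V_def using bg_lmult[OF gc A.one_closed, of "drop i s @ [\<one>]"] st gc by simp
  finally have ev: "Bc.cap g (tB (bg (\<one> # take i s @ [\<one>])) (bg (\<one> # drop i s @ [\<one>]))) = V i" .
  have "V i = \<zero>\<^bsub>Bar\<^esub>" if "m ~= i"
  proof -
   have "bg (\<one> # take i s @ [\<one>]) : grade Bar (int i)" by (rule bg_grade) (use st i in simp_all)
   then have "g (bg (\<one> # take i s @ [\<one>])) : grade (regular A) (int i + - int m)" by (rule ghom_degree[OF g _ refl])
   then have "g (bg (\<one> # take i s @ [\<one>])) = \<zero>" using that by simp
   moreover have "klin Bar (%x. bg ([] @ x # drop i s @ [\<one>]))" by (rule klin_bg) (use st in simp_all)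
   ultimately show ?thesis using amap_zero[OF klin_amap] by (simp add: V_def)
  qed
  then show "Bc.cap g (tB (bg (take (Suc i) ?L @ [\<one>])) (bg (\<one> # drop (Suc i) ?L))) = (if m = i then V i else \<zero>\<^bsub>Bar\<^esub>)"
   unfolding e ev by simp
 qed
 also have "\<dots> = (if m <= length s then V m else \<zero>\<^bsub>Bar\<^esub>)"
 proof (cases "m <= length s")
  case True
  have "finsum Bar (%i. if m = i then V i else \<zero>\<^bsub>Bar\<^esub>) {..length s} = V m"
   by (rule Bar.finsum_singleton) (use True Vc in simp_all)
  then show ?thesis using True by simp
 next
  case False
  have "finsum Bar (%i. if m = i then V i else \<zero>\<^bsub>Bar\<^esub>) {..length s} = finsum Bar (%i. \<zero>\<^bsub>Bar\<^esub>) {..length s}"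
   by (rule Bar.finsum_cong') (use False in auto)
  then show ?thesis using False Bar.finsum_zero by simp
 qed
 finally show ?thesis by (simp add: V_def)
qed

text \<open>The cut after \<open>i\<close> inner letters yields the insertion at position
  \<open>i + 1\<close>. Its sign combines \<open>(-1)^(im)\<close> from moving \<open>g\<close> past
  the prefix with \<open>(-1)^i\<close> from \<open>star\<close>, which is Gerstenhaber's
  \<open>(-1)^((m-1)i)\<close>.\<close>

lemma circ_gerst:
 fixes n m :: nat
 assumes f: "BB.coch (int n) f" and g: "BB.coch (int m) g" and as: "set as <= carrier A" "int (length as) = int n + int m - 1"
 shows "BB.circ (int m) f g (gen (\<one> # as @ [\<one>])) = gerst_circle A n m (to_cochain K A f) (to_cochain K A g) as"
proof -
 let ?L = "\<one> # as @ [\<one>]"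
 let ?F = "%z. f (\<phi>B (Bc.ins (int m) (BB.G g) z))"
 note Gg = BB.G_ghom[OF g] and rg = gab_group[OF regular_gab]
 have F: "amap TB (regular A) ?F"
  by (rule amap_comp[OF ghom_amap[OF f] amap_comp[OF ghom_amap[OF \<phi>B_ghom] ghom_amap[OF Bc.ins_ghom[OF Gg]]]])
 have L: "set ?L <= carrier A" "?L : BL" using as by (simp_all add: BL_cons)
 have st: "set (take i as) <= carrier A" "set (drop i as) <= carrier A" for i
  by (rule order_trans[OF set_take_subset as(1)], rule order_trans[OF set_drop_subset as(1)])
 have fc: "f z : carrier A" "g z : carrier A" if "z : carrier Bar" for z using ghomD(4)[OF f that] ghomD(4)[OF g that] by simp_all
 define h where "h i = [koszul_sign ((int m - 1) * (int i - 1))] \<cdot> gerst_insert m i (to_cochain K A f) (to_cochain K A g) as" for i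
 define lb where "lb xs = gen ([\<one>] @ xs @ [\<one>])" for xs
 have lbc: "lb xs : carrier Bar" "lb xs = bg (\<one> # xs @ [\<one>])" if "set xs <= carrier A" for xs
  using that gen_closed[of "\<one> # xs @ [\<one>]"] by (simp_all add: lb_def BL_cons)
 \<comment> \<open>The word that results when \<open>g\<close> consumes the \<open>m\<close> letters
   after the cut.\<close>
 define W where "W i = take i as @ [g (lb (take m (drop i as)))] @ drop (i + m) as" for i
 have Wset: "set (W i) <= carrier A" for i
 proof -
  have "set (take m (drop i as)) <= carrier A" by (rule order_trans[OF set_take_subset st(2)])
  then show ?thesis using st fc(2)[OF lbc(1)] by (simp add: W_def)
 qed
 have hW: "h (Suc i) = sneg A ((int m - 1) * int i) (f (lb (W i)))" for i
  using fc(1)[OF lbc(1)[OF Wset]]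
  by (simp add: h_def gerst_insert_def to_cochain_def W_def lb_def koszul_pow[OF A.abelian_group_axioms] sneg_def)
 have hc: "h (Suc i) : carrier A" for i unfolding hW using fc(1)[OF lbc(1)[OF Wset]] by (simp add: sneg_def)
 have trm: "?F (tB (bg (take (Suc i) ?L @ [\<one>])) (bg (\<one> # drop (Suc i) ?L))) = (if i < n then h (Suc i) else \<zero>)"
  if i: "i <= length as" for i
 proof -
  let ?l = "\<one> # take i as @ [\<one>]" and ?r = "\<one> # drop i as @ [\<one>]"
  have e: "take (Suc i) ?L @ [\<one>] = ?l" "\<one> # drop (Suc i) ?L = ?r" using i by simp_all
  have lr: "bg ?l : carrier Bar" "bg ?r : carrier Bar" by (rule bg_closed; simp add: st)+
  have sg: "sgnmap Bar (int m) (bg ?l) = sneg Bar (int i * int m) (bg ?l)"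
   using sgnmap_val[OF Bar_graded bg_grade[of ?l "int i"], of "int m"] st i by simp
  have sc: "sneg Bar (int i * int m) (bg ?l) : carrier Bar" using lr by (simp add: sneg_def)
  have Gc: "BB.G g (bg ?r) : carrier Bar" by (rule ghomD(4)[OF Gg lr(2)])
  have "?F (tB (bg ?l) (bg ?r)) = f (phi2 (sneg Bar (int i * int m) (bg ?l)) (BB.G g (bg ?r)))"
   unfolding Bc.ins_val[OF Gg lr] sg by (simp only: \<phi>B_val[OF sc Gc])
  also have "\<dots> = (if i < n then h (Suc i) else \<zero>)"
  proof (cases "i < n")
   case True
   then have "m <= length (drop i as)" using as(2) by simp
   then have Gr: "BB.G g (bg ?r) = bg (g (lb (take m (drop i as))) # drop (i + m) as @ [\<one>])"
    using G_gen[OF g st(2), of i] lbc(2)[OF order_trans[OF set_take_subset st(2)], of m i] by (simp add: add.commute)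
   let ?r' = "g (lb (take m (drop i as))) # drop (i + m) as @ [\<one>]"
   have g1: "g (lb (take m (drop i as))) : carrier A"
    by (rule fc(2)[OF lbc(1)[OF order_trans[OF set_take_subset st(2)]]])
   have BLs: "?l : BL" "?r' : BL" using st g1 by (simp_all add: BL_cons)
   have "lst ?l ?r' = \<one> # W i @ [\<one>]" using g1 by (simp add: lst_def W_def)
   then have "star ?l ?r' = sneg Bar (int i) (lb (W i))"
    using i lbc(2)[OF Wset] by (simp add: star_def sneg_def)
   then have p: "phi2 (gen ?l) (gen ?r') = sneg Bar (int i) (lb (W i))" using phi2_gen[OF BLs] by simp
   have "phi2 (sneg Bar k (gen ?l)) (gen ?r') = sneg Bar k (sneg Bar (int i) (lb (W i)))" for k
    using amap_neg[OF phi2_amap_l[OF gen_closed[OF BLs(2)]] gen_closed[OF BLs(1)]] by (simp add: sneg_def p)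
   then have "f (phi2 (sneg Bar (int i * int m) (bg ?l)) (BB.G g (bg ?r))) = f (sneg Bar (int i * int m) (sneg Bar (int i) (lb (W i))))"
    unfolding Gr using BLs by simp
   also have "\<dots> = sneg A ((int m - 1) * int i) (f (lb (W i)))"
    using lbc(1)[OF Wset[of i]] fc(1)[OF lbc(1)[OF Wset[of i]]] ghomD(7)[OF f, of "lb (W i)"]
    by (cases "even m"; cases "even i"; simp add: sneg_def)
   finally show ?thesis using True hW by simp
  next
   case False
   then have "~ m <= length (drop i as)" using as(2) i by auto
   then have "BB.G g (bg ?r) = \<zero>\<^bsub>Bar\<^esub>" using G_gen[OF g st(2), of i] by simp
   then show ?thesis using False amap_zero[OF phi2_amap_r[OF sc]] ghomD(6)[OF f] by simp
  qed
  finally show ?thesis unfolding e .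
 qed
 have "BB.circ (int m) f g (gen ?L) = ?F (spl TB (%l r. tB (bg l) (bg r)) ?L)"
  by (simp only: BB.circ_def BB.psi_def \<Delta>B_gen[OF L(2)])
 also have "\<dots> = spl (regular A) (%l r. ?F (tB (bg l) (bg r))) ?L" by (rule spl_amap[OF F tB_bok2 L(1)])
 also have "\<dots> = finsum (regular A) (%i. ?F (tB (bg (take (Suc i) ?L @ [\<one>])) (bg (\<one> # drop (Suc i) ?L)))) {..length ?L - 2}"
  by (rule spl_finsum[OF rg _ L(1)]) (use amap_closed[OF F] in "simp_all add: bok2_def bg_closed")
 also have "\<dots> = finsum A (%i. if i < n then h (Suc i) else \<zero>) {..length as}"
 proof -
  interpret R: abelian_group "regular A" by (rule rg)
  have "finsum (regular A) (%i. ?F (tB (bg (take (Suc i) ?L @ [\<one>])) (bg (\<one> # drop (Suc i) ?L)))) {..length ?L - 2}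
    = finsum (regular A) (%i. if i < n then h (Suc i) else \<zero>) {..length as}"
  proof (rule R.finsum_cong')
   show "{..length ?L - 2} = {..length as}" by simp
   show "(%i. if i < n then h (Suc i) else \<zero>) : {..length as} \<rightarrow> carrier (regular A)" using hc by simp
   show "?F (tB (bg (take (Suc i) ?L @ [\<one>])) (bg (\<one> # drop (Suc i) ?L))) = (if i < n then h (Suc i) else \<zero>)"
    if "i : {..length as}" for i using that by (intro trm) simp
  qed
  also have "\<dots> = finsum A (%i. if i < n then h (Suc i) else \<zero>) {..length as}"
   by (rule finsum_regular) (use hc in simp_all)
  finally show ?thesis .
 qed
 \<comment> \<open>After a cut with \<open>i \<ge> n\<close> fewer than \<open>m\<close> letters
   remain. Conversely all \<open>i < n\<close> are present, as the word has \<open>n + m - 1\<close>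
   letters, also for \<open>m = 0\<close>.\<close>
 also have "\<dots> = finsum A (%i. h (Suc i)) {..<n}"
  by (rule A.add.finprod_mono_neutral_cong_left[symmetric]) (use hc as(2) in auto)
 also have "\<dots> = finsum A h (Suc ` {..<n})"
  by (rule A.finsum_reindex[symmetric]) (use hc in auto)
 also have "Suc ` {..<n} = {1..n}" by (simp add: image_Suc_lessThan)
 finally show ?thesis by (simp add: gerst_circle_def h_def)
qed

text \<open>Agreement with a bimodule map on generators already makes \<open>b\<close> respect the
  relators, so the lift requires no multilinearity check of its own.\<close>

lemma pres_lift_eq:
 assumes F: "ghom A Bar (regular A) s F" and b: "!!l. l : BL ==> b l = F (gen l)" and z: "z : carrier Bar"
 shows "pres_lift A b z = F z"
proof -
 have m: "mlin (regular A) (%l. F (bg l))"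
  unfolding mlin_def
 proof (intro allI impI, elim conjE)
  fix as bs assume "set as <= carrier A" "set bs <= carrier A"
  then show "klin (regular A) (%x. F (bg (as @ x # bs)))"
   by (intro klin_comp[OF klin_bg ghom_amap[OF F]]) (simp_all add: ghomD(9)[OF F] scalar_closed)
 qed
 have e: "b l = F (bg l)" if "l : BL" for l using b that by simp
 show ?thesis
  unfolding pres_lift_regular
  by (rule bar_ext[OF blift_amap[OF regular_gab m e] ghom_amap[OF F] _ z]) (simp_all add: blift_gen[OF regular_gab m e])
qed

text \<open>\<open>circ_gerst\<close> settles words with outer letters \<open>\<one>\<close>.
  Bimodule linearity extends this to all words of that degree, and in other degrees both sides
  vanish.\<close>

lemma bar_bracket_eq:
 fixes n m :: nat
 assumes f: "BB.coch (int n) f" and g: "BB.coch (int m) g" and z: "z : carrier Bar"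
 shows "bar_bracket K A n m f g z = BB.br (int n) (int m) f g z"
proof -
 let ?k = "int n + int m - 1"
 note br = BB.br_ghom[OF f g refl]
 show ?thesis
  unfolding bar_bracket_def of_cochain_def
 proof (rule pres_lift_eq[OF br _ z])
  fix l assume l: "l : BL"
  obtain a s c where s: "l = a # s @ [c]" "a : carrier A" "set s <= carrier A" "c : carrier A" by (rule BL_cases[OF l])
  let ?\<beta> = "gerst_bracket A n m (to_cochain K A f) (to_cochain K A g)"
  show "(if int (length l) = ?k + 2 then hd l \<otimes> ?\<beta> (butlast (tl l)) \<otimes> last l else \<zero>) = BB.br (int n) (int m) f g (gen l)"
  proof (cases "int (length s) = ?k")
   case True
   have t: "int (length s) = int m + int n - 1" using True by simp
   have 1: "\<one> # s @ [\<one>] : BL" using s by (simp add: BL_cons)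
   note gl = gen_closed[OF 1]
   have "BB.br (int n) (int m) f g (gen (\<one> # s @ [\<one>])) = ?\<beta> s"
    using BB.circ_closed[OF g f gl]
    by (simp add: BB.br_def circ_gerst[OF f g s(3) True] circ_gerst[OF g f s(3) t] gerst_bracket_def
      koszul_pow[OF A.abelian_group_axioms] sneg_def)
   moreover have "BB.br (int n) (int m) f g (gen (\<one> # s @ [\<one>])) : carrier A" using ghomD(4)[OF br gl] by simp
   ultimately have bc: "?\<beta> s : carrier A" and be: "BB.br (int n) (int m) f g (bg (\<one> # s @ [\<one>])) = ?\<beta> s"
    using 1 by simp_all
   have "a \<otimes> (?\<beta> s \<otimes> c) = BB.br (int n) (int m) f g (gen l)"
    using chom_gen[OF chom_ghom[OF br refl] s(2,4,3) refl] by (simp add: be s(1))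
   then show ?thesis using s bc True by (simp add: A.m_assoc)
  next
   case False
   have "gen l : grade Bar (int (length s))" by (rule gen_grade[OF l]) (simp add: s(1))
   then have "BB.br (int n) (int m) f g (gen l) : grade (regular A) (int (length s) + - ?k)" by (rule ghom_degree[OF br _ refl])
   then have "BB.br (int n) (int m) f g (gen l) = \<zero>" using False by simp
   then show ?thesis using False s(1) by simp
  qed
 qed
qed

end

section \<open>Hochschild cohomology\<close>

context cplx begin

abbreviation "cochain n f == ghom A Q (regular A) (- n) f"

lemma hh_cochains_iff: "f : hh_cochains A Q n \<longleftrightarrow> cochain n f"
 by (simp add: hh_cochains_def graded_hom_ghom[OF Q_gab regular_gab])

lemma hh_cocycles_iff: "f : hh_cocycles A Q d n \<longleftrightarrow> cochain n f & (ALL x:carrier Q. f (d x) = \<zero>)"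
 by (simp add: hh_cocycles_def hh_cochains_iff)

lemma hh_rel_iff: "(f, f') : hh_rel A Q d n \<longleftrightarrow> f : hh_cocycles A Q d n & f' : hh_cocycles A Q d n &
  (EX h. cochain (n - 1) h & (ALL x:carrier Q. f x = f' x \<oplus> h (d x)))"
 unfolding hh_rel_def using hh_cochains_iff by blast

lemma cochain_closed: "cochain n f ==> x : carrier Q ==> f x : carrier A"
 using ghomD(4)[of A Q "regular A" "- n" f x] by simp

lemma hh_rel_refl: "f : hh_cocycles A Q d n ==> (f, f) : hh_rel A Q d n"
proof -
 assume f: "f : hh_cocycles A Q d n"
 have "cochain (n - 1) (%x. \<zero>)"
  by (rule ghomI[OF Q_gab regular_gab]) (simp_all add: amapI[OF Q_gp gab_group[OF regular_gab]])
 moreover have "ALL x:carrier Q. f x = f x \<oplus> \<zero>" using f cochain_closed[of n f] by (simp add: hh_cocycles_iff)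
 ultimately show ?thesis unfolding hh_rel_iff using f by blast
qed

lemma hh_rel_sym: "(f, g) : hh_rel A Q d n ==> (g, f) : hh_rel A Q d n"
proof -
 assume r: "(f, g) : hh_rel A Q d n"
 then obtain h where h: "cochain (n - 1) h" "ALL x:carrier Q. f x = g x \<oplus> h (d x)" unfolding hh_rel_iff by blast
 have g: "cochain n g" using r by (simp add: hh_rel_iff hh_cocycles_iff)
 have "g x = f x \<oplus> \<ominus> h (d x)" if "x : carrier Q" for x
  using h(2) that cochain_closed[OF g that] cochain_closed[OF h(1), of "d x"] by (simp add: A.a_assoc A.r_neg)
 moreover have "cochain (n - 1) (%x. \<ominus> h x)" using ghom_uminus[OF h(1)] by simp
 ultimately show ?thesis unfolding hh_rel_iff using r[unfolded hh_rel_iff] by blast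
qed

lemma hh_rel_trans: "(f, g) : hh_rel A Q d n ==> (g, k) : hh_rel A Q d n ==> (f, k) : hh_rel A Q d n"
proof -
 assume r: "(f, g) : hh_rel A Q d n" "(g, k) : hh_rel A Q d n"
 obtain h where h: "cochain (n - 1) h" "ALL x:carrier Q. f x = g x \<oplus> h (d x)" using r(1) unfolding hh_rel_iff by blast
 obtain h' where h': "cochain (n - 1) h'" "ALL x:carrier Q. g x = k x \<oplus> h' (d x)" using r(2) unfolding hh_rel_iff by blast
 have k: "cochain n k" using r by (simp add: hh_rel_iff hh_cocycles_iff)
 have "f x = k x \<oplus> (h' (d x) \<oplus> h (d x))" if "x : carrier Q" for x
  using h(2) h'(2) that cochain_closed[OF k that] cochain_closed[OF h(1), of "d x"] cochain_closed[OF h'(1), of "d x"] by (simp add: A.a_assoc)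
 moreover have "cochain (n - 1) (%x. h' x \<oplus> h x)" using ghom_plus[OF h(1) h'(1)] by simp
 ultimately show ?thesis unfolding hh_rel_iff using r[unfolded hh_rel_iff] by blast
qed

lemma hh_equiv: "equiv (hh_cocycles A Q d n) (hh_rel A Q d n)"
proof (rule equivI)
 show "hh_rel A Q d n <= hh_cocycles A Q d n \<times> hh_cocycles A Q d n" by (auto simp: hh_rel_def)
 show "refl_on (hh_cocycles A Q d n) (hh_rel A Q d n)" by (auto simp: refl_on_def hh_rel_refl)
 show "sym (hh_rel A Q d n)" using hh_rel_sym by (blast intro: symI)
 show "trans (hh_rel A Q d n)" using hh_rel_trans by (blast intro: transI)
qed

text \<open>A cocycle kills the summand \<open>d (k x)\<close> of the homotopy, and the other
  summand is a coboundary.\<close>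

lemma hh_homotopic_id:
 assumes f: "f : hh_cocycles A Q d n" and E: "ghom A Q Q 0 E" and k: "ghom A Q Q 1 k"
  and h: "!!x. x : carrier Q ==> E x \<ominus>\<^bsub>Q\<^esub> x = d (k x) \<oplus>\<^bsub>Q\<^esub> k (d x)" and Ed: "!!x. x : carrier Q ==> E (d x) = d (E x)"
 shows "(f \<circ> E, f) : hh_rel A Q d n"
proof -
 have fc: "cochain n f" and fd: "!!x. x : carrier Q ==> f (d x) = \<zero>" using f by (simp_all add: hh_cocycles_iff)
 have fE: "cochain n (f \<circ> E)" using ghom_comp[OF fc E, of "- n"] by (simp add: comp_def)
 have c: "f \<circ> E : hh_cocycles A Q d n" using fE fd ghomD(4)[OF E] by (simp add: hh_cocycles_iff Ed)
 have kc: "cochain (n - 1) (%x. f (k x))" by (rule ghom_comp[OF fc k]) simp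
 have "(f \<circ> E) x = f x \<oplus> f (k (d x))" if x: "x : carrier Q" for x
 proof -
  interpret G: abelian_group Q by (rule Q_gp)
  have Ex: "E x : carrier Q" "k x : carrier Q" "k (d x) : carrier Q" using x ghomD(4)[OF E] ghomD(4)[OF k] by simp_all
  have "E x = x \<oplus>\<^bsub>Q\<^esub> (E x \<ominus>\<^bsub>Q\<^esub> x)"
   by (rule rep_eq[of Q], (rule rep_rules | rule rep_atom | rule Q_gp | rule x | rule Ex)+, simp)
  then have e: "E x = x \<oplus>\<^bsub>Q\<^esub> (d (k x) \<oplus>\<^bsub>Q\<^esub> k (d x))" using h[OF x] by simp
  have "f (x \<oplus>\<^bsub>Q\<^esub> (d (k x) \<oplus>\<^bsub>Q\<^esub> k (d x))) = f x \<oplus> f (k (d x))"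
   using x Ex ghomD(5)[OF fc] fd[OF Ex(2)] cochain_closed[OF fc Ex(3)] by simp
  then show ?thesis using e by simp
 qed
 then show ?thesis unfolding hh_rel_iff using f c kc by blast
qed

end

text \<open>Pullback along \<open>G\<close> is the inverse, because both composites are homotopic to
  identities.\<close>

lemma hh_pullback_bij:
 assumes M: "cplx K A M dM \<mu>M" and N: "cplx K A N dN \<mu>N"
  and F: "ghom A M N 0 F" "!!x. x : carrier M ==> dN (F x) = F (dM x)"
  and G: "ghom A N M 0 G" "!!x. x : carrier N ==> dM (G x) = G (dN x)"
  and kM: "ghom A M M 1 k" "!!x. x : carrier M ==> G (F x) \<ominus>\<^bsub>M\<^esub> x = dM (k x) \<oplus>\<^bsub>M\<^esub> k (dM x)"
  and kN: "ghom A N N 1 k'" "!!x. x : carrier N ==> F (G x) \<ominus>\<^bsub>N\<^esub> x = dN (k' x) \<oplus>\<^bsub>N\<^esub> k' (dN x)"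
 shows "bij_betw (hh_pullback A M dM n F) (HH A N dN n) (HH A M dM n)"
proof -
 interpret M: cplx K A M dM \<mu>M by (rule M)
 interpret N: cplx K A N dN \<mu>N by (rule N)
 let ?rM = "hh_rel A M dM n" and ?rN = "hh_rel A N dN n"
 note eM = M.hh_equiv[of n] and eN = N.hh_equiv[of n]
 have pF: "(f \<circ> F, f' \<circ> F) : ?rM" if r: "(f, f') : ?rN" for f f'
 proof -
  obtain h where h: "N.cochain (n - 1) h" "ALL x:carrier N. f x = f' x \<oplus>\<^bsub>A\<^esub> h (dN x)" using r unfolding N.hh_rel_iff by blast
  have c: "u \<circ> F : hh_cocycles A M dM n" if "u : hh_cocycles A N dN n" for u
   using that ghom_comp[OF _ F(1), of "regular A" "- n" u "- n"] ghomD(4)[OF F(1)]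
   by (auto simp: M.hh_cocycles_iff N.hh_cocycles_iff comp_def F(2)[symmetric])
  have "M.cochain (n - 1) (%x. h (F x))" by (rule ghom_comp[OF h(1) F(1)]) simp
  moreover have "(f \<circ> F) x = (f' \<circ> F) x \<oplus>\<^bsub>A\<^esub> h (F (dM x))" if "x : carrier M" for x
   using h(2) ghomD(4)[OF F(1) that] by (simp add: F(2)[OF that, symmetric])
  ultimately show ?thesis unfolding M.hh_rel_iff using c r[unfolded N.hh_rel_iff] by blast
 qed
 have pG: "(f \<circ> G, f' \<circ> G) : ?rN" if r: "(f, f') : ?rM" for f f'
 proof -
  obtain h where h: "M.cochain (n - 1) h" "ALL x:carrier M. f x = f' x \<oplus>\<^bsub>A\<^esub> h (dM x)" using r unfolding M.hh_rel_iff by blast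
  have c: "u \<circ> G : hh_cocycles A N dN n" if "u : hh_cocycles A M dM n" for u
   using that ghom_comp[OF _ G(1), of "regular A" "- n" u "- n"] ghomD(4)[OF G(1)]
   by (auto simp: M.hh_cocycles_iff N.hh_cocycles_iff comp_def G(2)[symmetric])
  have "N.cochain (n - 1) (%x. h (G x))" by (rule ghom_comp[OF h(1) G(1)]) simp
  moreover have "(f \<circ> G) x = (f' \<circ> G) x \<oplus>\<^bsub>A\<^esub> h (G (dN x))" if "x : carrier N" for x
   using h(2) ghomD(4)[OF G(1) that] by (simp add: G(2)[OF that, symmetric])
  ultimately show ?thesis unfolding N.hh_rel_iff using c r[unfolded M.hh_rel_iff] by blast
 qed
 have GF: "(f \<circ> G \<circ> F, f) : ?rM" if "f : hh_cocycles A M dM n" for f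
  using M.hh_homotopic_id[OF that ghom_comp[OF G(1) F(1)] kM(1) kM(2)] F(2) G(2) ghomD(4)[OF F(1)]
  by (simp add: comp_def)
 have FG: "(f \<circ> F \<circ> G, f) : ?rN" if "f : hh_cocycles A N dN n" for f
  using N.hh_homotopic_id[OF that ghom_comp[OF F(1) G(1)] kN(1) kN(2)] F(2) G(2) ghomD(4)[OF G(1)]
  by (simp add: comp_def)
 have inN: "f : hh_cocycles A N dN n ==> (f, f) : ?rN" for f by (rule N.hh_rel_refl)
 \<comment> \<open>The union in \<open>hh_pullback\<close> runs over all representatives, which by
   \<open>pF\<close> yield the same class.\<close>
 have val: "hh_pullback A M dM n F (?rN `` {f}) = ?rM `` {f \<circ> F}" if f: "f : hh_cocycles A N dN n" for f
 proof -
  have "?rM `` {g \<circ> F} = ?rM `` {f \<circ> F}" if "g : ?rN `` {f}" for g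
   using equiv_class_eq[OF eM pF] that by blast
  then show ?thesis unfolding hh_pullback_def using inN[OF f] by blast
 qed
 have cF: "f \<circ> F : hh_cocycles A M dM n" if "f : hh_cocycles A N dN n" for f
  using pF[OF inN[OF that]] unfolding M.hh_rel_iff by blast
 have cG: "f \<circ> G : hh_cocycles A N dN n" if "f : hh_cocycles A M dM n" for f
  using pG[OF M.hh_rel_refl[OF that]] unfolding N.hh_rel_iff by blast
 show ?thesis
 proof (rule bij_betw_imageI)
  show "inj_on (hh_pullback A M dM n F) (HH A N dN n)"
  proof (rule inj_onI)
   fix X1 X2 assume X: "X1 : HH A N dN n" "X2 : HH A N dN n" and e: "hh_pullback A M dM n F X1 = hh_pullback A M dM n F X2"
   obtain f1 where f1: "f1 : hh_cocycles A N dN n" "X1 = ?rN `` {f1}" using X(1) unfolding HH_def by (rule quotientE)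
   obtain f2 where f2: "f2 : hh_cocycles A N dN n" "X2 = ?rN `` {f2}" using X(2) unfolding HH_def by (rule quotientE)
   have "?rM `` {f1 \<circ> F} = ?rM `` {f2 \<circ> F}" using e f1 f2 val by simp
   then have "(f1 \<circ> F, f2 \<circ> F) : ?rM" by (rule eq_equiv_class[OF _ eM cF[OF f2(1)]])
   then have "(f1 \<circ> F \<circ> G, f2 \<circ> F \<circ> G) : ?rN" by (rule pG)
   then have "(f1, f2) : ?rN" using N.hh_rel_trans[OF N.hh_rel_sym[OF FG[OF f1(1)]]] N.hh_rel_trans FG[OF f2(1)] by blast
   then show "X1 = X2" using f1 f2 equiv_class_eq[OF eN] by simp
  qed
  show "hh_pullback A M dM n F ` HH A N dN n = HH A M dM n"
  proof (intro equalityI subsetI)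
   fix Y assume "Y : hh_pullback A M dM n F ` HH A N dN n"
   then obtain X1 where X1: "X1 : HH A N dN n" "Y = hh_pullback A M dM n F X1" by blast
   obtain f where f: "f : hh_cocycles A N dN n" "X1 = ?rN `` {f}" using X1(1) unfolding HH_def by (rule quotientE)
   show "Y : HH A M dM n" unfolding X1(2) f(2) val[OF f(1)] HH_def by (rule quotientI[OF cF[OF f(1)]])
  next
   fix Y assume "Y : HH A M dM n"
   then obtain f where f: "f : hh_cocycles A M dM n" "Y = ?rM `` {f}" unfolding HH_def by (rule quotientE)
   have "hh_pullback A M dM n F (?rN `` {f \<circ> G}) = Y"
    unfolding val[OF cG[OF f(1)]] f(2) by (rule equiv_class_eq[OF eM GF[OF f(1)]])
   moreover have "?rN `` {f \<circ> G} : HH A N dN n" unfolding HH_def by (rule quotientI[OF cG[OF f(1)]])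
   ultimately show "Y : hh_pullback A M dM n F ` HH A N dN n" by blast
  qed
 qed
qed

lemma (in lifting) homotopic_maps:
 assumes F: "ghom A M N 0 F" "!!x. x : carrier M ==> dN (F x) = F (dM x)" "!!x. x : carrier M ==> \<mu>N (F x) = \<mu>M x"
  and F': "ghom A M N 0 F'" "!!x. x : carrier M ==> dN (F' x) = F' (dM x)" "!!x. x : carrier M ==> \<mu>N (F' x) = \<mu>M x"
 shows "EX k. ghom A M N 1 k & (ALL x:carrier M. F x \<ominus>\<^bsub>N\<^esub> F' x = dN (k x) \<oplus>\<^bsub>N\<^esub> k (dM x))"
proof -
 have E: "ghom A M N 0 (%x. F x \<ominus>\<^bsub>N\<^esub> F' x)" by (rule ghom_diff[OF F(1) F'(1)])
 have "dN (F x \<ominus>\<^bsub>N\<^esub> F' x) = sneg N 0 (F (dM x) \<ominus>\<^bsub>N\<^esub> F' (dM x))" if "x : carrier M" for x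
  using that ghomD(4)[OF F(1) that] ghomD(4)[OF F'(1) that] by (simp add: F(2) F'(2) sneg_def)
 moreover have "\<mu>N (F x \<ominus>\<^bsub>N\<^esub> F' x) = \<zero>" if "x : carrier M" for x
  using that ghomD(4)[OF F(1) that] ghomD(4)[OF F'(1) that] by (simp add: F(3) F'(3) a_minus_def S.A.r_neg)
 ultimately show ?thesis using null_homotopy[OF E] by (simp add: sneg_def)
qed

theorem theorem10:
  fixes K :: "'k ring" and A :: "('k, 'a) module" and P :: "('a, 'p) graded_bimodule"
    and d :: "'p \<Rightarrow> 'p" and \<mu> :: "'p \<Rightarrow> 'a" and t :: "'p \<Rightarrow> 'p" and \<eta> :: "'a \<Rightarrow> 'p"
    and \<iota> :: "'p \<Rightarrow> ('a, 'p) tens"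
  assumes "assoc_algebra K A"
    and "projective_resolution K A P d \<mu>"
    and "left_contracting_homotopy A P d \<mu> t \<eta>"
    and "graded_hom A P (tensor_K K A (regular A) P) \<iota>"
    and "\<forall>x\<in>carrier P. left_action_map P (\<iota> x) = x"
  shows "(\<forall>n m :: nat. \<forall>f\<in>hh_cocycles A P d (int n). \<forall>g\<in>hh_cocycles A P d (int m).
            bracket K A P d \<mu> t \<eta> \<iota> (int n) (int m) f g \<in> hh_cocycles A P d (int n + int m - 1)) \<and>
         (\<forall>n m :: nat. \<forall>(f, f')\<in>hh_rel A P d (int n). \<forall>(g, g')\<in>hh_rel A P d (int m).
            (bracket K A P d \<mu> t \<eta> \<iota> (int n) (int m) f g,
             bracket K A P d \<mu> t \<eta> \<iota> (int n) (int m) f' g') \<in> hh_rel A P d (int n + int m - 1)) \<and>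
         (\<exists>\<phi>. comparison_map A (bar K A) (bar_diff K A) (bar_aug K A) P d \<mu> \<phi>) \<and>
         (\<forall>\<phi>. comparison_map A (bar K A) (bar_diff K A) (bar_aug K A) P d \<mu> \<phi> \<longrightarrow>
            (\<forall>n. bij_betw (hh_pullback A (bar K A) (bar_diff K A) n \<phi>)
                   (HH A P d n) (HH A (bar K A) (bar_diff K A) n)) \<and>
            (\<forall>n m :: nat. \<forall>f\<in>hh_cocycles A P d (int n). \<forall>g\<in>hh_cocycles A P d (int m).
               (bracket K A P d \<mu> t \<eta> \<iota> (int n) (int m) f g \<circ> \<phi>,
                bar_bracket K A n m (f \<circ> \<phi>) (g \<circ> \<phi>))
                 \<in> hh_rel A (bar K A) (bar_diff K A) (int n + int m - 1)))"
proof -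
 interpret B: bar_alg K A by unfold_locales (rule assms(1))
 interpret P: split_resolution K A P d \<mu> t \<eta> \<iota> by unfold_locales (use assms in simp_all)
 let ?B = "bar K A" and ?dB = "bar_diff K A" and ?\<mu>B = "bar_aug K A"
 let ?br = "bracket K A P d \<mu> t \<eta> \<iota>"
 note cP = P.P_contracted and cB = B.bar_contracted
 \<comment> \<open>From the bar complex to \<open>P\<close>: existence of comparison maps and the
   null-homotopy of the correction map. The reverse direction provides a homotopy inverse, the
   remaining two the homotopies for the round trips.\<close>
 interpret BP: lifting K A ?B ?dB ?\<mu>B P d \<mu> by (rule B.bar_lifting[OF cP])
 interpret BB: lifting K A ?B ?dB ?\<mu>B ?B ?dB ?\<mu>B by (rule B.bar_lifting[OF cB])
 interpret PB: lifting K A P d \<mu> ?B ?dB ?\<mu>B by (rule P.projective_lifting[OF cB])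
 interpret PP: lifting K A P d \<mu> P d \<mu> by (rule P.projective_lifting[OF cP])
 have deg: "n + m - 1 - 1 = n + m - (2::int)" for n m by simp
 have brP: "?br n m f g : hh_cocycles A P d (n + m - 1)"
  if f: "f : hh_cocycles A P d n" and g: "g : hh_cocycles A P d m" for n m f g
 proof -
  have fc: "P.cochain n f" and fd: "!!x. x : carrier P ==> f (d x) = \<zero>\<^bsub>A\<^esub>" using f by (simp_all add: P.hh_cocycles_iff)
  have gc: "P.cochain m g" and gd: "!!x. x : carrier P ==> g (d x) = \<zero>\<^bsub>A\<^esub>" using g by (simp_all add: P.hh_cocycles_iff)
  have "P.cochain (n + m - 1) (?br n m f g)"
   by (rule ghom_cong[OF P.PB.br_ghom[OF fc gc refl]]) (simp add: P.bracket_eq[OF fc gc])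
  moreover have "?br n m f g (d x) = \<zero>\<^bsub>A\<^esub>" if "x : carrier P" for x
   using P.PB.br_cocycle[OF fc gc fd gd that] P.bracket_eq[OF fc gc, of "d x"] that by simp
  ultimately show ?thesis by (simp add: P.hh_cocycles_iff)
 qed
 have rel1: "(?br n m f g, ?br n m f' g) : hh_rel A P d (n + m - 1)"
  if r: "(f, f') : hh_rel A P d n" and g: "g : hh_cocycles A P d m" for n m f f' g
 proof -
  have f: "f : hh_cocycles A P d n" "f' : hh_cocycles A P d n" using r by (simp_all add: P.hh_rel_iff)
  obtain h where h: "P.cochain (n - 1) h" "ALL x:carrier P. f x = f' x \<oplus>\<^bsub>A\<^esub> h (d x)" using r unfolding P.hh_rel_iff by blast
  have c: "P.cochain n f" "P.cochain n f'" "P.cochain m g" and gd: "!!x. x : carrier P ==> g (d x) = \<zero>\<^bsub>A\<^esub>"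
   using f g by (simp_all add: P.hh_cocycles_iff)
  obtain H where "P.cochain (n + m - 2) H" "ALL x:carrier P. P.PB.br n m f g x = P.PB.br n m f' g x \<oplus>\<^bsub>A\<^esub> H (d x)"
   using P.PB.br_homotopic1[OF c(1,2) h(1) c(3) _ gd] h(2) by blast
  then have "P.cochain (n + m - 1 - 1) H" "ALL x:carrier P. ?br n m f g x = ?br n m f' g x \<oplus>\<^bsub>A\<^esub> H (d x)"
   unfolding deg by (simp_all add: P.bracket_eq[OF c(1,3)] P.bracket_eq[OF c(2,3)])
  then show ?thesis unfolding P.hh_rel_iff using brP[OF f(1) g] brP[OF f(2) g] by blast
 qed
 have rel2: "(?br n m f g, ?br n m f g') : hh_rel A P d (n + m - 1)"
  if r: "(g, g') : hh_rel A P d m" and f: "f : hh_cocycles A P d n" for n m f g g'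
 proof -
  have g: "g : hh_cocycles A P d m" "g' : hh_cocycles A P d m" using r by (simp_all add: P.hh_rel_iff)
  obtain h where h: "P.cochain (m - 1) h" "ALL x:carrier P. g x = g' x \<oplus>\<^bsub>A\<^esub> h (d x)" using r unfolding P.hh_rel_iff by blast
  have c: "P.cochain m g" "P.cochain m g'" "P.cochain n f" and fd: "!!x. x : carrier P ==> f (d x) = \<zero>\<^bsub>A\<^esub>"
   using f g by (simp_all add: P.hh_cocycles_iff)
  obtain H where "P.cochain (n + m - 2) H" "ALL x:carrier P. P.PB.br n m f g x = P.PB.br n m f g' x \<oplus>\<^bsub>A\<^esub> H (d x)"
   using P.PB.br_homotopic2[OF c(1,2) h(1) c(3) _ fd] h(2) by blast
  then have "P.cochain (n + m - 1 - 1) H" "ALL x:carrier P. ?br n m f g x = ?br n m f g' x \<oplus>\<^bsub>A\<^esub> H (d x)"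
   unfolding deg by (simp_all add: P.bracket_eq[OF c(3,1)] P.bracket_eq[OF c(3,2)])
  then show ?thesis unfolding P.hh_rel_iff using brP[OF f g(1)] brP[OF f g(2)] by blast
 qed
 have relP: "(?br n m f g, ?br n m f' g') : hh_rel A P d (n + m - 1)"
  if "(f, f') : hh_rel A P d n" "(g, g') : hh_rel A P d m" for n m f f' g g'
  using P.hh_rel_trans[OF rel1[OF that(1)] rel2[OF that(2)]] that by (simp add: P.hh_rel_iff)
 have cmp: "comparison_map A ?B ?dB ?\<mu>B P d \<mu> \<phi> \<longleftrightarrow> ghom A ?B P 0 \<phi> & (ALL x:carrier ?B. d (\<phi> x) = \<phi> (?dB x) & \<mu> (\<phi> x) = ?\<mu>B x)" for \<phi>
  by (simp add: comparison_map_def graded_hom_ghom0[OF B.Bar_gab P.P_gab])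
 have main: "bij_betw (hh_pullback A ?B ?dB k \<phi>) (HH A P d k) (HH A ?B ?dB k)" (is ?bij)
  "!!f g. f : hh_cocycles A P d (int n) ==> g : hh_cocycles A P d (int m) ==>
   (?br (int n) (int m) f g \<circ> \<phi>, bar_bracket K A n m (f \<circ> \<phi>) (g \<circ> \<phi>)) : hh_rel A ?B ?dB (int n + int m - 1)"
  if c: "comparison_map A ?B ?dB ?\<mu>B P d \<mu> \<phi>" for \<phi> k and n m :: nat
 proof -
  have ph: "ghom A ?B P 0 \<phi>" and pd: "!!x. x : carrier ?B ==> d (\<phi> x) = \<phi> (?dB x)" and pm: "!!x. x : carrier ?B ==> \<mu> (\<phi> x) = ?\<mu>B x"
   using c unfolding cmp by simp_all
  note pc = ghomD(4)[OF ph]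
  \<comment> \<open>A comparison map in the opposite direction. Both composites cover the identity
    of \<open>A\<close>, so they are homotopic to identities.\<close>
  obtain \<psi> where q: "ghom A P ?B 0 \<psi>" "ALL x:carrier P. ?dB (\<psi> x) = \<psi> (d x) & ?\<mu>B (\<psi> x) = \<mu> x" using PB.comparison_exists by blast
  note qc = ghomD(4)[OF q(1)]
  have e1: "ghom A ?B ?B 0 (%x. \<psi> (\<phi> x))" "ghom A P P 0 (%x. \<phi> (\<psi> x))"
   by (rule ghom_comp[OF q(1) ph], simp, rule ghom_comp[OF ph q(1)], simp)
  have i1: "ghom A ?B ?B 0 (%x. x)" "ghom A P P 0 (%x. x)" by (rule ghom_id[OF B.Bar_gab], rule ghom_id[OF P.P_gab])
  obtain k1 where k1: "ghom A ?B ?B 1 k1" "ALL x:carrier ?B. \<psi> (\<phi> x) \<ominus>\<^bsub>?B\<^esub> x = ?dB (k1 x) \<oplus>\<^bsub>?B\<^esub> k1 (?dB x)"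
   using BB.homotopic_maps[OF e1(1) _ _ i1(1)] pd pm q(2) pc by auto
  obtain k2 where k2: "ghom A P P 1 k2" "ALL x:carrier P. \<phi> (\<psi> x) \<ominus>\<^bsub>P\<^esub> x = d (k2 x) \<oplus>\<^bsub>P\<^esub> k2 (d x)"
   using PP.homotopic_maps[OF e1(2) _ _ i1(2)] pd pm q(2) qc by auto
  show ?bij
   by (rule hh_pullback_bij[OF B.Bc.cplx_axioms P.cplx_axioms ph pd q(1) _ k1(1) _ k2(1)]) (use q(2) k1(2) k2(2) in simp_all)
  fix f g assume f: "f : hh_cocycles A P d (int n)" and g: "g : hh_cocycles A P d (int m)"
  interpret C: bcompare K A P d \<mu> P.\<Delta>P P.\<phi>P P.\<psi>P ?B ?dB ?\<mu>B B.\<Delta>B B.\<phi>B P.hP \<phi>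
   by (intro bcompare.intro P.P_bdata B.bar_bdata bcompare_axioms.intro P.hP_ghom P.D_hP P.mul_hP ph pd pm)
  have fc: "P.cochain (int n) f" and fd: "ALL x:carrier P. f (d x) = \<zero>\<^bsub>A\<^esub>" using f by (simp_all add: P.hh_cocycles_iff)
  have gc: "P.cochain (int m) g" and gd: "ALL x:carrier P. g (d x) = \<zero>\<^bsub>A\<^esub>" using g by (simp_all add: P.hh_cocycles_iff)
  let ?k = "int n + int m - 1"
  \<comment> \<open>The null-homotopy that \<open>br_compare\<close> asks for goes from the bar
    complex to \<open>P\<close>, hence it comes from freeness on words and the contraction of
    \<open>P\<close>.\<close>
  obtain H where H: "B.Bc.cochain (int n + int m - 2) H"
   "ALL x:carrier ?B. P.PB.br (int n) (int m) f g (\<phi> x) = B.BB.br (int n) (int m) (%x. f (\<phi> x)) (%x. g (\<phi> x)) x \<oplus>\<^bsub>A\<^esub> H (?dB x)"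
   using C.br_compare[OF fc fd gc gd BP.null_homotopy] by blast
  have pfc: "B.Bc.cochain (int n) (f \<circ> \<phi>)" using ghom_comp[OF fc ph, of "- int n"] by (simp add: comp_def)
  have pgc: "B.Bc.cochain (int m) (g \<circ> \<phi>)" using ghom_comp[OF gc ph, of "- int m"] by (simp add: comp_def)
  have pfd: "(f \<circ> \<phi>) (?dB x) = \<zero>\<^bsub>A\<^esub>" "(g \<circ> \<phi>) (?dB x) = \<zero>\<^bsub>A\<^esub>" if "x : carrier ?B" for x
   using fd gd pc[OF that] pd[OF that, symmetric] by simp_all
  note bb = B.bar_bracket_eq[OF pfc pgc]
  have b2: "bar_bracket K A n m (f \<circ> \<phi>) (g \<circ> \<phi>) : hh_cocycles A ?B ?dB ?k"
   unfolding B.Bc.hh_cocycles_iff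
  proof (intro conjI ballI)
   show "B.Bc.cochain ?k (bar_bracket K A n m (f \<circ> \<phi>) (g \<circ> \<phi>))"
    by (rule ghom_cong[OF B.BB.br_ghom[OF pfc pgc refl]]) (simp add: bb)
   fix x assume x: "x : carrier ?B"
   show "bar_bracket K A n m (f \<circ> \<phi>) (g \<circ> \<phi>) (?dB x) = \<zero>\<^bsub>A\<^esub>"
    using bb[of "?dB x"] B.BB.br_cocycle[OF pfc pgc pfd x] x by simp
  qed
  note bP = brP[OF f g, unfolded P.hh_cocycles_iff]
  have b1: "?br (int n) (int m) f g \<circ> \<phi> : hh_cocycles A ?B ?dB ?k"
   unfolding B.Bc.hh_cocycles_iff
  proof (intro conjI ballI)
   show "B.Bc.cochain ?k (?br (int n) (int m) f g \<circ> \<phi>)"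
    using ghom_comp[OF conjunct1[OF bP] ph, of "- ?k"] by (simp add: comp_def)
   fix x assume x: "x : carrier ?B"
   show "(?br (int n) (int m) f g \<circ> \<phi>) (?dB x) = \<zero>\<^bsub>A\<^esub>"
    using bP pc[OF x] pd[OF x, symmetric] by simp
  qed
  have "(?br (int n) (int m) f g \<circ> \<phi>) x = bar_bracket K A n m (f \<circ> \<phi>) (g \<circ> \<phi>) x \<oplus>\<^bsub>A\<^esub> H (?dB x)" if x: "x : carrier ?B" for x
   using H(2) x bb[OF x] P.bracket_eq[OF fc gc pc[OF x]] by (simp add: comp_def)
  moreover have "B.Bc.cochain (?k - 1) H" unfolding deg by (rule H(1))
  ultimately show "(?br (int n) (int m) f g \<circ> \<phi>, bar_bracket K A n m (f \<circ> \<phi>) (g \<circ> \<phi>)) : hh_rel A ?B ?dB ?k"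
   unfolding B.Bc.hh_rel_iff using b1 b2 by blast
 qed
 have ex: "EX \<phi>. comparison_map A ?B ?dB ?\<mu>B P d \<mu> \<phi>" unfolding cmp by (rule BP.comparison_exists)
 show ?thesis
  by (intro conjI allI ballI impI) (use brP relP ex main in auto)
qed

end
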